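(* Let $k=\mathbb F_q$ be the finite field with $q$ elements, let $t=1/q$, and let $(\alpha;\beta)$ be a point of the Thoma simplex. Let $g\in GL_n(k)$ and suppose that the conjugacy class of $g$ corresponds to the family of partitions $\varphi:\mathcal F\to\mathbb Y$ with $\sum_{f\in\mathcal F}\deg(f)\,|\varphi(f)|=n$. Write $d(f)=\deg f$. Then the unipotent character $\chi^{(\alpha;\beta)}$ satisfies $$\chi^{(\alpha;\beta)}(g)=\prod_{f\in\mathcal F} r_{\varphi(f)}\bigl(\alpha^{d(f)};\,-(-\beta)^{d(f)};\,t^{d(f)}\bigr).$$
   Context: Thoma simplex: the set of pairs $(\alpha;\beta)$ of weakly decreasing sequences of nonnegative reals $\alpha=(\alpha_1,\alpha_2,\dots)$, $\beta=(\beta_1,\beta_2,\dots)$ with $\sum_i\alpha_i+\sum_i\beta_i\le 1$. Specializations: let $\Lambda$ be the algebra of symmetric functions, with power sums $p_m$. For $u\in\Lambda$ and $d\ge1$, $u(\alpha^d;-(-\beta)^d)$ denotes the image of $u$ under the algebra homomorphism $\Lambda\to\mathbb R$ with $p_m\mapsto \sum_i\alpha_i^{md}-\sum_i(-\beta_i)^{md}$, with the convention that for $d=1$ and $m=1$ the value is $p_1\mapsto 1$. For $d=1$ this is written $u(\alpha;\beta)$. Unipotent characters of $GL_n(k)$: for a partition $\mu\vdash n$ let $\psi^\mu$ be the character of $GL_n(k)$ induced from the trivial character of the parabolic subgroup $P_\mu$ of block upper triangular matrices with diagonal blocks of sizes $\mu_1,\mu_2,\dots$. The irreducible unipotent characters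 $\chi^\lambda$, $\lambda\vdash n$, are determined by $\psi^\mu=\sum_{\lambda\vdash n}K_{\lambda\mu}\chi^\lambda$, where $K_{\lambda\mu}$ are the ordinary Kostka numbers (so $\chi^{(n)}$ is the trivial character). The group $GLB(k)$ is the group of invertible infinite matrices over $k$ with only finitely many nonzero entries below the main diagonal. The unipotent character $\chi^{(\alpha;\beta)}$ of (the Bruhat–Schwartz group algebra of) $GLB(k)$, evaluated at the element of the subalgebra isomorphic to $\mathbb C[GL_n(k)]$ corresponding to $g\in GL_n(k)$, is given by $$\chi^{(\alpha;\beta)}(g)=\sum_{\lambda\vdash n}\chi^\lambda(g)\,s_\lambda(\alpha;\beta),$$ where $s_\lambda$ is the Schur function. The functions $r_\rho$: for $\rho\vdash m$ and a parameter $t$, $$r_\rho(\,\cdot\,;t)=t^{-n(\rho)}\sum_{\lambda\vdash m}K_{\lambda\rho}(t)\,s_\lambda(\cdot),\qquad n(\rho)=\sum_{i\ge1}(i-1)\rho_i,$$ where $K_{\lambda\rho}(t)$ are the Kostka–Foulkes polynomials ($s_\lambda=\sum_\rho K_{\lambda\rho}(t)P_\rho(\,\cdot\,;t)$ with $P_\rho$ the Hall–Littlewood functions); $r_\emptyset=1$. In $r_\rho(\alpha^d;-(-\beta)^d;t^d)$ each Schur function $s_\lambda$ is replaced by its value $s_\lambda(\alpha^d;-(-\beta)^d)$, i.e. its image under the algebra homomorphism $\Lambda\to\mathbb R$ with $p_m\mapsto\sum_i\alpha_i^{md}-\sum_i(-\beta_i)^{md}$ (and $p_1\mapsto1$ when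 $d=1$), and the parameter is $t^d$. Conjugacy classes: $\mathcal F$ is the set of monic irreducible polynomials in $k[T]$ other than $T$, and $\mathbb Y$ is the set of all partitions. The class of $g$ corresponds to $\varphi$ if $k^n$, as a $k[T]$-module with $T$ acting by $g$, is isomorphic to $\bigoplus_{f}\bigoplus_i k[T]/(f^{\varphi(f)_i})$. *)

theory Defs
  imports
    Complex_Main
    "HOL-Library.Poly_Mapping"
    "HOL-Combinatorics.Permutations"
    "HOL-Algebra.QuotRing"
    "Jordan_Normal_Form.VS_Connect"
begin

section \<open>Partitions and tableaux\<close>

text \<open>A partition is the weakly decreasing list of its nonzero parts; parts are indexed from 0.\<close>

definition is_partition :: "nat list \<Rightarrow> bool" where
  "is_partition \<nu> \<longleftrightarrow> sorted_wrt (\<ge>) \<nu> \<and> 0 \<notin> set \<nu>"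

definition partitions_of :: "nat \<Rightarrow> nat list set" where
  "partitions_of n = {\<nu>. is_partition \<nu> \<and> sum_list \<nu> = n}"

definition part :: "nat list \<Rightarrow> nat \<Rightarrow> nat" where
  "part \<nu> i = (if i < length \<nu> then \<nu> ! i else 0)"

definition n_stat :: "nat list \<Rightarrow> nat" where
  "n_stat \<rho> = (\<Sum>i<length \<rho>. i * \<rho> ! i)"

definition cells :: "nat list \<Rightarrow> (nat \<times> nat) set" where
  "cells \<nu> = {(i, j). i < length \<nu> \<and> j < \<nu> ! i}"

text \<open>Semistandard tableaux with entries in the naturals (entry \<open>i\<close> stands for the variable
  \<open>x\<^sub>i\<close>); the value 0 outside the diagram only makes the representing function unique.\<close>

definition ssyt :: "nat list \<Rightarrow> (nat \<times> nat \<Rightarrow> nat) set" where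
  "ssyt \<nu> = {T.
     (\<forall>i j j'. j < j' \<and> (i, j) \<in> cells \<nu> \<and> (i, j') \<in> cells \<nu> \<longrightarrow> T (i, j) \<le> T (i, j')) \<and>
     (\<forall>i i' j. i < i' \<and> (i, j) \<in> cells \<nu> \<and> (i', j) \<in> cells \<nu> \<longrightarrow> T (i, j) < T (i', j)) \<and>
     (\<forall>c. c \<notin> cells \<nu> \<longrightarrow> T c = 0)}"

definition content :: "nat list \<Rightarrow> (nat \<times> nat \<Rightarrow> nat) \<Rightarrow> nat \<Rightarrow> nat" where
  "content \<nu> T i = card {c \<in> cells \<nu>. T c = i}"

definition kostka :: "nat list \<Rightarrow> nat list \<Rightarrow> nat" where
  "kostka \<nu> \<mu> = card {T \<in> ssyt \<nu>. content \<nu> T = part \<mu>}"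

section \<open>Symmetric functions over the reals\<close>

text \<open>A formal power series in \<open>x\<^sub>0, x\<^sub>1, \<dots>\<close> is given by its coefficients.\<close>

type_synonym monomial = "nat \<Rightarrow>\<^sub>0 nat"
type_synonym series = "monomial \<Rightarrow> real"

definition mono_degree :: "monomial \<Rightarrow> nat" where
  "mono_degree a = (\<Sum>i\<in>Poly_Mapping.keys a. Poly_Mapping.lookup a i)"

definition Sym :: "series set" where
  "Sym = {u. (\<forall>\<pi> a. bij \<pi> \<longrightarrow> u (Poly_Mapping.map_key \<pi> a) = u a) \<and>
             (\<exists>D. \<forall>a. u a \<noteq> 0 \<longrightarrow> mono_degree a \<le> D)}"

definition series_one :: series where
  "series_one a = (if a = 0 then 1 else 0)"

definition series_mult :: "series \<Rightarrow> series \<Rightarrow> series" where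
  "series_mult u v c = (\<Sum>(a, b) \<in> {(a, b). a + b = c}. u a * v b)"

definition power_sum :: "nat \<Rightarrow> series" where
  "power_sum m a = (if \<exists>i. a = Poly_Mapping.single i m then 1 else 0)"

definition schur :: "nat list \<Rightarrow> series" where
  "schur \<nu> a = real (card {T \<in> ssyt \<nu>. content \<nu> T = Poly_Mapping.lookup a})"

text \<open>The value of a symmetric function at \<open>(x\<^sub>0, \<dots>, x\<^sub>N\<^sub>-\<^sub>1, 0, 0, \<dots>)\<close>. Only finitely many monomials
  contribute because the degree is bounded.\<close>

definition eval_vars :: "nat \<Rightarrow> series \<Rightarrow> (nat \<Rightarrow> real) \<Rightarrow> real" where
  "eval_vars N u x =
     (\<Sum>a \<in> {a. Poly_Mapping.keys a \<subseteq> {..<N} \<and> u a \<noteq> 0}. u a * (\<Prod>i<N. x i ^ Poly_Mapping.lookup a i))"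

text \<open>The Hall--Littlewood function \<open>P\<^sub>\<nu>(x; t)\<close>: in \<open>N \<ge> \<ell>(\<nu>)\<close> variables it is
  the sum, over \<open>w\<close> in \<open>S\<^sub>N\<close> modulo the stabilizer of \<open>\<nu>\<close>, of \<open>w\<close> applied to
  \<open>x\<^sup>\<nu> \<Prod> (x\<^sub>i - t x\<^sub>j) / (x\<^sub>i - x\<^sub>j)\<close>, the product being over all \<open>i, j\<close> with
  \<open>\<nu>\<^sub>i > \<nu>\<^sub>j\<close>
  (Macdonald, Symmetric Functions and Hall Polynomials, III (2.2)). The coset of \<open>w\<close> is recorded
  by the rearrangement of \<open>\<nu>\<close> that it produces. Since the reals are infinite, the identity
  of rational functions is tested at points with distinct coordinates.\<close>

definition rearrangements :: "nat \<Rightarrow> nat list \<Rightarrow> (nat \<Rightarrow> nat) set" where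
  "rearrangements N \<nu> = {part \<nu> \<circ> \<pi> | \<pi>. \<pi> permutes {..<N}}"

definition hall_littlewood :: "nat list \<Rightarrow> real \<Rightarrow> series" where
  "hall_littlewood \<nu> t = (THE P. P \<in> Sym \<and>
     (\<forall>N \<ge> length \<nu>. \<forall>x. inj_on x {..<N} \<longrightarrow>
        eval_vars N P x =
          (\<Sum>a \<in> rearrangements N \<nu>. (\<Prod>i<N. x i ^ a i) *
             (\<Prod>(i, j) \<in> {(i, j). i < N \<and> j < N \<and> a i > a j}. (x i - t * x j) / (x i - x j)))))"

text \<open>The Kostka--Foulkes polynomials \<open>K\<^sub>\<nu>\<^sub>\<rho>\<close>, as a function of \<open>\<rho>\<close> for fixed \<open>\<nu>\<close>.\<close>

definition kostka_foulkes :: "nat list \<Rightarrow> nat list \<Rightarrow> real poly" where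
  "kostka_foulkes \<nu> = (THE K.
     (\<forall>\<rho>. \<rho> \<notin> partitions_of (sum_list \<nu>) \<longrightarrow> K \<rho> = 0) \<and>
     (\<forall>t a. schur \<nu> a =
        (\<Sum>\<rho> \<in> partitions_of (sum_list \<nu>). poly (K \<rho>) t * hall_littlewood \<rho> t a)))"

section \<open>Specializations\<close>

definition sym_alg_hom :: "(series \<Rightarrow> real) \<Rightarrow> bool" where
  "sym_alg_hom h \<longleftrightarrow>
     h series_one = 1 \<and>
     (\<forall>c. \<forall>u\<in>Sym. h (\<lambda>a. c * u a) = c * h u) \<and>
     (\<forall>u\<in>Sym. \<forall>v\<in>Sym. h (\<lambda>a. u a + v a) = h u + h v) \<and>
     (\<forall>u\<in>Sym. \<forall>v\<in>Sym. h (series_mult u v) = h u * h v)"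

text \<open>The algebra homomorphism sending the \<open>m\<close>-th power sum to \<open>v m\<close>. The value 0 outside
  the algebra of symmetric functions is a convention that makes it unique as a total function.\<close>

definition specialization :: "(nat \<Rightarrow> real) \<Rightarrow> series \<Rightarrow> real" where
  "specialization v = (THE h. sym_alg_hom h \<and> (\<forall>m\<ge>1. h (power_sum m) = v m) \<and>
     (\<forall>u. u \<notin> Sym \<longrightarrow> h u = 0))"

definition thoma_simplex :: "((nat \<Rightarrow> real) \<times> (nat \<Rightarrow> real)) set" where
  "thoma_simplex = {(\<alpha>, \<beta>). decseq \<alpha> \<and> decseq \<beta> \<and> (\<forall>i. 0 \<le> \<alpha> i) \<and> (\<forall>i. 0 \<le> \<beta> i) \<and>
     summable \<alpha> \<and> summable \<beta> \<and> suminf \<alpha> + suminf \<beta> \<le> 1}"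

text \<open>\<open>thoma_spec \<alpha> \<beta> d u\<close> is \<open>u(\<alpha>\<^sup>d; -(-\<beta>)\<^sup>d)\<close>.\<close>

definition thoma_spec :: "(nat \<Rightarrow> real) \<Rightarrow> (nat \<Rightarrow> real) \<Rightarrow> nat \<Rightarrow> series \<Rightarrow> real" where
  "thoma_spec \<alpha> \<beta> d = specialization (\<lambda>m. if d = 1 \<and> m = 1 then 1
     else suminf (\<lambda>i. \<alpha> i ^ (m * d)) - suminf (\<lambda>i. (- \<beta> i) ^ (m * d)))"

text \<open>\<open>r_fun \<rho> h t\<close> is \<open>r\<^sub>\<rho>(\<cdot>; t)\<close> with every Schur function replaced by its value under \<open>h\<close>.\<close>

definition r_fun :: "nat list \<Rightarrow> (series \<Rightarrow> real) \<Rightarrow> real \<Rightarrow> real" where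
  "r_fun \<rho> h t = inverse (t ^ n_stat \<rho>) *
     (\<Sum>\<nu> \<in> partitions_of (sum_list \<rho>). poly (kostka_foulkes \<nu> \<rho>) t * h (schur \<nu>))"

section \<open>Unipotent characters\<close>

definition GL :: "nat \<Rightarrow> 'k::field mat monoid" where
  "GL n = units_of (ring_mat TYPE('k) n ())"

text \<open>\<open>g\<close> is block upper triangular iff its entries vanish below and to the left of every
  boundary \<open>\<mu>\<^sub>1 + \<dots> + \<mu>\<^sub>b\<close> between two diagonal blocks.\<close>

definition parabolic :: "nat \<Rightarrow> nat list \<Rightarrow> 'k::field mat set" where
  "parabolic n \<mu> = {g \<in> carrier (GL n).
     \<forall>b \<le> length \<mu>. \<forall>i<n. \<forall>j<n.
       j < sum_list (take b \<mu>) \<and> sum_list (take b \<mu>) \<le> i \<longrightarrow> g $$ (i, j) = 0}"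

definition induced_char ::
  "('g, 'b) monoid_scheme \<Rightarrow> 'g set \<Rightarrow> ('g \<Rightarrow> complex) \<Rightarrow> 'g \<Rightarrow> complex" where
  "induced_char G H \<theta> g =
     (\<Sum>x \<in> carrier G. let y = inv\<^bsub>G\<^esub> x \<otimes>\<^bsub>G\<^esub> g \<otimes>\<^bsub>G\<^esub> x in if y \<in> H then \<theta> y else 0)
       / of_nat (card H)"

definition parabolic_char :: "nat \<Rightarrow> nat list \<Rightarrow> 'k::field mat \<Rightarrow> complex" where
  "parabolic_char n \<mu> = induced_char (GL n) (parabolic n \<mu>) (\<lambda>_. 1)"

definition unipotent_char :: "nat \<Rightarrow> nat list \<Rightarrow> 'k::field mat \<Rightarrow> complex" where
  "unipotent_char n = (THE \<chi>.
     (\<forall>\<nu> g. \<nu> \<notin> partitions_of n \<or> g \<notin> carrier (GL n) \<longrightarrow> \<chi> \<nu> g = 0) \<and>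
     (\<forall>\<mu> \<in> partitions_of n. \<forall>g \<in> carrier (GL n).
        parabolic_char n \<mu> g = (\<Sum>\<nu> \<in> partitions_of n. of_nat (kostka \<nu> \<mu>) * \<chi> \<nu> g)))"

text \<open>The unipotent character of \<open>GLB(k)\<close> attached to \<open>(\<alpha>; \<beta>)\<close>, restricted to
  the subalgebra \<open>\<complex>[GL\<^sub>n(k)]\<close>.\<close>

definition GLB_unipotent_char ::
  "(nat \<Rightarrow> real) \<Rightarrow> (nat \<Rightarrow> real) \<Rightarrow> nat \<Rightarrow> 'k::field mat \<Rightarrow> complex" where
  "GLB_unipotent_char \<alpha> \<beta> n g =
     (\<Sum>\<nu> \<in> partitions_of n. unipotent_char n \<nu> g * of_real (thoma_spec \<alpha> \<beta> 1 (schur \<nu>)))"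

section \<open>Conjugacy classes\<close>

definition poly_mat :: "'k::field poly \<Rightarrow> 'k mat \<Rightarrow> 'k mat" where
  "poly_mat p g = mat (dim_row g) (dim_row g)
     (\<lambda>(i, j). \<Sum>l\<le>degree p. poly.coeff p l * (g ^\<^sub>m l) $$ (i, j))"

text \<open>In the module records below the fields \<open>mult\<close> and \<open>one\<close> play no role.\<close>

definition mat_module :: "nat \<Rightarrow> 'k::field mat \<Rightarrow> ('k poly, 'k vec) module" where
  "mat_module n g = \<lparr>carrier = carrier_vec n, mult = undefined, one = undefined,
     zero = 0\<^sub>v n, add = (+), smult = (\<lambda>p v. poly_mat p g *\<^sub>v v)\<rparr>"

definition quotient_module :: "('a, 'b) ring_scheme \<Rightarrow> 'a set \<Rightarrow> ('a, 'a set) module" where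
  "quotient_module R I = \<lparr>carrier = carrier (R Quot I), mult = undefined, one = undefined,
     zero = \<zero>\<^bsub>R Quot I\<^esub>, add = (\<lambda>X Y. X \<oplus>\<^bsub>R Quot I\<^esub> Y),
     smult = (\<lambda>p X. (I +>\<^bsub>R\<^esub> p) \<otimes>\<^bsub>R Quot I\<^esub> X)\<rparr>"

definition direct_sum_module ::
  "'i set \<Rightarrow> ('i \<Rightarrow> ('a, 'm) module) \<Rightarrow> ('a, 'i \<Rightarrow> 'm) module" where
  "direct_sum_module J M = \<lparr>
     carrier = {v \<in> (\<Pi>\<^sub>E j\<in>J. carrier (M j)). finite {j \<in> J. v j \<noteq> \<zero>\<^bsub>M j\<^esub>}},
     mult = undefined, one = undefined,
     zero = (\<lambda>j\<in>J. \<zero>\<^bsub>M j\<^esub>),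
     add = (\<lambda>v w. \<lambda>j\<in>J. v j \<oplus>\<^bsub>M j\<^esub> w j),
     smult = (\<lambda>r v. \<lambda>j\<in>J. r \<odot>\<^bsub>M j\<^esub> v j)\<rparr>"

definition module_isomorphic ::
  "('a, 'c) ring_scheme \<Rightarrow> ('a, 'm) module \<Rightarrow> ('a, 'n) module \<Rightarrow> bool" where
  "module_isomorphic R M N \<longleftrightarrow>
     (\<exists>\<Phi> \<in> LinearCombinations.module_hom R M N. bij_betw \<Phi> (carrier M) (carrier N))"

definition irred_polys :: "'k::field poly set" where
  "irred_polys = {f. lead_coeff f = 1 \<and> Factorial_Ring.irreducible f \<and> f \<noteq> [:0, 1:]}"

text \<open>\<open>class_type n g \<phi>\<close>: the \<open>k[T]\<close>-module \<open>k\<^sup>n\<close>, with \<open>T\<close> acting by \<open>g\<close>, is isomorphic to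
  the direct sum of the \<open>k[T]/(f\<^bsup>\<phi>(f)\<^sub>i\<^esup>)\<close>.\<close>

definition class_type :: "nat \<Rightarrow> 'k::field mat \<Rightarrow> ('k poly \<Rightarrow> nat list) \<Rightarrow> bool" where
  "class_type n g \<phi> \<longleftrightarrow>
     module_isomorphic (class_ring :: 'k poly ring) (mat_module n g)
       (direct_sum_module {(f, i). f \<in> irred_polys \<and> i < length (\<phi> f)}
          (\<lambda>(f, i). quotient_module class_ring (PIdl\<^bsub>class_ring\<^esub> (f ^ (\<phi> f ! i)))))"

end

theory Submission
  imports Defs "HOL-Library.Function_Algebras" "HOL-Computational_Algebra.Computational_Algebra"
begin

text \<open>Let \<open>u\<close> be the symmetric function whose coefficient at \<open>x\<^sup>\<mu>\<close> is \<open>\<psi>\<^sup>\<mu>(g)\<close>, the number of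
  \<open>g\<close>-stable flags of type \<open>\<mu>\<close> in \<open>k\<^sup>n\<close>. Expanding in Schur functions gives
  \<open>u = \<Sum> \<chi>\<^sup>\<lambda>(g) s\<^sub>\<lambda>\<close>, so the character value is the Thoma specialization of \<open>u\<close>. A submodule of a sum
  of modules killed by coprime polynomials splits, hence \<open>u\<close> is the product over \<open>f\<close> of the flag
  functions of the \<open>f\<close>-primary components. All submodules of such a component have dimension divisible by
  \<open>d = deg f\<close>, so its flag function is a plethysm with \<open>p\<^sub>d\<close>, which the Thoma specialization
  turns into the specialization at \<open>(\<alpha>\<^sup>d; -(-\<beta>)\<^sup>d)\<close>.

  It remains to identify the flag function of a module \<open>X\<close> of type \<open>\<rho>\<close> over a residue field with
  \<open>Q = 1 / t\<close> elements as \<open>r\<^sub>\<rho>\<close>. The submodules containing \<open>f X\<close> are sorted by Schubert cells, and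
  summing over them, with weight \<open>Q\<close> to the power \<open>r (r - 1) / 2\<close> in colength \<open>r\<close>, is adjoint to multiplication of
  Hall--Littlewood functions by \<open>e\<^sub>r\<close> (Pieri rule). Moebius inversion recovers the sum over all
  submodules of colength \<open>m\<close> by the recursion that expresses \<open>h\<^sub>m\<close> through the \<open>e\<^sub>r\<close>. Hence
  \<open>\<Sum> t\<^bsup>n(\<rho>)\<^esup> P\<^sub>\<rho> F\<^sub>\<rho>(c) = \<Prod> h\<^bsub>c_i\<^esub>\<close> for the flag numbers \<open>F\<^sub>\<rho>(c)\<close>, and the Cauchy
  identity together with the linear independence of the \<open>P\<^sub>\<rho>\<close> gives the result.\<close>

text \<open>Four objects of the statement are given by description (\<open>hall_littlewood\<close>,
  \<open>kostka_foulkes\<close>, \<open>specialization\<close>, \<open>unipotent_char\<close>), so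
  existence and uniqueness come first; as Hall--Littlewood functions are pinned down by their values
  at points with distinct coordinates, identities of symmetric series are proved by evaluation.
  Expansions are required for every real t, while the Pieri argument divides by 1 - t and by
  t-integers; polynomial dependence on t bridges the gap. Submodules of given colength are hard to
  sort by type directly, but those containing f X are subspaces of X / f X, and relative to a
  complete flag through the images of the kernels of f^v the type depends on the Schubert cell
  alone. This is why e_r precedes h_m. The weight turns the contribution of a cell with jump set S
  into Q to the sum of S, by which n(rho) changes up to inversions; with the sign (-1)^r it is also
  the Moebius function of the subspace lattice. Flag numbers are computed for arbitrary
  compositions; the symmetry of u then comes from its identification.\<close>

abbreviation lookup :: "('a \<Rightarrow>\<^sub>0 'b::zero) \<Rightarrow> 'a \<Rightarrow> 'b" where "lookup \<equiv> Poly_Mapping.lookup"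
abbreviation keys :: "('a \<Rightarrow>\<^sub>0 'b::zero) \<Rightarrow> 'a set" where "keys \<equiv> Poly_Mapping.keys"
abbreviation single :: "'a \<Rightarrow> 'b \<Rightarrow> ('a \<Rightarrow>\<^sub>0 'b::zero)" where "single \<equiv> Poly_Mapping.single"
abbreviation map_key :: "('a \<Rightarrow> 'b) \<Rightarrow> ('b \<Rightarrow>\<^sub>0 'c::zero) \<Rightarrow> ('a \<Rightarrow>\<^sub>0 'c)" where "map_key \<equiv> Poly_Mapping.map_key"
abbreviation irr :: "'k::field poly \<Rightarrow> bool" where "irr \<equiv> Factorial_Ring.irreducible"
abbreviation Par :: "nat \<Rightarrow> nat list set" where "Par \<equiv> partitions_of"
abbreviation mdeg :: "monomial \<Rightarrow> nat" where "mdeg \<equiv> mono_degree"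
abbreviation ties :: "'a set \<Rightarrow> 'a set \<Rightarrow> ('a \<Rightarrow> 'b) \<Rightarrow> ('a \<times> 'a) set" where
  "ties A B a \<equiv> {(i, j). i \<in> A \<and> j \<in> B \<and> a i = a j}"

lemmas Par_def = partitions_of_def
lemmas sum_cong = sum.cong[OF refl]

lemma supp_subset: "\<forall>i\<ge>N. a i = 0 \<Longrightarrow> {i::nat. a i \<noteq> 0} \<subseteq> {..<N}"
  by (metis (mono_tags, lifting) lessThan_iff mem_Collect_eq not_le subsetI)

lemma card_field_gt1: "card (UNIV :: 'k::{field,finite} set) > 1"
  using card_mono[of "UNIV :: 'k set" "{0, 1}"] by simp

text \<open>Back substitution by descending rank: row i of \<open>M\<close> is \<open>M i i\<close>
  times the unit vector at i plus a combination of unit vectors of larger rank, which the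
  coefficient rows \<open>d j\<close> already produce. The rank replaces an ordering of the index
  set.\<close>

lemma triangular_left_inverse:
  fixes M :: "'i \<Rightarrow> 'i \<Rightarrow> real" and rank :: "'i \<Rightarrow> nat"
  assumes fin: "finite I" and diag: "\<And>i. i \<in> I \<Longrightarrow> M i i \<noteq> 0"
    and tri: "\<And>i j. i \<in> I \<Longrightarrow> j \<in> I \<Longrightarrow> M i j \<noteq> 0 \<Longrightarrow> i \<noteq> j \<Longrightarrow> rank i < rank j"
  shows "\<exists>C. \<forall>i\<in>I. \<forall>j\<in>I. (\<Sum>k\<in>I. C i k * M k j) = (if i = j then 1 else 0)"
proof -
  have "\<forall>i\<in>I. \<exists>c. \<forall>j\<in>I. (\<Sum>k\<in>I. c k * M k j) = (if i = j then 1 else 0)"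
  proof
    fix i assume "i \<in> I"
    then show "\<exists>c. \<forall>j\<in>I. (\<Sum>k\<in>I. c k * M k j) = (if i = j then 1 else 0)"
    proof (induction "Max (rank ` I) - rank i" arbitrary: i rule: less_induct)
      case less
      have "\<exists>c. \<forall>l\<in>I. (\<Sum>k\<in>I. c k * M k l) = (if j = l then 1 else 0)"
        if "j \<in> I" "rank i < rank j" for j
      proof (rule less.hyps)
        have "rank j \<le> Max (rank ` I)" using fin that by auto
        then show "Max (rank ` I) - rank j < Max (rank ` I) - rank i" using that by linarith
      qed (use that in auto)
      then have "\<forall>j\<in>{j \<in> I. rank i < rank j}. \<exists>c. \<forall>l\<in>I. (\<Sum>k\<in>I. c k * M k l) = (if j = l then 1 else 0)"
        by blast
      from bchoice[OF this] obtain d where d: "\<And>j l. j \<in> I \<Longrightarrow> rank i < rank j \<Longrightarrow> l \<in> I \<Longrightarrow>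
          (\<Sum>k\<in>I. d j k * M k l) = (if j = l then 1 else 0)"
        by blast
      define c where "c k = ((if k = i then 1 else 0) - (\<Sum>j\<in>I-{i}. M i j * d j k)) / M i i" for k
      have "(\<Sum>k\<in>I. c k * M k l) = (if i = l then 1 else 0)" if l: "l \<in> I" for l
      proof -
        have "(\<Sum>k\<in>I. c k * M k l) * M i i =
            (\<Sum>k\<in>I. (if k = i then M i l else 0) - (\<Sum>j\<in>I-{i}. M i j * (d j k * M k l)))"
          unfolding sum_distrib_right
          by (rule sum.cong) (use diag less.prems in
              \<open>auto simp: c_def field_simps sum_distrib_left sum_distrib_right\<close>)
        also have "\<dots> = M i l - (\<Sum>j\<in>I-{i}. M i j * (\<Sum>k\<in>I. d j k * M k l))"
          using fin less.prems
          by (simp add: sum_subtractf sum.swap[of _ "I-{i}"] sum_distrib_left sum.delta)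
        also have "(\<Sum>j\<in>I-{i}. M i j * (\<Sum>k\<in>I. d j k * M k l)) = (\<Sum>j\<in>I-{i}. if j = l then M i j else 0)"
        proof (rule sum_cong)
          fix j assume j: "j \<in> I - {i}"
          show "M i j * (\<Sum>k\<in>I. d j k * M k l) = (if j = l then M i j else 0)"
          proof (cases "M i j = 0")
            case False
            then have "rank i < rank j" using tri[of i j] j less.prems by auto
            then have "(\<Sum>k\<in>I. d j k * M k l) = (if j = l then 1 else 0)" using d j l by blast
            then show ?thesis by simp
          qed auto
        qed
        also have "M i l - \<dots> = (if i = l then M i i else 0)"
          using fin l by (auto simp: sum.delta)
        finally show ?thesis using diag[OF less.prems] by (auto split: if_splits)
      qed
      then show ?case by blast
    qed
  qed
  from bchoice[OF this] show ?thesis by blast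
qed

text \<open>The transpose is triangular for the reversed rank and so has a left inverse
  \<open>D\<close>; evaluating the triple product of \<open>C\<close>, \<open>M\<close> and the
  transpose of \<open>D\<close> in two ways identifies \<open>C\<close> with that transpose, which
  makes \<open>C\<close> a right inverse too.\<close>

lemma triangular_inverse:
  fixes M :: "'i \<Rightarrow> 'i \<Rightarrow> real" and rank :: "'i \<Rightarrow> nat"
  assumes fin: "finite I" and diag: "\<And>i. i \<in> I \<Longrightarrow> M i i \<noteq> 0"
    and tri: "\<And>i j. i \<in> I \<Longrightarrow> j \<in> I \<Longrightarrow> M i j \<noteq> 0 \<Longrightarrow> i \<noteq> j \<Longrightarrow> rank i < rank j"
  shows "\<exists>C. (\<forall>i\<in>I. \<forall>j\<in>I. (\<Sum>k\<in>I. C i k * M k j) = (if i = j then 1 else 0)) \<and>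
             (\<forall>i\<in>I. \<forall>j\<in>I. (\<Sum>k\<in>I. M i k * C k j) = (if i = j then 1 else 0))"
proof -
  obtain C where C: "\<forall>i\<in>I. \<forall>j\<in>I. (\<Sum>k\<in>I. C i k * M k j) = (if i = j then 1 else 0)"
    using triangular_left_inverse[of I M rank, OF fin diag tri] by blast
  have "\<exists>D. \<forall>i\<in>I. \<forall>j\<in>I. (\<Sum>k\<in>I. D i k * M j k) = (if i = j then 1 else 0)"
  proof (rule triangular_left_inverse[where rank = "\<lambda>i. Max (rank ` I) - rank i"])
    fix i j assume "i \<in> I" "j \<in> I" "M j i \<noteq> 0" "i \<noteq> j"
    moreover have "rank i \<le> Max (rank ` I)" using fin \<open>i \<in> I\<close> by auto
    ultimately show "Max (rank ` I) - rank i < Max (rank ` I) - rank j" using tri[of j i] by auto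
  qed (use fin diag in auto)
  then obtain D where D: "\<forall>i\<in>I. \<forall>j\<in>I. (\<Sum>k\<in>I. D i k * M j k) = (if i = j then 1 else 0)" by blast
  have CD: "C i j = D j i" if "i \<in> I" "j \<in> I" for i j
  proof -
    have "(\<Sum>k\<in>I. \<Sum>l\<in>I. C i k * M k l * D j l) = (\<Sum>k\<in>I. C i k * (\<Sum>l\<in>I. D j l * M k l))"
      by (simp add: sum_distrib_left mult_ac)
    also have "\<dots> = (\<Sum>k\<in>I. if k = j then C i k else 0)" by (rule sum.cong) (use D that in auto)
    also have "\<dots> = C i j" using fin that by (simp add: sum.delta)
    finally have 1: "(\<Sum>k\<in>I. \<Sum>l\<in>I. C i k * M k l * D j l) = C i j" .
    have "(\<Sum>k\<in>I. \<Sum>l\<in>I. C i k * M k l * D j l) = (\<Sum>l\<in>I. (\<Sum>k\<in>I. C i k * M k l) * D j l)"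
      by (subst sum.swap) (simp add: sum_distrib_right)
    also have "\<dots> = (\<Sum>l\<in>I. if l = i then D j l else 0)" by (rule sum.cong) (use C that in auto)
    also have "\<dots> = D j i" using fin that by (simp add: sum.delta)
    finally show ?thesis using 1 by simp
  qed
  have "(\<Sum>k\<in>I. M i k * C k j) = (if i = j then 1 else 0)" if "i \<in> I" "j \<in> I" for i j
  proof -
    have "(\<Sum>k\<in>I. M i k * C k j) = (\<Sum>k\<in>I. D j k * M i k)"
      by (rule sum.cong) (use CD that in auto)
    then show ?thesis using D that by auto
  qed
  with C show ?thesis by blast
qed

text \<open>The parts in decreasing order; for infinite support the underlying \<open>mset_set\<close> is empty.\<close>

definition shp :: "(nat \<Rightarrow> nat) \<Rightarrow> nat list" where
  "shp a = rev (sorted_list_of_multiset (image_mset a (mset_set {i. a i \<noteq> 0})))"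

lemma mset_shp: "mset (shp a) = image_mset a (mset_set {i. a i \<noteq> 0})"
  by (simp add: shp_def)

lemma is_partition_shp: "is_partition (shp a)"
proof -
  have "sorted_wrt (\<ge>) (shp a)"
    unfolding shp_def sorted_wrt_rev by simp
  moreover have "0 \<notin> set (shp a)"
  proof (cases "finite {i. a i \<noteq> 0}")
    case True then show ?thesis by (auto simp: shp_def)
  next
    case False then show ?thesis by (simp add: shp_def)
  qed
  ultimately show ?thesis by (simp add: is_partition_def)
qed

lemma partition_eqI_mset:
  assumes "is_partition \<mu>" "is_partition \<nu>" "mset \<mu> = mset \<nu>"
  shows "\<mu> = \<nu>"
proof -
  have "sorted (rev \<mu>)" "sorted (rev \<nu>)" using assms by (auto simp: is_partition_def sorted_wrt_rev)
  then have "rev \<mu> = rev \<nu>" using assms(3) by (metis mset_rev properties_for_sort)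
  then show ?thesis by simp
qed

lemma shp_eq_iff: "shp a = shp b \<longleftrightarrow> image_mset a (mset_set {i. a i \<noteq> 0}) = image_mset b (mset_set {i. b i \<noteq> 0})"
  by (metis mset_shp partition_eqI_mset is_partition_shp)

lemma image_mset_supp:
  assumes "\<forall>i. i \<notin> A \<longrightarrow> a i = 0" "finite A"
  shows "image_mset a (mset_set A) = image_mset a (mset_set {i. a i \<noteq> 0}) + replicate_mset (card (A - {i. a i \<noteq> 0})) 0"
proof -
  let ?S = "{i. a i \<noteq> 0}"
  have sub: "?S \<subseteq> A" using assms by auto
  have "mset_set A = mset_set ?S + mset_set (A - ?S)"
    using sub assms(2) by (metis Diff_disjoint Diff_partition finite_Diff finite_subset mset_set_Union)
  moreover have "image_mset a (mset_set (A - ?S)) = image_mset (\<lambda>_. 0) (mset_set (A - ?S))"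
    by (rule image_mset_cong) (use assms in auto)
  ultimately show ?thesis
    by (simp add: image_mset_const_eq)
qed

lemma card_supp_shp: "length (shp a) = card {i. a i \<noteq> 0}"
  by (metis mset_shp size_image_mset size_mset size_mset_set)

lemma finite_part_supp: "finite {i. part \<nu> i \<noteq> 0}"
  by (rule finite_subset[of _ "{..<length \<nu>}"]) (auto simp: part_def split: if_splits)

lemma part_supp_partition: "is_partition \<nu> \<Longrightarrow> {i. part \<nu> i \<noteq> 0} = {..<length \<nu>}"
  by (auto simp: part_def is_partition_def split: if_splits) (metis gr0I nth_mem)

lemma shp_part: assumes "is_partition \<nu>" shows "shp (part \<nu>) = \<nu>"
proof (rule partition_eqI_mset[OF is_partition_shp assms])
  have "mset (shp (part \<nu>)) = image_mset (part \<nu>) (mset_set {0..<length \<nu>})"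
    using part_supp_partition[OF assms] by (simp add: mset_shp atLeast0LessThan)
  also have "\<dots> = image_mset ((!) \<nu>) (mset_set {0..<length \<nu>})"
    by (rule image_mset_cong) (auto simp: part_def)
  also have "\<dots> = mset \<nu>"
    by (metis map_nth mset_map mset_upt)
  finally show "mset (shp (part \<nu>)) = mset \<nu>" .
qed

lemma shp_perm:
  assumes "bij \<pi>" shows "shp (a \<circ> \<pi>) = shp a"
proof -
  have "{i. a i \<noteq> 0} = \<pi> ` {i. (a \<circ> \<pi>) i \<noteq> 0}"
  proof (intro equalityI subsetI)
    fix i assume i: "i \<in> {i. a i \<noteq> 0}"
    obtain j where "i = \<pi> j" using assms by (metis bij_pointE)
    then show "i \<in> \<pi> ` {i. (a \<circ> \<pi>) i \<noteq> 0}" using i by auto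
  qed auto
  then have "mset_set {i. a i \<noteq> 0} = image_mset \<pi> (mset_set {i. (a \<circ> \<pi>) i \<noteq> 0})"
    using assms by (metis image_mset_mset_set bij_is_inj inj_on_subset subset_UNIV)
  then show ?thesis unfolding shp_eq_iff by (simp add: multiset.map_comp)
qed

text \<open>Padding both value multisets with the same number of zeros turns equality of the nonzero
  parts into equality of multisets over \<open>{..<N}\<close>, which a permutation realizes.\<close>

lemma shp_eq_permutes:
  assumes "shp a = shp b" "\<forall>i\<ge>N. a i = 0" "\<forall>i\<ge>N. b i = 0"
  shows "\<exists>\<pi>. \<pi> permutes {..<N} \<and> a = b \<circ> \<pi>"
proof -
  have sub: "{i. a i \<noteq> 0} \<subseteq> {..<N}" "{i. b i \<noteq> 0} \<subseteq> {..<N}"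
    using assms by (metis supp_subset)+
  have fin: "finite {i. a i \<noteq> 0}" "finite {i. b i \<noteq> 0}"
    using sub finite_subset by blast+
  have "card {i. a i \<noteq> 0} = card {i. b i \<noteq> 0}" using assms(1) card_supp_shp by metis
  then have "card ({..<N} - {i. a i \<noteq> 0}) = card ({..<N} - {i. b i \<noteq> 0})"
    using sub fin by (simp add: card_Diff_subset)
  then have "image_mset a (mset_set {..<N}) = image_mset b (mset_set {..<N})"
    using image_mset_supp[of "{..<N}" a] image_mset_supp[of "{..<N}" b] assms
    by (auto simp: shp_eq_iff)
  then obtain \<pi> where \<pi>: "\<pi> permutes {..<N}" "\<forall>x\<in>{..<N}. a x = b (\<pi> x)"
    using image_mset_eq_implies_permutes[of "{..<N}" a b] by auto
  have "a x = b (\<pi> x)" for x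
  proof (cases "x < N")
    case False
    then show ?thesis using assms \<pi> by (metis lessThan_iff not_le permutes_not_in)
  qed (use \<pi> in auto)
  then show ?thesis using \<pi> by (auto simp: fun_eq_iff)
qed

lemma sum_shp:
  assumes "finite {i. a i \<noteq> 0}"
  shows "(\<Sum>x\<in>#mset (shp a). h x) = (\<Sum>i | a i \<noteq> 0. h (a i))"
  by (simp add: mset_shp sum_unfold_sum_mset multiset.map_comp comp_def)

lemma sum_list_shp:
  assumes "\<forall>i\<ge>N. a i = 0" shows "sum_list (shp a) = (\<Sum>i<N. a i)"
proof -
  have sub: "{i. a i \<noteq> 0} \<subseteq> {..<N}"
    using assms by (metis supp_subset)
  then have fin: "finite {i. a i \<noteq> 0}" using finite_subset by blast
  have "sum_list (shp a) = (\<Sum>i | a i \<noteq> 0. a i)"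
    using sum_shp[OF fin, of "\<lambda>x. x"] by (simp add: sum_mset_sum_list)
  also have "\<dots> = (\<Sum>i<N. a i)" by (rule sum.mono_neutral_left) (use sub in auto)
  finally show ?thesis .
qed

lemma sum_part: "N \<ge> length \<nu> \<Longrightarrow> (\<Sum>i<N. part \<nu> i) = sum_list \<nu>"
proof -
  assume N: "N \<ge> length \<nu>"
  have "(\<Sum>i<N. part \<nu> i) = (\<Sum>i<length \<nu>. part \<nu> i)"
    by (rule sum.mono_neutral_right) (use N in "auto simp: part_def")
  also have "\<dots> = sum_list \<nu>" by (simp add: part_def sum_list_sum_nth atLeast0LessThan)
  finally show ?thesis .
qed

lemma part_desc: "is_partition \<nu> \<Longrightarrow> i \<le> j \<Longrightarrow> part \<nu> j \<le> part \<nu> i"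
  by (auto simp: part_def is_partition_def sorted_wrt_iff_nth_less) (metis le_neq_implies_less le_refl)

lemma part_pos: "is_partition \<nu> \<Longrightarrow> i < length \<nu> \<Longrightarrow> 0 < part \<nu> i"
  using part_supp_partition[of \<nu>] by auto

lemma length_le_sum_list: "0 \<notin> set \<nu> \<Longrightarrow> length \<nu> \<le> sum_list (\<nu> :: nat list)"
  by (induction \<nu>) auto

lemma finite_partitions_of [simp]: "finite (Par n)"
proof (rule finite_subset)
  show "Par n \<subseteq> {xs. set xs \<subseteq> {..n} \<and> length xs \<le> n}"
    using length_le_sum_list member_le_sum_list by (fastforce simp: Par_def is_partition_def)
  show "finite {xs. set xs \<subseteq> {..n} \<and> length xs \<le> n}" by (rule finite_lists_length_le) simp
qed

text \<open>The number of cells in the first \<open>k\<close> columns of \<open>\<rho>\<close>, i.e. the length of the kernel of \<open>f\<^sup>k\<close> on a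
  module of type \<open>\<rho>\<close>.\<close>

definition pmin :: "nat list \<Rightarrow> nat \<Rightarrow> nat" where
  "pmin \<rho> k = (\<Sum>x\<leftarrow>\<rho>. min x k)"

lemma pmin_Suc: "pmin \<rho> (Suc k) = pmin \<rho> k + length (filter (\<lambda>x. k < x) \<rho>)"
  by (induction \<rho>) (auto simp: pmin_def)

text \<open>The first difference of \<open>pmin\<close> at k is the number of parts above k, and the
  difference of two such numbers is a multiplicity.\<close>

lemma partition_eqI_pmin:
  assumes "is_partition \<mu>" "is_partition \<nu>" "\<And>k. pmin \<mu> k = pmin \<nu> k"
  shows "\<mu> = \<nu>"
proof (rule partition_eqI_mset[OF assms(1,2)], rule multiset_eqI)
  fix k
  have eq: "length (filter (\<lambda>x. k < x) \<mu>) = length (filter (\<lambda>x. k < x) \<nu>)" for k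
    using pmin_Suc[of \<mu> k] pmin_Suc[of \<nu> k] assms(3) by simp
  have *: "count (mset \<rho>) (Suc j) + length (filter (\<lambda>x. Suc j < x) \<rho>) = length (filter (\<lambda>x. j < x) \<rho>)" for \<rho> j
    by (induction \<rho>) auto
  show "count (mset \<mu>) k = count (mset \<nu>) k"
  proof (cases k)
    case 0
    have "0 \<notin># mset \<mu>" "0 \<notin># mset \<nu>"
      using assms(1,2) by (simp_all add: is_partition_def)
    then show ?thesis using 0 by (metis not_in_iff)
  next
    case (Suc j)
    then show ?thesis using *[of \<mu> j] *[of \<nu> j] eq by simp
  qed
qed

lemma pmin_shp:
  assumes "\<forall>i\<ge>N. a i = 0" shows "pmin (shp a) k = (\<Sum>i<N. min (a i) k)"
proof -
  have sub: "{i. a i \<noteq> 0} \<subseteq> {..<N}"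
    using assms by (metis supp_subset)
  then have fin: "finite {i. a i \<noteq> 0}" using finite_subset by blast
  have "pmin (shp a) k = (\<Sum>i | a i \<noteq> 0. min (a i) k)"
    using sum_shp[OF fin, of "\<lambda>x. min x k"] by (simp add: pmin_def flip: sum_mset_sum_list)
  also have "\<dots> = (\<Sum>i<N. min (a i) k)" by (rule sum.mono_neutral_left) (use sub in auto)
  finally show ?thesis .
qed

lemma pmin_large: "sum_list \<rho> \<le> k \<Longrightarrow> pmin \<rho> k = sum_list \<rho>"
  by (induction \<rho>) (auto simp: pmin_def)

lemma pmin_0 [simp]: "pmin \<rho> 0 = 0"
  by (simp add: pmin_def sum_list_0)

section \<open>Symmetric series and their evaluations\<close>

definition mon :: "nat list \<Rightarrow> monomial" where "mon c = Abs_poly_mapping (part c)"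

lemma lookup_mon [simp]: "lookup (mon c) = part c"
  unfolding mon_def using finite_part_supp by (rule lookup_Abs_poly_mapping)

definition shape :: "monomial \<Rightarrow> nat list" where "shape a = shp (lookup a)"

lemma is_partition_shape [simp]: "is_partition (shape a)"
  by (simp add: shape_def is_partition_shp)

lemma shape_mon [simp]: "is_partition \<mu> \<Longrightarrow> shape (mon \<mu>) = \<mu>"
  by (simp add: shape_def shp_part)

lemma keys_bound: "\<exists>N. \<forall>i\<ge>N. lookup (a::monomial) i = 0"
proof -
  obtain N where N: "\<forall>i\<in>keys a. i < N" using finite_nat_set_iff_bounded[of "keys a"] by auto
  then show ?thesis by (metis in_keys_iff not_less)
qed

lemma keys_subset_iff: "keys (a::monomial) \<subseteq> {..<N} \<longleftrightarrow> (\<forall>i\<ge>N. lookup a i = 0)"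
  by (auto simp: subset_iff in_keys_iff) (metis not_le less_irrefl)

lemma mono_degree_eq:
  assumes "\<forall>i\<ge>N. lookup a i = 0"
  shows "mdeg a = (\<Sum>i<N. lookup a i)"
  unfolding mono_degree_def
  by (rule sum.mono_neutral_left) (use assms keys_subset_iff in "auto simp: in_keys_iff")

lemma mono_degree_shape: "mdeg a = sum_list (shape a)"
proof -
  obtain N where "\<forall>i\<ge>N. lookup a i = 0" using keys_bound by blast
  then show ?thesis by (simp add: mono_degree_eq shape_def sum_list_shp)
qed

lemma shape_in_partitions_of: "shape a \<in> Par n \<longleftrightarrow> mdeg a = n"
  by (simp add: Par_def mono_degree_shape)

lemma mono_degree_add: "mdeg (a + b) = mdeg a + mdeg b"
proof -
  obtain N M where "\<forall>i\<ge>N. lookup a i = 0" "\<forall>i\<ge>M. lookup b i = 0"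
    using keys_bound by metis
  then have "\<forall>i\<ge>max N M. lookup a i = 0" "\<forall>i\<ge>max N M. lookup b i = 0"
    by auto
  then show ?thesis
    using mono_degree_eq[of "max N M" a] mono_degree_eq[of "max N M" b] mono_degree_eq[of "max N M" "a+b"]
    by (simp add: lookup_add sum.distrib)
qed

lemma lookup_map_key: "bij \<pi> \<Longrightarrow> lookup (map_key \<pi> a) = lookup a \<circ> \<pi>"
  by (simp add: Poly_Mapping.map_key.rep_eq bij_is_inj)

lemma shape_map_key: "bij \<pi> \<Longrightarrow> shape (map_key \<pi> a) = shape a"
  by (simp add: shape_def lookup_map_key shp_perm)

text \<open>Membership in \<open>Sym\<close> means invariance under bijections of all indices, and
  two finitely supported exponent sequences of the same shape differ by a finite permutation, which
  is such a bijection.\<close>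

lemma SymD: assumes "u \<in> Sym" "shape a = shape b" shows "u a = u b"
proof -
  obtain N M where "\<forall>i\<ge>N. lookup a i = 0" "\<forall>i\<ge>M. lookup b i = 0"
    using keys_bound by metis
  then have "\<forall>i\<ge>max N M. lookup a i = 0" "\<forall>i\<ge>max N M. lookup b i = 0"
    by auto
  then obtain \<pi> where \<pi>: "\<pi> permutes {..<max N M}" "lookup a = lookup b \<circ> \<pi>"
    using shp_eq_permutes[of "lookup a" "lookup b" "max N M"] assms(2) by (auto simp: shape_def)
  have bij: "bij \<pi>" using \<pi> permutes_bij by blast
  have "a = map_key \<pi> b"
    using \<pi> lookup_map_key[OF bij] by (metis poly_mapping_eqI)
  then show ?thesis using assms(1) bij by (simp add: Sym_def)
qed

lemma SymI: assumes "\<And>a b. shape a = shape b \<Longrightarrow> u a = u b" "\<And>a. u a \<noteq> 0 \<Longrightarrow> mdeg a \<le> D" shows "u \<in> Sym"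
  unfolding Sym_def using assms shape_map_key by blast

lemma Sym_bound: assumes "u \<in> Sym" obtains D where "\<And>a. u a \<noteq> 0 \<Longrightarrow> mdeg a \<le> D"
  using assms by (auto simp: Sym_def)

lemma Sym_zero [simp]: "(\<lambda>a. 0) \<in> Sym"
  by (rule SymI) auto

lemma Sym_add: assumes "u \<in> Sym" "v \<in> Sym" shows "(\<lambda>a. u a + v a) \<in> Sym"
proof -
  obtain D where D: "\<And>a. u a \<noteq> 0 \<Longrightarrow> mdeg a \<le> D" using Sym_bound[OF assms(1)] by blast
  obtain E where E: "\<And>a. v a \<noteq> 0 \<Longrightarrow> mdeg a \<le> E" using Sym_bound[OF assms(2)] by blast
  from D E have "\<And>a. u a + v a \<noteq> 0 \<Longrightarrow> mdeg a \<le> max D E"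
    by (metis add.left_neutral max.coboundedI1 max.coboundedI2)
  moreover have "u a + v a = u b + v b" if "shape a = shape b" for a b
    using SymD[OF assms(1) that] SymD[OF assms(2) that] by simp
  ultimately show ?thesis by (intro SymI[where D = "max D E"])
qed

lemma Sym_scale: assumes "u \<in> Sym" shows "(\<lambda>a. c * u a) \<in> Sym"
proof -
  obtain D where "\<And>a. u a \<noteq> 0 \<Longrightarrow> mdeg a \<le> D" using Sym_bound[OF assms] by blast
  then show ?thesis by (intro SymI[where D = D]) (auto intro: SymD[OF assms])
qed

lemma Sym_sum: assumes "\<And>i. i \<in> I \<Longrightarrow> u i \<in> Sym" shows "(\<lambda>a. \<Sum>i\<in>I. u i a) \<in> Sym"
  using assms
proof (induction I rule: infinite_finite_induct)
  case (insert i I)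
  then show ?case using Sym_add[of "u i" "\<lambda>a. \<Sum>i\<in>I. u i a"] by simp
qed simp_all

lemma series_one_Sym [simp]: "series_one \<in> Sym"
proof (rule SymI)
  fix a b :: monomial assume eq: "shape a = shape b"
  have "a = 0 \<longleftrightarrow> shape a = []" for a
    using card_supp_shp[of "lookup a"]
    by (auto simp: shape_def poly_mapping_eq_iff fun_eq_iff)
  then show "series_one a = series_one b" using eq by (simp add: series_one_def)
next
  fix a show "series_one a \<noteq> 0 \<Longrightarrow> mdeg a \<le> 0"
    by (auto simp: series_one_def mono_degree_def split: if_splits)
qed

definition MonLe :: "nat \<Rightarrow> nat \<Rightarrow> monomial set" where
  "MonLe N D = {a. keys a \<subseteq> {..<N} \<and> mdeg a \<le> D}"

definition xpow :: "nat \<Rightarrow> (nat \<Rightarrow> real) \<Rightarrow> monomial \<Rightarrow> real" where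
  "xpow N x a = (\<Prod>i<N. x i ^ lookup a i)"

lemma lookup_le_degree: "lookup a i \<le> mdeg a"
proof (cases "i \<in> keys a")
  case True then show ?thesis unfolding mono_degree_def by (intro member_le_sum) auto
next
  case False then show ?thesis by (simp add: in_keys_iff)
qed

lemma finite_MonLe [simp]: "finite (MonLe N D)"
proof -
  let ?F = "{f. \<forall>i::nat. (i \<in> {..<N} \<longrightarrow> f i \<in> {..D}) \<and> (i \<notin> {..<N} \<longrightarrow> f i = (0::nat))}"
  have "finite ?F" by (rule finite_set_of_finite_funs) auto
  moreover have "lookup ` MonLe N D \<subseteq> ?F"
    using lookup_le_degree by (auto simp: MonLe_def keys_subset_iff intro: order_trans)
  ultimately have "finite (lookup ` MonLe N D)" by (rule finite_subset[rotated])
  then show ?thesis by (rule finite_imageD) (auto simp: inj_on_def)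
qed

lemma MonLe_add: "a \<in> MonLe N D \<Longrightarrow> b \<in> MonLe N E \<Longrightarrow> a + b \<in> MonLe N (D + E)"
  by (auto simp: MonLe_def keys_subset_iff mono_degree_add lookup_add)

lemma MonLe_add_iff: "a + b \<in> MonLe N D \<Longrightarrow> a \<in> MonLe N D \<and> b \<in> MonLe N D"
  by (auto simp: MonLe_def keys_subset_iff mono_degree_add lookup_add)

lemma finite_add_pairs [simp]: "finite {(a, b). a + b = (c::monomial)}"
proof -
  obtain N where "\<forall>i\<ge>N. lookup c i = 0" using keys_bound by blast
  then have "c \<in> MonLe N (mdeg c)" by (simp add: MonLe_def keys_subset_iff)
  then have "{(a, b). a + b = c} \<subseteq> MonLe N (mdeg c) \<times> MonLe N (mdeg c)"
    using MonLe_add_iff[where N = N and D = "mdeg c"] by clarify fast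
  then show ?thesis by (rule finite_subset) simp
qed

lemma series_mult_nonzero:
  assumes "series_mult u v c \<noteq> 0" shows "\<exists>a b. a + b = c \<and> u a \<noteq> 0 \<and> v b \<noteq> 0"
proof (rule ccontr)
  assume *: "\<not> ?thesis"
  have "series_mult u v c = 0"
    unfolding series_mult_def by (rule sum.neutral) (use * in auto)
  with assms show False by simp
qed

lemma series_mult_Sym: assumes "u \<in> Sym" "v \<in> Sym" shows "series_mult u v \<in> Sym"
proof -
  obtain D where D: "\<And>a. u a \<noteq> 0 \<Longrightarrow> mdeg a \<le> D" using Sym_bound[OF assms(1)] by blast
  obtain E where E: "\<And>a. v a \<noteq> 0 \<Longrightarrow> mdeg a \<le> E" using Sym_bound[OF assms(2)] by blast
  note DE = D E
  have "series_mult u v (map_key \<pi> c) = series_mult u v c" if \<pi>: "bij \<pi>" for \<pi> c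
  proof -
    let ?f = "\<lambda>a::monomial. map_key \<pi> a" and ?g = "\<lambda>a::monomial. map_key (inv_into UNIV \<pi>) a"
    have gf: "?g (?f a) = a" "?f (?g a) = a" for a
      using \<pi> by (auto intro!: poly_mapping_eqI simp: lookup_map_key bij_imp_bij_inv bij_is_inj bij_is_surj surj_f_inv_f)
    have pl: "?f (a + b) = ?f a + ?f b" "?g (a + b) = ?g a + ?g b" for a b
      using \<pi> by (auto simp: map_key_plus bij_is_inj bij_imp_bij_inv)
    have "bij_betw (\<lambda>(a,b). (?f a, ?f b)) {(a, b). a + b = c} {(a, b). a + b = ?f c}"
      by (rule bij_betw_byWitness[where f' = "\<lambda>(a,b). (?g a, ?g b)"]) (auto simp: gf simp flip: pl)
    from sum.reindex_bij_betw[OF this, of "\<lambda>(a,b). u a * v b"]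
    have "series_mult u v (?f c) = (\<Sum>(a, b)\<in>{(a, b). a + b = c}. u (?f a) * v (?f b))"
      by (simp add: series_mult_def case_prod_beta)
    also have "\<dots> = series_mult u v c"
      using assms \<pi> by (simp add: series_mult_def Sym_def)
    finally show ?thesis .
  qed
  moreover have "mdeg c \<le> D + E" if "series_mult u v c \<noteq> 0" for c
  proof -
    from series_mult_nonzero[OF that] obtain a b where "a + b = c" "u a \<noteq> 0" "v b \<noteq> 0" by blast
    then show ?thesis using DE[of a] DE[of b] by (auto simp: mono_degree_add intro: add_mono)
  qed
  ultimately show ?thesis unfolding Sym_def by blast
qed

lemma eval_vars_eq:
  assumes "\<And>a. u a \<noteq> 0 \<Longrightarrow> mdeg a \<le> D"
  shows "eval_vars N u x = (\<Sum>a\<in>MonLe N D. u a * xpow N x a)"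
  unfolding eval_vars_def xpow_def
  by (rule sum.mono_neutral_left) (use assms finite_MonLe[of N D] in "auto simp: MonLe_def")

lemma eval_vars_mult:
  assumes "u \<in> Sym" "v \<in> Sym"
  shows "eval_vars N (series_mult u v) x = eval_vars N u x * eval_vars N v x"
proof -
  obtain D where D: "\<And>a. u a \<noteq> 0 \<Longrightarrow> mdeg a \<le> D" using Sym_bound[OF assms(1)] by blast
  obtain E where E: "\<And>a. v a \<noteq> 0 \<Longrightarrow> mdeg a \<le> E" using Sym_bound[OF assms(2)] by blast
  note DE = D E
  have deg: "mdeg c \<le> D + E" if "series_mult u v c \<noteq> 0" for c
  proof -
    from series_mult_nonzero[OF that] obtain a b where "a + b = c" "u a \<noteq> 0" "v b \<noteq> 0" by blast
    then show ?thesis using DE(1)[of a] DE(2)[of b] by (auto simp: mono_degree_add intro: add_mono)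
  qed
  let ?S = "MonLe N D \<times> MonLe N E"
  let ?h = "\<lambda>(a, b). u a * v b * (xpow N x a * xpow N x b)"
  have "eval_vars N (series_mult u v) x = (\<Sum>c\<in>MonLe N (D+E). series_mult u v c * xpow N x c)"
    by (rule eval_vars_eq[OF deg])
  also have "\<dots> = (\<Sum>c\<in>MonLe N (D+E). \<Sum>p\<in>{p \<in> ?S. (\<lambda>(a,b). a + b) p = c}. ?h p)"
  proof (rule sum_cong)
    fix c assume c: "c \<in> MonLe N (D+E)"
    have "series_mult u v c * xpow N x c = (\<Sum>p\<in>{(a, b). a + b = c}. ?h p)"
      unfolding series_mult_def sum_distrib_right
      by (rule sum.cong) (auto simp: xpow_def lookup_add power_add prod.distrib)
    also have "\<dots> = (\<Sum>p\<in>{p \<in> ?S. (\<lambda>(a,b). a + b) p = c}. ?h p)"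
    proof (rule sum.mono_neutral_right)
      show "\<forall>p\<in>{(a, b). a + b = c} - {p \<in> ?S. (\<lambda>(a,b). a + b) p = c}. ?h p = 0"
      proof
        fix p assume p: "p \<in> {(a, b). a + b = c} - {p \<in> ?S. (\<lambda>(a,b). a + b) p = c}"
        obtain a b where [simp]: "p = (a, b)" by (cases p)
        have "a + b = c" using p by auto
        then have "a \<in> MonLe N (D+E)" "b \<in> MonLe N (D+E)" using c MonLe_add_iff[of a b N "D+E"] by auto
        then have "u a = 0 \<or> v b = 0" using p DE(1)[of a] DE(2)[of b] by (auto simp: MonLe_def)
        then show "?h p = 0" by auto
      qed
    qed auto
    finally show "series_mult u v c * xpow N x c = (\<Sum>p\<in>{p \<in> ?S. (\<lambda>(a,b). a + b) p = c}. ?h p)" .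
  qed
  also have "\<dots> = (\<Sum>p\<in>?S. ?h p)"
    by (rule sum.group) (auto intro: MonLe_add)
  also have "\<dots> = (\<Sum>a\<in>MonLe N D. u a * xpow N x a) * (\<Sum>b\<in>MonLe N E. v b * xpow N x b)"
    by (simp add: sum_product sum.cartesian_product mult_ac)
  also have "\<dots> = eval_vars N u x * eval_vars N v x"
    using eval_vars_eq[OF DE(1)] eval_vars_eq[OF DE(2)] by simp
  finally show ?thesis .
qed

lemma eval_vars_linear:
  assumes "finite I" "\<And>i. i \<in> I \<Longrightarrow> u i \<in> Sym"
  shows "eval_vars N (\<lambda>a. \<Sum>i\<in>I. c i * u i a) x = (\<Sum>i\<in>I. c i * eval_vars N (u i) x)"
proof -
  have "\<forall>i\<in>I. \<exists>D. \<forall>a. u i a \<noteq> 0 \<longrightarrow> mdeg a \<le> D"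
    using assms(2) by (simp add: Sym_def)
  from bchoice[OF this] obtain D where D: "\<And>i a. i \<in> I \<Longrightarrow> u i a \<noteq> 0 \<Longrightarrow> mdeg a \<le> D i"
    by blast
  define E where "E = (\<Sum>i\<in>I. D i)"
  have E: "mdeg a \<le> E" if "i \<in> I" "u i a \<noteq> 0" for i a
    using D[OF that] member_le_sum[of i I D] assms(1) that(1) unfolding E_def by simp
  have "eval_vars N (\<lambda>a. \<Sum>i\<in>I. c i * u i a) x = (\<Sum>a\<in>MonLe N E. (\<Sum>i\<in>I. c i * u i a) * xpow N x a)"
  proof (rule eval_vars_eq)
    fix a assume "(\<Sum>i\<in>I. c i * u i a) \<noteq> 0"
    then obtain i where "i \<in> I" "c i * u i a \<noteq> 0" by (meson sum.neutral)
    then show "mdeg a \<le> E" using E by auto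
  qed
  also have "\<dots> = (\<Sum>i\<in>I. c i * (\<Sum>a\<in>MonLe N E. u i a * xpow N x a))"
    by (simp add: sum_distrib_left sum_distrib_right sum.swap[of _ I] mult_ac)
  also have "\<dots> = (\<Sum>i\<in>I. c i * eval_vars N (u i) x)"
    by (rule sum_cong) (simp add: eval_vars_eq[OF E])
  finally show ?thesis .
qed

text \<open>Uniqueness of base \<open>B\<close> digits, in the form needed to tell exponent vectors
  apart after the Kronecker substitution.\<close>

lemma digits_inj:
  assumes "\<And>i. i < N \<Longrightarrow> f i < B" "\<And>i. i < N \<Longrightarrow> g i < (B::nat)"
    and "(\<Sum>i<N. f i * B ^ i) = (\<Sum>i<N. g i * B ^ i)"
  shows "\<forall>i<N. f i = g i"
  using assms
proof (induction N arbitrary: f g)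
  case (Suc N)
  have split: "(\<Sum>i<Suc N. h i * B ^ i) = h 0 + B * (\<Sum>i<N. h (Suc i) * B ^ i)" for h :: "nat \<Rightarrow> nat"
    by (simp only: sum.lessThan_Suc_shift) (simp add: sum_distrib_left mult_ac)
  have eq: "f 0 + B * (\<Sum>i<N. f (Suc i) * B ^ i) = g 0 + B * (\<Sum>i<N. g (Suc i) * B ^ i)"
    using Suc.prems(3) split by simp
  have lt: "f 0 < B" "g 0 < B" using Suc.prems by auto
  have 0: "f 0 = g 0" using arg_cong[OF eq, of "\<lambda>z. z mod B"] lt by simp
  then have "(\<Sum>i<N. f (Suc i) * B ^ i) = (\<Sum>i<N. g (Suc i) * B ^ i)" using eq lt by simp
  then have *: "\<forall>i<N. f (Suc i) = g (Suc i)" by (intro Suc.IH) (simp_all add: Suc.prems)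
  show ?case
  proof (intro allI impI)
    fix i assume "i < Suc N"
    then show "f i = g i" using 0 * by (cases i) auto
  qed
qed simp

text \<open>The Kronecker substitution \<open>x\<^sub>i = y\<^bsup>B^i\<^esup>\<close> separates the monomials of bounded degree and, for
  \<open>y > 1\<close>, produces points with distinct coordinates.\<close>

lemma eval_vars_inj:
  assumes "u \<in> Sym" "v \<in> Sym"
    and ev: "\<And>N x. N \<ge> N0 \<Longrightarrow> inj_on x {..<N} \<Longrightarrow> eval_vars N u x = eval_vars N v x"
  shows "u = v"
proof
  fix a0
  obtain D where D: "\<And>a. u a \<noteq> 0 \<Longrightarrow> mdeg a \<le> D" using Sym_bound[OF assms(1)] by blast
  obtain E where E: "\<And>a. v a \<noteq> 0 \<Longrightarrow> mdeg a \<le> E" using Sym_bound[OF assms(2)] by blast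
  note DE = D E
  define F where "F = max D E"
  have uF: "\<And>a. u a \<noteq> 0 \<Longrightarrow> mdeg a \<le> F" and vF: "\<And>a. v a \<noteq> 0 \<Longrightarrow> mdeg a \<le> F"
    using DE by (fastforce simp: F_def)+
  show "u a0 = v a0"
  proof (cases "mdeg a0 \<le> F")
    case False
    then show ?thesis using uF vF by metis
  next
    case True
    obtain M where M: "\<forall>i\<ge>M. lookup a0 i = 0" using keys_bound by blast
    define N where "N = max M N0"
    have a0: "a0 \<in> MonLe N F" using True M by (auto simp: MonLe_def keys_subset_iff N_def)
    \<comment> \<open>\<open>B\<close> exceeds every exponent that occurs, and being at least 2 it
      keeps the coordinates y^(B^i) distinct.\<close>
    define B where "B = F + 2"
    define code where "code a = (\<Sum>i<N. lookup a i * B ^ i)" for a :: monomial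
    have inj: "inj_on code (MonLe N F)"
    proof (rule inj_onI)
      fix a b assume ab: "a \<in> MonLe N F" "b \<in> MonLe N F" "code a = code b"
      have lt: "lookup c i < B" if "c \<in> MonLe N F" for c i
        using lookup_le_degree[of c i] that by (simp add: MonLe_def B_def)
      have *: "\<forall>i<N. lookup a i = lookup b i"
        by (rule digits_inj[where B = B]) (use ab lt in "simp_all add: code_def")
      show "a = b"
      proof (rule poly_mapping_eqI)
        fix i show "lookup a i = lookup b i"
          using * ab by (cases "i < N") (simp_all add: MonLe_def keys_subset_iff)
      qed
    qed
    define p where "p = (\<Sum>a\<in>MonLe N F. Polynomial.monom (u a - v a) (code a))"
    have "poly p y = 0" if y: "y > 1" for y :: real
    proof -
      define x where "x i = y ^ (B ^ i)" for i
      have "inj_on x {..<N}"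
        using y by (intro inj_onI) (simp add: x_def power_inject_exp B_def)
      then have "eval_vars N u x = eval_vars N v x" using ev[of N x] by (simp add: N_def)
      then have "(\<Sum>a\<in>MonLe N F. (u a - v a) * xpow N x a) = 0"
        using eval_vars_eq[OF uF] eval_vars_eq[OF vF] by (simp add: left_diff_distrib sum_subtractf)
      moreover have "xpow N x a = y ^ code a" for a
        by (simp add: xpow_def x_def code_def power_sum power_mult[symmetric] mult.commute)
      ultimately show ?thesis by (simp add: p_def poly_sum poly_monom)
    qed
    then have "{1<..} \<subseteq> {y. poly p y = 0}" by auto
    then have "p = 0"
      using poly_roots_finite[of p] infinite_Ioi[of "1::real"] finite_subset by blast
    then have "0 = Polynomial.coeff p (code a0)" by simp
    also have "\<dots> = (\<Sum>a\<in>MonLe N F. if a = a0 then u a - v a else 0)"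
      unfolding p_def coeff_sum
      by (rule sum.cong) (use inj a0 in "auto simp: inj_on_def")
    also have "\<dots> = u a0 - v a0" using a0 by (simp add: sum.delta)
    finally show ?thesis by simp
  qed
qed

lemma part_inj: assumes "part a = part b" "length a = length b" shows "a = b"
  using assms by (metis nth_equalityI part_def)

text \<open>The coefficient of a product at a composition is a convolution over entrywise
  splittings; the flag numbers of a sum of coprime modules obey the same convolution.\<close>

lemma series_mult_mon:
  "series_mult u v (mon c) =
    (\<Sum>(a, b)\<in>{(a, b). length a = length c \<and> length b = length c \<and> map2 (+) a b = c}. u (mon a) * v (mon b))"
proof -
  let ?P = "{(a, b). length a = length c \<and> length b = length c \<and> map2 (+) a b = c}"
  have add: "mon a + mon b = mon (map2 (+) a b)" if "length a = length b" for a b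
    by (rule poly_mapping_eqI) (use that in "auto simp: lookup_add part_def")
  have inj: "a = b" if "mon a = mon b" "length a = length b" for a b
    using that part_inj by (metis lookup_mon)
  let ?l = "\<lambda>a. map (lookup a) [0..<length c]"
  have ml: "mon (?l a) = a" if "\<forall>i\<ge>length c. lookup a i = 0" for a
    by (rule poly_mapping_eqI) (use that in "auto simp: part_def")
  have lm: "?l (mon a) = a" if "length a = length c" for a
    using that by (intro nth_equalityI) (simp_all add: part_def)
  have *: "\<forall>i\<ge>length c. lookup a i = 0" "\<forall>i\<ge>length c. lookup b i = 0"
    if "a + b = mon c" for a b
  proof -
    have "lookup a i + lookup b i = part c i" for i
      using that by (metis lookup_add lookup_mon)
    then show "\<forall>i\<ge>length c. lookup a i = 0" "\<forall>i\<ge>length c. lookup b i = 0"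
      by (metis add_is_0 not_le part_def)+
  qed
  have "bij_betw (\<lambda>(a,b). (mon a, mon b)) ?P {(a, b). a + b = mon c}"
  proof (rule bij_betw_byWitness[where f' = "\<lambda>(a,b). (?l a, ?l b)"])
    show "\<forall>p\<in>?P. (\<lambda>(a, b). (?l a, ?l b)) ((\<lambda>(a, b). (mon a, mon b)) p) = p"
    proof
      fix p assume "p \<in> ?P"
      then obtain a b where p: "p = (a, b)" "length a = length c" "length b = length c" by auto
      show "(\<lambda>(a, b). (?l a, ?l b)) ((\<lambda>(a, b). (mon a, mon b)) p) = p"
        unfolding p prod.case by (simp only: lm p)
    qed
    show "\<forall>p\<in>{(a, b). a + b = mon c}. (\<lambda>(a, b). (mon a, mon b)) ((\<lambda>(a, b). (?l a, ?l b)) p) = p"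
    proof
      fix p assume "p \<in> {(a, b). a + b = mon c}"
      then obtain a b where p: "p = (a, b)" "a + b = mon c" by auto
      show "(\<lambda>(a, b). (mon a, mon b)) ((\<lambda>(a, b). (?l a, ?l b)) p) = p"
        unfolding p prod.case by (simp only: ml[OF *(1)[OF p(2)]] ml[OF *(2)[OF p(2)]])
    qed
    show "(\<lambda>(a, b). (mon a, mon b)) ` ?P \<subseteq> {(a, b). a + b = mon c}"
    proof
      fix p assume "p \<in> (\<lambda>(a, b). (mon a, mon b)) ` ?P"
      then obtain a b where "p = (mon a, mon b)" "length a = length c" "length b = length c" "map2 (+) a b = c" by auto
      then show "p \<in> {(a, b). a + b = mon c}" using add[of a b] by simp
    qed
    show "(\<lambda>(a, b). (?l a, ?l b)) ` {(a, b). a + b = mon c} \<subseteq> ?P"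
    proof
      fix p assume "p \<in> (\<lambda>(a, b). (?l a, ?l b)) ` {(a, b). a + b = mon c}"
      then obtain a b where p: "p = (?l a, ?l b)" and ab: "a + b = mon c" by auto
      have "mon (map2 (+) (?l a) (?l b)) = mon (?l a) + mon (?l b)" by (rule add[symmetric]) simp
      also have "\<dots> = mon c" using ml *[OF ab] ab by simp
      finally have "map2 (+) (?l a) (?l b) = c" by (rule inj) simp
      then show "p \<in> ?P" using p by simp
    qed
  qed
  from sum.reindex_bij_betw[OF this, of "\<lambda>(a,b). u a * v b"]
  show ?thesis by (simp add: series_mult_def case_prod_beta)
qed

definition msym :: "nat list \<Rightarrow> series" where "msym \<mu> a = (if shape a = \<mu> then 1 else 0)"

lemma msym_Sym [simp]: "msym \<mu> \<in> Sym"
  by (rule SymI[where D = "sum_list \<mu>"]) (auto simp: msym_def mono_degree_shape split: if_splits)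

lemma Sym_msym_expand:
  assumes "u \<in> Sym" "\<And>a. u a \<noteq> 0 \<Longrightarrow> mdeg a = n"
  shows "u a = (\<Sum>\<mu>\<in>Par n. u (mon \<mu>) * msym \<mu> a)"
proof -
  have "(\<Sum>\<mu>\<in>Par n. u (mon \<mu>) * msym \<mu> a) = (\<Sum>\<mu>\<in>Par n. if shape a = \<mu> then u (mon \<mu>) else 0)"
    by (rule sum.cong) (auto simp: msym_def)
  also have "\<dots> = (if shape a \<in> Par n then u (mon (shape a)) else 0)"
    by (simp add: sum.delta)
  also have "\<dots> = u a"
    using assms(2)[of a] SymD[OF assms(1), of "mon (shape a)" a] by (auto simp: shape_in_partitions_of)
  finally show ?thesis by simp
qed

lemma Sym_eqI_mon:
  assumes "u \<in> Sym" "v \<in> Sym" "\<And>\<mu>. is_partition \<mu> \<Longrightarrow> u (mon \<mu>) = v (mon \<mu>)"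
  shows "u = v"
proof
  fix a show "u a = v a"
    using SymD[OF assms(1), of a "mon (shape a)"] SymD[OF assms(2), of a "mon (shape a)"] assms(3) by simp
qed

section \<open>Schur functions and horizontal strips\<close>

definition psum :: "(nat \<Rightarrow> nat) \<Rightarrow> nat" where "psum p = (\<Sum>i | p i \<noteq> 0. p i)"
definition fsupp :: "(nat \<Rightarrow> nat) \<Rightarrow> bool" where "fsupp p \<longleftrightarrow> (\<exists>N. \<forall>i\<ge>N. p i = 0)"

lemma psum_eq: assumes "\<forall>i\<ge>N. p i = 0" shows "psum p = (\<Sum>i<N. p i)"
proof -
  have "{i. p i \<noteq> 0} \<subseteq> {..<N}" using assms by (metis supp_subset)
  then show ?thesis unfolding psum_def by (rule sum.mono_neutral_left[rotated]) auto
qed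

lemma psum_part: "psum (part \<nu>) = sum_list \<nu>"
  using psum_eq[of "length \<nu>" "part \<nu>"] sum_part[of \<nu> "length \<nu>"] by (simp add: part_def)

lemma fsupp_part: "fsupp (part \<nu>)"
  unfolding fsupp_def by (rule exI[of _ "length \<nu>"]) (simp add: part_def)

lemma fsupp_zero: "fsupp (\<lambda>_. 0)" by (simp add: fsupp_def)

text \<open>\<open>hs l k\<close>: the skew diagram \<open>l/k\<close> is a horizontal strip.\<close>

definition hs :: "(nat \<Rightarrow> nat) \<Rightarrow> (nat \<Rightarrow> nat) \<Rightarrow> bool" where
  "hs l k \<longleftrightarrow> (\<forall>i. k i \<le> l i \<and> l (Suc i) \<le> k i)"

definition desc :: "(nat \<Rightarrow> nat) \<Rightarrow> bool" where "desc p \<longleftrightarrow> (\<forall>i. p (Suc i) \<le> p i)"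

lemma hs_desc: "hs l k \<Longrightarrow> desc l" "hs l k \<Longrightarrow> desc k"
  unfolding hs_def desc_def by (metis order_trans)+

lemma hs_fsupp1: "hs l k \<Longrightarrow> fsupp l \<Longrightarrow> fsupp k"
  unfolding hs_def fsupp_def by (metis le_zero_eq)

lemma hs_fsupp2: assumes "hs l k" "fsupp k" shows "fsupp l"
proof -
  obtain N where N: "\<forall>i\<ge>N. k i = 0" using assms by (auto simp: fsupp_def)
  have "l i = 0" if "i \<ge> Suc N" for i
  proof -
    obtain j where "i = Suc j" "j \<ge> N" using \<open>i \<ge> Suc N\<close> by (cases i) auto
    then have "l i \<le> 0" using N assms(1) unfolding hs_def by metis
    then show ?thesis by simp
  qed
  then show ?thesis unfolding fsupp_def by blast
qed

lemma psum_mono: assumes "\<forall>i. k i \<le> l i" "fsupp l" shows "psum k \<le> psum l"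
proof -
  obtain N where N: "\<forall>i\<ge>N. l i = 0" using assms by (auto simp: fsupp_def)
  then have "\<forall>i\<ge>N. k i = 0" using assms(1) by (metis le_zero_eq)
  then show ?thesis using N assms(1) by (simp add: psum_eq sum_mono)
qed

lemma le_psum: assumes "fsupp l" shows "l i \<le> psum l"
proof -
  obtain N where N: "\<forall>i\<ge>N. l i = 0" using assms by (auto simp: fsupp_def)
  show ?thesis
  proof (cases "i < N")
    case True then show ?thesis using psum_eq[OF N] by (simp add: member_le_sum)
  next
    case False then show ?thesis using N by simp
  qed
qed

lemma psum_zero_iff: assumes "fsupp p" shows "psum p = 0 \<longleftrightarrow> p = (\<lambda>_. 0)"
proof
  assume "psum p = 0"
  then have "p i = 0" for i using le_psum[OF assms, of i] by simp
  then show "p = (\<lambda>_. 0)" by (simp add: fun_eq_iff)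
qed (simp add: psum_def)

lemma finite_below: assumes "fsupp l" shows "finite {k. \<forall>i. k i \<le> (l i :: nat)}"
proof -
  obtain N where N: "\<forall>i\<ge>N. l i = 0" using assms by (auto simp: fsupp_def)
  let ?F = "{f. \<forall>i::nat. (i \<in> {..<N} \<longrightarrow> f i \<in> {..psum l}) \<and> (i \<notin> {..<N} \<longrightarrow> f i = (0::nat))}"
  have "finite ?F" by (rule finite_set_of_finite_funs) auto
  moreover have "{k. \<forall>i. k i \<le> l i} \<subseteq> ?F"
  proof
    fix k assume "k \<in> {k. \<forall>i. k i \<le> l i}"
    then have k: "k i \<le> l i" for i by auto
    have "k i \<le> psum l" for i using k[of i] le_psum[OF assms, of i] by linarith
    moreover have "k i = 0" if "\<not> i < N" for i using k[of i] N that by simp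
    ultimately show "k \<in> ?F" by simp
  qed
  ultimately show ?thesis by (rule finite_subset[rotated])
qed

definition down :: "nat \<Rightarrow> (nat \<Rightarrow> nat) \<Rightarrow> (nat \<Rightarrow> nat) set" where
  "down r l = {k. hs l k \<and> psum k + r = psum l}"
definition up :: "nat \<Rightarrow> (nat \<Rightarrow> nat) \<Rightarrow> (nat \<Rightarrow> nat) set" where
  "up m k = {l. hs l k \<and> psum l = psum k + m}"

lemma finite_down: assumes "fsupp l" shows "finite (down r l)"
  by (rule finite_subset[OF _ finite_below[OF assms]]) (auto simp: down_def hs_def)

lemma finite_up: assumes "fsupp k" shows "finite (up m k)"
proof (rule finite_subset)
  let ?b = "\<lambda>i. case i of 0 \<Rightarrow> psum k + m | Suc j \<Rightarrow> k j"
  have "fsupp ?b"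
    using assms unfolding fsupp_def by (metis (no_types, lifting) Suc_le_D Suc_le_mono old.nat.simps(5))
  then show "finite {l. \<forall>i. l i \<le> ?b i}" by (rule finite_below)
  show "up m k \<subseteq> {l. \<forall>i. l i \<le> ?b i}"
  proof clarify
    fix l i assume l: "l \<in> up m k"
    then have "fsupp l" using hs_fsupp2 assms by (auto simp: up_def)
    then show "l i \<le> ?b i" using l le_psum[of l i] by (auto simp: up_def hs_def split: nat.split)
  qed
qed

definition strip_sum :: "nat \<Rightarrow> ((nat \<Rightarrow> nat) \<Rightarrow> real) \<Rightarrow> (nat \<Rightarrow> nat) \<Rightarrow> real" where
  "strip_sum r g l = (\<Sum>k\<in>down r l. g k)"
definition costrip_sum :: "nat \<Rightarrow> ((nat \<Rightarrow> nat) \<Rightarrow> real) \<Rightarrow> (nat \<Rightarrow> nat) \<Rightarrow> real" where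
  "costrip_sum m g k = (\<Sum>l\<in>up m k. g l)"

lemma common_bound:
  assumes "fsupp p" "fsupp q"
  obtains N where "\<forall>i\<ge>N. p i = 0" "\<forall>i\<ge>N. q i = 0"
proof -
  obtain N M where NM: "\<forall>i\<ge>N. p i = 0" "\<forall>i\<ge>M. q i = 0" using assms unfolding fsupp_def by blast
  show thesis by (rule that[of "max N M"]) (use NM in auto)
qed

text \<open>The middle partitions of two successive horizontal strips form a product of intervals; reflecting
  every interval exchanges the sizes of the two strips.\<close>

definition reflect :: "(nat \<Rightarrow> nat) \<Rightarrow> (nat \<Rightarrow> nat) \<Rightarrow> (nat \<Rightarrow> nat) \<Rightarrow> nat \<Rightarrow> nat" where
  "reflect n m k i = max (m i) (n (Suc i)) + (case i of 0 \<Rightarrow> n 0 | Suc j \<Rightarrow> min (n (Suc j)) (m j)) - k i"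

lemma mid_iff: "hs n k \<and> hs k m \<longleftrightarrow>
   (\<forall>i. max (m i) (n (Suc i)) \<le> k i \<and> k i \<le> (case i of 0 \<Rightarrow> n 0 | Suc j \<Rightarrow> min (n (Suc j)) (m j)))"
  (is "?L \<longleftrightarrow> (\<forall>i. ?lo i \<le> k i \<and> k i \<le> ?hi i)")
proof
  assume ?L
  then show "\<forall>i. ?lo i \<le> k i \<and> k i \<le> ?hi i" by (auto simp: hs_def split: nat.split)
next
  assume R: "\<forall>i. ?lo i \<le> k i \<and> k i \<le> ?hi i"
  have "k i \<le> n i" for i using R[rule_format, of i] by (cases i) auto
  moreover have "k (Suc i) \<le> m i" for i using R[rule_format, of "Suc i"] by auto
  ultimately show ?L using R by (auto simp: hs_def)
qed

lemma reflect_mid: assumes "hs n k" "hs k m" shows "hs n (reflect n m k)" "hs (reflect n m k) m" "reflect n m (reflect n m k) = k"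
proof -
  have R: "\<forall>i. max (m i) (n (Suc i)) \<le> k i \<and> k i \<le> (case i of 0 \<Rightarrow> n 0 | Suc j \<Rightarrow> min (n (Suc j)) (m j))"
    using mid_iff assms by blast
  have "\<forall>i. max (m i) (n (Suc i)) \<le> reflect n m k i \<and> reflect n m k i \<le> (case i of 0 \<Rightarrow> n 0 | Suc j \<Rightarrow> min (n (Suc j)) (m j))"
  proof
    fix i show "max (m i) (n (Suc i)) \<le> reflect n m k i \<and> reflect n m k i \<le> (case i of 0 \<Rightarrow> n 0 | Suc j \<Rightarrow> min (n (Suc j)) (m j))"
      using R[rule_format, of i] unfolding reflect_def by linarith
  qed
  then show "hs n (reflect n m k)" "hs (reflect n m k) m" using mid_iff by blast+
  show "reflect n m (reflect n m k) = k"
  proof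
    fix i show "reflect n m (reflect n m k) i = k i"
      using R[rule_format, of i] unfolding reflect_def by linarith
  qed
qed

text \<open>Each row of \<open>k\<close> and its reflection add up to the two interval ends. Summed
  over the rows, the lower end of row i pairs with the upper end of row i + 1, and max + min of
  \<open>m i\<close> and \<open>n (Suc i)\<close> is their sum.\<close>

lemma psum_reflect: assumes "hs n k" "hs k m" "fsupp n" shows "psum (reflect n m k) + psum k = psum n + psum m"
proof -
  have "fsupp m" "fsupp k" using assms hs_fsupp1 by blast+
  then obtain N where N: "\<forall>i\<ge>N. n i = 0" "\<forall>i\<ge>N. m i = 0" using common_bound[OF assms(3)] by blast
  have kN: "\<forall>i\<ge>Suc N. k i = 0" using N assms(1) unfolding hs_def by (metis Suc_leD le_zero_eq)
  let ?lo = "\<lambda>i. max (m i) (n (Suc i))" and ?hi = "\<lambda>i. case i of 0 \<Rightarrow> n 0 | Suc j \<Rightarrow> min (n (Suc j)) (m j)"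
  have R: "k i \<le> ?lo i + ?hi i" for i using mid_iff[of n k m] assms by (meson trans_le_add2)
  have rN: "\<forall>i\<ge>Suc N. reflect n m k i = 0" using N by (auto simp: reflect_def split: nat.split)
  have "psum (reflect n m k) + psum k = (\<Sum>i<Suc N. ?lo i + ?hi i)"
    unfolding psum_eq[OF rN] psum_eq[OF kN] sum.distrib[symmetric]
    by (rule sum.cong) (use R in "auto simp: reflect_def")
  also have "\<dots> = (\<Sum>i<N. ?lo i) + (\<Sum>i<Suc N. ?hi i)"
    using N by (simp add: sum.distrib)
  also have "(\<Sum>i<Suc N. ?hi i) = n 0 + (\<Sum>i<N. min (n (Suc i)) (m i))"
    by (simp only: sum.lessThan_Suc_shift) simp
  also have "(\<Sum>i<N. ?lo i) + (n 0 + (\<Sum>i<N. min (n (Suc i)) (m i))) = n 0 + (\<Sum>i<N. n (Suc i) + m i)"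
  proof -
    have "(\<Sum>i<N. ?lo i) + (\<Sum>i<N. min (n (Suc i)) (m i)) = (\<Sum>i<N. n (Suc i) + m i)"
      unfolding sum.distrib[symmetric] by (rule sum.cong) auto
    then show ?thesis by linarith
  qed
  also have "\<dots> = (\<Sum>i<Suc N. n i) + (\<Sum>i<N. m i)"
    by (simp add: sum.lessThan_Suc_shift sum.distrib del: sum.lessThan_Suc)
  also have "\<dots> = psum n + psum m"
    using psum_eq[of "Suc N" n] psum_eq[of N m] N by simp
  finally show ?thesis .
qed

text \<open>Reflection of the middle partition is an involution that exchanges strips of sizes a and
  b. This is the source of the symmetry of Schur functions.\<close>

lemma strip_sum_commute:
  assumes "fsupp n"
  shows "strip_sum a (strip_sum b g) n = strip_sum b (strip_sum a g) n"
proof -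
  have fin: "\<forall>k\<in>down a n. finite (down b k)" for a b
    using assms hs_fsupp1 finite_down by (auto simp: down_def)
  have eq: "strip_sum a (strip_sum b g) n = (\<Sum>p\<in>Sigma (down a n) (down b). g (snd p))" for a b
    unfolding strip_sum_def by (subst sum.Sigma) (use assms fin finite_down in "auto simp: case_prod_beta")
  have step: "reflect n m k \<in> down b n" "m \<in> down a (reflect n m k)" "reflect n m (reflect n m k) = k"
    if "k \<in> down a n" "m \<in> down b k" for k m a b
    using that reflect_mid[of n k m] psum_reflect[of n k m] assms by (auto simp: down_def)
  show ?thesis unfolding eq
    by (rule sum.reindex_bij_witness[where i = "\<lambda>(k, m). (reflect n m k, m)" and j = "\<lambda>(k, m). (reflect n m k, m)"])
      (use step in auto)
qed

text \<open>The commutation rule for adding and removing horizontal strips. Below the first row,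
  \<open>l (Suc i)\<close> (strip added to s, then removed down to p) and \<open>u i\<close> (strip
  removed from s, then added up to p) run through the same interval and are exchanged by reflection.
  Only the first row of \<open>l\<close> is unbounded above; its excess over
  \<open>max (p 0) (s 0)\<close> is the summation index k.\<close>

lemma costrip_strip:
  assumes s: "fsupp s"
  shows "costrip_sum m (strip_sum r g) s = (\<Sum>k\<le>min m r. strip_sum (r - k) (costrip_sum (m - k) g) s)"
proof -
  define lo hi where "lo p i = max (p (Suc i)) (s (Suc i))" and "hi p i = min (p i) (s i)" for p :: "nat \<Rightarrow> nat" and i
  define fw where "fw p l i = lo p i + hi p i - l (Suc i)" for p l :: "nat \<Rightarrow> nat" and i
  define bw where "bw p k u i = (case i of 0 \<Rightarrow> max (p 0) (s 0) + k | Suc j \<Rightarrow> lo p j + hi p j - u j)" for p u :: "nat \<Rightarrow> nat" and i k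
  let ?A = "Sigma (up m s) (down r)"
  let ?B = "Sigma {..min m r} (\<lambda>k. Sigma (down (r - k) s) (up (m - k)))"
  have A: "(l, p) \<in> ?A \<longleftrightarrow> hs l s \<and> hs l p \<and> psum l = psum s + m \<and> psum p + r = psum l" for l p
    by (auto simp: up_def down_def)
  have B: "(k, u, p) \<in> ?B \<longleftrightarrow> k \<le> m \<and> k \<le> r \<and> hs s u \<and> hs p u \<and> psum u + (r - k) = psum s \<and> psum p = psum u + (m - k)" for k u p
    by (auto simp: up_def down_def)
  have int1: "lo p i \<le> l (Suc i) \<and> l (Suc i) \<le> hi p i" if "hs l s" "hs l p" for l p i
    using that by (auto simp: hs_def lo_def hi_def)
  have int2: "lo p i \<le> u i \<and> u i \<le> hi p i" if "hs s u" "hs p u" for u p i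
    using that by (auto simp: hs_def lo_def hi_def)
  \<comment> \<open>As for \<open>reflect\<close>, max + min of two rows is their sum; the only
    surplus is the excess k of the first row.\<close>
  have size: "psum u + psum l = psum p + psum s + k"
    if l0: "l 0 = max (p 0) (s 0) + k" and ul: "\<And>i. u i + l (Suc i) = lo p i + hi p i" and f: "fsupp p" "fsupp u" "fsupp l" for k u p l
  proof -
    obtain N1 where N1: "\<forall>i\<ge>N1. p i = 0" "\<forall>i\<ge>N1. s i = 0" using common_bound f(1) s by blast
    obtain N2 where N2: "\<forall>i\<ge>N2. u i = 0" "\<forall>i\<ge>N2. l i = 0" using common_bound f by blast
    define N where "N = max N1 N2"
    have N: "\<forall>i\<ge>N. p i = 0" "\<forall>i\<ge>N. s i = 0" "\<forall>i\<ge>N. u i = 0" "\<forall>i\<ge>Suc N. l i = 0" "\<forall>i\<ge>Suc N. p i = 0" "\<forall>i\<ge>Suc N. s i = 0"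
      using N1 N2 by (auto simp: N_def)
    have "psum u + psum l = l 0 + (\<Sum>i<N. u i + l (Suc i))"
      unfolding psum_eq[OF N(3)] psum_eq[OF N(4)] sum.distrib by (simp add: sum.lessThan_Suc_shift del: sum.lessThan_Suc)
    also have "\<dots> = k + (max (p 0) (s 0) + (\<Sum>i<N. lo p i)) + (\<Sum>i<N. hi p i)"
      by (simp add: ul l0 sum.distrib)
    also have "max (p 0) (s 0) + (\<Sum>i<N. lo p i) = (\<Sum>i<Suc N. max (p i) (s i))"
      by (simp add: sum.lessThan_Suc_shift lo_def del: sum.lessThan_Suc)
    also have "(\<Sum>i<N. hi p i) = (\<Sum>i<Suc N. min (p i) (s i))" using N by (simp add: hi_def)
    also have "k + (\<Sum>i<Suc N. max (p i) (s i)) + (\<Sum>i<Suc N. min (p i) (s i)) = k + (\<Sum>i<Suc N. p i + s i)"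
    proof -
      have "(\<Sum>i<Suc N. max (p i) (s i)) + (\<Sum>i<Suc N. min (p i) (s i)) = (\<Sum>i<Suc N. p i + s i)"
        unfolding sum.distrib[symmetric] by (rule sum.cong) auto
      then show ?thesis by linarith
    qed
    also have "\<dots> = psum p + psum s + k"
      unfolding psum_eq[OF N(5)] psum_eq[OF N(6)] by (simp add: sum.distrib)
    finally show ?thesis .
  qed
  have forward: "(l 0 - max (p 0) (s 0), fw p l, p) \<in> ?B \<and> bw p (l 0 - max (p 0) (s 0)) (fw p l) = l" if "(l, p) \<in> ?A" for l p
  proof -
    have l: "hs l s" "hs l p" "psum l = psum s + m" "psum p + r = psum l" using that A by auto
    have f: "fsupp l" "fsupp p" using hs_fsupp2[OF l(1) s] hs_fsupp1[OF l(2)] by auto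
    have I: "lo p i \<le> l (Suc i)" "l (Suc i) \<le> hi p i" for i using int1 l by auto
    have I': "lo p i \<le> fw p l i \<and> fw p l i \<le> hi p i" for i using I[of i] unfolding fw_def by linarith
    have u: "hs s (fw p l)" "hs p (fw p l)"
      using I' by (auto simp: hs_def lo_def hi_def)
    have l0: "l 0 = max (p 0) (s 0) + (l 0 - max (p 0) (s 0))" using l by (auto simp: hs_def)
    have ul: "fw p l i + l (Suc i) = lo p i + hi p i" for i using I(2)[of i] by (simp add: fw_def)
    have sz: "psum (fw p l) + psum l = psum p + psum s + (l 0 - max (p 0) (s 0))"
      by (rule size[OF l0 ul f(2) _ f(1)]) (use hs_fsupp1[OF u(1) s] in simp)
    have le: "psum (fw p l) \<le> psum s" "psum (fw p l) \<le> psum p"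
      using psum_mono[OF _ s, of "fw p l"] psum_mono[OF _ f(2), of "fw p l"] u by (auto simp: hs_def)
    have "bw p (l 0 - max (p 0) (s 0)) (fw p l) = l"
    proof
      fix i show "bw p (l 0 - max (p 0) (s 0)) (fw p l) i = l i"
        using l0 ul by (cases i) (auto simp: bw_def fw_def I(2) le_add2 trans_le_add2)
    qed
    then show ?thesis unfolding B using u l sz le by auto
  qed
  have backward: "(bw p k u, p) \<in> ?A \<and> bw p k u 0 - max (p 0) (s 0) = k \<and> fw p (bw p k u) = u" if "(k, u, p) \<in> ?B" for k u p
  proof -
    have u: "k \<le> m" "k \<le> r" "hs s u" "hs p u" "psum u + (r - k) = psum s" "psum p = psum u + (m - k)" using that B by auto
    have f: "fsupp u" "fsupp p" using hs_fsupp1[OF u(3) s] hs_fsupp2[OF u(4)] by auto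
    have I: "lo p i \<le> u i" "u i \<le> hi p i" for i using int2 u by auto
    have I': "lo p i \<le> bw p k u (Suc i)" "bw p k u (Suc i) \<le> hi p i" for i
      using I[of i] by (auto simp: bw_def)
    have l: "hs (bw p k u) s" "hs (bw p k u) p"
    proof -
      have "s i \<le> bw p k u i \<and> p i \<le> bw p k u i" for i
        using I'(1)[of "i - 1"] by (cases i) (auto simp: bw_def lo_def)
      moreover have "bw p k u (Suc i) \<le> s i \<and> bw p k u (Suc i) \<le> p i" for i
        using I'(2)[of i] by (auto simp: hi_def)
      ultimately show "hs (bw p k u) s" "hs (bw p k u) p" by (auto simp: hs_def)
    qed
    have ul: "u i + bw p k u (Suc i) = lo p i + hi p i" for i using I(2)[of i] by (simp add: bw_def)
    have sz: "psum u + psum (bw p k u) = psum p + psum s + k"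
      by (rule size[OF _ ul f(2,1) hs_fsupp2[OF l(1) s]]) (simp add: bw_def)
    have "fw p (bw p k u) = u"
    proof
      fix i show "fw p (bw p k u) i = u i" using ul[of i] I'(2)[of i] by (simp add: fw_def)
    qed
    then show ?thesis unfolding A using l sz u by (auto simp: bw_def)
  qed
  have fU: "finite (up i u)" if "u \<in> down j s" for i j u
    using that by (intro finite_up) (auto simp: down_def intro: hs_fsupp1[OF _ s])
  have fB: "finite (Sigma (down (r - k) s) (up (m - k)))" for k
    by (intro finite_SigmaI finite_down[OF s] finite_up) (auto simp: down_def intro: hs_fsupp1[OF _ s])
  have "costrip_sum m (strip_sum r g) s = (\<Sum>q\<in>?A. g (snd q))"
    unfolding costrip_sum_def strip_sum_def
    by (subst sum.Sigma) (use finite_up[OF s] finite_down hs_fsupp2[OF _ s] in "auto simp: case_prod_beta up_def")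
  also have "\<dots> = (\<Sum>q\<in>?B. g (snd (snd q)))"
  proof (rule sum.reindex_bij_witness[where j = "\<lambda>(l, p). (l 0 - max (p 0) (s 0), fw p l, p)" and i = "\<lambda>(k, u, p). (bw p k u, p)"])
    fix q assume q: "q \<in> ?A"
    obtain l p where [simp]: "q = (l, p)" by (cases q)
    show "(case case q of (l, p) \<Rightarrow> (l 0 - max (p 0) (s 0), fw p l, p) of (k, u, p) \<Rightarrow> (bw p k u, p)) = q"
      using forward[of l p] q by simp
    show "(case q of (l, p) \<Rightarrow> (l 0 - max (p 0) (s 0), fw p l, p)) \<in> ?B"
      using forward[of l p] q by simp
    show "g (snd (snd (case q of (l, p) \<Rightarrow> (l 0 - max (p 0) (s 0), fw p l, p)))) = g (snd q)" by simp
  next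
    fix q assume q: "q \<in> ?B"
    obtain k u p where [simp]: "q = (k, u, p)" by (cases q)
    show "(case case q of (k, u, p) \<Rightarrow> (bw p k u, p) of (l, p) \<Rightarrow> (l 0 - max (p 0) (s 0), fw p l, p)) = q"
      using backward[of k u p] q by simp
    show "(case q of (k, u, p) \<Rightarrow> (bw p k u, p)) \<in> ?A" using backward[of k u p] q by simp
  qed
  also have "\<dots> = (\<Sum>k\<le>min m r. \<Sum>q\<in>Sigma (down (r - k) s) (up (m - k)). g (snd q))"
    by (subst sum.Sigma) (simp_all add: fB case_prod_beta)
  also have "\<dots> = (\<Sum>k\<le>min m r. strip_sum (r - k) (costrip_sum (m - k) g) s)"
    unfolding costrip_sum_def strip_sum_def
    by (intro sum_cong, subst sum.Sigma) (simp_all add: fU finite_down[OF s] case_prod_beta)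
  finally show ?thesis .
qed

text \<open>The complete homogeneous polynomial h_m in N variables, split by the exponent of the
  last variable.\<close>

fun hN :: "(nat \<Rightarrow> real) \<Rightarrow> nat \<Rightarrow> nat \<Rightarrow> real" where
  "hN x 0 m = (if m = 0 then 1 else 0)"
| "hN x (Suc N) m = (\<Sum>k\<le>m. x N ^ k * hN x N (m - k))"

text \<open>The Schur polynomial in \<open>N\<close> variables, by the branching rule.\<close>

fun sN :: "(nat \<Rightarrow> real) \<Rightarrow> nat \<Rightarrow> (nat \<Rightarrow> nat) \<Rightarrow> real" where
  "sN x 0 p = (if p = (\<lambda>_. 0) then 1 else 0)"
| "sN x (Suc N) p = (\<Sum>r\<le>psum p. x N ^ r * strip_sum r (sN x N) p)"

text \<open>The Pieri rule for Schur polynomials and h_m. After branching in the last variable, the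
  commutation rule moves the added strip inside, and the double sum factors into the recursions of
  \<open>hN\<close> and \<open>sN\<close>.\<close>

lemma costrip_sN: "fsupp k \<Longrightarrow> costrip_sum m (sN x N) k = hN x N m * sN x N k"
proof (induction N arbitrary: m k)
  case 0
  have "costrip_sum m (sN x 0) k = (\<Sum>l\<in>up m k. if l = (\<lambda>_. 0) then 1 else 0)"
    by (simp add: costrip_sum_def)
  also have "\<dots> = (if (\<lambda>_. 0) \<in> up m k then 1 else 0)"
    using finite_up[OF 0] by (simp add: sum.delta)
  also have "(\<lambda>_. 0) \<in> up m k \<longleftrightarrow> k = (\<lambda>_. 0) \<and> m = 0"
    using psum_zero_iff[OF fsupp_zero] by (auto simp: up_def hs_def fun_eq_iff psum_def)
  finally show ?case by auto
next
  case (Suc N)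
  let ?s = "sN x N" and ?T = "psum k + m"
  have zero: "strip_sum r g k = 0" if "r > psum k" for r g
  proof -
    have "down r k = {}" using that by (auto simp: down_def)
    then show ?thesis by (simp add: strip_sum_def)
  qed
  have "costrip_sum m (sN x (Suc N)) k = (\<Sum>r\<le>?T. x N ^ r * costrip_sum m (strip_sum r ?s) k)"
    unfolding costrip_sum_def sum_distrib_left by (subst sum.swap) (auto simp: up_def intro!: sum.cong)
  also have "\<dots> = (\<Sum>r\<le>?T. \<Sum>j\<le>min m r. x N ^ r * strip_sum (r - j) (costrip_sum (m - j) ?s) k)"
    by (simp add: costrip_strip[OF Suc.prems] sum_distrib_left)
  also have "\<dots> = (\<Sum>r\<le>?T. \<Sum>j\<le>min m r. x N ^ r * (hN x N (m - j) * strip_sum (r - j) ?s k))"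
  proof (intro sum.cong refl arg_cong2[where f = "(*)"])
    fix r j
    show "strip_sum (r - j) (costrip_sum (m - j) ?s) k = hN x N (m - j) * strip_sum (r - j) ?s k"
      unfolding strip_sum_def sum_distrib_left
      by (rule sum.cong) (use Suc.IH hs_fsupp1[OF _ Suc.prems] in "auto simp: down_def")
  qed
  also have "\<dots> = (\<Sum>j\<le>m. \<Sum>r\<le>psum k. (x N ^ j * hN x N (m - j)) * (x N ^ r * strip_sum r ?s k))"
    (is "(\<Sum>r\<le>?T. \<Sum>j\<le>min m r. ?f r j) = (\<Sum>j\<le>m. \<Sum>r\<le>psum k. ?g j r)")
  proof -
    have "(\<Sum>r\<le>?T. \<Sum>j\<le>min m r. ?f r j) = (\<Sum>q\<in>Sigma {..?T} (\<lambda>r. {..min m r}). ?f (fst q) (snd q))"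
      by (subst sum.Sigma) (auto simp: case_prod_beta)
    \<comment> \<open>Strips larger than \<open>psum k\<close> contribute 0; the remaining range
      becomes a product after replacing r by r - j.\<close>
    also have "\<dots> = (\<Sum>q\<in>{q \<in> Sigma {..?T} (\<lambda>r. {..min m r}). fst q - snd q \<le> psum k}. ?f (fst q) (snd q))"
      by (rule sum.mono_neutral_right) (auto simp: zero)
    also have "\<dots> = (\<Sum>q\<in>{..m} \<times> {..psum k}. ?g (fst q) (snd q))"
      by (rule sum.reindex_bij_witness[where j = "\<lambda>(r, j). (j, r - j)" and i = "\<lambda>(j, r). (r + j, j)"])
        (auto simp: power_add[symmetric])
    also have "\<dots> = (\<Sum>j\<le>m. \<Sum>r\<le>psum k. ?g j r)"
      by (simp add: sum.cartesian_product case_prod_beta)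
    finally show ?thesis .
  qed
  also have "\<dots> = hN x (Suc N) m * sN x (Suc N) k"
    by (simp add: sum_product)
  finally show ?case .
qed

text \<open>The coefficient of a Schur function, by the branching rule: \<open>c\<close> lists the exponents from the last variable
  to the first.\<close>

fun sc :: "nat list \<Rightarrow> (nat \<Rightarrow> nat) \<Rightarrow> real" where
  "sc [] p = (if p = (\<lambda>_. 0) then 1 else 0)"
| "sc (m # c) p = strip_sum m (sc c) p"

definition PF :: "nat \<Rightarrow> (nat \<Rightarrow> nat) set" where "PF n = {p. fsupp p \<and> desc p \<and> psum p = n}"

lemma desc_iff: "desc p \<longleftrightarrow> (\<forall>i j. i \<le> j \<longrightarrow> p j \<le> p i)"
  unfolding desc_def by (metis Suc_n_not_le_n lift_Suc_antimono_le nat_le_linear)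

lemma desc_part: "is_partition \<nu> \<Longrightarrow> desc (part \<nu>)"
  by (simp add: desc_def part_desc)

lemma part_shp: assumes "fsupp p" "desc p" shows "part (shp p) = p"
proof -
  obtain N where N: "\<forall>i\<ge>N. p i = 0" using assms by (auto simp: fsupp_def)
  define k where "k = (LEAST i. p i = 0)"
  have pk: "p k = 0" unfolding k_def by (rule LeastI[of _ N]) (use N in auto)
  have iff: "p i = 0 \<longleftrightarrow> k \<le> i" for i
    using not_less_Least[of i "\<lambda>i. p i = 0"] assms(2) pk unfolding k_def[symmetric] desc_iff
    by (metis le_zero_eq not_le)
  have pm: "part (map p [0..<k]) = p" using iff by (auto simp: part_def fun_eq_iff)
  have "0 \<notin> set (map p [0..<k])"
  proof
    assume "0 \<in> set (map p [0..<k])"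
    then obtain i where "i < k" "p i = 0" by auto
    then show False using iff[of i] by simp
  qed
  moreover have "sorted_wrt (\<ge>) (map p [0..<k])"
    using assms(2) by (simp add: sorted_wrt_iff_nth_less desc_iff)
  ultimately have "is_partition (map p [0..<k])" by (simp add: is_partition_def)
  then have "shp (part (map p [0..<k])) = map p [0..<k]" by (rule shp_part)
  then show ?thesis using pm by simp
qed

lemma PF_part: "PF n = part ` Par n"
proof (intro equalityI subsetI)
  fix p assume p: "p \<in> PF n"
  then have "p = part (shp p)" by (simp add: PF_def part_shp)
  moreover have "shp p \<in> Par n"
    using p calculation by (metis (mono_tags, lifting) PF_def is_partition_shp mem_Collect_eq Par_def psum_part)
  ultimately show "p \<in> part ` Par n" by blast
qed (auto simp: PF_def fsupp_part desc_part psum_part Par_def)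

lemma inj_on_part: "inj_on part (Par n)"
  by (rule inj_on_inverseI[where g = shp]) (simp add: Par_def shp_part)

lemma sN_zero: "sN x N (\<lambda>_. 0) = 1"
proof (induction N)
  case (Suc N)
  have "down 0 (\<lambda>_. 0) = {\<lambda>_. 0}" by (auto simp: down_def hs_def fun_eq_iff)
  moreover have "psum (\<lambda>_. 0) = 0" by (simp add: psum_def)
  ultimately show ?case using Suc by (simp add: strip_sum_def)
qed simp

text \<open>Counting the pairs \<open>l\<close>, \<open>k\<close> with l/k a strip of size m from
  either side moves the strip sum from \<open>sc\<close> to \<open>sN\<close>, where the Pieri rule
  turns it into the factor h_m.\<close>

lemma sum_sc_sN: "(\<Sum>l\<in>PF (sum_list c). sc c l * sN x N l) = (\<Prod>m\<leftarrow>c. hN x N m)"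
proof (induction c)
  case Nil
  have "PF 0 = {\<lambda>_. 0}" by (auto simp: PF_def psum_zero_iff fsupp_zero desc_def)
  then show ?case by (simp add: sN_zero)
next
  case (Cons m c)
  let ?n = "sum_list c"
  have fin: "finite (PF n)" for n by (simp add: PF_part)
  have "(\<Sum>l\<in>PF (sum_list (m # c)). sc (m # c) l * sN x N l)
      = (\<Sum>q\<in>Sigma (PF (m + ?n)) (down m). sc c (snd q) * sN x N (fst q))"
    unfolding sc.simps strip_sum_def sum_distrib_right
    by (subst sum.Sigma) (use fin finite_down in "auto simp: PF_def case_prod_beta")
  also have "\<dots> = (\<Sum>q\<in>Sigma (PF ?n) (up m). sc c (fst q) * sN x N (snd q))"
    by (rule sum.reindex_bij_witness[where i = "\<lambda>(k, l). (l, k)" and j = "\<lambda>(l, k). (k, l)"])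
      (auto simp: PF_def up_def down_def intro: hs_desc hs_fsupp1 hs_fsupp2)
  also have "\<dots> = (\<Sum>k\<in>PF ?n. \<Sum>l\<in>up m k. sc c k * sN x N l)"
    by (subst sum.Sigma) (use fin finite_up in "auto simp: PF_def case_prod_beta")
  also have "\<dots> = (\<Sum>k\<in>PF ?n. sc c k * (hN x N m * sN x N k))"
    by (intro sum.cong refl) (simp add: sum_distrib_left[symmetric] costrip_sN[unfolded costrip_sum_def] PF_def)
  also have "\<dots> = hN x N m * (\<Sum>k\<in>PF ?n. sc c k * sN x N k)"
    by (simp add: sum_distrib_left mult_ac)
  finally show ?case using Cons by simp
qed

lemma strip_sum_cong:
  assumes "fsupp p" "\<And>k. fsupp k \<Longrightarrow> g k = h k" shows "strip_sum r g p = strip_sum r h p"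
  unfolding strip_sum_def by (rule sum.cong) (use assms hs_fsupp1 in "auto simp: down_def")

lemma sc_pull: "fsupp p \<Longrightarrow> sc (c1 @ m # c2) p = sc (m # c1 @ c2) p"
proof (induction c1 arbitrary: p)
  case (Cons a c1)
  have "sc ((a # c1) @ m # c2) p = strip_sum a (sc (m # c1 @ c2)) p"
    using Cons by (auto intro: strip_sum_cong)
  also have "\<dots> = strip_sum a (strip_sum m (sc (c1 @ c2))) p"
    by (simp add: strip_sum_def)
  also have "\<dots> = strip_sum m (strip_sum a (sc (c1 @ c2))) p" by (rule strip_sum_commute[OF Cons.prems])
  also have "\<dots> = sc (m # (a # c1) @ c2) p" by (simp add: strip_sum_def)
  finally show ?case .
qed simp

lemma sc_mset: "mset c = mset c' \<Longrightarrow> fsupp p \<Longrightarrow> sc c p = sc c' p"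
proof (induction c arbitrary: c' p)
  case (Cons m c)
  have "m \<in> set c'" using Cons.prems(1) by (metis list.set_intros(1) mset_eq_setD)
  then obtain c1 c2 where c': "c' = c1 @ m # c2" by (meson split_list)
  have "mset c = mset (c1 @ c2)" using Cons.prems(1) c' by simp
  then have "sc (m # c) p = sc (m # c1 @ c2) p"
    using Cons by (auto intro: strip_sum_cong)
  then show ?case using sc_pull[OF Cons.prems(2)] c' by simp
qed simp

lemma sc_nonneg: "sc c p \<ge> 0"
  by (induction c arbitrary: p) (auto simp: strip_sum_def intro: sum_nonneg)

lemma sc_nonzero: "sc (m # c) p \<noteq> 0 \<Longrightarrow> \<exists>k\<in>down m p. sc c k \<noteq> 0"
  unfolding sc.simps strip_sum_def by (meson sum.neutral)

lemma sc_size: "sc c p \<noteq> 0 \<Longrightarrow> fsupp p \<Longrightarrow> sum_list c = psum p"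
proof (induction c arbitrary: p)
  case Nil then show ?case by (auto simp: psum_zero_iff split: if_splits)
next
  case (Cons m c)
  obtain k where "k \<in> down m p" "sc c k \<noteq> 0" using sc_nonzero[OF Cons.prems(1)] by blast
  then show ?case using Cons.IH[of k] hs_fsupp1 Cons.prems(2) by (auto simp: down_def)
qed

section \<open>Tableaux and the branching rule\<close>

definition cellf :: "(nat \<Rightarrow> nat) \<Rightarrow> (nat \<times> nat) set" where "cellf p = {(i, j). j < p i}"

text \<open>Shapes are functions here because the induction produces the smaller shape row by row,
  possibly with empty rows.\<close>

definition st :: "(nat \<Rightarrow> nat) \<Rightarrow> nat list \<Rightarrow> (nat \<times> nat \<Rightarrow> nat) set" where
  "st p c = {T.
     (\<forall>i j j'. j < j' \<and> j' < p i \<longrightarrow> T (i, j) \<le> T (i, j')) \<and>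
     (\<forall>i i' j. i < i' \<and> j < p i \<and> j < p i' \<longrightarrow> T (i, j) < T (i', j)) \<and>
     (\<forall>q. q \<notin> cellf p \<longrightarrow> T q = 0) \<and> (\<forall>v. card {q \<in> cellf p. T q = v} = part c v)}"

lemma cells_part: "cells \<nu> = cellf (part \<nu>)"
  by (auto simp: cells_def cellf_def part_def split: if_splits)

lemma ssyt_st: "{T \<in> ssyt \<nu>. content \<nu> T = part c} = st (part \<nu>) c"
  unfolding ssyt_def st_def content_def cells_part fun_eq_iff by (auto simp: cellf_def)

lemma cellf_Sigma: "cellf p = Sigma {i. p i \<noteq> 0} (\<lambda>i. {..<p i})"
  by (auto simp: cellf_def)

lemma fsupp_finite: assumes "fsupp p" shows "finite {i. p i \<noteq> 0}"
proof -
  obtain N where "\<forall>i\<ge>N. p i = 0" using assms by (auto simp: fsupp_def)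
  then have "{i. p i \<noteq> 0} \<subseteq> {..<N}" by (metis supp_subset)
  then show ?thesis by (rule finite_subset) simp
qed

lemma finite_cellf: "fsupp p \<Longrightarrow> finite (cellf p)"
  unfolding cellf_Sigma by (intro finite_SigmaI fsupp_finite) auto

lemma card_cellf: "fsupp p \<Longrightarrow> card (cellf p) = psum p"
  unfolding cellf_Sigma psum_def using fsupp_finite[of p] by (subst card_SigmaI) auto

lemma st_value:
  assumes "fsupp p" "T \<in> st p c" "q \<in> cellf p" shows "T q < length c"
proof (rule ccontr)
  assume "\<not> T q < length c"
  then have "card {q' \<in> cellf p. T q' = T q} = 0" using assms(2) by (simp add: st_def part_def)
  moreover have "finite {q' \<in> cellf p. T q' = T q}" using finite_cellf[OF assms(1)] by simp
  ultimately have "{q' \<in> cellf p. T q' = T q} = {}" by (simp only: card_0_eq)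
  then show False using assms(3) by blast
qed

lemma finite_st: assumes "fsupp p" shows "finite (st p c)"
proof (rule finite_subset)
  show "finite {T. \<forall>q. (q \<in> cellf p \<longrightarrow> T q \<in> {..<length c}) \<and> (q \<notin> cellf p \<longrightarrow> T q = 0)}"
    by (rule finite_set_of_finite_funs) (use finite_cellf[OF assms] in auto)
  show "st p c \<subseteq> {T. \<forall>q. (q \<in> cellf p \<longrightarrow> T q \<in> {..<length c}) \<and> (q \<notin> cellf p \<longrightarrow> T q = 0)}"
    using st_value[OF assms] by (auto simp: st_def)
qed

lemma downset_nat:
  assumes "finite (S :: nat set)" "\<And>i j. j \<in> S \<Longrightarrow> i < j \<Longrightarrow> i \<in> S" shows "S = {..<card S}"
proof -
  obtain b where b: "S \<subseteq> {..<b}" using assms(1) finite_nat_iff_bounded by blast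
  define k where "k = (LEAST i. i \<notin> S)"
  have "k \<notin> S" unfolding k_def by (rule LeastI[of _ b]) (use b in auto)
  moreover have "i \<in> S" if "i < k" for i using not_less_Least[of i "\<lambda>i. i \<notin> S"] that by (simp add: k_def)
  ultimately have "S = {..<k}" using assms(2) by (metis lessThan_iff linorder_neqE_nat subsetI subset_antisym)
  then show ?thesis by (metis card_lessThan)
qed

text \<open>The cells with the largest possible entry form a horizontal strip, since columns
  increase strictly. Removing them leaves a tableau of shape \<open>k\<close>, and
  \<open>ext\<close> fills the strip with that entry again.\<close>

lemma card_st_snoc:
  assumes p: "fsupp p" "desc p"
  shows "card (st p (c @ [m])) = (\<Sum>k\<in>down m p. card (st k c))"
proof -
  define N where "N = length c"
  define ext where "ext k T = (\<lambda>(i, j). if j < k i then T (i, j) else if j < p i then N else (0::nat))" for k and T :: "nat \<times> nat \<Rightarrow> nat"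
  have pd: "i \<le> j \<Longrightarrow> p j \<le> p i" for i j using p(2) by (simp add: desc_iff)
  have part_snoc: "part (c @ [m]) v = (if v < N then part c v else if v = N then m else 0)" for v
    by (auto simp: part_def N_def nth_append)
  have ext_lt: "{j. j < p i \<and> ext k T (i, j) < N} = {..<k i}" if "k \<in> down m p" "T \<in> st k c" for k T i
  proof -
    have k: "hs p k" "fsupp k" using that hs_fsupp1 p by (auto simp: down_def)
    show ?thesis using k st_value[OF k(2) that(2)]
      by (auto simp: ext_def hs_def N_def cellf_def split: if_splits intro: less_le_trans)
  qed
  have sub1: "ext k T \<in> st p (c @ [m])" if kT: "k \<in> down m p" "T \<in> st k c" for k T
  proof -
    have k: "hs p k" "fsupp k" "desc k" "psum k + m = psum p" using kT hs_fsupp1 p hs_desc by (auto simp: down_def)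
    have le: "k i \<le> p i" "p (Suc i) \<le> k i" for i using k by (auto simp: hs_def)
    have lt: "T (i, j) < N" if "j < k i" for i j using st_value[OF k(2) kT(2), of "(i,j)"] that by (simp add: cellf_def N_def)
    have row: "ext k T (i, j) \<le> ext k T (i, j')" if "j < j'" "j' < p i" for i j j'
      using that kT(2) lt[of j i] by (auto simp: ext_def st_def)
    have col: "ext k T (i, j) < ext k T (i', j)" if "i < i'" "j < p i" "j < p i'" for i i' j
    proof -
      have "j < k i" using le(2)[of i] pd[of "Suc i" i'] that by simp
      moreover have "T (i, j) < T (i', j)" if "j < k i'" using kT(2) that \<open>i < i'\<close> \<open>j < k i\<close> by (auto simp: st_def)
      ultimately show ?thesis using lt[of j i] that by (auto simp: ext_def)
    qed
    have "card {q \<in> cellf p. ext k T q = v} = part (c @ [m]) v" for v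
    proof -
      consider "v < N" | "v = N" | "v > N" by linarith
      then show ?thesis
      proof cases
        case 1
        have "{q \<in> cellf p. ext k T q = v} = {q \<in> cellf k. T q = v}"
          using 1 le by (auto simp: ext_def cellf_def split: if_splits intro: less_le_trans)
        then show ?thesis using kT(2) 1 by (simp add: st_def part_snoc)
      next
        case 2
        have "{q \<in> cellf p. ext k T q = v} = cellf p - cellf k"
          using 2 lt by (auto simp: ext_def cellf_def split: if_splits) (metis less_irrefl)
        moreover have "cellf k \<subseteq> cellf p" using le by (auto simp: cellf_def intro: less_le_trans)
        ultimately have "card {q \<in> cellf p. ext k T q = v} = psum p - psum k"
          using finite_cellf[OF k(2)] card_cellf p(1) k(2) by (simp add: card_Diff_subset)
        then show ?thesis using k(4) 2 by (simp add: part_snoc)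
      next
        case 3
        have "{q \<in> cellf p. ext k T q = v} = {}" using 3 lt by (auto simp: ext_def cellf_def split: if_splits) (meson less_asym)
        then show ?thesis using 3 by (simp only: part_snoc) simp
      qed
    qed
    moreover have "ext k T q = 0" if "q \<notin> cellf p" for q
      using that le by (auto simp: ext_def cellf_def not_less split: if_splits prod.split) (meson le_trans not_le)
    ultimately show ?thesis using row col by (auto simp: st_def)
  qed
  have sub2: "\<exists>k\<in>down m p. T \<in> ext k ` st k c" if T: "T \<in> st p (c @ [m])" for T
  proof -
    have TN: "T (i, j) \<le> N" if "j < p i" for i j
      using st_value[OF p(1) T, of "(i, j)"] that by (simp add: cellf_def N_def)
    have rowT: "T (i, j) \<le> T (i, j')" if "j < j'" "j' < p i" for i j j' using T that by (auto simp: st_def)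
    have colT: "T (i, j) < T (i', j)" if "i < i'" "j < p i" "j < p i'" for i i' j using T that by (auto simp: st_def)
    have out: "\<forall>q. q \<notin> cellf p \<longrightarrow> T q = 0" using T unfolding st_def by (elim CollectE conjE)
    have con: "card {q \<in> cellf p. T q = v} = part (c @ [m]) v" for v using T by (auto simp: st_def)
    \<comment> \<open>Rows increase weakly, so the cells with entry below \<open>N\<close> form an
      initial segment of each row; its length defines the inner shape.\<close>
    define k where "k i = card {j. j < p i \<and> T (i, j) < N}" for i
    have kset: "{j. j < p i \<and> T (i, j) < N} = {..<k i}" for i
      unfolding k_def
    proof (rule downset_nat)
      fix j j' assume j: "j' \<in> {j. j < p i \<and> T (i, j) < N}" "j < j'"
      then show "j \<in> {j. j < p i \<and> T (i, j) < N}" using rowT[of j j' i] by auto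
    qed simp
    have kiff: "j < k i \<longleftrightarrow> j < p i \<and> T (i, j) < N" for i j using kset[of i] by auto
    have hs: "hs p k"
      unfolding hs_def
    proof (intro allI conjI)
      fix i show "k i \<le> p i" using kiff[of _ i] by (meson leI less_irrefl)
      show "p (Suc i) \<le> k i"
      proof (rule ccontr)
        assume "\<not> p (Suc i) \<le> k i"
        then have a: "k i < p (Suc i)" by simp
        then have b: "k i < p i" using pd[of i "Suc i"] by simp
        have "T (i, k i) < N" using colT[of i "Suc i" "k i"] TN[of "k i" "Suc i"] a b by simp
        then show False using kiff[of "k i" i] b by simp
      qed
    qed
    have kf: "fsupp k" by (rule hs_fsupp1[OF hs p(1)])
    define T' where "T' = (\<lambda>(i, j). if j < k i then T (i, j) else 0)"
    have ck: "cellf k = cellf p - {q \<in> cellf p. T q = N}"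
      using kiff TN by (auto simp: cellf_def order.strict_iff_order)
    have "card (cellf k) = psum p - m"
      unfolding ck using con[of N] finite_cellf[OF p(1)] card_cellf[OF p(1)]
      by (subst card_Diff_subset) (auto simp: part_snoc)
    moreover have "m \<le> psum p"
      using con[of N] card_mono[OF finite_cellf[OF p(1)], of "{q \<in> cellf p. T q = N}"] card_cellf[OF p(1)]
      by (auto simp: part_snoc)
    ultimately have "k \<in> down m p" using hs card_cellf[OF kf] by (simp add: down_def)
    moreover have "T' \<in> st k c"
    proof -
      have "card {q \<in> cellf k. T' q = v} = part c v" for v
      proof (cases "v < N")
        case True
        have "{q \<in> cellf k. T' q = v} = {q \<in> cellf p. T q = v}"
          using True kiff by (auto simp: cellf_def T'_def)
        then show ?thesis using con[of v] True by (simp add: part_snoc)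
      next
        case False
        have "{q \<in> cellf k. T' q = v} = {}"
          using False kiff by (auto simp: cellf_def T'_def)
        then show ?thesis using False by (simp only: part_def N_def) simp
      qed
      then show ?thesis using rowT colT kiff by (auto simp: st_def T'_def cellf_def)
    qed
    moreover have "T = ext k T'"
    proof
      fix q :: "nat \<times> nat" obtain i j where [simp]: "q = (i, j)" by (cases q)
      show "T q = ext k T' q"
        using kiff[of j i] TN[of j i] out[rule_format, of q] by (auto simp: ext_def T'_def cellf_def)
    qed
    ultimately show ?thesis by blast
  qed
  have inj: "inj_on (ext k) (st k c)" for k
  proof (rule inj_onI)
    fix T T' assume TT: "T \<in> st k c" "T' \<in> st k c" "ext k T = ext k T'"
    show "T = T'"
    proof
      fix q :: "nat \<times> nat" obtain i j where [simp]: "q = (i, j)" by (cases q)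
      show "T q = T' q"
        using fun_cong[OF TT(3), of q] TT(1,2) by (cases "j < k i") (auto simp: ext_def st_def cellf_def)
    qed
  qed
  have "st p (c @ [m]) = (\<Union>k\<in>down m p. ext k ` st k c)"
  proof (intro equalityI subsetI)
    fix T assume "T \<in> st p (c @ [m])"
    from sub2[OF this] show "T \<in> (\<Union>k\<in>down m p. ext k ` st k c)" by blast
  next
    fix T assume "T \<in> (\<Union>k\<in>down m p. ext k ` st k c)"
    then obtain k T' where "k \<in> down m p" "T' \<in> st k c" "T = ext k T'" by blast
    then show "T \<in> st p (c @ [m])" using sub1 by simp
  qed
  moreover have "card (\<Union>k\<in>down m p. ext k ` st k c) = (\<Sum>k\<in>down m p. card (ext k ` st k c))"
  proof (rule card_UN_disjoint)
    show "finite (down m p)" by (rule finite_down[OF p(1)])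
    show "\<forall>k\<in>down m p. finite (ext k ` st k c)" using finite_st hs_fsupp1 p by (auto simp: down_def)
    show "\<forall>k\<in>down m p. \<forall>k'\<in>down m p. k \<noteq> k' \<longrightarrow> ext k ` st k c \<inter> ext k' ` st k' c = {}"
    proof (intro ballI impI, rule ccontr)
      fix k k' assume k: "k \<in> down m p" "k' \<in> down m p" "k \<noteq> k'" "ext k ` st k c \<inter> ext k' ` st k' c \<noteq> {}"
      then obtain T T' where T: "T \<in> st k c" "T' \<in> st k' c" "ext k T = ext k' T'" by blast
      have "k i = k' i" for i using ext_lt[OF k(1) T(1), of i] ext_lt[OF k(2) T(2), of i] T(3) by (metis lessThan_eq_iff)
      then show False using k(3) by auto
    qed
  qed
  moreover have "(\<Sum>k\<in>down m p. card (ext k ` st k c)) = (\<Sum>k\<in>down m p. card (st k c))"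
    by (rule sum.cong) (simp_all add: card_image inj)
  ultimately show ?thesis by simp
qed

lemma card_st: "fsupp p \<Longrightarrow> desc p \<Longrightarrow> real (card (st p c)) = sc (rev c) p"
proof (induction c arbitrary: p rule: rev_induct)
  case Nil
  have "st p [] = (if p = (\<lambda>_. 0) then {\<lambda>_. 0} else {})"
  proof (cases "p = (\<lambda>_. 0)")
    case True then show ?thesis by (auto simp: st_def cellf_def part_def)
  next
    case False
    then obtain i where "p i \<noteq> 0" by auto
    then have "(i, 0) \<in> cellf p" by (simp add: cellf_def)
    then show ?thesis using st_value[OF Nil(1), of _ "[]" "(i, 0)"] False by auto
  qed
  then show ?case by simp
next
  case (snoc m c)
  have "real (card (st p (c @ [m]))) = (\<Sum>k\<in>down m p. real (card (st k c)))"
    using card_st_snoc[OF snoc.prems] by simp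
  also have "\<dots> = (\<Sum>k\<in>down m p. sc (rev c) k)"
    by (rule sum.cong) (use snoc hs_fsupp1 hs_desc in "auto simp: down_def")
  finally show ?case by (simp add: strip_sum_def)
qed

text \<open>\<open>sc\<close> strips off the variables starting with the last one, hence the
  reversal.\<close>

lemma schur_mon: "is_partition \<nu> \<Longrightarrow> schur \<nu> (mon c) = sc (rev c) (part \<nu>)"
  by (simp add: schur_def ssyt_st card_st fsupp_part desc_part)

lemma kostka_schur: "real (kostka \<nu> \<mu>) = schur \<nu> (mon \<mu>)"
  by (simp add: kostka_def schur_def)

lemma mon_of_monomial:
  assumes "\<forall>i\<ge>N. lookup a i = 0"
  shows "a = mon (map (lookup a) [0..<N])"
  by (rule poly_mapping_eqI) (use assms in "auto simp: part_def")

lemma schur_Sym: assumes \<nu>: "is_partition \<nu>" shows "schur \<nu> \<in> Sym"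
proof (rule SymI)
  fix a b assume ab: "shape a = shape b"
  obtain N where N: "\<forall>i\<ge>N. lookup a i = 0" "\<forall>i\<ge>N. lookup b i = 0"
    using common_bound[of "lookup a" "lookup b"] keys_bound unfolding fsupp_def by blast
  then obtain \<pi> where \<pi>: "\<pi> permutes {..<N}" "lookup a = lookup b \<circ> \<pi>"
    using shp_eq_permutes ab unfolding shape_def by blast
  have "mset (map (lookup a) [0..<N]) = image_mset (lookup b) (image_mset \<pi> (mset_set {..<N}))"
    using \<pi>(2) by (simp add: multiset.map_comp atLeast0LessThan)
  also have "image_mset \<pi> (mset_set {..<N}) = mset_set {..<N}" using \<pi>(1) by (rule permutes_image_mset)
  finally have "mset (map (lookup a) [0..<N]) = mset (map (lookup b) [0..<N])"
    by (simp add: atLeast0LessThan)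
  then show "schur \<nu> a = schur \<nu> b"
    using mon_of_monomial[OF N(1)] mon_of_monomial[OF N(2)] schur_mon[OF \<nu>] sc_mset fsupp_part by (metis mset_rev)
next
  fix a assume nz: "schur \<nu> a \<noteq> 0"
  obtain N where N: "\<forall>i\<ge>N. lookup a i = 0" using keys_bound by blast
  have "sc (rev (map (lookup a) [0..<N])) (part \<nu>) \<noteq> 0"
    using nz mon_of_monomial[OF N] schur_mon[OF \<nu>] by metis
  then have "sum_list (rev (map (lookup a) [0..<N])) = sum_list \<nu>"
    using sc_size fsupp_part psum_part by metis
  then show "mdeg a \<le> sum_list \<nu>"
    using mono_degree_eq[OF N] by (simp add: sum_list_rev interv_sum_list_conv_sum_set_nat atLeast0LessThan)
qed

lemma schur_degree: assumes \<nu>: "is_partition \<nu>" and nz: "schur \<nu> a \<noteq> 0" shows "mdeg a = sum_list \<nu>"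
proof -
  obtain N where N: "\<forall>i\<ge>N. lookup a i = 0" using keys_bound by blast
  have "sc (rev (map (lookup a) [0..<N])) (part \<nu>) \<noteq> 0"
    using nz mon_of_monomial[OF N] schur_mon[OF \<nu>] by metis
  then have "sum_list (rev (map (lookup a) [0..<N])) = sum_list \<nu>"
    using sc_size fsupp_part psum_part by metis
  then show ?thesis
    using mono_degree_eq[OF N] by (simp add: sum_list_rev interv_sum_list_conv_sum_set_nat atLeast0LessThan)
qed

definition comps :: "nat \<Rightarrow> nat \<Rightarrow> nat list set" where "comps N n = {c. length c = N \<and> sum_list c = n}"

lemma finite_comps [simp]: "finite (comps N n)"
proof (rule finite_subset)
  show "comps N n \<subseteq> {c. set c \<subseteq> {..n} \<and> length c = N}"
    using member_le_sum_list by (fastforce simp: comps_def)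
qed (rule finite_lists_length_eq, simp)

lemma eval_vars_comps:
  assumes "\<And>a. u a \<noteq> 0 \<Longrightarrow> mdeg a = n"
  shows "eval_vars N u x = (\<Sum>c\<in>comps N n. u (mon c) * (\<Prod>i<N. x i ^ part c i))"
proof -
  have "eval_vars N u x = (\<Sum>a\<in>MonLe N n. u a * xpow N x a)"
    by (rule eval_vars_eq) (use assms in auto)
  also have "\<dots> = (\<Sum>a\<in>{a \<in> MonLe N n. mdeg a = n}. u a * xpow N x a)"
    by (rule sum.mono_neutral_right) (use assms in auto)
  also have "\<dots> = (\<Sum>c\<in>comps N n. u (mon c) * (\<Prod>i<N. x i ^ part c i))"
  proof (rule sum.reindex_bij_witness[where i = mon and j = "\<lambda>a. map (lookup a) [0..<N]"])
    fix a assume a: "a \<in> {a \<in> MonLe N n. mdeg a = n}"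
    then have N: "\<forall>i\<ge>N. lookup a i = 0" by (simp add: MonLe_def keys_subset_iff)
    show m: "mon (map (lookup a) [0..<N]) = a" using mon_of_monomial[OF N] by simp
    show "map (lookup a) [0..<N] \<in> comps N n"
      using a mono_degree_eq[OF N] by (simp add: comps_def interv_sum_list_conv_sum_set_nat atLeast0LessThan)
    show "u (mon (map (lookup a) [0..<N])) * (\<Prod>i<N. x i ^ part (map (lookup a) [0..<N]) i) = u a * xpow N x a"
      unfolding m by (simp add: xpow_def part_def)
  next
    fix c assume c: "c \<in> comps N n"
    show "map (lookup (mon c)) [0..<N] = c"
      using c by (intro nth_equalityI) (simp_all add: comps_def part_def)
    have N: "\<forall>i\<ge>N. lookup (mon c) i = 0" using c by (simp add: comps_def part_def)
    have "mdeg (mon c) = n" using mono_degree_eq[OF N] c sum_part[of c N] by (simp add: comps_def)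
    then show "mon c \<in> {a \<in> MonLe N n. mdeg a = n}" using N by (simp add: MonLe_def keys_subset_iff)
  qed
  finally show ?thesis .
qed

lemma sN_expand: "fsupp p \<Longrightarrow> sN x N p = (\<Sum>c\<in>comps N (psum p). sc (rev c) p * (\<Prod>i<N. x i ^ part c i))"
proof (induction N arbitrary: p)
  case 0
  have "comps 0 n = (if n = 0 then {[]} else {})" for n by (auto simp: comps_def)
  then show ?case using psum_zero_iff[OF 0] by auto
next
  case (Suc N)
  let ?n = "psum p"
  have "sN x (Suc N) p = (\<Sum>r\<le>?n. \<Sum>k\<in>down r p. \<Sum>c\<in>comps N (?n - r). x N ^ r * (sc (rev c) k * (\<Prod>i<N. x i ^ part c i)))"
    unfolding sN.simps strip_sum_def sum_distrib_left
  proof (intro sum.cong refl)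
    fix r k assume k: "k \<in> down r p"
    then have "psum k = ?n - r" "fsupp k" using hs_fsupp1 Suc.prems by (auto simp: down_def)
    then show "x N ^ r * sN x N k = (\<Sum>c\<in>comps N (?n - r). x N ^ r * (sc (rev c) k * (\<Prod>i<N. x i ^ part c i)))"
      using Suc.IH[of k] by (simp add: sum_distrib_left)
  qed
  also have "\<dots> = (\<Sum>r\<le>?n. \<Sum>c\<in>comps N (?n - r). sc (r # rev c) p * (x N ^ r * (\<Prod>i<N. x i ^ part c i)))"
    unfolding sc.simps strip_sum_def sum_distrib_right by (subst sum.swap) (simp add: mult_ac)
  also have "\<dots> = (\<Sum>q\<in>Sigma {..?n} (\<lambda>r. comps N (?n - r)). sc (fst q # rev (snd q)) p * (x N ^ fst q * (\<Prod>i<N. x i ^ part (snd q) i)))"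
    by (subst sum.Sigma) (auto simp: case_prod_beta)
  also have "\<dots> = (\<Sum>c\<in>comps (Suc N) ?n. sc (rev c) p * (\<Prod>i<Suc N. x i ^ part c i))"
  proof (rule sum.reindex_bij_witness[where i = "\<lambda>c. (last c, butlast c)" and j = "\<lambda>(r, c). c @ [r]"])
    fix q assume q: "q \<in> Sigma {..?n} (\<lambda>r. comps N (?n - r))"
    obtain r c where [simp]: "q = (r, c)" by (cases q)
    show "(last (case q of (r, c) \<Rightarrow> c @ [r]), butlast (case q of (r, c) \<Rightarrow> c @ [r])) = q" by simp
    show "(case q of (r, c) \<Rightarrow> c @ [r]) \<in> comps (Suc N) ?n" using q by (simp add: comps_def)
    have "(\<Prod>i<N. x i ^ part (c @ [r]) i) = (\<Prod>i<N. x i ^ part c i)"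
      by (rule prod.cong) (use q in "auto simp: comps_def part_def nth_append")
    then show "sc (rev (case q of (r, c) \<Rightarrow> c @ [r])) p * (\<Prod>i<Suc N. x i ^ part (case q of (r, c) \<Rightarrow> c @ [r]) i)
       = sc (fst q # rev (snd q)) p * (x N ^ fst q * (\<Prod>i<N. x i ^ part (snd q) i))"
      using q by (auto simp: comps_def part_def nth_append mult_ac)
  next
    fix c assume c: "c \<in> comps (Suc N) ?n"
    then have ne: "c \<noteq> []" by (auto simp: comps_def)
    then have s: "sum_list (butlast c) + last c = ?n"
      using c sum_list_append[of "butlast c" "[last c]"] by (simp add: comps_def)
    show "(case (last c, butlast c) of (r, c) \<Rightarrow> c @ [r]) = c" using ne by simp
    show "(last c, butlast c) \<in> Sigma {..?n} (\<lambda>r. comps N (?n - r))" using s c by (simp add: comps_def)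
  qed
  finally show ?case .
qed

lemma eval_schur: assumes "is_partition \<nu>" shows "eval_vars N (schur \<nu>) x = sN x N (part \<nu>)"
  using sN_expand[OF fsupp_part, of x N \<nu>] eval_vars_comps[of "schur \<nu>" "sum_list \<nu>" N x] schur_degree[OF assms]
  by (simp add: psum_part schur_mon[OF assms])

text \<open>The Cauchy identity read as the coefficient of y^c: the y-variables stay formal, the
  x-variables are evaluated.\<close>

theorem cauchy_schur:
  "(\<Sum>\<nu>\<in>Par (sum_list c). schur \<nu> (mon c) * eval_vars N (schur \<nu>) x) = (\<Prod>m\<leftarrow>c. hN x N m)"
proof -
  have "(\<Sum>\<nu>\<in>Par (sum_list c). schur \<nu> (mon c) * eval_vars N (schur \<nu>) x)
      = (\<Sum>\<nu>\<in>Par (sum_list c). sc c (part \<nu>) * sN x N (part \<nu>))"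
    by (rule sum.cong) (auto simp: Par_def schur_mon eval_schur intro: sc_mset fsupp_part)
  also have "\<dots> = (\<Sum>l\<in>PF (sum_list c). sc c l * sN x N l)"
    unfolding PF_part by (simp add: sum.reindex[OF inj_on_part])
  finally show ?thesis by (simp add: sum_sc_sN)
qed

text \<open>Strictly monotone for the dominance order on partitions of n, so it serves as a
  numerical rank for triangularity.\<close>

definition dom_rank :: "nat \<Rightarrow> nat list \<Rightarrow> nat" where
  "dom_rank n \<nu> = (\<Sum>k\<le>n. \<Sum>i<k. part \<nu> i)"

text \<open>Induction along the strips. The bound on the number of rows is carried along because
  from the length of the composition on both partial sums equal the total size.\<close>

lemma sc_dominance:
  "sc (rev c) p \<noteq> 0 \<Longrightarrow> fsupp p \<Longrightarrow> (\<forall>i\<ge>length c. p i = 0) \<and> (\<forall>k. (\<Sum>i<k. part c i) \<le> (\<Sum>i<k. p i))"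
proof (induction c arbitrary: p rule: rev_induct)
  case Nil then show ?case by (auto simp: part_def split: if_splits)
next
  case (snoc m c)
  have "sc (m # rev c) p \<noteq> 0" using snoc.prems by simp
  from sc_nonzero[OF this] obtain q where q: "q \<in> down m p" "sc (rev c) q \<noteq> 0" by blast
  have f: "fsupp q" using q snoc.prems hs_fsupp1 by (auto simp: down_def)
  have hs: "q i \<le> p i" "p (Suc i) \<le> q i" for i using q by (auto simp: down_def hs_def)
  have IH: "q i = 0" if "i \<ge> length c" for i using snoc.IH[OF q(2) f] that by blast
  have IH2: "(\<Sum>i<k. part c i) \<le> (\<Sum>i<k. q i)" for k using snoc.IH[OF q(2) f] by blast
  have z: "p i = 0" if "i \<ge> length (c @ [m])" for i
  proof -
    obtain j where "i = Suc j" "j \<ge> length c" using \<open>i \<ge> length (c @ [m])\<close> by (cases i) auto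
    then show ?thesis using hs(2)[of j] IH[of j] by simp
  qed
  have "(\<Sum>i<k. part (c @ [m]) i) \<le> (\<Sum>i<k. p i)" for k
  proof (cases "k \<le> length c")
    case True
    have "(\<Sum>i<k. part (c @ [m]) i) = (\<Sum>i<k. part c i)"
      by (rule sum.cong) (use True in "auto simp: part_def nth_append")
    also have "\<dots> \<le> (\<Sum>i<k. q i)" by (rule IH2)
    also have "\<dots> \<le> (\<Sum>i<k. p i)" by (rule sum_mono) (rule hs)
    finally show ?thesis .
  next
    case False
    have "(\<Sum>i<k. part (c @ [m]) i) = sum_list (c @ [m])" by (rule sum_part) (use False in simp)
    also have "\<dots> = psum p" using sc_size[OF snoc.prems] by (simp add: sum_list_rev)
    also have "\<dots> = (\<Sum>i<k. p i)" by (rule psum_eq) (use z False in auto)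
    finally show ?thesis by simp
  qed
  then show ?case using z by blast
qed

text \<open>Deleting the last row of a partition removes a horizontal strip, so the tableau with row
  i filled by i is counted; all other terms are nonnegative.\<close>

lemma sc_diag: "is_partition \<nu> \<Longrightarrow> sc (rev \<nu>) (part \<nu>) > 0"
proof (induction \<nu> rule: rev_induct)
  case Nil then show ?case by (simp add: part_def)
next
  case (snoc m \<nu>)
  have p: "is_partition \<nu>" using snoc.prems by (auto simp: is_partition_def sorted_wrt_append)
  have "hs (part (\<nu> @ [m])) (part \<nu>)"
    using snoc.prems by (auto simp: hs_def part_def nth_append is_partition_def sorted_wrt_append sorted_wrt_iff_nth_less not_less less_Suc_eq)
  then have d: "part \<nu> \<in> down m (part (\<nu> @ [m]))" by (simp add: down_def psum_part)
  have "0 < sc (rev \<nu>) (part \<nu>)" by (rule snoc.IH[OF p])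
  also have "\<dots> \<le> strip_sum m (sc (rev \<nu>)) (part (\<nu> @ [m]))"
    unfolding strip_sum_def by (rule member_le_sum[OF d]) (auto simp: sc_nonneg finite_down fsupp_part)
  finally show ?case by simp
qed

lemma kostka_triangular:
  assumes "\<nu> \<in> Par n" "\<mu> \<in> Par n" "kostka \<nu> \<mu> \<noteq> 0" "\<nu> \<noteq> \<mu>"
  shows "dom_rank n \<mu> < dom_rank n \<nu>"
proof -
  have p: "is_partition \<nu>" "is_partition \<mu>" "sum_list \<nu> = n" "sum_list \<mu> = n" using assms by (auto simp: Par_def)
  have "sc (rev \<mu>) (part \<nu>) \<noteq> 0" using assms(3) kostka_schur[of \<nu> \<mu>] schur_mon[OF p(1)] by simp
  then have le: "(\<Sum>i<k. part \<mu> i) \<le> (\<Sum>i<k. part \<nu> i)" for k using sc_dominance fsupp_part by blast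
  have len: "length \<nu> \<le> n" "length \<mu> \<le> n" using p length_le_sum_list[of \<nu>] length_le_sum_list[of \<mu>] by (auto simp: is_partition_def)
  have "dom_rank n \<mu> \<noteq> dom_rank n \<nu>"
  proof
    assume "dom_rank n \<mu> = dom_rank n \<nu>"
    then have "\<not> (\<exists>k\<in>{..n}. (\<Sum>i<k. part \<mu> i) < (\<Sum>i<k. part \<nu> i))"
      unfolding dom_rank_def using le sum_strict_mono_ex1[of "{..n}" "\<lambda>k. \<Sum>i<k. part \<mu> i" "\<lambda>k. \<Sum>i<k. part \<nu> i"] by auto
    then have "\<forall>k\<in>{..n}. (\<Sum>i<k. part \<mu> i) = (\<Sum>i<k. part \<nu> i)" using le by (meson le_neq_implies_less)
    then have eq: "(\<Sum>i<k. part \<mu> i) = (\<Sum>i<k. part \<nu> i)" if "k \<le> n" for k using that by auto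
    have "part \<mu> i = part \<nu> i" for i
    proof (cases "Suc i \<le> n")
      case True
      then show ?thesis using eq[of "Suc i"] eq[of i] by simp
    next
      case False then show ?thesis using len by (simp add: part_def)
    qed
    then have "part \<mu> = part \<nu>" by auto
    then show False using assms(4) shp_part p by metis
  qed
  moreover have "dom_rank n \<mu> \<le> dom_rank n \<nu>" unfolding dom_rank_def by (rule sum_mono) (rule le)
  ultimately show ?thesis by simp
qed

lemma kostka_diag: "is_partition \<nu> \<Longrightarrow> kostka \<nu> \<nu> \<noteq> 0"
  using sc_diag[of \<nu>] kostka_schur[of \<nu> \<nu>] schur_mon[of \<nu> \<nu>] by auto

section \<open>The Pieri rule for Hall--Littlewood functions\<close>

definition subs :: "nat \<Rightarrow> 'a set \<Rightarrow> 'a set set" where "subs k B = {S. S \<subseteq> B \<and> card S = k}"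

lemma finite_subs [simp]: "finite B \<Longrightarrow> finite (subs k B)"
  by (rule finite_subset[of _ "Pow B"]) (auto simp: subs_def)

lemma subs_0 [simp]: "finite B \<Longrightarrow> subs 0 B = {{}}"
  by (auto simp: subs_def dest: finite_subset)

text \<open>For the weights \<open>wt\<close> this symmetrization yields e_k when z = x and a
  Gaussian binomial coefficient when z = 1.\<close>

definition subset_sum :: "('a \<Rightarrow> 'a \<Rightarrow> real) \<Rightarrow> ('a \<Rightarrow> real) \<Rightarrow> nat \<Rightarrow> 'a set \<Rightarrow> real" where
  "subset_sum w z k B = (\<Sum>S\<in>subs k B. (\<Prod>i\<in>S. z i) * (\<Prod>i\<in>S. \<Prod>j\<in>B-S. w i j))"

definition qn :: "real \<Rightarrow> nat \<Rightarrow> real" where "qn t n = (\<Sum>i<n. t ^ i)"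

text \<open>Mark an element i of a (k + 1)-subset S with weight
  \<open>\<Prod>j\<in>S-{i}. w i j\<close>; by hypothesis the marks of S add up to
  \<open>qn t (Suc k)\<close>. The factors of i over S - {i} and over B - S combine to the product
  over B - {i}.\<close>

lemma subset_sum_rec:
  assumes fin: "finite B" and q: "\<And>C. C \<subseteq> B \<Longrightarrow> (\<Sum>i\<in>C. \<Prod>j\<in>C-{i}. w i j) = qn t (card C)"
  shows "qn t (Suc k) * subset_sum w z (Suc k) B =
    (\<Sum>i\<in>B. z i * (\<Prod>j\<in>B-{i}. w i j) * subset_sum w z k (B - {i}))"
proof -
  have finS: "finite S" if "S \<in> subs k B" for S k using that fin finite_subset by (auto simp: subs_def)
  have "qn t (Suc k) * subset_sum w z (Suc k) B = (\<Sum>S\<in>subs (Suc k) B. \<Sum>i\<in>S.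
      (\<Prod>j\<in>S-{i}. w i j) * ((\<Prod>i\<in>S. z i) * (\<Prod>i\<in>S. \<Prod>j\<in>B-S. w i j)))"
    unfolding subset_sum_def sum_distrib_left
    by (rule sum_cong) (simp add: q subs_def sum_distrib_right[symmetric])
  also have "\<dots> = (\<Sum>p\<in>Sigma (subs (Suc k) B) (\<lambda>S. S). (\<Prod>j\<in>fst p-{snd p}. w (snd p) j) *
      ((\<Prod>i\<in>fst p. z i) * (\<Prod>i\<in>fst p. \<Prod>j\<in>B-fst p. w i j)))"
    by (subst sum.Sigma) (use fin finS in "auto simp: case_prod_beta")
  also have "\<dots> = (\<Sum>p\<in>Sigma B (\<lambda>i. subs k (B - {i})). z (fst p) * (\<Prod>j\<in>B-{fst p}. w (fst p) j) *
       ((\<Prod>i\<in>snd p. z i) * (\<Prod>i\<in>snd p. \<Prod>j\<in>B-{fst p}-snd p. w i j)))" (is "sum ?f _ = sum ?h _")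
  proof (rule sum.reindex_bij_witness[where j = "\<lambda>(S, i). (i, S - {i})" and i = "\<lambda>(i, S). (insert i S, i)"])
    fix p assume p: "p \<in> Sigma (subs (Suc k) B) (\<lambda>S. S)"
    obtain S i where [simp]: "p = (S, i)" by (cases p)
    have S: "S \<subseteq> B" "card S = Suc k" "i \<in> S" "finite S" using p finS[of S] by (auto simp: subs_def)
    show "(case case p of (S, i) \<Rightarrow> (i, S - {i}) of (i, S) \<Rightarrow> (insert i S, i)) = p" using S by auto
    show "(case p of (S, i) \<Rightarrow> (i, S - {i})) \<in> Sigma B (\<lambda>i. subs k (B - {i}))" using S by (auto simp: subs_def)
    have e: "B - {i} - (S - {i}) = B - S" using S by auto
    have u: "B - {i} = (S - {i}) \<union> (B - S)" using S by auto
    have 1: "(\<Prod>j\<in>B-{i}. w i j) = (\<Prod>j\<in>S-{i}. w i j) * (\<Prod>j\<in>B-S. w i j)"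
      unfolding u by (rule prod.union_disjoint) (use S fin in auto)
    have 2: "(\<Prod>i\<in>S. z i) = z i * (\<Prod>i\<in>S-{i}. z i)"
      "(\<Prod>l\<in>S. \<Prod>j\<in>B-S. w l j) = (\<Prod>j\<in>B-S. w i j) * (\<Prod>l\<in>S-{i}. \<Prod>j\<in>B-S. w l j)"
      using S by (auto intro: prod.remove)
    show "?h (case p of (S, i) \<Rightarrow> (i, S - {i})) = ?f p"
      by (simp add: e 1 2)
  next
    fix p assume p: "p \<in> Sigma B (\<lambda>i. subs k (B - {i}))"
    obtain i S where [simp]: "p = (i, S)" by (cases p)
    have S: "S \<subseteq> B - {i}" "card S = k" "i \<in> B" "finite S" using p fin finite_subset[of S "B - {i}"] by (auto simp: subs_def)
    then have "i \<notin> S" by auto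
    then show "(case case p of (i, S) \<Rightarrow> (insert i S, i) of (S, i) \<Rightarrow> (i, S - {i})) = p"
      "(case p of (i, S) \<Rightarrow> (insert i S, i)) \<in> Sigma (subs (Suc k) B) (\<lambda>S. S)"
      using S by (auto simp: subs_def)
  qed
  also have "\<dots> = (\<Sum>i\<in>B. z i * (\<Prod>j\<in>B-{i}. w i j) * subset_sum w z k (B - {i}))"
    unfolding subset_sum_def sum_distrib_left by (subst sum.Sigma) (use fin in "auto simp: case_prod_beta")
  finally show ?thesis .
qed

text \<open>Defined through the generating polynomial, so that identities for all k can be obtained
  from polynomial interpolation.\<close>

definition es :: "('a \<Rightarrow> real) \<Rightarrow> 'a set \<Rightarrow> nat \<Rightarrow> real" where
  "es x C k = Polynomial.coeff (\<Prod>j\<in>C. [:1, x j:]) k"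

lemma es_0 [simp]: "es x C 0 = 1"
  by (simp add: es_def poly_0_coeff_0[symmetric] poly_prod)

lemma es_insert: "finite C \<Longrightarrow> c \<notin> C \<Longrightarrow> es x (insert c C) (Suc k) = es x C (Suc k) + x c * es x C k"
  by (simp add: es_def)

lemma es_scale: "finite C \<Longrightarrow> es (\<lambda>j. t * x j) C k = t ^ k * es x C k"
proof (induction C arbitrary: k rule: finite_induct)
  case empty then show ?case by (cases k) (simp_all add: es_def)
next
  case (insert c C) then show ?case by (cases k) (simp_all add: es_insert algebra_simps)
qed

lemma es_sum:
  fixes x :: "'a \<Rightarrow> real"
  shows "finite C \<Longrightarrow> es x C k = (\<Sum>S\<in>subs k C. \<Prod>i\<in>S. x i)"
proof (induction C arbitrary: k rule: finite_induct)
  case empty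
  have "subs k ({} :: 'a set) = (if k = 0 then {{}} else {})" by (auto simp: subs_def)
  then show ?case by (cases k) (simp_all add: es_def)
next
  case (insert c C)
  show ?case
  proof (cases k)
    case 0 then show ?thesis using insert by simp
  next
    case (Suc l)
    have fin: "finite S" if "S \<subseteq> C" for S using that insert.hyps(1) finite_subset by blast
    have "subs k (insert c C) = subs k C \<union> insert c ` subs l C"
    proof (intro equalityI subsetI)
      fix S assume S: "S \<in> subs k (insert c C)"
      show "S \<in> subs k C \<union> insert c ` subs l C"
      proof (cases "c \<in> S")
        case True
        then have "S = insert c (S - {c})" "S - {c} \<in> subs l C"
          using S Suc insert.hyps by (auto simp: subs_def)
        then show ?thesis by blast
      qed (use S in "auto simp: subs_def")
    next
      fix S assume "S \<in> subs k C \<union> insert c ` subs l C"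
      then show "S \<in> subs k (insert c C)"
        using insert.hyps Suc fin by (auto simp: subs_def card_insert_if)
    qed
    moreover have "subs k C \<inter> insert c ` subs l C = {}" using insert.hyps by (auto simp: subs_def)
    moreover have "inj_on (insert c) (subs l C)"
      using insert.hyps by (intro inj_onI) (auto simp: subs_def)
    ultimately have "(\<Sum>S\<in>subs k (insert c C). \<Prod>i\<in>S. x i) = (\<Sum>S\<in>subs k C. \<Prod>i\<in>S. x i) + (\<Sum>S\<in>subs l C. \<Prod>i\<in>insert c S. x i)"
      using insert.hyps by (simp add: sum.union_disjoint sum.reindex)
    also have "(\<Sum>S\<in>subs l C. \<Prod>i\<in>insert c S. x i) = x c * (\<Sum>S\<in>subs l C. \<Prod>i\<in>S. x i)"
      unfolding sum_distrib_left
    proof (rule sum_cong)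
      fix S assume "S \<in> subs l C"
      then have "finite S" "c \<notin> S" using fin insert.hyps by (auto simp: subs_def)
      then show "(\<Prod>i\<in>insert c S. x i) = x c * (\<Prod>i\<in>S. x i)" by simp
    qed
    finally show ?thesis using insert Suc by (simp add: es_insert)
  qed
qed

lemma es_top: "finite C \<Longrightarrow> es x C (card C) = (\<Prod>i\<in>C. x i)"
proof -
  assume fin: "finite C"
  have "subs (card C) C = {C}" using card_subset_eq[OF fin] by (auto simp: subs_def)
  then show ?thesis using es_sum[OF fin] by simp
qed

definition wt :: "('a \<Rightarrow> real) \<Rightarrow> real \<Rightarrow> 'a \<Rightarrow> 'a \<Rightarrow> real" where
  "wt x t i j = (x i - t * x j) / (x i - x j)"

abbreviation wts :: "('a \<Rightarrow> real) \<Rightarrow> real \<Rightarrow> 'a set \<Rightarrow> 'a \<Rightarrow> real" where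
  "wts x t C i \<equiv> \<Prod>j\<in>C-{i}. wt x t i j"

lemma degree_prod_linear: "finite C \<Longrightarrow> degree (\<Prod>j\<in>C. [:1, y j:]) \<le> card (C :: 'a set)"
  for y :: "'a \<Rightarrow> real"
proof -
  assume fin: "finite C"
  have "degree (\<Prod>j\<in>C. [:1, y j:]) \<le> (\<Sum>j\<in>C. degree [:1, y j:])"
    using degree_prod_sum_le[OF fin, of "\<lambda>j. [:1, y j:]"] by (simp add: comp_def)
  also have "\<dots> \<le> (\<Sum>j\<in>C. 1)" by (rule sum_mono) simp
  finally show ?thesis by simp
qed

text \<open>By Lagrange interpolation at the points \<open>- 1 / x\<^sub>j\<close>.\<close>

lemma interpolation_nonzero:
  assumes fin: "finite C" and inj: "inj_on x C" and nz: "\<And>i. i \<in> C \<Longrightarrow> x i \<noteq> 0"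
  shows "[:0, 1 - t:] * (\<Sum>i\<in>C. smult (x i * wts x t C i) (\<Prod>j\<in>C-{i}. [:1, x j:]))
     = (\<Prod>j\<in>C. [:1, x j:]) - (\<Prod>j\<in>C. [:1, t * x j:])"
    (is "?L = ?R")
\<comment> \<open>Both sides have degree at most \<open>card C\<close>; the node 0 brings the number
  of nodes to \<open>card C + 1\<close>.\<close>
proof (rule poly_eqI_degree[where A = "insert 0 ((\<lambda>j. - 1 / x j) ` C)"])
  have inj': "inj_on (\<lambda>j. - 1 / x j) C" using inj nz by (auto simp: inj_on_def)
  have "0 \<notin> (\<lambda>j. - 1 / x j) ` C" using nz by auto
  then have card: "card (insert 0 ((\<lambda>j. - 1 / x j) ` C)) = Suc (card C)"
    using fin card_image[OF inj'] by simp
  have "degree ?R \<le> card C"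
    by (rule degree_diff_le) (rule degree_prod_linear[OF fin])+
  then show "degree ?R < card (insert 0 ((\<lambda>j. - 1 / x j) ` C))" using card by simp
  have "degree (\<Sum>i\<in>C. smult (x i * wts x t C i) (\<Prod>j\<in>C-{i}. [:1, x j:])) \<le> card C - 1"
  proof (rule degree_sum_le[OF fin])
    fix i assume "i \<in> C"
    have "degree (\<Prod>j\<in>C-{i}. [:1, x j:]) \<le> card C - 1"
      using degree_prod_linear[of "C - {i}" x] fin \<open>i \<in> C\<close> by simp
    then show "degree (smult (x i * wts x t C i) (\<Prod>j\<in>C-{i}. [:1, x j:])) \<le> card C - 1"
      using degree_smult_le order_trans by blast
  qed
  moreover have "degree [:0, 1 - t:] \<le> 1" by simp
  ultimately have "degree ?L \<le> 1 + (card C - 1)"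
    using degree_mult_le[of "[:0, 1 - t:]"] by (meson add_mono order_trans)
  then have "degree ?L \<le> card C \<or> C = {}" by (cases "card C") (use fin in auto)
  then show "degree ?L < card (insert 0 ((\<lambda>j. - 1 / x j) ` C))" using card by auto
next
  fix y assume "y \<in> insert 0 ((\<lambda>j. - 1 / x j) ` C)"
  then consider "y = 0" | l where "l \<in> C" "y = - 1 / x l" by auto
  then show "poly ?L y = poly ?R y"
  proof cases
    case 1 then show ?thesis by (simp add: poly_prod)
  next
    case 2
    have xl: "x l \<noteq> 0" using 2 nz by auto
    have z: "(\<Prod>j\<in>A. 1 + y * x j) = 0" if "l \<in> A" "A \<subseteq> C" for A
      using that fin finite_subset 2 xl by (intro prod_zero) auto
    have "(\<Sum>i\<in>C. (x i * wts x t C i) * (\<Prod>j\<in>C-{i}. 1 + y * x j))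
        = (\<Sum>i\<in>C. if i = l then (x l * wts x t C l) * (\<Prod>j\<in>C-{l}. 1 + y * x j) else 0)"
      by (rule sum.cong) (use z[of "C - {_}"] 2 in auto)
    also have "\<dots> = x l * (\<Prod>j\<in>C-{l}. wt x t l j * (1 + y * x j))"
      using fin 2 by (simp add: sum.delta prod.distrib)
    also have "(\<Prod>j\<in>C-{l}. wt x t l j * (1 + y * x j)) = (\<Prod>j\<in>C-{l}. 1 + y * (t * x j))"
    proof (rule prod.cong[OF refl])
      fix j assume j: "j \<in> C - {l}"
      then have "x l - x j \<noteq> 0" using inj 2 by (auto simp: inj_on_def)
      moreover have "1 + y * x j = (x l - x j) / x l" "1 + y * (t * x j) = (x l - t * x j) / x l"
        using xl unfolding 2(2) by (simp_all add: diff_divide_distrib)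
      ultimately show "wt x t l j * (1 + y * x j) = 1 + y * (t * x j)"
        by (simp add: wt_def)
    qed
    finally have L: "poly ?L y = y * (1 - t) * (x l * (\<Prod>j\<in>C-{l}. 1 + y * (t * x j)))"
      by (simp add: poly_sum poly_prod)
    have "poly ?R y = - (\<Prod>j\<in>C. 1 + y * (t * x j))"
      using z[of C] 2 by (simp add: poly_prod)
    also have "(\<Prod>j\<in>C. 1 + y * (t * x j)) = (1 + y * (t * x l)) * (\<Prod>j\<in>C-{l}. 1 + y * (t * x j))"
      by (rule prod.remove) (use fin 2 in auto)
    finally have R: "poly ?R y = - ((1 + y * (t * x l)) * (\<Prod>j\<in>C-{l}. 1 + y * (t * x j)))" .
    have yx: "y * x l = - 1" using xl 2 by simp
    have "1 + y * (t * x l) = 1 - t" using yx by (metis mult.left_commute mult_minus1_right uminus_add_conv_diff add.commute diff_conv_add_uminus)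
    moreover have "y * (1 - t) * (x l * P) = (y * x l) * ((1 - t) * P)" for P by simp
    ultimately show ?thesis unfolding L R using yx by simp
  qed
qed

text \<open>At most one coordinate \<open>x z\<close> can vanish. Its summand is 0, its linear
  factors are 1 and \<open>wt x t i z = 1\<close> for the other i, so the identity for
  \<open>C\<close> reduces to that for \<open>C - {z}\<close>.\<close>

lemma interpolation:
  assumes fin: "finite C" and inj: "inj_on x C"
  shows "[:0, 1 - t:] * (\<Sum>i\<in>C. smult (x i * wts x t C i) (\<Prod>j\<in>C-{i}. [:1, x j:]))
     = (\<Prod>j\<in>C. [:1, x j:]) - (\<Prod>j\<in>C. [:1, t * x j:])"
proof (cases "\<exists>i\<in>C. x i = 0")
  case False then show ?thesis using interpolation_nonzero[OF assms] by blast
next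
  case True
  then obtain z where z: "z \<in> C" "x z = 0" by blast
  let ?D = "C - {z}"
  have nz: "x i \<noteq> 0" if "i \<in> ?D" for i using that z inj by (metis DiffD1 DiffD2 inj_onD singletonI)
  have fD: "finite ?D" "inj_on x ?D" using fin inj by (auto simp: inj_on_def)
  have rem: "(\<Prod>j\<in>C. h j) = h z * (\<Prod>j\<in>?D. h j)" for h :: "'a \<Rightarrow> real poly" by (rule prod.remove) (use fin z in auto)
  have "(\<Sum>i\<in>C. smult (x i * wts x t C i) (\<Prod>j\<in>C-{i}. [:1, x j:]))
      = (\<Sum>i\<in>?D. smult (x i * wts x t C i) (\<Prod>j\<in>C-{i}. [:1, x j:]))"
    by (subst sum.remove[OF fin z(1)]) (simp add: z)
  also have "\<dots> = (\<Sum>i\<in>?D. smult (x i * wts x t ?D i) (\<Prod>j\<in>?D-{i}. [:1, x j:]))"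
  proof (rule sum_cong)
    fix i assume i: "i \<in> ?D"
    have c: "C - {i} - {z} = ?D - {i}" by auto
    have "wts x t C i = wt x t i z * (\<Prod>j\<in>C-{i}-{z}. wt x t i j)"
      "(\<Prod>j\<in>C-{i}. [:1, x j:]) = [:1, x z:] * (\<Prod>j\<in>C-{i}-{z}. [:1, x j:])"
      by (rule prod.remove; use fin z i in auto)+
    moreover have "wt x t i z = 1" using nz[OF i] z by (simp add: wt_def)
    ultimately show "smult (x i * wts x t C i) (\<Prod>j\<in>C-{i}. [:1, x j:]) =
      smult (x i * wts x t ?D i) (\<Prod>j\<in>?D-{i}. [:1, x j:])"
      using z by (simp add: c)
  qed
  finally show ?thesis using interpolation_nonzero[OF fD nz, of t] rem z by simp
qed

text \<open>The coefficient of degree k + 1 of the interpolation identity; scaling the variables by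
  t multiplies e_(k+1) by t^(k+1), and 1 - t cancels.\<close>

lemma weighted_es:
  assumes fin: "finite C" and inj: "inj_on x C" and t: "t \<noteq> 1"
  shows "(\<Sum>i\<in>C. x i * wts x t C i * es x (C - {i}) k) = qn t (Suc k) * es x C (Suc k)"
proof -
  have "(1 - t) * (\<Sum>i\<in>C. x i * wts x t C i * es x (C - {i}) k)
     = Polynomial.coeff ([:0, 1 - t:] * (\<Sum>i\<in>C. smult (x i * wts x t C i) (\<Prod>j\<in>C-{i}. [:1, x j:]))) (Suc k)"
    by (simp add: coeff_sum es_def)
  also have "\<dots> = es x C (Suc k) - es (\<lambda>j. t * x j) C (Suc k)"
    unfolding interpolation[OF fin inj] by (simp add: es_def)
  also have "\<dots> = (1 - t ^ Suc k) * es x C (Suc k)" using es_scale[OF fin] by (simp add: algebra_simps)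
  also have "1 - t ^ Suc k = (1 - t) * qn t (Suc k)" unfolding qn_def by (rule one_diff_power_eq)
  finally show ?thesis using t by simp
qed

text \<open>The case k + 1 = \<open>card C\<close> of the previous identity, divided by the product
  of all coordinates. A zero coordinate is split off: it contributes t^(card C - 1) and leaves the
  other weights unchanged.\<close>

lemma weight_total:
  assumes fin: "finite C" and inj: "inj_on x C" and t: "t \<noteq> 1"
  shows "(\<Sum>i\<in>C. \<Prod>j\<in>C-{i}. wt x t i j) = qn t (card C)"
proof -
  have main: "(\<Sum>i\<in>C. \<Prod>j\<in>C-{i}. wt x t i j) = qn t (card C)"
    if fin: "finite C" and inj: "inj_on x C" and nz: "\<And>i. i \<in> C \<Longrightarrow> x i \<noteq> 0" for C
  proof (cases "C = {}")
    case True then show ?thesis by (simp add: qn_def)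
  next
    case False
    then obtain k where k: "card C = Suc k" using fin by (metis card_0_eq not0_implies_Suc)
    have "(\<Prod>i\<in>C. x i) * (\<Sum>i\<in>C. \<Prod>j\<in>C-{i}. wt x t i j)
        = (\<Sum>i\<in>C. x i * wts x t C i * es x (C - {i}) k)"
      unfolding sum_distrib_left
    proof (rule sum_cong)
      fix i assume i: "i \<in> C"
      have "es x (C - {i}) k = (\<Prod>j\<in>C-{i}. x j)" using es_top[of "C - {i}" x] fin i k by simp
      then show "(\<Prod>i\<in>C. x i) * wts x t C i = x i * wts x t C i * es x (C - {i}) k"
        using prod.remove[OF fin i, of x] by simp
    qed
    also have "\<dots> = (\<Prod>i\<in>C. x i) * qn t (card C)"
      using weighted_es[OF fin inj t, of k] es_top[OF fin, of x] k by simp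
    finally show ?thesis using nz fin by simp
  qed
  show ?thesis
  proof (cases "\<exists>i\<in>C. x i = 0")
    case False then show ?thesis using main[OF fin inj] by blast
  next
    case True
    then obtain z where z: "z \<in> C" "x z = 0" by blast
    let ?D = "C - {z}"
    have nz: "x i \<noteq> 0" if "i \<in> ?D" for i using that z inj by (metis DiffD1 DiffD2 inj_onD singletonI)
    have fD: "finite ?D" "inj_on x ?D" using fin inj by (auto simp: inj_on_def)
    have k: "card C = Suc (card ?D)" using fin z by (metis card_Suc_Diff1)
    have "(\<Prod>j\<in>?D. wt x t z j) = (\<Prod>j\<in>?D. t)"
      by (rule prod.cong) (use z nz in "auto simp: wt_def")
    moreover have "wts x t C i = wts x t ?D i" if i: "i \<in> ?D" for i
    proof -
      have c: "C - {i} - {z} = ?D - {i}" by auto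
      have "wts x t C i = wt x t i z * (\<Prod>j\<in>C-{i}-{z}. wt x t i j)"
        by (rule prod.remove) (use fin z i in auto)
      then show ?thesis using c nz[OF i] z by (simp add: wt_def)
    qed
    ultimately have "(\<Sum>i\<in>C. \<Prod>j\<in>C-{i}. wt x t i j) = t ^ card ?D + (\<Sum>i\<in>?D. \<Prod>j\<in>?D-{i}. wt x t i j)"
      by (subst sum.remove[OF fin z(1)]) simp
    then show ?thesis using main[OF fD nz] k by (simp add: qn_def)
  qed
qed

lemma qn_pos: "t > 0 \<Longrightarrow> qn t (Suc k) > 0"
  unfolding qn_def by (intro sum_pos) auto

text \<open>Marking an element and \<open>weighted_es\<close> give both sides the same recursion in
  k.\<close>

lemma subset_sum_es:
  assumes "finite B" "inj_on x B" "t > 0" "t \<noteq> 1"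
  shows "subset_sum (wt x t) x k B = es x B k"
  using assms(1,2)
proof (induction k arbitrary: B)
  case 0 then show ?case by (simp add: subset_sum_def)
next
  case (Suc k)
  have "qn t (Suc k) * subset_sum (wt x t) x (Suc k) B =
      (\<Sum>i\<in>B. x i * wts x t B i * subset_sum (wt x t) x k (B - {i}))"
  proof (rule subset_sum_rec[OF Suc.prems(1)])
    fix C assume "C \<subseteq> B"
    then show "(\<Sum>i\<in>C. \<Prod>j\<in>C - {i}. wt x t i j) = qn t (card C)"
      using Suc.prems assms by (intro weight_total) (auto intro: finite_subset inj_on_subset)
  qed
  also have "\<dots> = (\<Sum>i\<in>B. x i * wts x t B i * es x (B - {i}) k)"
    by (rule sum_cong) (use Suc in "auto simp: inj_on_def")
  also have "\<dots> = qn t (Suc k) * es x B (Suc k)" by (rule weighted_es[OF Suc.prems assms(4)])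
  finally show ?case using qn_pos[OF assms(3), of k] by simp
qed

text \<open>The Gaussian binomial coefficient; the recursion is the one that
  \<open>subset_sum\<close> obeys when z = 1.\<close>

fun tbinom :: "real \<Rightarrow> nat \<Rightarrow> nat \<Rightarrow> real" where
  "tbinom t 0 n = 1"
| "tbinom t (Suc k) n = qn t n * tbinom t k (n - 1) / qn t (Suc k)"

lemma subset_sum_tbinom:
  assumes "finite B" "\<And>C. C \<subseteq> B \<Longrightarrow> (\<Sum>i\<in>C. \<Prod>j\<in>C-{i}. w i j) = qn t (card C)" "t > 0"
  shows "subset_sum w (\<lambda>_. 1) k B = tbinom t k (card B)"
  using assms(1,2)
proof (induction k arbitrary: B)
  case 0 then show ?case by (simp add: subset_sum_def)
next
  case (Suc k)
  have "qn t (Suc k) * subset_sum w (\<lambda>_. 1) (Suc k) B =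
      (\<Sum>i\<in>B. 1 * (\<Prod>j\<in>B-{i}. w i j) * subset_sum w (\<lambda>_. 1) k (B - {i}))"
    by (rule subset_sum_rec[OF Suc.prems])
  also have "\<dots> = (\<Sum>i\<in>B. (\<Prod>j\<in>B-{i}. w i j) * tbinom t k (card B - 1))"
  proof (rule sum_cong)
    fix i assume "i \<in> B"
    then have "subset_sum w (\<lambda>_. 1) k (B - {i}) = tbinom t k (card B - 1)"
      using Suc.IH[of "B - {i}"] Suc.prems by auto
    then show "1 * (\<Prod>j\<in>B-{i}. w i j) * subset_sum w (\<lambda>_. 1) k (B - {i}) = (\<Prod>j\<in>B-{i}. w i j) * tbinom t k (card B - 1)"
      by simp
  qed
  also have "\<dots> = qn t (card B) * tbinom t k (card B - 1)"
    using Suc.prems(2)[of B] by (simp add: sum_distrib_right[symmetric])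
  finally show ?case using qn_pos[OF assms(3), of k] by (simp add: field_simps)
qed

text \<open>The limit of \<open>wt\<close> when the coordinates decrease rapidly with the index. It
  has the same total on every finite set, and products of it are powers of t that count
  inversions.\<close>

definition wt0 :: "real \<Rightarrow> nat \<Rightarrow> nat \<Rightarrow> real" where "wt0 t i j = (if i < j then 1 else t)"

lemma weight0_total: "finite C \<Longrightarrow> (\<Sum>i\<in>C. \<Prod>j\<in>C-{i}. wt0 t i j) = qn t (card C)"
proof (induction C rule: finite_linorder_max_induct)
  case empty then show ?case by (simp add: qn_def)
next
  case (insert m C)
  have m: "m \<notin> C" using insert.hyps by auto
  have "(\<Prod>j\<in>insert m C-{i}. wt0 t i j) = (\<Prod>j\<in>C-{i}. wt0 t i j)" if "i \<in> C" for i
  proof -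
    have "insert m C - {i} = insert m (C - {i})" "m \<notin> C - {i}" using m that by auto
    then show ?thesis using insert.hyps that by (simp add: wt0_def)
  qed
  moreover have "(\<Prod>j\<in>insert m C-{m}. wt0 t m j) = (\<Prod>j\<in>C. t)"
    by (rule prod.cong) (use m insert.hyps in "auto simp: wt0_def dest: order_less_asym")
  ultimately show ?case using insert m by (simp add: qn_def)
qed

text \<open>Both sides are the Gaussian binomial coefficient, since it is computed from the totals
  over subsets alone. This removes the dependence on x from the Pieri coefficients.\<close>

lemma subset_sum_wt_wt0:
  assumes "finite B" "inj_on x B" "t > 0" "t \<noteq> 1"
  shows "subset_sum (wt x t) (\<lambda>_. 1) k B = subset_sum (wt0 t) (\<lambda>_. 1) k B"
proof -
  have "subset_sum (wt x t) (\<lambda>_. 1) k B = tbinom t k (card B)"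
    by (rule subset_sum_tbinom[OF assms(1) _ assms(3)], rule weight_total)
      (use assms in "auto intro: finite_subset inj_on_subset")
  moreover have "subset_sum (wt0 t) (\<lambda>_. 1) k B = tbinom t k (card B)"
    by (rule subset_sum_tbinom[OF assms(1) _ assms(3)], rule weight0_total)
      (use assms in "auto intro: finite_subset")
  ultimately show ?thesis by simp
qed

section \<open>Exchanging weights block by block\<close>

lemma sum_Pow_card_invariant:
  fixes u1 u2 h :: "'a set \<Rightarrow> real"
  assumes fin: "finite B" and eq: "\<And>k. (\<Sum>T\<in>subs k B. u1 T) = (\<Sum>T\<in>subs k B. u2 T)"
    and inv: "\<And>T T'. T \<subseteq> B \<Longrightarrow> T' \<subseteq> B \<Longrightarrow> card T = card T' \<Longrightarrow> h T = h T'"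
  shows "(\<Sum>T\<in>Pow B. u1 T * h T) = (\<Sum>T\<in>Pow B. u2 T * h T)"
proof -
  have "(\<Sum>T\<in>Pow B. u T * h T) = (\<Sum>k\<le>card B. \<Sum>T\<in>subs k B. u T * h T)" for u :: "'a set \<Rightarrow> real"
  proof -
    have "(\<Sum>T\<in>Pow B. u T * h T) = (\<Sum>k\<in>{..card B}. \<Sum>T\<in>{T \<in> Pow B. card T = k}. u T * h T)"
      by (rule sum.group[symmetric]) (use fin in "auto intro: card_mono")
    then show ?thesis by (simp add: subs_def)
  qed
  moreover have "(\<Sum>T\<in>subs k B. u1 T * h T) = (\<Sum>T\<in>subs k B. u2 T * h T)" for k
  proof (cases "subs k B = {}")
    case False
    then obtain T0 where T0: "T0 \<in> subs k B" by blast
    have "h T = h T0" if "T \<in> subs k B" for T using that T0 inv by (auto simp: subs_def)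
    then have "(\<Sum>T\<in>subs k B. u T * h T) = (\<Sum>T\<in>subs k B. u T) * h T0" for u
      unfolding sum_distrib_right by (intro sum.cong) auto
    then show ?thesis using eq by simp
  qed simp
  ultimately show ?thesis by simp
qed

definition block :: "('a \<Rightarrow> 'b) \<Rightarrow> 'a set \<Rightarrow> 'b \<Rightarrow> 'a set" where "block a I v = {i \<in> I. a i = v}"

text \<open>Weights attached to the blocks of equal values are replaced one block at a time. This
  works because the old and new weights have equal sums over the subsets of each size, while the
  remaining factor sees only the sizes of the intersections with the blocks. \<open>V\<close> is the
  set of values treated so far.\<close>

lemma block_exchange_aux:
  fixes a :: "'a \<Rightarrow> 'b" and u1 u2 :: "'b \<Rightarrow> 'a set \<Rightarrow> real"
  assumes fin: "finite I" and fV: "finite V"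
    and eq: "\<And>v k. (\<Sum>T\<in>subs k (block a I v). u1 v T) = (\<Sum>T\<in>subs k (block a I v). u2 v T)"
    and inv: "\<And>S S'. S \<subseteq> {i \<in> I. a i \<in> V} \<Longrightarrow> S' \<subseteq> {i \<in> I. a i \<in> V} \<Longrightarrow>
       (\<And>v. v \<in> V \<Longrightarrow> card (S \<inter> block a I v) = card (S' \<inter> block a I v)) \<Longrightarrow> g S = (g S' :: real)"
  shows "(\<Sum>S\<in>Pow {i \<in> I. a i \<in> V}. (\<Prod>v\<in>V. u1 v (S \<inter> block a I v)) * g S)
       = (\<Sum>S\<in>Pow {i \<in> I. a i \<in> V}. (\<Prod>v\<in>V. u2 v (S \<inter> block a I v)) * g S)"
  using fV inv
proof (induction V arbitrary: g rule: finite_induct)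
  case empty then show ?case by simp
next
  case (insert v V)
  let ?B = "block a I"
  let ?IV = "{i \<in> I. a i \<in> V}"
  have fB: "finite (?B v)" "finite ?IV" using fin by (auto simp: block_def)
  have dec: "(\<Sum>S\<in>Pow {i \<in> I. a i \<in> insert v V}. (\<Prod>l\<in>insert v V. u l (S \<inter> ?B l)) * g S)
     = (\<Sum>S\<in>Pow ?IV. \<Sum>T\<in>Pow (?B v). (\<Prod>l\<in>V. u l (S \<inter> ?B l)) * u v T * g (S \<union> T))" (is "?L = ?R")
    for u :: "'b \<Rightarrow> 'a set \<Rightarrow> real"
  proof -
    have "?R = (\<Sum>p\<in>Pow ?IV \<times> Pow (?B v). (\<Prod>l\<in>V. u l (fst p \<inter> ?B l)) * u v (snd p) * g (fst p \<union> snd p))"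
      by (simp add: sum.cartesian_product case_prod_beta)
    also have "\<dots> = ?L"
    proof (rule sum.reindex_bij_witness[where j = "\<lambda>(S, T). S \<union> T" and i = "\<lambda>S. (S \<inter> ?IV, S \<inter> ?B v)"])
      fix p assume p: "p \<in> Pow ?IV \<times> Pow (?B v)"
      obtain S T where [simp]: "p = (S, T)" by (cases p)
      have ST: "S \<subseteq> ?IV" "T \<subseteq> ?B v" using p by auto
      have i: "(S \<union> T) \<inter> ?IV = S" "(S \<union> T) \<inter> ?B v = T" using ST insert.hyps by (auto simp: block_def)
      show "((case p of (S, T) \<Rightarrow> S \<union> T) \<inter> ?IV, (case p of (S, T) \<Rightarrow> S \<union> T) \<inter> ?B v) = p" using i by simp
      show "(case p of (S, T) \<Rightarrow> S \<union> T) \<in> Pow {i \<in> I. a i \<in> insert v V}" using ST by (auto simp: block_def)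
      have "(S \<union> T) \<inter> ?B l = S \<inter> ?B l" if "l \<in> V" for l using ST that insert.hyps by (auto simp: block_def)
      then show "(\<Prod>l\<in>insert v V. u l ((case p of (S, T) \<Rightarrow> S \<union> T) \<inter> ?B l)) * g (case p of (S, T) \<Rightarrow> S \<union> T)
         = (\<Prod>l\<in>V. u l (fst p \<inter> ?B l)) * u v (snd p) * g (fst p \<union> snd p)"
        using insert.hyps i by simp
    next
      fix S assume S: "S \<in> Pow {i \<in> I. a i \<in> insert v V}"
      show "(case (S \<inter> ?IV, S \<inter> ?B v) of (S, T) \<Rightarrow> S \<union> T) = S" using S by (auto simp: block_def)
      show "(S \<inter> ?IV, S \<inter> ?B v) \<in> Pow ?IV \<times> Pow (?B v)" by auto
    qed
    finally show ?thesis by simp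
  qed
  have inv1: "g (S \<union> T) = g (S' \<union> T)"
    if "T \<subseteq> ?B v" "S \<subseteq> ?IV" "S' \<subseteq> ?IV" "\<And>l. l \<in> V \<Longrightarrow> card (S \<inter> ?B l) = card (S' \<inter> ?B l)" for S S' T
  proof (rule insert.prems)
    show "S \<union> T \<subseteq> {i \<in> I. a i \<in> insert v V}" "S' \<union> T \<subseteq> {i \<in> I. a i \<in> insert v V}"
      using that by (auto simp: block_def)
    fix l assume l: "l \<in> insert v V"
    have "(S \<union> T) \<inter> ?B l = (if l = v then T else S \<inter> ?B l)" "(S' \<union> T) \<inter> ?B l = (if l = v then T else S' \<inter> ?B l)"
      using that insert.hyps l by (auto simp: block_def)
    then show "card ((S \<union> T) \<inter> ?B l) = card ((S' \<union> T) \<inter> ?B l)" using that(4) l by auto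
  qed
  have inv2: "g (S \<union> T) = g (S \<union> T')"
    if "S \<subseteq> ?IV" "T \<subseteq> ?B v" "T' \<subseteq> ?B v" "card T = card T'" for S T T'
  proof (rule insert.prems)
    show "S \<union> T \<subseteq> {i \<in> I. a i \<in> insert v V}" "S \<union> T' \<subseteq> {i \<in> I. a i \<in> insert v V}"
      using that by (auto simp: block_def)
    fix l assume l: "l \<in> insert v V"
    have "(S \<union> T) \<inter> ?B l = (if l = v then T else S \<inter> ?B l)" "(S \<union> T') \<inter> ?B l = (if l = v then T' else S \<inter> ?B l)"
      using that insert.hyps l by (auto simp: block_def)
    then show "card ((S \<union> T) \<inter> ?B l) = card ((S \<union> T') \<inter> ?B l)" using that(4) l by auto
  qed
  have "(\<Sum>S\<in>Pow ?IV. \<Sum>T\<in>Pow (?B v). (\<Prod>l\<in>V. u1 l (S \<inter> ?B l)) * u1 v T * g (S \<union> T))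
      = (\<Sum>T\<in>Pow (?B v). u1 v T * (\<Sum>S\<in>Pow ?IV. (\<Prod>l\<in>V. u1 l (S \<inter> ?B l)) * g (S \<union> T)))"
    by (subst sum.swap) (simp add: sum_distrib_left mult_ac)
  also have "\<dots> = (\<Sum>T\<in>Pow (?B v). u1 v T * (\<Sum>S\<in>Pow ?IV. (\<Prod>l\<in>V. u2 l (S \<inter> ?B l)) * g (S \<union> T)))"
  proof (rule sum_cong, rule arg_cong[where f = "(*) _"])
    fix T assume T: "T \<in> Pow (?B v)"
    show "(\<Sum>S\<in>Pow ?IV. (\<Prod>l\<in>V. u1 l (S \<inter> ?B l)) * g (S \<union> T)) = (\<Sum>S\<in>Pow ?IV. (\<Prod>l\<in>V. u2 l (S \<inter> ?B l)) * g (S \<union> T))"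
      by (rule insert.IH) (use inv1 T in blast)
  qed
  also have "\<dots> = (\<Sum>S\<in>Pow ?IV. (\<Prod>l\<in>V. u2 l (S \<inter> ?B l)) * (\<Sum>T\<in>Pow (?B v). u1 v T * g (S \<union> T)))"
    by (simp add: sum_distrib_left mult_ac sum.swap[of _ "Pow ?IV"])
  also have "\<dots> = (\<Sum>S\<in>Pow ?IV. (\<Prod>l\<in>V. u2 l (S \<inter> ?B l)) * (\<Sum>T\<in>Pow (?B v). u2 v T * g (S \<union> T)))"
  proof (rule sum_cong, rule arg_cong[where f = "(*) _"])
    fix S assume S: "S \<in> Pow ?IV"
    show "(\<Sum>T\<in>Pow (?B v). u1 v T * g (S \<union> T)) = (\<Sum>T\<in>Pow (?B v). u2 v T * g (S \<union> T))"
      by (rule sum_Pow_card_invariant[OF fB(1) eq]) (use inv2 S in blast)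
  qed
  finally show ?case unfolding dec by (simp add: sum_distrib_left mult_ac)
qed

lemma block_exchange:
  fixes a :: "'a \<Rightarrow> 'b" and u1 u2 :: "'b \<Rightarrow> 'a set \<Rightarrow> real"
  assumes fin: "finite I"
    and eq: "\<And>v k. (\<Sum>T\<in>subs k (block a I v). u1 v T) = (\<Sum>T\<in>subs k (block a I v). u2 v T)"
    and inv: "\<And>S S'. S \<subseteq> I \<Longrightarrow> S' \<subseteq> I \<Longrightarrow>
       (\<And>v. card (S \<inter> block a I v) = card (S' \<inter> block a I v)) \<Longrightarrow> g S = (g S' :: real)"
  shows "(\<Sum>S\<in>Pow I. (\<Prod>v\<in>a ` I. u1 v (S \<inter> block a I v)) * g S)
       = (\<Sum>S\<in>Pow I. (\<Prod>v\<in>a ` I. u2 v (S \<inter> block a I v)) * g S)"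
proof -
  have I: "{i \<in> I. a i \<in> a ` I} = I" by auto
  have "g S = g S'" if "S \<subseteq> I" "S' \<subseteq> I" "\<And>v. v \<in> a ` I \<Longrightarrow> card (S \<inter> block a I v) = card (S' \<inter> block a I v)" for S S'
  proof (rule inv[OF that(1,2)])
    fix v show "card (S \<inter> block a I v) = card (S' \<inter> block a I v)"
    proof (cases "v \<in> a ` I")
      case False
      then have "block a I v = {}" by (auto simp: block_def)
      then show ?thesis by simp
    qed (rule that)
  qed
  then show ?thesis using block_exchange_aux[OF fin finite_imageI[OF fin, of a] eq, of g] unfolding I by blast
qed

lemma prod_blocks:
  fixes w :: "'a \<Rightarrow> 'a \<Rightarrow> real"
  assumes "finite I"
  shows "(\<Prod>v\<in>a ` I. \<Prod>i\<in>block a I v \<inter> X. \<Prod>j\<in>block a I v \<inter> Y. w i j) = (\<Prod>(i, j)\<in>ties (I \<inter> X) (I \<inter> Y) a. w i j)"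
proof -
  let ?P = "\<lambda>v. (block a I v \<inter> X) \<times> (block a I v \<inter> Y)"
  have "ties (I \<inter> X) (I \<inter> Y) a = (\<Union>v\<in>a ` I. ?P v)"
    by (auto simp: block_def)
  moreover have "prod (\<lambda>(i, j). w i j) (\<Union>v\<in>a ` I. ?P v) = (\<Prod>v\<in>a ` I. prod (\<lambda>(i, j). w i j) (?P v))"
    by (rule prod.UNION_disjoint) (use assms in "auto simp: block_def")
  ultimately show ?thesis by (simp add: prod.cartesian_product)
qed

lemma prod_over_blocks:
  fixes z :: "'a \<Rightarrow> real"
  assumes "finite I" "S \<subseteq> I"
  shows "(\<Prod>v\<in>a ` I. \<Prod>i\<in>S \<inter> block a I v. z i) = (\<Prod>i\<in>S. z i)"
proof -
  have "S = (\<Union>v\<in>a ` I. S \<inter> block a I v)" using assms by (auto simp: block_def)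
  moreover have "prod z (\<Union>v\<in>a ` I. S \<inter> block a I v) = (\<Prod>v\<in>a ` I. prod z (S \<inter> block a I v))"
    by (rule prod.UNION_disjoint) (use assms in "auto simp: block_def")
  ultimately show ?thesis by simp
qed

lemma sum_over_blocks:
  fixes F :: "'b \<Rightarrow> bool \<Rightarrow> nat"
  assumes "finite I" "S \<subseteq> I"
  shows "(\<Sum>i\<in>I. F (a i) (i \<in> S)) = (\<Sum>v\<in>a ` I. card (S \<inter> block a I v) * F v True + (card (block a I v) - card (S \<inter> block a I v)) * F v False)"
proof -
  have "(\<Sum>i\<in>I. F (a i) (i \<in> S)) = (\<Sum>v\<in>a ` I. \<Sum>i\<in>{i \<in> I. a i = v}. F (a i) (i \<in> S))"
    by (rule sum.group[symmetric]) (use assms in auto)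
  also have "\<dots> = (\<Sum>v\<in>a ` I. card (S \<inter> block a I v) * F v True + (card (block a I v) - card (S \<inter> block a I v)) * F v False)"
  proof (rule sum_cong)
    fix v
    have fb: "finite (block a I v)" using assms by (simp add: block_def)
    have u: "{i \<in> I. a i = v} = (S \<inter> block a I v) \<union> (block a I v - S \<inter> block a I v)" by (auto simp: block_def)
    have "(\<Sum>i\<in>{i \<in> I. a i = v}. F (a i) (i \<in> S)) = (\<Sum>i\<in>S \<inter> block a I v. F (a i) (i \<in> S)) + (\<Sum>i\<in>block a I v - S \<inter> block a I v. F (a i) (i \<in> S))"
      unfolding u by (rule sum.union_disjoint) (use fb in auto)
    also have "(\<Sum>i\<in>S \<inter> block a I v. F (a i) (i \<in> S)) = (\<Sum>i\<in>S \<inter> block a I v. F v True)"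
      by (rule sum.cong) (auto simp: block_def)
    also have "(\<Sum>i\<in>block a I v - S \<inter> block a I v. F (a i) (i \<in> S)) = (\<Sum>i\<in>block a I v - S \<inter> block a I v. F v False)"
      by (rule sum.cong) (auto simp: block_def)
    finally show "(\<Sum>i\<in>{i \<in> I. a i = v}. F (a i) (i \<in> S)) = card (S \<inter> block a I v) * F v True + (card (block a I v) - card (S \<inter> block a I v)) * F v False"
      using fb by (simp add: card_Diff_subset)
  qed
  finally show ?thesis .
qed

section \<open>Pieri coefficients of Hall--Littlewood functions\<close>

definition Om :: "nat \<Rightarrow> nat \<Rightarrow> (nat \<Rightarrow> nat) set" where
  "Om N m = {a. (\<forall>i\<ge>N. a i = 0) \<and> (\<Sum>i<N. a i) = m}"

definition xp :: "(nat \<Rightarrow> real) \<Rightarrow> nat \<Rightarrow> (nat \<Rightarrow> nat) \<Rightarrow> real" where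
  "xp x N a = (\<Prod>i<N. x i ^ a i)"

definition HLw :: "(nat \<Rightarrow> real) \<Rightarrow> real \<Rightarrow> nat \<Rightarrow> (nat \<Rightarrow> nat) \<Rightarrow> real" where
  "HLw x t N a = (\<Prod>(i, j)\<in>{(i, j). i < N \<and> j < N \<and> a i > a j}. wt x t i j)"

definition ind :: "nat set \<Rightarrow> nat \<Rightarrow> nat" where "ind S i = (if i \<in> S then 1 else 0)"

text \<open>The exponent of t in the Pieri coefficient: only pairs inside a block of equal rows
  count, and summing over the choices in a block gives a Gaussian binomial coefficient.\<close>

definition inv_stat :: "nat list \<Rightarrow> nat set \<Rightarrow> nat" where
  "inv_stat \<rho> S = card {(i, j). i \<in> S \<and> j \<in> {..<length \<rho>} - S \<and> i < j \<and> part \<rho> i = part \<rho> j}"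

definition lower :: "nat list \<Rightarrow> nat set \<Rightarrow> nat list" where
  "lower \<rho> S = shp (\<lambda>i. part \<rho> i - ind S i)"

text \<open>The adjoint of multiplication by \<open>e\<^sub>r\<close> for the pairing \<open>\<Sum> P\<^sub>\<rho>(x; t) f(\<rho>)\<close>; the next operator is its
  version for compositions, before symmetrization.\<close>

definition ET :: "'a::comm_ring_1 \<Rightarrow> nat \<Rightarrow> (nat list \<Rightarrow> 'a) \<Rightarrow> nat list \<Rightarrow> 'a" where
  "ET t r f \<rho> = (\<Sum>S\<in>subs r {..<length \<rho>}. t ^ inv_stat \<rho> S * f (lower \<rho> S))"

definition ETx :: "(nat \<Rightarrow> real) \<Rightarrow> real \<Rightarrow> nat \<Rightarrow> nat \<Rightarrow> (nat list \<Rightarrow> real) \<Rightarrow> (nat \<Rightarrow> nat) \<Rightarrow> real" where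
  "ETx x t N r f a = (\<Sum>S\<in>{S \<in> subs r {..<N}. \<forall>i\<in>S. 1 \<le> a i}.
     (\<Prod>(i, j)\<in>ties ({..<N} - S) S a. wt x t i j) * f (shp (\<lambda>i. a i - ind S i)))"

lemma finite_Om [simp]: "finite (Om N m)"
proof (rule finite_subset)
  show "finite {a. \<forall>i. a i \<le> (if i < N then m else 0)}"
    by (rule finite_below) (auto simp: fsupp_def intro: exI[of _ N])
  have "a i \<le> (\<Sum>i<N. a i)" if "i < N" for a :: "nat \<Rightarrow> nat" and i
    using that by (intro member_le_sum) auto
  then show "Om N m \<subseteq> {a. \<forall>i. a i \<le> (if i < N then m else 0)}" by (auto simp: Om_def)
qed

lemma sum_ind: "S \<subseteq> {..<N} \<Longrightarrow> (\<Sum>i<N. ind S i) = card S"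
proof -
  assume "S \<subseteq> {..<N}"
  then have "(\<Sum>i<N. ind S i) = (\<Sum>i\<in>S. 1)"
    by (intro sum.mono_neutral_cong_right) (auto simp: ind_def)
  then show ?thesis by simp
qed

lemma xp_raise:
  assumes "T \<subseteq> {..<N}" shows "xp x N (\<lambda>i. b i + ind T i) = xp x N b * (\<Prod>i\<in>T. x i)"
proof -
  have "xp x N (\<lambda>i. b i + ind T i) = xp x N b * (\<Prod>i<N. x i ^ ind T i)"
    by (simp add: xp_def power_add prod.distrib)
  also have "(\<Prod>i<N. x i ^ ind T i) = (\<Prod>i\<in>T. x i)"
    using assms by (intro prod.mono_neutral_cong_right) (auto simp: ind_def)
  finally show ?thesis .
qed

text \<open>Raising the exponents in \<open>T\<close> turns the ties of \<open>b\<close> from T to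
  its complement into strict inequalities of \<open>a\<close>, and inequalities of \<open>b\<close>
  by exactly one from the complement to T into ties of \<open>a\<close>. So the two sides are
  products over the same set of pairs.\<close>

lemma HLw_raise:
  fixes b :: "nat \<Rightarrow> nat"
  assumes T: "T \<subseteq> {..<N}" and a: "\<And>i. a i = b i + ind T i"
  shows "HLw x t N a * (\<Prod>(i, j)\<in>ties ({..<N} - T) T a. wt x t i j) =
    HLw x t N b * (\<Prod>(i, j)\<in>ties T ({..<N} - T) b. wt x t i j)"
proof -
  let ?w = "\<lambda>(i, j). wt x t i j"
  have fin: "finite A" if "A \<subseteq> {..<N} \<times> {..<N}" for A using that finite_subset by blast
  have "HLw x t N a * (\<Prod>p\<in>ties ({..<N} - T) T a. ?w p)
     = (\<Prod>p\<in>{(i, j). i < N \<and> j < N \<and> a i > a j} \<union> ties ({..<N} - T) T a. ?w p)"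
    unfolding HLw_def by (rule prod.union_disjoint[symmetric]) (use T in "auto intro!: fin")
  also have "{(i, j). i < N \<and> j < N \<and> a i > a j} \<union> ties ({..<N} - T) T a
     = {(i, j). i < N \<and> j < N \<and> b i > b j} \<union> ties T ({..<N} - T) b"
    (is "?A = ?B")
  proof -
    have "(i < N \<and> j < N \<and> a i > a j) \<or> (i < N \<and> i \<notin> T \<and> j \<in> T \<and> a i = a j) \<longleftrightarrow>
      (i < N \<and> j < N \<and> b i > b j) \<or> (i \<in> T \<and> j < N \<and> j \<notin> T \<and> b i = b j)" for i j
    proof -
      have "i \<in> T \<longrightarrow> i < N" "j \<in> T \<longrightarrow> j < N" using T by auto
      then show ?thesis unfolding a ind_def by (cases "i \<in> T"; cases "j \<in> T"; simp; presburger)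
    qed
    then have pt: "(i, j) \<in> ?A \<longleftrightarrow> (i, j) \<in> ?B" for i j by simp
    show "?A = ?B"
    proof (rule Set.set_eqI)
      fix p show "p \<in> ?A \<longleftrightarrow> p \<in> ?B" using pt[of "fst p" "snd p"] by simp
    qed
  qed
  also have "(\<Prod>p\<in>{(i, j). i < N \<and> j < N \<and> b i > b j} \<union> ties T ({..<N} - T) b. ?w p)
     = HLw x t N b * (\<Prod>p\<in>ties T ({..<N} - T) b. ?w p)"
    unfolding HLw_def by (rule prod.union_disjoint) (use T in "auto intro!: fin")
  finally show ?thesis .
qed

text \<open>Inside a block of equal exponents the weighted sum over k-subsets is e_k of the block,
  and so is the unweighted one; exchanging the weights in all blocks leaves e_r of all
  variables.\<close>

lemma sum_raise:
  fixes x :: "nat \<Rightarrow> real" and b :: "nat \<Rightarrow> nat"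
  assumes x: "inj_on x {..<N}" and t: "0 < t" "t \<noteq> 1"
  shows "(\<Sum>T\<in>subs r {..<N}. (\<Prod>i\<in>T. x i) * (\<Prod>(i, j)\<in>ties T ({..<N} - T) b. wt x t i j)) = es x {..<N} r"
proof -
  let ?I = "{..<N}" let ?B = "block b ?I"
  let ?u1 = "\<lambda>v T. (\<Prod>i\<in>T. x i) * (\<Prod>i\<in>T. \<Prod>j\<in>?B v - T. wt x t i j)"
  let ?u2 = "\<lambda>v T. (\<Prod>i\<in>T. x i)"
  let ?g = "\<lambda>S. if card S = r then 1 else 0 :: real"
  have fB: "finite (?B v)" for v by (rule finite_subset[of _ ?I]) (auto simp: block_def)
  have "(\<Sum>S\<in>Pow ?I. (\<Prod>v\<in>b ` ?I. ?u1 v (S \<inter> ?B v)) * ?g S) = (\<Sum>S\<in>Pow ?I. (\<Prod>v\<in>b ` ?I. ?u2 v (S \<inter> ?B v)) * ?g S)"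
  proof (rule block_exchange)
    fix v k
    have "(\<Sum>T\<in>subs k (?B v). ?u1 v T) = es x (?B v) k"
      using subset_sum_es[OF fB inj_on_subset[OF x] t, of v k] by (simp add: subset_sum_def block_def subset_eq)
    then show "(\<Sum>T\<in>subs k (?B v). ?u1 v T) = (\<Sum>T\<in>subs k (?B v). ?u2 v T)" using es_sum[OF fB] by simp
  next
    fix S S' assume S: "S \<subseteq> ?I" "S' \<subseteq> ?I" "\<And>v. card (S \<inter> ?B v) = card (S' \<inter> ?B v)"
    have "card S = card S'"
      using sum_over_blocks[of ?I S "\<lambda>_ c. if c then 1 else 0" b] sum_over_blocks[of ?I S' "\<lambda>_ c. if c then 1 else 0" b] S
        sum_ind[OF S(1)] sum_ind[OF S(2)] by (simp add: ind_def)
    then show "?g S = ?g S'" by simp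
  qed simp
  moreover have "(\<Sum>S\<in>Pow ?I. h S * ?g S) = (\<Sum>S\<in>subs r ?I. h S)" for h
    by (rule sum.mono_neutral_cong_right) (auto simp: subs_def)
  ultimately have EQ: "(\<Sum>S\<in>subs r ?I. \<Prod>v\<in>b ` ?I. ?u1 v (S \<inter> ?B v)) = (\<Sum>S\<in>subs r ?I. \<Prod>v\<in>b ` ?I. ?u2 v (S \<inter> ?B v))" by simp
  have P2: "(\<Prod>v\<in>b ` ?I. ?u2 v (S \<inter> ?B v)) = (\<Prod>i\<in>S. x i)" if "S \<in> subs r ?I" for S
    by (rule prod_over_blocks) (use that in "auto simp: subs_def")
  have P1: "(\<Prod>v\<in>b ` ?I. ?u1 v (S \<inter> ?B v)) = (\<Prod>i\<in>S. x i) * (\<Prod>(i, j)\<in>ties S (?I - S) b. wt x t i j)"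
    if S: "S \<in> subs r ?I" for S
  proof -
    have S': "S \<subseteq> ?I" using S by (simp add: subs_def)
    have "(\<Prod>v\<in>b ` ?I. \<Prod>i\<in>S \<inter> ?B v. \<Prod>j\<in>?B v - S \<inter> ?B v. wt x t i j)
        = (\<Prod>v\<in>b ` ?I. \<Prod>i\<in>?B v \<inter> S. \<Prod>j\<in>?B v \<inter> (- S). wt x t i j)"
      by (intro prod.cong refl) auto
    also have "\<dots> = (\<Prod>(i, j)\<in>ties (?I \<inter> S) (?I \<inter> - S) b. wt x t i j)"
      by (rule prod_blocks) simp
    also have "ties (?I \<inter> S) (?I \<inter> - S) b = ties S (?I - S) b"
      using S' by auto
    finally show ?thesis using prod_over_blocks[where I = ?I and S = S and a = b and z = x] S' by (simp add: prod.distrib)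
  qed
  have "(\<Sum>T\<in>subs r ?I. (\<Prod>i\<in>T. x i) * (\<Prod>(i, j)\<in>ties T (?I - T) b. wt x t i j))
      = (\<Sum>S\<in>subs r ?I. \<Prod>v\<in>b ` ?I. ?u1 v (S \<inter> ?B v))"
    by (rule sum_cong) (rule P1[symmetric])
  also note EQ
  also have "(\<Sum>S\<in>subs r ?I. \<Prod>v\<in>b ` ?I. ?u2 v (S \<inter> ?B v)) = (\<Sum>S\<in>subs r ?I. \<Prod>i\<in>S. x i)"
    by (rule sum_cong) (rule P2)
  finally show ?thesis using es_sum[of ?I x r] by simp
qed

text \<open>Substitute a = b + \<open>ind S\<close>: the weights match by \<open>HLw_raise\<close>,
  and the remaining sum over S is e_r for every b.\<close>

lemma pieri_pairing_x:
  assumes x: "inj_on x {..<N}" and t: "0 < t" "t \<noteq> 1"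
  shows "(\<Sum>a\<in>Om N (m + r). xp x N a * HLw x t N a * ETx x t N r f a) =
    es x {..<N} r * (\<Sum>b\<in>Om N m. xp x N b * HLw x t N b * f (shp b))"
proof -
  let ?E = "\<lambda>a S. (\<Prod>(i, j)\<in>ties ({..<N} - S) S a. wt x t i j)"
  let ?F = "\<lambda>b T. (\<Prod>(i, j)\<in>ties T ({..<N} - T) b. wt x t i j)"
  let ?G = "\<lambda>a. {S \<in> subs r {..<N}. \<forall>i\<in>S. 1 \<le> a i}"
  have "(\<Sum>a\<in>Om N (m + r). xp x N a * HLw x t N a * ETx x t N r f a) =
     (\<Sum>p\<in>Sigma (Om N (m + r)) ?G. xp x N (fst p) * HLw x t N (fst p) * (?E (fst p) (snd p) * f (shp (\<lambda>i. fst p i - ind (snd p) i))))"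
    unfolding ETx_def sum_distrib_left by (subst sum.Sigma) (auto simp: case_prod_beta)
  also have "\<dots> = (\<Sum>p\<in>Om N m \<times> subs r {..<N}. xp x N (fst p) * HLw x t N (fst p) * f (shp (fst p)) * ((\<Prod>i\<in>snd p. x i) * ?F (fst p) (snd p)))"
    (is "sum ?f _ = sum ?h _")
  proof (rule sum.reindex_bij_witness[where j = "\<lambda>(a, S). (\<lambda>i. a i - ind S i, S)" and i = "\<lambda>(b, S). (\<lambda>i. b i + ind S i, S)"])
    fix p assume p: "p \<in> Sigma (Om N (m + r)) ?G"
    obtain a S where [simp]: "p = (a, S)" by (cases p)
    have S: "S \<subseteq> {..<N}" "card S = r" "\<And>i. i \<in> S \<Longrightarrow> 1 \<le> a i" and a: "a \<in> Om N (m + r)" using p by (auto simp: subs_def)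
    define b where "b i = a i - ind S i" for i
    have ab: "a = (\<lambda>i. b i + ind S i)" using S by (auto simp: b_def ind_def fun_eq_iff)
    show "(case case p of (a, S) \<Rightarrow> (\<lambda>i. a i - ind S i, S) of (b, S) \<Rightarrow> (\<lambda>i. b i + ind S i, S)) = p"
      using ab b_def by (simp add: fun_eq_iff)
    have "(\<Sum>i<N. b i) + r = m + r"
      using a sum_ind[OF S(1)] S(2) by (simp add: ab Om_def sum.distrib)
    then have "b \<in> Om N m" using a by (auto simp: Om_def b_def)
    then show "(case p of (a, S) \<Rightarrow> (\<lambda>i. a i - ind S i, S)) \<in> Om N m \<times> subs r {..<N}"
      using S by (simp add: b_def[abs_def, symmetric] subs_def)
    have "xp x N a * HLw x t N a * (?E a S * f (shp b)) = (xp x N b * (\<Prod>i\<in>S. x i)) * (HLw x t N b * ?F b S) * f (shp b)"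
      using xp_raise[OF S(1), of x b] HLw_raise[OF S(1), of a b x t] fun_cong[OF ab] unfolding ab[symmetric] by (simp add: mult_ac)
    then show "?h (case p of (a, S) \<Rightarrow> (\<lambda>i. a i - ind S i, S)) = ?f p"
      by (auto simp: b_def[abs_def] mult_ac)
  next
    fix p assume p: "p \<in> Om N m \<times> subs r {..<N}"
    obtain b S where [simp]: "p = (b, S)" by (cases p)
    have S: "S \<subseteq> {..<N}" "card S = r" and b: "b \<in> Om N m" using p by (auto simp: subs_def)
    show "(case case p of (b, S) \<Rightarrow> (\<lambda>i. b i + ind S i, S) of (a, S) \<Rightarrow> (\<lambda>i. a i - ind S i, S)) = p" by simp
    have "(\<lambda>i. b i + ind S i) \<in> Om N (m + r)"
      using b S sum_ind[OF S(1)] by (auto simp: Om_def sum.distrib ind_def)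
    then show "(case p of (b, S) \<Rightarrow> (\<lambda>i. b i + ind S i, S)) \<in> Sigma (Om N (m + r)) ?G"
      using S by (auto simp: subs_def ind_def)
  qed
  also have "\<dots> = (\<Sum>b\<in>Om N m. xp x N b * HLw x t N b * f (shp b) * (\<Sum>T\<in>subs r {..<N}. (\<Prod>i\<in>T. x i) * ?F b T))"
    unfolding sum_distrib_left by (simp add: sum.cartesian_product case_prod_beta)
  also have "\<dots> = es x {..<N} r * (\<Sum>b\<in>Om N m. xp x N b * HLw x t N b * f (shp b))"
    unfolding sum_raise[OF x t] by (simp add: sum_distrib_left mult_ac)
  finally show ?thesis .
qed

lemma ETx_permute:
  assumes \<pi>: "\<pi> permutes {..<N}"
  shows "ETx (x \<circ> \<pi>) t N r f (a \<circ> \<pi>) = ETx x t N r f a"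
proof -
  let ?I = "{..<N}"
  have inj: "inj \<pi>" and bij: "bij \<pi>" using \<pi> permutes_inj permutes_bij by auto
  have memI: "\<pi> i < N \<longleftrightarrow> i < N" for i using permutes_in_image[OF \<pi>, of i] by simp
  show ?thesis unfolding ETx_def
  proof (rule sum.reindex_bij_witness[where j = "\<lambda>S. \<pi> ` S" and i = "\<lambda>S. \<pi> -` S"])
    fix S assume S: "S \<in> {S \<in> subs r ?I. \<forall>i\<in>S. 1 \<le> (a \<circ> \<pi>) i}"
    show "\<pi> -` (\<pi> ` S) = S" using inj by (simp add: inj_vimage_image_eq)
    have card: "card (\<pi> ` S) = card S" by (rule card_image) (use inj inj_on_subset in blast)
    show "\<pi> ` S \<in> {S \<in> subs r ?I. \<forall>i\<in>S. 1 \<le> a i}" using S card memI by (auto simp: subs_def)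
    have 1: "(\<Prod>(i, j)\<in>ties (?I - \<pi> ` S) (\<pi> ` S) a. wt x t i j)
       = (\<Prod>(i, j)\<in>ties (?I - S) S (a \<circ> \<pi>). wt (x \<circ> \<pi>) t i j)"
    proof (rule prod.reindex_bij_witness[where j = "\<lambda>(i, j). (inv_into UNIV \<pi> i, inv_into UNIV \<pi> j)" and i = "\<lambda>(i, j). (\<pi> i, \<pi> j)"])
      fix p assume p: "p \<in> ties (?I - \<pi> ` S) (\<pi> ` S) a"
      obtain i j where [simp]: "p = (\<pi> i, \<pi> j)" by (cases p) (metis bij bij_pointE)
      show "(case case p of (i, j) \<Rightarrow> (inv_into UNIV \<pi> i, inv_into UNIV \<pi> j) of (i, j) \<Rightarrow> (\<pi> i, \<pi> j)) = p"
        using inj by (simp add: inv_f_f)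
      show "(case p of (i, j) \<Rightarrow> (inv_into UNIV \<pi> i, inv_into UNIV \<pi> j)) \<in> ties (?I - S) S (a \<circ> \<pi>)"
        using p inj memI by (simp add: inv_f_f inj_image_mem_iff)
      show "(case case p of (i, j) \<Rightarrow> (inv_into UNIV \<pi> i, inv_into UNIV \<pi> j) of (i, j) \<Rightarrow> wt (x \<circ> \<pi>) t i j) = (case p of (i, j) \<Rightarrow> wt x t i j)"
        using inj by (simp add: inv_f_f wt_def)
    next
      fix p assume p: "p \<in> ties (?I - S) S (a \<circ> \<pi>)"
      show "(case case p of (i, j) \<Rightarrow> (\<pi> i, \<pi> j) of (i, j) \<Rightarrow> (inv_into UNIV \<pi> i, inv_into UNIV \<pi> j)) = p"
        using inj by (cases p) (simp add: inv_f_f)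
      show "(case p of (i, j) \<Rightarrow> (\<pi> i, \<pi> j)) \<in> ties (?I - \<pi> ` S) (\<pi> ` S) a"
        using p inj memI by (cases p) (simp add: inj_image_mem_iff)
    qed
    have "(\<lambda>i. (a \<circ> \<pi>) i - ind S i) = (\<lambda>i. a i - ind (\<pi> ` S) i) \<circ> \<pi>"
      using inj by (auto simp: ind_def fun_eq_iff inj_image_mem_iff)
    then have 2: "shp (\<lambda>i. (a \<circ> \<pi>) i - ind S i) = shp (\<lambda>i. a i - ind (\<pi> ` S) i)"
      using shp_perm[OF bij] by metis
    show "(\<Prod>(i, j)\<in>ties (?I - \<pi> ` S) (\<pi> ` S) a. wt x t i j) * f (shp (\<lambda>i. a i - ind (\<pi> ` S) i)) =
      (\<Prod>(i, j)\<in>ties (?I - S) S (a \<circ> \<pi>). wt (x \<circ> \<pi>) t i j) * f (shp (\<lambda>i. (a \<circ> \<pi>) i - ind S i))"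
      unfolding 1 2 ..
  next
    fix S assume S: "S \<in> {S \<in> subs r ?I. \<forall>i\<in>S. 1 \<le> a i}"
    show "\<pi> ` (\<pi> -` S) = S" using bij by (simp add: bij_is_surj surj_image_vimage_eq)
    have "card (\<pi> -` S) = card S" using bij by (simp add: card_vimage_inj bij_is_inj bij_is_surj)
    then show "\<pi> -` S \<in> {S \<in> subs r ?I. \<forall>i\<in>S. 1 \<le> (a \<circ> \<pi>) i}"
      using S memI by (auto simp: subs_def)
  qed
qed

text \<open>The x-dependent weights can be exchanged for \<open>wt0\<close> in each block, because
  the shape of the lowered sequence depends only on how many rows of each length are lowered. For
  decreasing exponents the resulting powers of t are those of \<open>ET\<close>.\<close>

lemma ETx_sorted:
  assumes x: "inj_on x {..<N}" and t: "0 < t" "t \<noteq> 1" and \<rho>: "is_partition \<rho>" "length \<rho> \<le> N"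
  shows "ETx x t N r f (part \<rho>) = ET t r f \<rho>"
proof -
  let ?I = "{..<N}" let ?a = "part \<rho>" let ?B = "block ?a ?I"
  let ?g = "\<lambda>S. if card S = r \<and> (\<forall>i\<in>S. 1 \<le> ?a i) then f (shp (\<lambda>i. ?a i - ind S i)) else 0"
  have fB: "finite (?B v)" for v by (rule finite_subset[of _ ?I]) (auto simp: block_def)
  have inv: "?g S = ?g S'" if S: "S \<subseteq> ?I" "S' \<subseteq> ?I" "\<And>v. card (S \<inter> ?B v) = card (S' \<inter> ?B v)" for S S'
  proof -
    have F: "(\<Sum>i\<in>?I. F (?a i) (i \<in> S)) = (\<Sum>i\<in>?I. F (?a i) (i \<in> S'))" for F :: "nat \<Rightarrow> bool \<Rightarrow> nat"
      using sum_over_blocks[of ?I S F ?a] sum_over_blocks[of ?I S' F ?a] S by simp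
    have "card S = card S'"
      using F[of "\<lambda>_ c. if c then 1 else 0"] sum_ind[OF S(1)] sum_ind[OF S(2)] by (simp add: ind_def)
    moreover have "(\<forall>i\<in>S. 1 \<le> ?a i) \<longleftrightarrow> card (S \<inter> ?B 0) = 0" if "S \<subseteq> ?I" for S
    proof -
      have "finite (S \<inter> ?B 0)" using fB by simp
      then have "card (S \<inter> ?B 0) = 0 \<longleftrightarrow> S \<inter> ?B 0 = {}" by (rule card_0_eq)
      moreover have "S \<inter> ?B 0 = {} \<longleftrightarrow> (\<forall>i\<in>S. 1 \<le> ?a i)"
        using that by (auto simp: block_def Suc_le_eq)
      ultimately show ?thesis by simp
    qed
    moreover have "shp (\<lambda>i. ?a i - ind S i) = shp (\<lambda>i. ?a i - ind S' i)"
    proof (rule partition_eqI_pmin[OF is_partition_shp is_partition_shp])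
      fix k
      have z: "\<forall>i\<ge>N. ?a i - ind S i = 0" for S using \<rho>(2) by (simp add: part_def)
      show "pmin (shp (\<lambda>i. ?a i - ind S i)) k = pmin (shp (\<lambda>i. ?a i - ind S' i)) k"
        unfolding pmin_shp[OF z] using F[of "\<lambda>v c. min (v - (if c then 1 else 0)) k"] by (simp add: ind_def)
    qed
    ultimately show ?thesis using S by metis
  qed
  have expand: "(\<Sum>S\<in>Pow ?I. (\<Prod>v\<in>?a ` ?I. \<Prod>i\<in>?B v - S \<inter> ?B v. \<Prod>j\<in>S \<inter> ?B v. w i j) * ?g S)
     = (\<Sum>S\<in>{S \<in> subs r ?I. \<forall>i\<in>S. 1 \<le> ?a i}.
         (\<Prod>(i, j)\<in>ties (?I - S) S ?a. w i j) * f (shp (\<lambda>i. ?a i - ind S i)))" for w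
  proof (rule sum.mono_neutral_cong_right)
    fix S assume S: "S \<in> {S \<in> subs r ?I. \<forall>i\<in>S. 1 \<le> ?a i}"
    have "(\<Prod>v\<in>?a ` ?I. \<Prod>i\<in>?B v - S \<inter> ?B v. \<Prod>j\<in>S \<inter> ?B v. w i j)
        = (\<Prod>v\<in>?a ` ?I. \<Prod>i\<in>?B v \<inter> (- S). \<Prod>j\<in>?B v \<inter> S. w i j)"
      by (intro prod.cong refl) auto
    also have "\<dots> = (\<Prod>(i, j)\<in>ties (?I \<inter> - S) (?I \<inter> S) ?a. w i j)"
      by (rule prod_blocks) simp
    also have "ties (?I \<inter> - S) (?I \<inter> S) ?a = ties (?I - S) S ?a"
      using S by (auto simp: subs_def)
    finally show "(\<Prod>v\<in>?a ` ?I. \<Prod>i\<in>?B v - S \<inter> ?B v. \<Prod>j\<in>S \<inter> ?B v. w i j) * ?g S =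
      (\<Prod>(i, j)\<in>ties (?I - S) S ?a. w i j) * f (shp (\<lambda>i. ?a i - ind S i))"
      using S by (simp add: subs_def)
  qed (auto simp: subs_def)
  have "(\<Sum>S\<in>Pow ?I. (\<Prod>v\<in>?a ` ?I. \<Prod>i\<in>?B v - S \<inter> ?B v. \<Prod>j\<in>S \<inter> ?B v. wt x t i j) * ?g S)
      = (\<Sum>S\<in>Pow ?I. (\<Prod>v\<in>?a ` ?I. \<Prod>i\<in>?B v - S \<inter> ?B v. \<Prod>j\<in>S \<inter> ?B v. wt0 t i j) * ?g S)"
  proof (rule block_exchange[where ?u1.0 = "\<lambda>v T. \<Prod>i\<in>?B v - T. \<Prod>j\<in>T. wt x t i j" and ?u2.0 = "\<lambda>v T. \<Prod>i\<in>?B v - T. \<Prod>j\<in>T. wt0 t i j"])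
    fix v k
    \<comment> \<open>The weights run from the complement of T to T, so \<open>subset_sum\<close>
      applies to the complement.\<close>
    have compl: "(\<Sum>T\<in>subs k (?B v). \<Prod>i\<in>?B v - T. \<Prod>j\<in>T. w i j) = (if k \<le> card (?B v) then subset_sum w (\<lambda>_. 1) (card (?B v) - k) (?B v) else 0)" for w
    proof (cases "k \<le> card (?B v)")
      case True
      have "(\<Sum>T\<in>subs k (?B v). \<Prod>i\<in>?B v - T. \<Prod>j\<in>T. w i j) = (\<Sum>T\<in>subs (card (?B v) - k) (?B v). \<Prod>i\<in>T. \<Prod>j\<in>?B v - T. w i j)"
        by (rule sum.reindex_bij_witness[where i = "\<lambda>T. ?B v - T" and j = "\<lambda>T. ?B v - T"])
          (use fB True in "auto simp: subs_def double_diff card_Diff_subset finite_subset")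
      then show ?thesis using True by (simp add: subset_sum_def)
    next
      case False
      then have "subs k (?B v) = {}" using card_mono[OF fB[of v]] by (auto simp: subs_def)
      then show ?thesis using False by simp
    qed
    have "subset_sum (wt x t) (\<lambda>_. 1) l (?B v) = subset_sum (wt0 t) (\<lambda>_. 1) l (?B v)" for l
      by (rule subset_sum_wt_wt0[OF fB _ t]) (rule inj_on_subset[OF x], auto simp: block_def)
    then show "(\<Sum>T\<in>subs k (?B v). \<Prod>i\<in>?B v - T. \<Prod>j\<in>T. wt x t i j) = (\<Sum>T\<in>subs k (?B v). \<Prod>i\<in>?B v - T. \<Prod>j\<in>T. wt0 t i j)"
      unfolding compl by simp
  next
    fix S S' assume "S \<subseteq> ?I" "S' \<subseteq> ?I" "\<And>v. card (S \<inter> ?B v) = card (S' \<inter> ?B v)"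
    then show "?g S = ?g S'" by (rule inv)
  qed simp
  then have "ETx x t N r f ?a = (\<Sum>S\<in>{S \<in> subs r ?I. \<forall>i\<in>S. 1 \<le> ?a i}.
         (\<Prod>(i, j)\<in>ties (?I - S) S ?a. wt0 t i j) * f (shp (\<lambda>i. ?a i - ind S i)))"
    unfolding expand ETx_def .
  also have "\<dots> = ET t r f \<rho>"
    unfolding ET_def
  proof (rule sum.cong)
    show "{S \<in> subs r ?I. \<forall>i\<in>S. 1 \<le> ?a i} = subs r {..<length \<rho>}"
    proof -
      have "1 \<le> ?a i \<longleftrightarrow> i < length \<rho>" for i using part_pos[OF \<rho>(1), of i] by (auto simp: part_def Suc_le_eq)
      then show ?thesis using \<rho>(2) by (auto simp: subs_def)
    qed
    fix S assume S: "S \<in> subs r {..<length \<rho>}"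
    let ?P = "ties (?I - S) S ?a"
    have nz: "i < length \<rho>" if "j \<in> S" "?a i = ?a j" for i j
      using that S part_pos[OF \<rho>(1), of j] by (auto simp: subs_def part_def split: if_splits)
    have nz': "i < N" if "j \<in> S" "?a j = ?a i" for i j
      using nz[OF that(1)] that(2) \<rho>(2) by force
    have finP: "finite ?P" by (rule finite_subset[of _ "?I \<times> ?I"]) (use S \<rho>(2) in "auto simp: subs_def")
    \<comment> \<open>Here \<open>i\<close> lies outside S and \<open>j\<close> inside; a factor t
      occurs for j < i, which is a pair of \<open>inv_stat\<close> written in the other
      order.\<close>
    have "(\<Prod>(i, j)\<in>?P. wt0 t i j) = (\<Prod>p\<in>{(i, j). (i, j) \<in> ?P \<and> j < i}. t)"
      by (rule prod.mono_neutral_cong_right[OF finP]) (auto simp: wt0_def split: if_splits, metis linorder_neqE_nat)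
    also have "\<dots> = t ^ card {(i, j). (i, j) \<in> ?P \<and> j < i}" by simp
    also have "card {(i, j). (i, j) \<in> ?P \<and> j < i} = inv_stat \<rho> S"
      unfolding inv_stat_def
      by (rule bij_betw_same_card[of prod.swap], rule bij_betw_byWitness[where f' = prod.swap])
        (use nz nz' in auto)
    finally show "(\<Prod>(i, j)\<in>?P. wt0 t i j) * f (shp (\<lambda>i. ?a i - ind S i)) = t ^ inv_stat \<rho> S * f (lower \<rho> S)"
      by (simp add: lower_def)
  qed
  finally show ?thesis .
qed

text \<open>A permutation sorts the exponents; applied to the coordinates as well it leaves
  \<open>ETx\<close> unchanged and keeps the coordinates distinct, so the sorted case
  suffices.\<close>

theorem pieri_pairing:
  assumes x: "inj_on x {..<N}" and t: "0 < t" "t \<noteq> 1"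
  shows "(\<Sum>a\<in>Om N (m + r). xp x N a * HLw x t N a * ET t r f (shp a)) =
    es x {..<N} r * (\<Sum>b\<in>Om N m. xp x N b * HLw x t N b * f (shp b))"
proof -
  have "ETx x t N r f a = ET t r f (shp a)" if a: "a \<in> Om N (m + r)" for a
  proof -
    have a0: "\<forall>i\<ge>N. a i = 0" using a by (simp add: Om_def)
    have sub: "{i. a i \<noteq> 0} \<subseteq> {..<N}" using a0 by (metis supp_subset)
    have len: "length (shp a) \<le> N" unfolding card_supp_shp using card_mono[OF _ sub] by simp
    have "shp a = shp (part (shp a))" by (simp add: shp_part is_partition_shp)
    moreover have "\<forall>i\<ge>N. part (shp a) i = 0" using len by (simp add: part_def)
    ultimately obtain \<pi> where \<pi>: "\<pi> permutes {..<N}" "a = part (shp a) \<circ> \<pi>" using shp_eq_permutes a0 by blast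
    define y where "y = x \<circ> inv_into UNIV \<pi>"
    have xy: "x = y \<circ> \<pi>" using permutes_inverses(2)[OF \<pi>(1)] by (simp add: y_def fun_eq_iff)
    have "inj_on y {..<N}"
    proof (rule inj_onI)
      fix i j assume ij: "i \<in> {..<N}" "j \<in> {..<N}" "y i = y j"
      have "inv_into UNIV \<pi> i \<in> {..<N}" "inv_into UNIV \<pi> j \<in> {..<N}"
        using ij permutes_in_image[OF permutes_inv[OF \<pi>(1)]] by auto
      then have "inv_into UNIV \<pi> i = inv_into UNIV \<pi> j" using ij(3) x by (auto simp: y_def inj_on_def)
      then show "i = j" using permutes_inverses(1)[OF \<pi>(1)] by metis
    qed
    from ETx_sorted[OF this t is_partition_shp len]
    have "ETx y t N r f (part (shp a)) = ET t r f (shp a)" .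
    then show ?thesis using ETx_permute[OF \<pi>(1), where x = y and a = "part (shp a)"] \<pi>(2) xy by metis
  qed
  then show ?thesis using pieri_pairing_x[OF x t, where m = m and r = r and f = f] by simp
qed

section \<open>Hall--Littlewood functions and Kostka--Foulkes polynomials\<close>

text \<open>If \<open>\<rho>\<close> has more than N parts the index set is empty and the value is
  0, as it should be for P_rho in N variables; so the Pieri rule and the expansions hold for every
  N.\<close>

definition hlp :: "(nat \<Rightarrow> real) \<Rightarrow> real \<Rightarrow> nat \<Rightarrow> nat list \<Rightarrow> real" where
  "hlp x t N \<rho> = (\<Sum>a\<in>{a \<in> Om N (sum_list \<rho>). shp a = \<rho>}. xp x N a * HLw x t N a)"

lemma shp_Om: "a \<in> Om N m \<Longrightarrow> shp a \<in> Par m"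
  using sum_list_shp[of N a] by (simp add: Om_def Par_def is_partition_shp)

lemma sum_Om_shp: "(\<Sum>a\<in>Om N m. xp x N a * HLw x t N a * f (shp a)) = (\<Sum>\<rho>\<in>Par m. hlp x t N \<rho> * f \<rho>)"
proof -
  have "(\<Sum>a\<in>Om N m. xp x N a * HLw x t N a * f (shp a))
      = (\<Sum>\<rho>\<in>Par m. \<Sum>a\<in>{a \<in> Om N m. shp a = \<rho>}. xp x N a * HLw x t N a * f (shp a))"
    by (rule sum.group[symmetric]) (auto simp: shp_Om)
  also have "\<dots> = (\<Sum>\<rho>\<in>Par m. hlp x t N \<rho> * f \<rho>)"
    unfolding hlp_def sum_distrib_right
    by (intro sum.cong refl) (auto simp: Par_def)
  finally show ?thesis .
qed

lemma pieri_hlp: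
  assumes "inj_on x {..<N}" "0 < t" "t \<noteq> 1"
  shows "(\<Sum>\<rho>\<in>Par (m + r). hlp x t N \<rho> * ET t r f \<rho>) = es x {..<N} r * (\<Sum>\<rho>\<in>Par m. hlp x t N \<rho> * f \<rho>)"
  using pieri_pairing[OF assms, where m = m and r = r and f = f] unfolding sum_Om_shp .

lemma rearrangements_eq:
  assumes "is_partition \<nu>" "length \<nu> \<le> N"
  shows "rearrangements N \<nu> = {a \<in> Om N (sum_list \<nu>). shp a = \<nu>}"
proof (intro equalityI subsetI)
  fix a assume "a \<in> rearrangements N \<nu>"
  then obtain \<pi> where \<pi>: "\<pi> permutes {..<N}" "a = part \<nu> \<circ> \<pi>" by (auto simp: rearrangements_def)
  have a0: "\<forall>i\<ge>N. a i = 0" using \<pi> assms(2) by (simp add: permutes_not_in part_def)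
  have s: "shp a = \<nu>" using \<pi> shp_perm[OF permutes_bij[OF \<pi>(1)]] shp_part[OF assms(1)] by simp
  show "a \<in> {a \<in> Om N (sum_list \<nu>). shp a = \<nu>}" using a0 s sum_list_shp[OF a0] by (simp add: Om_def)
next
  fix a assume a: "a \<in> {a \<in> Om N (sum_list \<nu>). shp a = \<nu>}"
  have "\<exists>\<pi>. \<pi> permutes {..<N} \<and> a = part \<nu> \<circ> \<pi>"
    by (rule shp_eq_permutes) (use a assms shp_part in "auto simp: Om_def part_def")
  then show "a \<in> rearrangements N \<nu>" by (auto simp: rearrangements_def)
qed

lemma partitions_of_0 [simp]: "Par 0 = {[]}"
proof (intro equalityI subsetI)
  fix \<nu> assume "\<nu> \<in> Par 0"
  then show "\<nu> \<in> {[]}" by (cases \<nu>) (auto simp: Par_def is_partition_def)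
qed (simp add: Par_def is_partition_def)

lemma hlp_Nil [simp]: "hlp x t N [] = 1"
proof -
  have z: "Om N 0 = {\<lambda>_. 0}"
  proof (intro equalityI subsetI)
    fix a assume a: "a \<in> Om N 0"
    have "a i = 0" for i using a by (cases "i < N") (auto simp: Om_def)
    then show "a \<in> {\<lambda>_. 0}" by auto
  qed (simp add: Om_def)
  have s: "shp (\<lambda>_. 0) = []" by (simp add: shp_def)
  have "{a \<in> Om N (sum_list []). shp a = []} = {\<lambda>_. 0}" using z s by auto
  then show ?thesis by (simp add: hlp_def xp_def HLw_def)
qed

text \<open>The coefficients of products of elementary symmetric functions in the basis \<open>P\<^sub>\<rho>\<close>.\<close>

fun BB :: "'a::comm_ring_1 \<Rightarrow> nat list \<Rightarrow> nat list \<Rightarrow> 'a" where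
  "BB t [] \<rho> = (if \<rho> = [] then 1 else 0)"
| "BB t (r # c) \<rho> = ET t r (BB t c) \<rho>"

lemma poly_BB: "poly (BB [:0, 1:] c \<rho>) t = BB (t::real) c \<rho>"
  by (induction c arbitrary: \<rho>) (simp_all add: ET_def poly_sum poly_power)

definition HLwp :: "(nat \<Rightarrow> real) \<Rightarrow> nat \<Rightarrow> (nat \<Rightarrow> nat) \<Rightarrow> real poly" where
  "HLwp x N a = (\<Prod>(i, j)\<in>{(i, j). i < N \<and> j < N \<and> a i > a j}. [:x i / (x i - x j), - x j / (x i - x j):])"

lemma poly_HLwp: "poly (HLwp x N a) t = HLw x t N a"
  unfolding HLwp_def HLw_def poly_prod
  by (rule prod.cong) (auto simp: wt_def diff_divide_distrib)

text \<open>The Pieri rule is iterated for 0 < t < 1. For fixed x both sides are polynomials in t,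
  so agreement there extends to every real t, in particular to t = 1.\<close>

lemma e_product_hlp:
  assumes x: "inj_on x {..<N}"
  shows "(\<Sum>\<rho>\<in>Par (sum_list c). hlp x t N \<rho> * BB t c \<rho>) = (\<Prod>r\<leftarrow>c. es x {..<N} r)"
proof -
  have *: "(\<Sum>\<rho>\<in>Par (sum_list c). hlp x t N \<rho> * BB t c \<rho>) = (\<Prod>r\<leftarrow>c. es x {..<N} r)"
    if t: "0 < t" "t < 1" for t
  proof (induction c)
    case (Cons r c)
    have "BB t (r # c) = ET t r (BB t c)" by auto
    then show ?case using pieri_hlp[OF x t(1), where m = "sum_list c" and r = r and f = "BB t c"] t Cons by (simp add: add.commute)
  qed simp
  define p where "p = (\<Sum>\<rho>\<in>Par (sum_list c). (\<Sum>a\<in>{a \<in> Om N (sum_list \<rho>). shp a = \<rho>}. smult (xp x N a) (HLwp x N a)) * BB [:0, 1:] c \<rho>)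
     - [:\<Prod>r\<leftarrow>c. es x {..<N} r:]"
  have p: "poly p t = (\<Sum>\<rho>\<in>Par (sum_list c). hlp x t N \<rho> * BB t c \<rho>) - (\<Prod>r\<leftarrow>c. es x {..<N} r)" for t
    by (simp add: p_def poly_sum poly_BB poly_HLwp hlp_def)
  have "{0<..<1} \<subseteq> {t. poly p t = 0}" using * by (auto simp: p)
  moreover have "infinite {0<..<1::real}" by simp
  ultimately have "p = 0" using poly_roots_finite[of p] finite_subset by blast
  then show ?thesis using p[of t] by simp
qed

text \<open>The conjugate partition, padded with zeros to length n. Products of the e_r over it
  expand unitriangularly in the P_rho.\<close>

definition col :: "nat \<Rightarrow> nat list \<Rightarrow> nat list" where
  "col n \<rho> = map (\<lambda>j. length (filter (\<lambda>x. j < x) \<rho>)) [0..<n]"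

lemma sum_take_col: "k \<le> n \<Longrightarrow> sum_list (take k (col n \<rho>)) = pmin \<rho> k"
proof (induction k)
  case (Suc k)
  then have "k < length (col n \<rho>)" by (simp add: col_def)
  then have "sum_list (take (Suc k) (col n \<rho>)) = sum_list (take k (col n \<rho>)) + col n \<rho> ! k"
    by (simp add: take_Suc_conv_app_nth)
  then show ?case using Suc by (simp add: pmin_Suc col_def)
qed simp

lemma sum_col: assumes "sum_list \<rho> \<le> n" shows "sum_list (col n \<rho>) = sum_list \<rho>"
  using sum_take_col[of n n \<rho>] pmin_large[OF assms] by (simp add: col_def)

lemma lower_bound: "\<forall>i\<ge>length \<rho>. part \<rho> i - ind S i = 0"
  by (simp add: part_def)

lemma pmin_part: "is_partition \<rho> \<Longrightarrow> pmin \<rho> k = (\<Sum>i<length \<rho>. min (part \<rho> i) k)"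
  using pmin_shp[of "length \<rho>" "part \<rho>" k] by (simp add: shp_part part_def)

lemma pmin_lower: "pmin (lower \<rho> S) k = (\<Sum>i<length \<rho>. min (part \<rho> i - ind S i) k)"
  unfolding lower_def by (rule pmin_shp[OF lower_bound])

lemma is_partition_lower [simp]: "is_partition (lower \<rho> S)"
  by (simp add: lower_def is_partition_shp)

text \<open>A lowered row satisfies min (a - 1) k + 1 = min a (k + 1), any other row min a k \<le>
  min a (k + 1).\<close>

lemma pmin_lower_le:
  assumes "is_partition \<rho>" "S \<in> subs r {..<length \<rho>}"
  shows "pmin (lower \<rho> S) k + r \<le> pmin \<rho> (Suc k)"
proof -
  have "pmin (lower \<rho> S) k + r = (\<Sum>i<length \<rho>. min (part \<rho> i - ind S i) k + ind S i)"
    using sum_ind[of S "length \<rho>"] assms(2) by (simp add: pmin_lower sum.distrib subs_def)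
  also have "\<dots> \<le> (\<Sum>i<length \<rho>. min (part \<rho> i) (Suc k))"
    by (rule sum_mono) (use part_pos[OF assms(1)] in "fastforce simp: ind_def")
  finally show ?thesis using pmin_part[OF assms(1)] by simp
qed

text \<open>By \<open>pmin_lower_le\<close> the first k columns of \<open>\<rho>\<close> hold at
  least r cells more than the first k - 1 columns of the shape left after a factor e_r, which
  matches the shift in the partial sums of \<open>r # c\<close>.\<close>

lemma BB_dominance:
  fixes t :: real
  shows "BB t c \<rho> \<noteq> 0 \<Longrightarrow> is_partition \<rho> \<Longrightarrow> sum_list (take k c) \<le> pmin \<rho> k"
proof (induction c arbitrary: \<rho> k)
  case (Cons r c)
  have "ET t r (BB t c) \<rho> \<noteq> 0" using Cons.prems by simp
  then obtain S where S: "S \<in> subs r {..<length \<rho>}" "BB t c (lower \<rho> S) \<noteq> 0"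
    unfolding ET_def by (metis (mono_tags, lifting) mult_zero_right sum.neutral)
  show ?case
  proof (cases k)
    case (Suc l)
    have "sum_list (take k (r # c)) = r + sum_list (take l c)" using Suc by simp
    also have "\<dots> \<le> r + pmin (lower \<rho> S) l" using Cons.IH[OF S(2)] by simp
    also have "\<dots> \<le> pmin \<rho> k" using pmin_lower_le[OF Cons.prems(2) S(1), of l] Suc by simp
    finally show ?thesis .
  qed simp
qed simp

lemma filter_lower_full:
  assumes "is_partition \<rho>"
  shows "length (filter (\<lambda>x. j < x) (lower \<rho> {..<length \<rho>})) = length (filter (\<lambda>x. Suc j < x) \<rho>)"
proof -
  have "pmin (lower \<rho> {..<length \<rho>}) k + length \<rho> = pmin \<rho> (Suc k)" for k
  proof -
    have "pmin (lower \<rho> {..<length \<rho>}) k + length \<rho> = (\<Sum>i<length \<rho>. min (part \<rho> i - ind {..<length \<rho>} i) k + 1)"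
      by (simp only: pmin_lower sum.distrib) simp
    also have "\<dots> = (\<Sum>i<length \<rho>. min (part \<rho> i) (Suc k))"
      by (rule sum_cong) (use part_pos[OF assms] in "fastforce simp: ind_def")
    finally show ?thesis using pmin_part[OF assms] by simp
  qed
  from this[of j] this[of "Suc j"] show ?thesis
    using pmin_Suc[of "lower \<rho> {..<length \<rho>}" j] pmin_Suc[of \<rho> "Suc j"] by simp
qed

text \<open>The first entry of the conjugate is the number of rows, so the only choice is to lower
  all rows, without inversions; this deletes the first column.\<close>

lemma BB_col_diag:
  fixes t :: real
  shows "is_partition \<rho> \<Longrightarrow> length (filter (\<lambda>x. n < x) \<rho>) = 0 \<Longrightarrow> BB t (col n \<rho>) \<rho> = 1"
proof (induction n arbitrary: \<rho>)
  case 0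
  then have "\<rho> = []" by (cases \<rho>) (auto simp: is_partition_def)
  then show ?case by (simp add: col_def)
next
  case (Suc n)
  let ?F = "{..<length \<rho>}" and ?\<mu> = "lower \<rho> {..<length \<rho>}"
  have "filter (\<lambda>x. 0 < x) \<rho> = \<rho>" using Suc.prems(1) by (auto simp: is_partition_def intro!: filter_True) (metis gr0I)
  moreover have "col n ?\<mu> = map (\<lambda>j. length (filter (\<lambda>x. Suc j < x) \<rho>)) [0..<n]"
    by (simp add: col_def filter_lower_full[OF Suc.prems(1)])
  moreover have "[0..<Suc n] = 0 # map Suc [0..<n]" by (simp add: map_Suc_upt upt_conv_Cons)
  ultimately have c: "col (Suc n) \<rho> = length \<rho> # col n ?\<mu>" by (simp add: col_def del: upt_Suc)
  have "subs (length \<rho>) ?F = {?F}" using card_subset_eq[of ?F] by (auto simp: subs_def)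
  moreover have "inv_stat \<rho> ?F = 0" by (simp add: inv_stat_def)
  moreover have "BB t (col n ?\<mu>) ?\<mu> = 1"
    by (rule Suc.IH) (use Suc.prems filter_lower_full[OF Suc.prems(1), of n] in auto)
  ultimately show ?case unfolding c by (simp add: ET_def)
qed

definition pmin_rank :: "nat \<Rightarrow> nat list \<Rightarrow> nat" where "pmin_rank n \<rho> = (\<Sum>k\<le>n. pmin \<rho> k)"

lemma BB_triangular:
  fixes t :: real
  assumes "\<mu> \<in> Par n" "\<rho> \<in> Par n" "BB t (col n \<mu>) \<rho> \<noteq> 0" "\<mu> \<noteq> \<rho>"
  shows "pmin_rank n \<mu> < pmin_rank n \<rho>"
proof -
  have p: "is_partition \<mu>" "is_partition \<rho>" "sum_list \<mu> = n" "sum_list \<rho> = n" using assms by (auto simp: Par_def)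
  have le: "pmin \<mu> k \<le> pmin \<rho> k" if "k \<le> n" for k
    using BB_dominance[OF assms(3) p(2), of k] sum_take_col[OF that] by simp
  have "\<exists>k\<in>{..n}. pmin \<mu> k < pmin \<rho> k"
  proof (rule ccontr)
    assume "\<not> ?thesis"
    then have eq: "pmin \<mu> k = pmin \<rho> k" if "k \<le> n" for k using le[OF that] that by force
    have "pmin \<mu> k = pmin \<rho> k" for k
      using eq[of k] pmin_large[of \<mu> k] pmin_large[of \<rho> k] p by (cases "k \<le> n") auto
    then show False using partition_eqI_pmin p assms(4) by blast
  qed
  then show ?thesis unfolding pmin_rank_def
    using le by (intro sum_strict_mono_ex1) auto
qed

lemma BB_inverse:
  fixes t :: real
  shows "\<exists>C. (\<forall>i\<in>Par n. \<forall>j\<in>Par n. (\<Sum>k\<in>Par n. C i k * BB t (col n k) j) = (if i = j then 1 else 0)) \<and>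
             (\<forall>i\<in>Par n. \<forall>j\<in>Par n. (\<Sum>k\<in>Par n. BB t (col n i) k * C k j) = (if i = j then 1 else 0))"
proof (rule triangular_inverse[where rank = "pmin_rank n"])
  fix \<rho> assume \<rho>: "\<rho> \<in> Par n"
  have "x \<le> n" if "x \<in> set \<rho>" for x using member_le_sum_list[OF that] \<rho> by (simp add: Par_def)
  then have "length (filter (\<lambda>x. n < x) \<rho>) = 0" by (auto simp: filter_empty_conv not_less)
  then show "BB t (col n \<rho>) \<rho> \<noteq> 0" using BB_col_diag[of \<rho> n t] \<rho> by (simp add: Par_def)
qed (use BB_triangular in auto)

section \<open>Hall--Littlewood functions as symmetric series\<close>

definition eser :: "nat \<Rightarrow> series" where
  "eser r a = (if mdeg a = r \<and> (\<forall>i. lookup a i \<le> 1) then 1 else 0)"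

lemma eser_Sym [simp]: "eser r \<in> Sym"
proof (rule SymI[where D = r])
  fix a b assume ab: "shape a = shape b"
  have "(\<forall>i. lookup a i \<le> 1) \<longleftrightarrow> (\<forall>x\<in>set (shape a). x \<le> 1)" for a :: monomial
  proof -
    have "set (shape a) = set_mset (mset (shape a))" by simp
    also have "\<dots> = lookup a ` {i. lookup a i \<noteq> 0}"
      by (simp only: shape_def mset_shp) simp
    finally have "set (shape a) = lookup a ` {i. lookup a i \<noteq> 0}" .
    then have "(\<forall>x\<in>set (shape a). x \<le> 1) \<longleftrightarrow> (\<forall>i. lookup a i \<noteq> 0 \<longrightarrow> lookup a i \<le> 1)"
      by (simp only:) blast
    then show ?thesis by (metis le_zero_eq nat_le_linear zero_le)
  qed
  then show "eser r a = eser r b" using ab by (simp add: eser_def mono_degree_shape)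
qed (auto simp: eser_def split: if_splits)

lemma mono_degree_mon: "mdeg (mon c) = sum_list c"
  using mono_degree_eq[of "length c" "mon c"] sum_part[of c "length c"] by (simp add: part_def)

lemma eval_eser: "eval_vars N (eser r) x = es x {..<N} r"
proof -
  have e: "eser r (mon c) = (if \<forall>i. part c i \<le> 1 then 1 else 0)" if "c \<in> comps N r" for c
    using that by (simp add: eser_def mono_degree_mon comps_def)
  have "eval_vars N (eser r) x = (\<Sum>c\<in>comps N r. eser r (mon c) * (\<Prod>i<N. x i ^ part c i))"
    by (rule eval_vars_comps) (auto simp: eser_def split: if_splits)
  also have "\<dots> = (\<Sum>c\<in>{c \<in> comps N r. \<forall>i. part c i \<le> 1}. (\<Prod>i<N. x i ^ part c i))"
    by (rule sum.mono_neutral_cong_right[OF finite_comps]) (auto simp: e)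
  also have "\<dots> = (\<Sum>S\<in>subs r {..<N}. \<Prod>i\<in>S. x i)"
  proof (rule sum.reindex_bij_witness[where j = "\<lambda>c. {i. part c i = 1}" and i = "\<lambda>S. map (ind S) [0..<N]"])
    fix c assume c: "c \<in> {c \<in> comps N r. \<forall>i. part c i \<le> 1}"
    have len: "length c = N" "sum_list c = r" using c by (auto simp: comps_def)
    have sub: "{i. part c i = 1} \<subseteq> {..<N}" using len by (auto simp: part_def split: if_splits)
    have z: "part c i = 0" if "part c i \<noteq> 1" for i
      using c that by (metis (mono_tags, lifting) One_nat_def le_SucE le_zero_eq mem_Collect_eq)
    have pc: "part c i = ind {i. part c i = 1} i" for i
      using c by (auto simp: ind_def) (metis One_nat_def le_SucE le_zero_eq)
    show "map (ind {i. part c i = 1}) [0..<N] = c"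
    proof (rule nth_equalityI)
      fix i assume "i < length (map (ind {i. part c i = 1}) [0..<N])"
      then have i: "i < N" by simp
      then have "map (ind {i. part c i = 1}) [0..<N] ! i = ind {i. part c i = 1} i" by simp
      also have "\<dots> = part c i" by (rule pc[symmetric])
      also have "\<dots> = c ! i" using i len by (simp add: part_def)
      finally show "map (ind {i. part c i = 1}) [0..<N] ! i = c ! i" .
    qed (simp add: len)
    have "card {i. part c i = 1} = r"
      using sum_ind[OF sub] sum_part[of c N] len unfolding pc[symmetric] by simp
    then show "{i. part c i = 1} \<in> subs r {..<N}" using sub by (simp add: subs_def)
    show "(\<Prod>i\<in>{i. part c i = 1}. x i) = (\<Prod>i<N. x i ^ part c i)"
      by (rule prod.mono_neutral_cong_left) (use sub in auto, metis z One_nat_def power_0)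
  next
    fix S assume S: "S \<in> subs r {..<N}"
    have p: "part (map (ind S) [0..<N]) = ind S"
      using S by (auto simp: part_def ind_def subs_def fun_eq_iff)
    show "{i. part (map (ind S) [0..<N]) i = 1} = S" unfolding p by (auto simp: ind_def)
    show "map (ind S) [0..<N] \<in> {c \<in> comps N r. \<forall>i. part c i \<le> 1}"
      using S sum_ind[of S N] unfolding p mem_Collect_eq
      by (simp add: comps_def subs_def interv_sum_list_conv_sum_set_nat atLeast0LessThan) (simp add: ind_def)
  qed
  finally show ?thesis by (simp add: es_sum)
qed

lemma eval_series_one: "eval_vars N series_one x = 1"
proof -
  have "eval_vars N series_one x = (\<Sum>a\<in>MonLe N 0. series_one a * xpow N x a)"
    by (rule eval_vars_eq) (auto simp: series_one_def mono_degree_def split: if_splits)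
  also have "\<dots> = (\<Sum>a\<in>{0}. series_one a * xpow N x a)"
    by (rule sum.mono_neutral_right[OF finite_MonLe]) (auto simp: MonLe_def mono_degree_def series_one_def)
  finally show ?thesis by (simp add: series_one_def xpow_def)
qed

fun eprod :: "nat list \<Rightarrow> series" where
  "eprod [] = series_one"
| "eprod (r # c) = series_mult (eser r) (eprod c)"

lemma eprod_Sym [simp]: "eprod c \<in> Sym"
  by (induction c) (auto intro: series_mult_Sym)

lemma eval_eprod: "eval_vars N (eprod c) x = (\<Prod>r\<leftarrow>c. es x {..<N} r)"
  by (induction c) (simp_all add: eval_series_one eval_vars_mult eval_eser)

text \<open>The inverse of the triangular coefficient matrix writes P_rho as a combination of
  products of the e_r. These are symmetric series, so a single series has the required values in
  every number of variables.\<close>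

lemma hall_littlewood_exists:
  assumes \<rho>: "\<rho> \<in> Par n"
    and C: "\<forall>i\<in>Par n. \<forall>j\<in>Par n. (\<Sum>k\<in>Par n. C i k * BB t (col n k) j) = (if i = j then 1 else 0)"
    and x: "inj_on x {..<N}"
  shows "eval_vars N (\<lambda>a. \<Sum>l\<in>Par n. C \<rho> l * eprod (col n l) a) x = hlp x t N \<rho>"
proof -
  let ?P = "Par n"
  have "eval_vars N (\<lambda>a. \<Sum>l\<in>?P. C \<rho> l * eprod (col n l) a) x = (\<Sum>l\<in>?P. C \<rho> l * eval_vars N (eprod (col n l)) x)"
    by (rule eval_vars_linear) auto
  also have "\<dots> = (\<Sum>l\<in>?P. C \<rho> l * (\<Sum>s\<in>?P. hlp x t N s * BB t (col n l) s))"
  proof (intro sum.cong refl arg_cong[where f = "(*) _"])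
    fix l assume "l \<in> ?P"
    then have "sum_list (col n l) = n" using sum_col[of l n] by (simp add: Par_def)
    then show "eval_vars N (eprod (col n l)) x = (\<Sum>s\<in>?P. hlp x t N s * BB t (col n l) s)"
      using e_product_hlp[OF x, where c = "col n l" and t = t] by (simp add: eval_eprod)
  qed
  also have "\<dots> = (\<Sum>s\<in>?P. hlp x t N s * (\<Sum>l\<in>?P. C \<rho> l * BB t (col n l) s))"
    unfolding sum_distrib_left by (subst sum.swap) (simp add: mult_ac)
  also have "\<dots> = (\<Sum>s\<in>?P. if s = \<rho> then hlp x t N s else 0)"
    by (rule sum.cong) (use C \<rho> in auto)
  also have "\<dots> = hlp x t N \<rho>" using \<rho> by (simp add: sum.delta)
  finally show ?thesis .
qed

text \<open>The defining formula is imposed from N = \<open>length \<rho>\<close> on, and evaluation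
  at those N is already injective on \<open>Sym\<close>.\<close>

lemma hall_littlewood_unique:
  assumes \<rho>: "is_partition \<rho>" and P: "P \<in> Sym" "\<And>N x. inj_on x {..<N} \<Longrightarrow> eval_vars N P x = hlp x t N \<rho>"
  shows "hall_littlewood \<rho> t = P"
  unfolding hall_littlewood_def
proof (rule the_equality)
  have rhs: "(\<Sum>a\<in>rearrangements N \<rho>. (\<Prod>i<N. x i ^ a i) *
      (\<Prod>(i, j)\<in>{(i, j). i < N \<and> j < N \<and> a i > a j}. (x i - t * x j) / (x i - x j))) = hlp x t N \<rho>"
    if "length \<rho> \<le> N" for N x
    unfolding rearrangements_eq[OF \<rho> that] hlp_def xp_def HLw_def wt_def ..
  show "P \<in> Sym \<and> (\<forall>N\<ge>length \<rho>. \<forall>x. inj_on x {..<N} \<longrightarrow> eval_vars N P x =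
      (\<Sum>a\<in>rearrangements N \<rho>. (\<Prod>i<N. x i ^ a i) *
      (\<Prod>(i, j)\<in>{(i, j). i < N \<and> j < N \<and> a i > a j}. (x i - t * x j) / (x i - x j))))"
    using P rhs by simp
  fix P' assume P': "P' \<in> Sym \<and> (\<forall>N\<ge>length \<rho>. \<forall>x. inj_on x {..<N} \<longrightarrow> eval_vars N P' x =
      (\<Sum>a\<in>rearrangements N \<rho>. (\<Prod>i<N. x i ^ a i) *
      (\<Prod>(i, j)\<in>{(i, j). i < N \<and> j < N \<and> a i > a j}. (x i - t * x j) / (x i - x j))))"
  show "P' = P"
    by (rule eval_vars_inj[where ?N0.0 = "length \<rho>"]) (use P P' rhs in auto)
qed

lemma hall_littlewood_e:
  assumes \<rho>: "\<rho> \<in> Par n"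
    and C: "\<forall>i\<in>Par n. \<forall>j\<in>Par n. (\<Sum>k\<in>Par n. C i k * BB t (col n k) j) = (if i = j then 1 else 0)"
  shows "hall_littlewood \<rho> t = (\<lambda>a. \<Sum>l\<in>Par n. C \<rho> l * eprod (col n l) a)"
  by (rule hall_littlewood_unique)
    (use \<rho> hall_littlewood_exists[OF \<rho> C] in "auto simp: Par_def intro!: Sym_sum Sym_scale")

lemma
  assumes "is_partition \<rho>"
  shows hall_littlewood_Sym: "hall_littlewood \<rho> t \<in> Sym"
    and eval_hall_littlewood: "inj_on x {..<N} \<Longrightarrow> eval_vars N (hall_littlewood \<rho> t) x = hlp x t N \<rho>"
proof -
  define n where "n = sum_list \<rho>"
  have \<rho>: "\<rho> \<in> Par n" using assms by (simp add: n_def Par_def)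
  obtain C where C: "\<forall>i\<in>Par n. \<forall>j\<in>Par n. (\<Sum>k\<in>Par n. C i k * BB t (col n k) j) = (if i = j then 1 else 0)"
    using BB_inverse by blast
  show "hall_littlewood \<rho> t \<in> Sym" unfolding hall_littlewood_e[OF \<rho> C] by (intro Sym_sum Sym_scale) simp
  show "eval_vars N (hall_littlewood \<rho> t) x = hlp x t N \<rho>" if "inj_on x {..<N}"
    unfolding hall_littlewood_e[OF \<rho> C] by (rule hall_littlewood_exists[OF \<rho> C that])
qed

lemma eval_HL_sum:
  assumes "inj_on x {..<N}"
  shows "eval_vars N (\<lambda>a. \<Sum>\<rho>\<in>Par n. c \<rho> * hall_littlewood \<rho> t a) x = (\<Sum>\<rho>\<in>Par n. c \<rho> * hlp x t N \<rho>)"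
proof -
  have "eval_vars N (\<lambda>a. \<Sum>\<rho>\<in>Par n. c \<rho> * hall_littlewood \<rho> t a) x = (\<Sum>\<rho>\<in>Par n. c \<rho> * eval_vars N (hall_littlewood \<rho> t) x)"
    by (rule eval_vars_linear[OF finite_partitions_of]) (auto simp: Par_def hall_littlewood_Sym)
  also have "\<dots> = (\<Sum>\<rho>\<in>Par n. c \<rho> * hlp x t N \<rho>)"
    by (rule sum.cong) (auto simp: Par_def eval_hall_littlewood assms)
  finally show ?thesis .
qed

lemma HL_sum_Sym: "(\<lambda>a. \<Sum>\<rho>\<in>Par n. c \<rho> * hall_littlewood \<rho> t a) \<in> Sym"
  by (intro Sym_sum Sym_scale) (simp add: Par_def hall_littlewood_Sym)

lemma eprod_HL:
  assumes l: "l \<in> Par n"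
  shows "eprod (col n l) = (\<lambda>a. \<Sum>\<rho>\<in>Par n. BB t (col n l) \<rho> * hall_littlewood \<rho> t a)"
proof (rule eval_vars_inj[OF eprod_Sym HL_sum_Sym])
  fix N and x :: "nat \<Rightarrow> real" assume x: "inj_on x {..<N}"
  have "sum_list (col n l) = n" using sum_col[of l n] l by (simp add: Par_def)
  then have "eval_vars N (eprod (col n l)) x = (\<Sum>\<rho>\<in>Par n. BB t (col n l) \<rho> * hlp x t N \<rho>)"
    using e_product_hlp[OF x, where c = "col n l" and t = t] by (simp add: eval_eprod mult.commute)
  also have "\<dots> = eval_vars N (\<lambda>a. \<Sum>\<rho>\<in>Par n. BB t (col n l) \<rho> * hall_littlewood \<rho> t a) x"
    by (rule eval_HL_sum[OF x, symmetric])
  finally show "eval_vars N (eprod (col n l)) x = eval_vars N (\<lambda>a. \<Sum>\<rho>\<in>Par n. BB t (col n l) \<rho> * hall_littlewood \<rho> t a) x" .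
qed

text \<open>At \<open>t = 1\<close> all weights are 1, so the Hall--Littlewood functions are the monomial ones.\<close>

lemma hall_littlewood_1: assumes \<mu>: "is_partition \<mu>" shows "hall_littlewood \<mu> 1 = msym \<mu>"
proof (rule hall_littlewood_unique[OF \<mu> msym_Sym])
  fix N and x :: "nat \<Rightarrow> real" assume x: "inj_on x {..<N}"
  have w: "HLw x 1 N a = 1" for a
    unfolding HLw_def by (rule prod.neutral) (use x in "auto simp: wt_def inj_on_def")
  have "eval_vars N (msym \<mu>) x = (\<Sum>c\<in>comps N (sum_list \<mu>). msym \<mu> (mon c) * (\<Prod>i<N. x i ^ part c i))"
    by (rule eval_vars_comps) (auto simp: msym_def mono_degree_shape split: if_splits)
  also have "\<dots> = (\<Sum>c\<in>{c \<in> comps N (sum_list \<mu>). shp (part c) = \<mu>}. xp x N (part c))"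
    by (rule sum.mono_neutral_cong_right) (auto simp: msym_def shape_def xp_def)
  also have "\<dots> = (\<Sum>a\<in>{a \<in> Om N (sum_list \<mu>). shp a = \<mu>}. xp x N a)"
  proof (rule sum.reindex_bij_witness[where j = part and i = "\<lambda>a. map a [0..<N]"])
    fix c assume c: "c \<in> {c \<in> comps N (sum_list \<mu>). shp (part c) = \<mu>}"
    then show "map (part c) [0..<N] = c" by (intro nth_equalityI) (auto simp: comps_def part_def)
    show "part c \<in> {a \<in> Om N (sum_list \<mu>). shp a = \<mu>}"
      using c sum_part[of c N] by (simp add: comps_def Om_def part_def)
  next
    fix a assume a: "a \<in> {a \<in> Om N (sum_list \<mu>). shp a = \<mu>}"
    show p: "part (map a [0..<N]) = a" using a by (auto simp: part_def Om_def fun_eq_iff)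
    show "map a [0..<N] \<in> {c \<in> comps N (sum_list \<mu>). shp (part c) = \<mu>}"
      unfolding mem_Collect_eq p using a by (simp add: comps_def Om_def interv_sum_list_conv_sum_set_nat atLeast0LessThan)
  qed simp
  finally show "eval_vars N (msym \<mu>) x = hlp x 1 N \<mu>" by (simp add: hlp_def w)
qed

lemma left_kernel_zero:
  fixes M C :: "'i \<Rightarrow> 'i \<Rightarrow> real"
  assumes fin: "finite I" and MC: "\<forall>i\<in>I. \<forall>j\<in>I. (\<Sum>k\<in>I. M i k * C k j) = (if i = j then 1 else 0)"
    and z: "\<And>j. j \<in> I \<Longrightarrow> (\<Sum>i\<in>I. d i * M i j) = 0" and i: "i \<in> I"
  shows "d i = 0"
proof -
  have "d i = (\<Sum>l\<in>I. if l = i then d l else 0)" using fin i by (simp add: sum.delta)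
  also have "\<dots> = (\<Sum>l\<in>I. d l * (\<Sum>k\<in>I. M l k * C k i))"
    by (rule sum.cong) (use MC i in auto)
  also have "\<dots> = (\<Sum>k\<in>I. (\<Sum>l\<in>I. d l * M l k) * C k i)"
    unfolding sum_distrib_left sum_distrib_right by (subst sum.swap) (simp add: mult_ac)
  also have "\<dots> = 0" using z by simp
  finally show ?thesis .
qed

text \<open>A relation is rewritten in products of the e_r, which do not depend on t, and then read
  at t = 1, where the Hall--Littlewood functions are the monomial ones and coefficients are visible.
  Invertibility of the matrices at 1 and at t gives the rest.\<close>

lemma HL_independent:
  assumes z: "\<And>a. (\<Sum>\<rho>\<in>Par n. c \<rho> * hall_littlewood \<rho> t a) = 0" and \<rho>: "\<rho> \<in> Par n"
  shows "c \<rho> = 0"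
proof -
  let ?P = "Par n"
  obtain C where C: "\<forall>i\<in>?P. \<forall>j\<in>?P. (\<Sum>k\<in>?P. C i k * BB t (col n k) j) = (if i = j then 1 else 0)"
    using BB_inverse by blast
  obtain D where D: "\<forall>i\<in>?P. \<forall>j\<in>?P. (\<Sum>k\<in>?P. BB 1 (col n i) k * D k j) = (if i = j then 1 else (0::real))"
    using BB_inverse by blast
  define d where "d l = (\<Sum>\<rho>\<in>?P. c \<rho> * C \<rho> l)" for l
  have "(\<Sum>l\<in>?P. d l * eprod (col n l) a) = 0" for a
  proof -
    have "0 = (\<Sum>\<rho>\<in>?P. c \<rho> * (\<Sum>l\<in>?P. C \<rho> l * eprod (col n l) a))"
      using z[of a] hall_littlewood_e[OF _ C] by simp
    also have "\<dots> = (\<Sum>l\<in>?P. d l * eprod (col n l) a)"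
      unfolding d_def sum_distrib_left sum_distrib_right by (subst sum.swap) (simp add: mult_ac)
    finally show ?thesis by simp
  qed
  then have d0: "(\<Sum>l\<in>?P. d l * eprod (col n l) a) = 0" for a .
  have "d l = 0" if "l \<in> ?P" for l
  proof (rule left_kernel_zero[OF _ D _ that])
    fix \<mu> assume \<mu>: "\<mu> \<in> ?P"
    have "eprod (col n l) (mon \<mu>) = BB 1 (col n l) \<mu>" if "l \<in> ?P" for l
    proof -
      have "eprod (col n l) (mon \<mu>) = (\<Sum>\<rho>\<in>?P. BB 1 (col n l) \<rho> * msym \<rho> (mon \<mu>))"
        unfolding eprod_HL[OF that, of 1] by (rule sum.cong) (auto simp: Par_def hall_littlewood_1)
      also have "\<dots> = (\<Sum>\<rho>\<in>?P. if \<rho> = \<mu> then BB 1 (col n l) \<rho> else 0)"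
        by (rule sum.cong) (use \<mu> in "auto simp: msym_def Par_def")
      also have "\<dots> = BB 1 (col n l) \<mu>" using \<mu> by (simp add: sum.delta)
      finally show ?thesis .
    qed
    then show "(\<Sum>l\<in>?P. d l * BB 1 (col n l) \<mu>) = 0" using d0[of "mon \<mu>"] by simp
  qed simp
  then have "(\<Sum>\<rho>\<in>?P. c \<rho> * C \<rho> l) = 0" if "l \<in> ?P" for l using that by (simp add: d_def)
  then show ?thesis
    using left_kernel_zero[where M = C and C = "\<lambda>k j. BB t (col n k) j" and I = ?P and d = c and i = \<rho>] C \<rho> by simp
qed

text \<open>Schur functions expand in monomial ones, these in products of the e_r by the inverse
  matrix at t = 1, and those in P_rho(t) by \<open>BB\<close>. Only the last step involves t, and it
  does so polynomially. Uniqueness is linear independence at each t.\<close>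

theorem schur_HL:
  assumes \<nu>: "is_partition \<nu>"
  shows "schur \<nu> a = (\<Sum>\<rho>\<in>Par (sum_list \<nu>). poly (kostka_foulkes \<nu> \<rho>) t * hall_littlewood \<rho> t a)"
proof -
  define n where "n = sum_list \<nu>"
  let ?P = "Par n"
  obtain C where C: "\<forall>i\<in>?P. \<forall>j\<in>?P. (\<Sum>k\<in>?P. C i k * BB 1 (col n k) j) = (if i = j then 1 else (0::real))"
    using BB_inverse by blast
  define K where "K \<rho> = (if \<rho> \<in> ?P then \<Sum>\<mu>\<in>?P. \<Sum>l\<in>?P. smult (schur \<nu> (mon \<mu>) * C \<mu> l) (BB [:0, 1:] (col n l) \<rho>) else 0)" for \<rho>
  have K: "schur \<nu> a = (\<Sum>\<rho>\<in>?P. poly (K \<rho>) t * hall_littlewood \<rho> t a)" for t a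
  proof -
    have "schur \<nu> a = (\<Sum>\<mu>\<in>?P. schur \<nu> (mon \<mu>) * msym \<mu> a)"
      by (rule Sym_msym_expand[OF schur_Sym[OF \<nu>]]) (simp add: n_def schur_degree[OF \<nu>])
    also have "\<dots> = (\<Sum>\<mu>\<in>?P. schur \<nu> (mon \<mu>) * (\<Sum>l\<in>?P. C \<mu> l * eprod (col n l) a))"
    proof (rule sum_cong)
      fix \<mu> assume \<mu>: "\<mu> \<in> ?P"
      then have "msym \<mu> = hall_littlewood \<mu> 1" by (simp add: Par_def hall_littlewood_1)
      then show "schur \<nu> (mon \<mu>) * msym \<mu> a = schur \<nu> (mon \<mu>) * (\<Sum>l\<in>?P. C \<mu> l * eprod (col n l) a)"
        unfolding hall_littlewood_e[OF \<mu> C] by simp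
    qed
    also have "\<dots> = (\<Sum>\<mu>\<in>?P. schur \<nu> (mon \<mu>) * (\<Sum>l\<in>?P. C \<mu> l * (\<Sum>\<rho>\<in>?P. BB t (col n l) \<rho> * hall_littlewood \<rho> t a)))"
      by (intro sum.cong refl arg_cong[where f = "(*) _"]) (simp add: eprod_HL[where t = t])
    also have "\<dots> = (\<Sum>\<rho>\<in>?P. \<Sum>\<mu>\<in>?P. \<Sum>l\<in>?P. schur \<nu> (mon \<mu>) * C \<mu> l * BB t (col n l) \<rho> * hall_littlewood \<rho> t a)"
      unfolding sum_distrib_left by (subst (2) sum.swap, subst sum.swap) (simp add: mult_ac)
    also have "\<dots> = (\<Sum>\<rho>\<in>?P. poly (K \<rho>) t * hall_littlewood \<rho> t a)"
      by (rule sum.cong) (simp_all add: K_def poly_sum poly_BB sum_distrib_right)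
    finally show ?thesis .
  qed
  have "kostka_foulkes \<nu> = K"
    unfolding kostka_foulkes_def n_def[symmetric]
  proof (rule the_equality)
    show "(\<forall>\<rho>. \<rho> \<notin> ?P \<longrightarrow> K \<rho> = 0) \<and> (\<forall>t a. schur \<nu> a = (\<Sum>\<rho>\<in>?P. poly (K \<rho>) t * hall_littlewood \<rho> t a))"
      using K by (simp add: K_def)
    fix K' assume K': "(\<forall>\<rho>. \<rho> \<notin> ?P \<longrightarrow> K' \<rho> = 0) \<and> (\<forall>t a. schur \<nu> a = (\<Sum>\<rho>\<in>?P. poly (K' \<rho>) t * hall_littlewood \<rho> t a))"
    show "K' = K"
    proof
      fix \<rho> show "K' \<rho> = K \<rho>"
      proof (cases "\<rho> \<in> ?P")
        case True
        have "poly (K' \<rho>) t = poly (K \<rho>) t" for t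
        proof -
          have "poly (K' \<rho>) t - poly (K \<rho>) t = 0"
            by (rule HL_independent[where t = t and n = n, OF _ True]) (use K K' in "simp add: left_diff_distrib sum_subtractf")
          then show ?thesis by simp
        qed
        then show ?thesis by (simp add: poly_eq_poly_eq_iff[symmetric] fun_eq_iff)
      qed (use K' K_def in auto)
    qed
  qed
  then show ?thesis using K n_def by simp
qed

section \<open>Submodule counts and Hall--Littlewood functions\<close>

text \<open>Up to the normalization by \<open>t\<^bsup>n(\<rho>)\<^esup>\<close>, this is \<^const>\<open>ET\<close> at \<open>t = 1 / Q\<close>.\<close>

definition EQ :: "real \<Rightarrow> nat \<Rightarrow> (nat list \<Rightarrow> real) \<Rightarrow> nat list \<Rightarrow> real" where
  "EQ Q r f \<rho> = (\<Sum>S\<in>subs r {..<length \<rho>}. Q ^ (\<Sum>S) * f (lower \<rho> S))"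

lemma double_sum_symmetric:
  fixes h :: "nat \<Rightarrow> nat \<Rightarrow> nat"
  assumes "\<And>i j. h i j = h j i"
  shows "(\<Sum>i<N. \<Sum>j<N. h i j) = 2 * (\<Sum>j<N. \<Sum>i<j. h i j) + (\<Sum>i<N. h i i)"
proof (induction N)
  case (Suc N)
  have "(\<Sum>i<N. h i N) = (\<Sum>i<N. h N i)" using assms by simp
  then show ?case using Suc by (simp add: sum.distrib)
qed simp

text \<open>On a partition this is 2 n(rho) + |rho|; being invariant under permutations, it gives
  access to n for a lowered sequence that is not sorted.\<close>

definition min_sum :: "nat \<Rightarrow> (nat \<Rightarrow> nat) \<Rightarrow> nat" where
  "min_sum N a = (\<Sum>i<N. \<Sum>j<N. min (a i) (a j))"

lemma min_sum_permutes: assumes "\<pi> permutes {..<N}" shows "min_sum N (a \<circ> \<pi>) = min_sum N a"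
proof -
  have "min_sum N (a \<circ> \<pi>) = (\<Sum>i<N. \<Sum>j<N. min (a (\<pi> i)) (a j))"
    unfolding min_sum_def comp_def
    by (rule sum_cong) (rule sum.reindex_bij_betw[OF permutes_imp_bij[OF assms]])
  also have "\<dots> = min_sum N a"
    unfolding min_sum_def
    by (rule sum.reindex_bij_betw[OF permutes_imp_bij[OF assms], where g = "\<lambda>i. \<Sum>j<N. min (a i) (a j)"])
  finally show ?thesis .
qed

lemma n_stat_part:
  assumes "length \<rho> \<le> N" shows "n_stat \<rho> = (\<Sum>j<N. j * part \<rho> j)"
proof -
  have "n_stat \<rho> = (\<Sum>j<length \<rho>. j * part \<rho> j)" by (simp add: n_stat_def part_def)
  also have "\<dots> = (\<Sum>j<N. j * part \<rho> j)" by (rule sum.mono_neutral_left) (use assms in "auto simp: part_def")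
  finally show ?thesis .
qed

lemma min_sum_part:
  assumes "is_partition \<rho>" "length \<rho> \<le> N"
  shows "min_sum N (part \<rho>) = 2 * n_stat \<rho> + sum_list \<rho>"
proof -
  have "(\<Sum>j<N. \<Sum>i<j. min (part \<rho> i) (part \<rho> j)) = (\<Sum>j<N. \<Sum>i<j. part \<rho> j)"
    by (intro sum.cong refl) (use part_desc[OF assms(1)] in "auto simp: min_def intro: antisym")
  then show ?thesis
    unfolding min_sum_def by (subst double_sum_symmetric) (auto simp: min.commute n_stat_part[OF assms(2)] sum_part[OF assms(2)])
qed

text \<open>For i < j the minimum of rows i and j drops by one if j is lowered, and also if only i
  is lowered and the rows are equal. The first kind contributes j for each j in \<open>S\<close>,
  the second \<open>inv_stat\<close>.\<close>

lemma n_stat_lower: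
  assumes \<rho>: "is_partition \<rho>" and S: "S \<in> subs r {..<length \<rho>}"
  shows "n_stat \<rho> = n_stat (lower \<rho> S) + inv_stat \<rho> S + \<Sum>S"
proof -
  define N where "N = length \<rho>"
  define b where "b i = part \<rho> i - ind S i" for i
  have SN: "S \<subseteq> {..<N}" "card S = r" using S by (auto simp: subs_def N_def)
  have b0: "\<forall>i\<ge>N. b i = 0" by (simp add: b_def N_def part_def)
  have shpb: "shp b = lower \<rho> S" by (simp add: lower_def b_def[abs_def])
  have len: "length (lower \<rho> S) \<le> N"
  proof -
    have "{i. b i \<noteq> 0} \<subseteq> {..<N}" using b0 by (metis supp_subset)
    then show ?thesis unfolding shpb[symmetric] card_supp_shp using card_mono[of "{..<N}"] by fastforce
  qed
  have "shp b = shp (part (lower \<rho> S))" by (simp add: shpb shp_part)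
  moreover have "\<forall>i\<ge>N. part (lower \<rho> S) i = 0" using len by (simp add: part_def)
  ultimately obtain \<pi> where \<pi>: "\<pi> permutes {..<N}" "b = part (lower \<rho> S) \<circ> \<pi>" using shp_eq_permutes b0 by blast
  have Gb: "min_sum N b = 2 * n_stat (lower \<rho> S) + sum_list (lower \<rho> S)"
    using min_sum_permutes[OF \<pi>(1)] min_sum_part[OF is_partition_lower len] \<pi>(2) by metis
  have G\<rho>: "min_sum N (part \<rho>) = 2 * n_stat \<rho> + sum_list \<rho>" by (rule min_sum_part[OF \<rho>]) (simp add: N_def)
  have pos: "1 \<le> part \<rho> i" if "i \<in> S" for i using part_pos[OF \<rho>, of i] SN that by (auto simp: N_def)
  have pair: "min (part \<rho> i) (part \<rho> j) = min (b i) (b j) + ind S j + (if i \<in> S \<and> j \<notin> S \<and> part \<rho> i = part \<rho> j then 1 else 0)"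
    if "i < j" for i j
    using part_desc[OF \<rho>, of i j] that pos[of i] pos[of j] unfolding b_def ind_def
    by (cases "i \<in> S"; cases "j \<in> S"; cases "part \<rho> i = part \<rho> j"; simp add: min_def; arith)
  have "(\<Sum>j<N. \<Sum>i<j. min (part \<rho> i) (part \<rho> j)) = (\<Sum>j<N. \<Sum>i<j. min (b i) (b j)) + (\<Sum>j<N. \<Sum>i<j. ind S j)
     + (\<Sum>j<N. \<Sum>i<j. (if i \<in> S \<and> j \<notin> S \<and> part \<rho> i = part \<rho> j then 1 else 0))"
    unfolding sum.distrib[symmetric] by (intro sum.cong refl) (use pair in auto)
  also have "(\<Sum>j<N. \<Sum>i<j. ind S j) = \<Sum>S"
  proof -
    have "(\<Sum>j<N. \<Sum>i<j. ind S j) = (\<Sum>j<N. if j \<in> S then j else 0)"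
      by (rule sum.cong) (auto simp: ind_def)
    also have "\<dots> = (\<Sum>j\<in>S. j)" by (rule sum.mono_neutral_cong_right) (use SN in auto)
    finally show ?thesis by simp
  qed
  also have "(\<Sum>j<N. \<Sum>i<j. (if i \<in> S \<and> j \<notin> S \<and> part \<rho> i = part \<rho> j then 1 else 0)) = inv_stat \<rho> S"
  proof -
    have "(\<Sum>j<N. \<Sum>i<j. (if i \<in> S \<and> j \<notin> S \<and> part \<rho> i = part \<rho> j then 1 else (0::nat)))
        = (\<Sum>p\<in>Sigma {..<N} (\<lambda>j. {..<j}). if snd p \<in> S \<and> fst p \<notin> S \<and> part \<rho> (snd p) = part \<rho> (fst p) then 1 else 0)"
      by (subst sum.Sigma) (auto simp: case_prod_beta)
    also have "\<dots> = card {p \<in> Sigma {..<N} (\<lambda>j. {..<j}). snd p \<in> S \<and> fst p \<notin> S \<and> part \<rho> (snd p) = part \<rho> (fst p)}"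
      by (subst sum.inter_filter[symmetric]) simp_all
    also have "\<dots> = inv_stat \<rho> S"
      unfolding inv_stat_def
      by (rule bij_betw_same_card[of prod.swap], rule bij_betw_byWitness[where f' = prod.swap])
        (use SN in "auto simp: N_def")
    finally show ?thesis .
  qed
  finally have P: "(\<Sum>j<N. \<Sum>i<j. min (part \<rho> i) (part \<rho> j)) = (\<Sum>j<N. \<Sum>i<j. min (b i) (b j)) + \<Sum>S + inv_stat \<rho> S" .
  have "min_sum N (part \<rho>) = 2 * (\<Sum>j<N. \<Sum>i<j. min (part \<rho> i) (part \<rho> j)) + sum_list \<rho>"
    unfolding min_sum_def by (subst double_sum_symmetric) (auto simp: min.commute sum_part N_def)
  moreover have "min_sum N b = 2 * (\<Sum>j<N. \<Sum>i<j. min (b i) (b j)) + sum_list (lower \<rho> S)"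
    unfolding min_sum_def using sum_list_shp[OF b0] by (subst double_sum_symmetric) (auto simp: min.commute shpb)
  ultimately show ?thesis using P Gb G\<rho> by linarith
qed

text \<open>By \<open>n_stat_lower\<close> the power of Q cancels against the same power of t; the
  normalization by t^n(rho) is what turns submodule counts into Pieri coefficients.\<close>

lemma EQ_ET:
  assumes "Q > 0" "t = 1 / Q" "is_partition \<rho>"
  shows "t ^ n_stat \<rho> * EQ Q r f \<rho> = ET t r (\<lambda>\<sigma>. t ^ n_stat \<sigma> * f \<sigma>) \<rho>"
  unfolding EQ_def ET_def sum_distrib_left
proof (rule sum_cong)
  fix S assume S: "S \<in> subs r {..<length \<rho>}"
  have "t ^ n_stat \<rho> * Q ^ (\<Sum>S) = t ^ n_stat (lower \<rho> S) * t ^ inv_stat \<rho> S * (t * Q) ^ (\<Sum>S)"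
    by (simp add: n_stat_lower[OF assms(3) S] power_add power_mult_distrib)
  then show "t ^ n_stat \<rho> * (Q ^ (\<Sum>S) * f (lower \<rho> S)) = t ^ inv_stat \<rho> S * (t ^ n_stat (lower \<rho> S) * f (lower \<rho> S))"
    using assms by (simp add: mult_ac)
qed

text \<open>The operator of summation over submodules of colength \<open>m\<close>, obtained from those over submodules
  with elementary quotient by Moebius inversion.\<close>

function AH :: "real \<Rightarrow> (nat list \<Rightarrow> real) \<Rightarrow> nat \<Rightarrow> nat list \<Rightarrow> real" where
  "AH Q f m = (\<lambda>\<rho>. if m = 0 then f \<rho> else (\<Sum>r\<in>{1..m}. (-1) ^ (r + 1) * EQ Q r (AH Q f (m - r)) \<rho>))"
  by auto
termination by (relation "measure (\<lambda>(Q, f, m). m)") auto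

declare AH.simps [simp del]

text \<open>The pairing of f with the normalized functions t^n(rho) P_rho; it converts
  \<open>EQ\<close> into multiplication by e_r and \<open>AH\<close> into multiplication by
  h_m.\<close>

definition theta :: "(nat \<Rightarrow> real) \<Rightarrow> real \<Rightarrow> nat \<Rightarrow> nat \<Rightarrow> (nat list \<Rightarrow> real) \<Rightarrow> real" where
  "theta x t N m f = (\<Sum>\<rho>\<in>Par m. hlp x t N \<rho> * (t ^ n_stat \<rho> * f \<rho>))"

lemma theta_EQ:
  assumes "inj_on x {..<N}" "Q > 1" "t = 1 / Q"
  shows "theta x t N (m + r) (EQ Q r f) = es x {..<N} r * theta x t N m f"
proof -
  have t: "0 < t" "t \<noteq> 1" using assms by auto
  have "theta x t N (m + r) (EQ Q r f) = (\<Sum>\<rho>\<in>Par (m + r). hlp x t N \<rho> * ET t r (\<lambda>\<sigma>. t ^ n_stat \<sigma> * f \<sigma>) \<rho>)"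
    unfolding theta_def by (rule sum.cong) (use EQ_ET assms in "auto simp: Par_def")
  then show ?thesis using pieri_hlp[OF assms(1) t] by (simp add: theta_def)
qed

lemma geometric_fps: "(1 - fps_const c * fps_X) * Abs_fps (\<lambda>k. c ^ k) = (1 :: real fps)"
proof (rule fps_ext)
  fix n show "fps_nth ((1 - fps_const c * fps_X) * Abs_fps (\<lambda>k. c ^ k)) n = fps_nth 1 n"
    by (cases n) (simp_all add: left_diff_distrib mult.assoc)
qed

text \<open>E(-z) H(z) = 1: a new variable x multiplies the first series by 1 - x z and the second
  by the geometric series in x z.\<close>

lemma eh_identity:
  assumes "m > 0" shows "(\<Sum>r\<le>m. (-1) ^ r * es x {..<N} r * hN x N (m - r)) = 0"
proof -
  let ?E = "\<lambda>N. Abs_fps (\<lambda>r. (-1) ^ r * es x {..<N::nat} r)" and ?H = "\<lambda>N. Abs_fps (hN x N)"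
  have "?E N * ?H N = 1"
  proof (induction N)
    case 0
    have "es x {} r = (if r = 0 then 1 else 0)" for r by (cases r) (simp_all add: es_def)
    then show ?case by (intro fps_ext) (auto simp: fps_mult_nth intro!: sum.neutral)
  next
    case (Suc N)
    have E: "?E (Suc N) = ?E N * (1 - fps_const (x N) * fps_X)"
    proof (rule fps_ext)
      fix r show "fps_nth (?E (Suc N)) r = fps_nth (?E N * (1 - fps_const (x N) * fps_X)) r"
      proof (cases r)
        case (Suc s)
        have "fps_nth (?E N * (1 - fps_const (x N) * fps_X)) (Suc s) = (-1) ^ Suc s * es x {..<N} (Suc s) - x N * ((-1) ^ s * es x {..<N} s)"
          by (simp add: right_diff_distrib mult.assoc[symmetric])
        then show ?thesis using Suc by (simp add: lessThan_Suc es_insert algebra_simps)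
      qed simp
    qed
    have H: "?H (Suc N) = Abs_fps (\<lambda>k. x N ^ k) * ?H N"
      by (rule fps_ext) (simp add: fps_mult_nth atLeast0AtMost)
    have "?E (Suc N) * ?H (Suc N) = (?E N * ?H N) * ((1 - fps_const (x N) * fps_X) * Abs_fps (\<lambda>k. x N ^ k))"
      unfolding E H by (simp only: mult_ac)
    also have "\<dots> = 1" by (simp only: Suc.IH geometric_fps mult_1_right)
    finally show ?case .
  qed
  then have "fps_nth (?E N * ?H N) m = 0" using assms by simp
  then show ?thesis by (simp add: fps_mult_nth atLeast0AtMost)
qed

lemma theta_AH:
  assumes x: "inj_on x {..<N}" and Q: "Q > 1" "t = 1 / Q"
  shows "theta x t N (s + m) (AH Q f m) = hN x N m * theta x t N s f"
proof (induction m rule: less_induct)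
  case (less m)
  have h0: "hN x N 0 = 1" by (induction N) simp_all
  show ?case
  proof (cases "m = 0")
    case True then show ?thesis by (simp add: AH.simps[of Q f 0] h0)
  next
    case False
    have "theta x t N (s + m) (AH Q f m) = (\<Sum>r\<in>{1..m}. (-1) ^ (r + 1) * theta x t N (s + m) (EQ Q r (AH Q f (m - r))))"
      unfolding theta_def AH.simps[of Q f m] using False
      by (simp add: sum_distrib_left sum.swap[of _ "Par _"] mult_ac)
    also have "\<dots> = (\<Sum>r\<in>{1..m}. (-1) ^ (r + 1) * (es x {..<N} r * (hN x N (m - r) * theta x t N s f)))"
    proof (intro sum.cong refl arg_cong[where f = "(*) _"])
      fix r assume r: "r \<in> {1..m}"
      have "theta x t N (s + (m - r) + r) (EQ Q r (AH Q f (m - r))) = es x {..<N} r * theta x t N (s + (m - r)) (AH Q f (m - r))"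
        by (rule theta_EQ[OF x Q])
      then show "theta x t N (s + m) (EQ Q r (AH Q f (m - r))) = es x {..<N} r * (hN x N (m - r) * theta x t N s f)"
        using r less.IH[of "m - r"] by simp
    qed
    also have "\<dots> = - (\<Sum>r\<in>{1..m}. (-1) ^ r * es x {..<N} r * hN x N (m - r)) * theta x t N s f"
      by (simp add: sum_distrib_left sum_distrib_right sum_negf[symmetric] mult_ac)
    also have "(\<Sum>r\<in>{1..m}. (-1) ^ r * es x {..<N} r * hN x N (m - r)) = - hN x N m"
    proof -
      have "{..m} = insert 0 {1..m}" by auto
      then have "(\<Sum>r\<le>m. (-1) ^ r * es x {..<N} r * hN x N (m - r)) = hN x N m + (\<Sum>r\<in>{1..m}. (-1) ^ r * es x {..<N} r * hN x N (m - r))"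
        by simp
      then show ?thesis using eh_identity[of m x N] False by simp
    qed
    finally show ?thesis by simp
  qed
qed

text \<open>The number of flags with quotients of lengths \<open>c\<close> in a module of type \<open>\<rho>\<close>.\<close>

fun FL :: "real \<Rightarrow> nat list \<Rightarrow> nat list \<Rightarrow> real" where
  "FL Q [] \<rho> = (if \<rho> = [] then 1 else 0)"
| "FL Q (m # c) \<rho> = AH Q (FL Q c) m \<rho>"

lemma theta_FL:
  assumes x: "inj_on x {..<N}" and Q: "Q > 1" "t = 1 / Q"
  shows "theta x t N (sum_list c) (FL Q c) = (\<Prod>m\<leftarrow>c. hN x N m)"
proof (induction c)
  case Nil then show ?case by (simp add: theta_def n_stat_def)
next
  case (Cons m c)
  have "FL Q (m # c) = AH Q (FL Q c) m" by auto
  then show ?case using theta_AH[OF x Q, of "sum_list c" m "FL Q c"] Cons by (simp add: add.commute)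
qed

definition rser :: "nat list \<Rightarrow> real \<Rightarrow> series" where
  "rser \<rho> t a = inverse (t ^ n_stat \<rho>) * (\<Sum>\<nu>\<in>Par (sum_list \<rho>). poly (kostka_foulkes \<nu> \<rho>) t * schur \<nu> a)"

lemma rser_Sym: "rser \<rho> t \<in> Sym"
  unfolding rser_def by (intro Sym_scale Sym_sum) (simp add: Par_def schur_Sym)

theorem FL_rser:
  assumes Q: "Q > 1" "t = 1 / Q" and \<rho>: "is_partition \<rho>" "sum_list c = sum_list \<rho>"
  shows "FL Q c \<rho> = rser \<rho> t (mon c)"
proof -
  let ?n = "sum_list c" let ?P = "Par (sum_list c)"
  let ?A = "\<lambda>a. \<Sum>\<rho>\<in>?P. (t ^ n_stat \<rho> * FL Q c \<rho>) * hall_littlewood \<rho> t a"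
  let ?B = "\<lambda>a. \<Sum>\<nu>\<in>?P. schur \<nu> (mon c) * schur \<nu> a"
  have SA: "?A \<in> Sym" by (rule HL_sum_Sym)
  have SB: "?B \<in> Sym" by (intro Sym_sum Sym_scale) (simp add: Par_def schur_Sym)
  have "?A = ?B"
  proof (rule eval_vars_inj[OF SA SB])
    fix N and x :: "nat \<Rightarrow> real" assume x: "inj_on x {..<N}"
    have "eval_vars N ?A x = theta x t N ?n (FL Q c)"
      unfolding eval_HL_sum[OF x] theta_def by (simp add: mult_ac)
    also have "\<dots> = (\<Prod>m\<leftarrow>c. hN x N m)" by (rule theta_FL[OF x Q])
    also have "\<dots> = (\<Sum>\<nu>\<in>?P. schur \<nu> (mon c) * eval_vars N (schur \<nu>) x)" by (rule cauchy_schur[symmetric])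
    also have "\<dots> = eval_vars N ?B x"
      by (rule eval_vars_linear[symmetric]) (auto simp: Par_def schur_Sym simp del: finite_partitions_of intro: finite_partitions_of[unfolded Par_def])
    finally show "eval_vars N ?A x = eval_vars N ?B x" .
  qed
  moreover have "?B a = (\<Sum>\<rho>\<in>?P. (\<Sum>\<nu>\<in>?P. schur \<nu> (mon c) * poly (kostka_foulkes \<nu> \<rho>) t) * hall_littlewood \<rho> t a)" for a
  proof -
    have "?B a = (\<Sum>\<nu>\<in>?P. schur \<nu> (mon c) * (\<Sum>\<rho>\<in>?P. poly (kostka_foulkes \<nu> \<rho>) t * hall_littlewood \<rho> t a))"
    proof (intro sum.cong refl arg_cong[where f = "(*) _"])
      fix \<nu> assume "\<nu> \<in> ?P"
      then show "schur \<nu> a = (\<Sum>\<rho>\<in>?P. poly (kostka_foulkes \<nu> \<rho>) t * hall_littlewood \<rho> t a)"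
        using schur_HL[of \<nu> a t] by (simp add: Par_def)
    qed
    also have "\<dots> = (\<Sum>\<rho>\<in>?P. \<Sum>\<nu>\<in>?P. schur \<nu> (mon c) * (poly (kostka_foulkes \<nu> \<rho>) t * hall_littlewood \<rho> t a))"
      unfolding sum_distrib_left by (rule sum.swap)
    finally show ?thesis by (simp add: sum_distrib_right mult.assoc)
  qed
  ultimately have eq: "?A a = (\<Sum>\<rho>\<in>?P. (\<Sum>\<nu>\<in>?P. schur \<nu> (mon c) * poly (kostka_foulkes \<nu> \<rho>) t) * hall_littlewood \<rho> t a)" for a
    by metis
  have "t ^ n_stat \<rho> * FL Q c \<rho> - (\<Sum>\<nu>\<in>?P. schur \<nu> (mon c) * poly (kostka_foulkes \<nu> \<rho>) t) = 0"
    by (rule HL_independent[where t = t and n = ?n])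
      (use eq \<rho> in "auto simp: left_diff_distrib sum_subtractf Par_def simp del: finite_partitions_of")
  moreover have "t ^ n_stat \<rho> \<noteq> 0" using Q by simp
  ultimately show ?thesis using \<rho> by (simp add: rser_def field_simps)
qed

section \<open>Power sums and specializations\<close>

lemma length_shape: "length (shape a) = card {i. lookup a i \<noteq> 0}"
  by (simp only: shape_def card_supp_shp)

lemma mset_shape: "mset (shape a) = image_mset (lookup a) (mset_set {i. lookup a i \<noteq> 0})"
  by (simp only: shape_def mset_shp)

lemma finite_lookup: "finite {i. lookup (a :: monomial) i \<noteq> 0}"
  by simp

lemma mset_shape_add_single:
  assumes "lookup c i = 0" "r \<noteq> 0"
  shows "mset (shape (single i r + c)) = add_mset r (mset (shape c))"
proof -
  have l: "lookup (single i r + c) j = (if j = i then r else lookup c j)" for j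
    using assms by (simp add: lookup_add lookup_single when_def)
  have s: "{j. lookup (single i r + c) j \<noteq> 0} = insert i {j. lookup c j \<noteq> 0}"
    unfolding l using assms by auto
  have "image_mset (lookup (single i r + c)) (mset_set {j. lookup c j \<noteq> 0})
      = image_mset (lookup c) (mset_set {j. lookup c j \<noteq> 0})"
    by (rule image_mset_cong) (use assms l in auto)
  then show ?thesis unfolding mset_shape s using assms l[of i] finite_lookup[of c] by simp
qed

lemma length_shape_add_single:
  assumes "lookup c i \<noteq> 0"
  shows "length (shape (single i r + c)) = length (shape c)"
proof -
  have "{j. lookup (single i r + c) j \<noteq> 0} = {j. lookup c j \<noteq> 0}"
    using assms by (auto simp: lookup_add lookup_single when_def)
  then show ?thesis by (simp only: length_shape)
qed

lemma shape_0 [simp]: "shape 0 = []"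
  by (simp add: shape_def shp_def)

lemma power_sum_msym: assumes "m \<ge> 1" shows "power_sum m = msym [m]"
proof
  fix a
  have "(\<exists>i. a = single i m) \<longleftrightarrow> shape a = [m]"
  proof
    assume "\<exists>i. a = single i m"
    then obtain i where a: "a = single i m + 0" by auto
    have "mset (shape a) = add_mset m (mset (shape 0))"
      unfolding a by (rule mset_shape_add_single) (use assms in auto)
    then show "shape a = [m]" by simp
  next
    assume s: "shape a = [m]"
    have "card {i. lookup a i \<noteq> 0} = 1" using s length_shape[of a] by simp
    then obtain i where i: "{i. lookup a i \<noteq> 0} = {i}" using card_1_singletonE by blast
    have "{#lookup a i#} = {#m#}" using mset_shape[of a] unfolding i s by simp
    then have "a = single i m"
      using i by (intro poly_mapping_eqI) (auto simp: lookup_single when_def)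
    then show "\<exists>i. a = single i m" ..
  qed
  then show "power_sum m a = msym [m] a" by (simp add: power_sum_def msym_def)
qed

lemma power_sum_Sym: "m \<ge> 1 \<Longrightarrow> power_sum m \<in> Sym"
  by (simp add: power_sum_msym)

fun pprod :: "nat list \<Rightarrow> series" where
  "pprod [] = series_one"
| "pprod (r # l) = series_mult (power_sum r) (pprod l)"

lemma pprod_Sym: "0 \<notin> set l \<Longrightarrow> pprod l \<in> Sym"
  by (induction l) (auto intro!: series_mult_Sym power_sum_Sym)

lemma series_mult_nonneg: "(\<And>a. u a \<ge> 0) \<Longrightarrow> (\<And>a. v a \<ge> 0) \<Longrightarrow> series_mult u v a \<ge> 0"
  unfolding series_mult_def by (rule sum_nonneg) auto

lemma pprod_nonneg: "pprod l a \<ge> 0"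
  by (induction l arbitrary: a) (auto simp: series_one_def power_sum_def intro!: series_mult_nonneg)

lemma pprod_Cons_nonzero:
  assumes "pprod (r # l) a \<noteq> 0"
  obtains i c where "a = single i r + c" "pprod l c \<noteq> 0"
proof -
  have "series_mult (power_sum r) (pprod l) a \<noteq> 0" using assms by simp
  from series_mult_nonzero[OF this] obtain b c where "b + c = a" "power_sum r b \<noteq> 0" "pprod l c \<noteq> 0" by blast
  moreover then obtain i where "b = single i r" by (auto simp: power_sum_def split: if_splits)
  ultimately show thesis using that by blast
qed

lemma pprod_degree: "pprod l a \<noteq> 0 \<Longrightarrow> mdeg a = sum_list l"
proof (induction l arbitrary: a)
  case Nil then show ?case by (auto simp: series_one_def mono_degree_def split: if_splits)
next
  case (Cons r l)
  obtain i c where a: "a = single i r + c" "pprod l c \<noteq> 0" using pprod_Cons_nonzero[OF Cons.prems] .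
  have "mdeg (single i r) = r" by (cases "r = 0") (auto simp: mono_degree_def)
  then show ?case using Cons.IH[OF a(2)] a(1) by (simp add: mono_degree_add)
qed

text \<open>A factor p_r either brings in a new variable, and with it a part r, or raises the
  exponent of a variable already present, which keeps the number of parts. This makes the passage
  from power sums to monomial functions triangular by length.\<close>

lemma pprod_length:
  "pprod l a \<noteq> 0 \<Longrightarrow> 0 \<notin> set l \<Longrightarrow> length (shape a) \<le> length l \<and> (length (shape a) = length l \<longrightarrow> mset (shape a) = mset l)"
proof (induction l arbitrary: a)
  case Nil then show ?case by (auto simp: series_one_def split: if_splits)
next
  case (Cons r l)
  obtain i c where a: "a = single i r + c" "pprod l c \<noteq> 0" using pprod_Cons_nonzero[OF Cons.prems(1)] .
  have IH: "length (shape c) \<le> length l" "length (shape c) = length l \<longrightarrow> mset (shape c) = mset l"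
    using Cons.IH[OF a(2)] Cons.prems by auto
  show ?case
  proof (cases "lookup c i = 0")
    case True
    have m: "mset (shape a) = add_mset r (mset (shape c))"
      unfolding a(1) by (rule mset_shape_add_single[OF True]) (use Cons.prems in auto)
    then have "length (shape a) = Suc (length (shape c))" by (metis size_add_mset size_mset)
    then show ?thesis using IH m by auto
  next
    case False
    then show ?thesis using length_shape_add_single[OF False, of r] IH a(1) by auto
  qed
qed

lemma pprod_positive: "mset (shape a) = mset l \<Longrightarrow> 0 \<notin> set l \<Longrightarrow> pprod l a > 0"
proof (induction l arbitrary: a)
  case Nil
  then have "shape a = []" by simp
  then have "{i. lookup a i \<noteq> 0} = {}" using length_shape[of a] finite_lookup[of a] by simp
  then have "a = 0" by (intro poly_mapping_eqI) auto
  then show ?case by (simp add: series_one_def)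
next
  case (Cons r l)
  have "r \<in># mset (shape a)" using Cons.prems by simp
  then obtain i where i: "lookup a i = r" unfolding mset_shape by auto
  define c where "c = a - single i r"
  have a: "single i r + c = a"
    by (rule poly_mapping_eqI) (use i in "auto simp: c_def lookup_add lookup_minus lookup_single when_def")
  have c0: "lookup c i = 0" using i by (simp add: c_def lookup_minus)
  have "add_mset r (mset (shape c)) = add_mset r (mset l)"
    using mset_shape_add_single[OF c0, of r] Cons.prems a by simp
  then have pos: "pprod l c > 0" using Cons by simp
  have "0 < power_sum r (single i r) * pprod l c" using pos by (auto simp: power_sum_def)
  also have "\<dots> \<le> series_mult (power_sum r) (pprod l) a"
    unfolding series_mult_def
    using member_le_sum[of "(single i r, c)" "{(a', b). a' + b = a}" "\<lambda>(a, b). power_sum r a * pprod l b"]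
      a pprod_nonneg by (force simp: power_sum_def)
  finally show ?case by simp
qed

lemma pprod_inverse:
  "\<exists>C. (\<forall>i\<in>Par n. \<forall>j\<in>Par n. (\<Sum>k\<in>Par n. C i k * pprod k (mon j)) = (if i = j then 1 else 0)) \<and>
       (\<forall>i\<in>Par n. \<forall>j\<in>Par n. (\<Sum>k\<in>Par n. pprod i (mon k) * C k j) = (if i = j then 1 else 0))"
proof (rule triangular_inverse[where rank = "\<lambda>\<mu>. n - length \<mu>"])
  fix \<mu> assume "\<mu> \<in> Par n"
  then show "pprod \<mu> (mon \<mu>) \<noteq> 0"
    using pprod_positive[of "mon \<mu>" \<mu>] by (auto simp: Par_def is_partition_def)
next
  fix \<mu> \<nu> assume a: "\<mu> \<in> Par n" "\<nu> \<in> Par n" "pprod \<mu> (mon \<nu>) \<noteq> 0" "\<mu> \<noteq> \<nu>"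
  then have p: "is_partition \<mu>" "is_partition \<nu>" "0 \<notin> set \<mu>" "sum_list \<mu> = n" by (auto simp: Par_def is_partition_def)
  have "length \<nu> \<le> length \<mu>" "length \<nu> = length \<mu> \<longrightarrow> mset \<nu> = mset \<mu>"
    using pprod_length[OF a(3) p(3)] shape_mon[OF p(2)] by auto
  moreover have "mset \<nu> \<noteq> mset \<mu>" using partition_eqI_mset[OF p(2,1)] a(4) by auto
  moreover have "length \<mu> \<le> n" using length_le_sum_list[OF p(3)] p(4) by simp
  ultimately show "n - length \<mu> < n - length \<nu>" by linarith
qed simp

definition pinv :: "nat \<Rightarrow> nat list \<Rightarrow> nat list \<Rightarrow> real" where
  "pinv n = (SOME C. (\<forall>i\<in>Par n. \<forall>j\<in>Par n. (\<Sum>k\<in>Par n. C i k * pprod k (mon j)) = (if i = j then 1 else 0)) \<and>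
       (\<forall>i\<in>Par n. \<forall>j\<in>Par n. (\<Sum>k\<in>Par n. pprod i (mon k) * C k j) = (if i = j then 1 else 0)))"

lemma pinv:
  assumes "i \<in> Par n" "j \<in> Par n"
  shows "(\<Sum>k\<in>Par n. pinv n i k * pprod k (mon j)) = (if i = j then 1 else 0)"
    and "(\<Sum>k\<in>Par n. pprod i (mon k) * pinv n k j) = (if i = j then 1 else 0)"
  using someI_ex[OF pprod_inverse[of n], folded pinv_def] assms by blast+

text \<open>The coefficient of p_l in the power sum expansion; it sees only the component of
  \<open>u\<close> of degree \<open>sum_list l\<close>, so inhomogeneous \<open>u\<close> are
  covered.\<close>

definition pc :: "series \<Rightarrow> nat list \<Rightarrow> real" where
  "pc u l = (\<Sum>\<mu>\<in>Par (sum_list l). u (mon \<mu>) * pinv (sum_list l) \<mu> l)"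

definition PD :: "nat \<Rightarrow> nat list set" where "PD D = (\<Union>n\<le>D. Par n)"

lemma PD_iff: "l \<in> PD D \<longleftrightarrow> is_partition l \<and> sum_list l \<le> D"
  by (auto simp: PD_def Par_def)

lemma finite_PD [simp]: "finite (PD D)" by (simp add: PD_def)

lemma pprod_Sym_PD: "l \<in> PD D \<Longrightarrow> pprod l \<in> Sym"
  by (rule pprod_Sym) (simp add: PD_iff is_partition_def)

lemma p_expansion:
  assumes u: "u \<in> Sym" and D: "\<And>a. u a \<noteq> 0 \<Longrightarrow> mdeg a \<le> D"
  shows "u = (\<lambda>a. \<Sum>l\<in>PD D. pc u l * pprod l a)"
proof
  fix a
  define n where "n = mdeg a"
  have sh: "shape a \<in> Par n" by (simp add: n_def shape_in_partitions_of)
  have pa: "pprod l a = pprod l (mon (shape a))" if "l \<in> PD D" for l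
    by (rule SymD[OF pprod_Sym_PD[OF that]]) simp
  show "u a = (\<Sum>l\<in>PD D. pc u l * pprod l a)"
  proof (cases "n \<le> D")
    case True
    have "(\<Sum>l\<in>PD D. pc u l * pprod l a) = (\<Sum>l\<in>Par n. pc u l * pprod l a)"
      by (rule sum.mono_neutral_right) (use True pprod_degree in "auto simp: PD_iff Par_def n_def")
    also have "\<dots> = (\<Sum>l\<in>Par n. \<Sum>\<mu>\<in>Par n. u (mon \<mu>) * (pinv n \<mu> l * pprod l (mon (shape a))))"
      by (rule sum_cong) (use pa True in "auto simp: pc_def Par_def PD_iff sum_distrib_right mult.assoc")
    also have "\<dots> = (\<Sum>\<mu>\<in>Par n. u (mon \<mu>) * (\<Sum>l\<in>Par n. pinv n \<mu> l * pprod l (mon (shape a))))"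
      unfolding sum_distrib_left by (rule sum.swap)
    also have "\<dots> = (\<Sum>\<mu>\<in>Par n. if \<mu> = shape a then u (mon \<mu>) else 0)"
      by (rule sum_cong) (use pinv(1) sh in auto)
    also have "\<dots> = u (mon (shape a))" using sh by (simp add: sum.delta)
    also have "\<dots> = u a" by (rule SymD[OF u]) simp
    finally show ?thesis by simp
  next
    case False
    then have "u a = 0" using D n_def by blast
    moreover have "pprod l a = 0" if "l \<in> PD D" for l
      using pprod_degree[of l a] that False by (auto simp: PD_iff n_def)
    ultimately show ?thesis by simp
  qed
qed

text \<open>The sum is finite because the degrees in \<open>u\<close> are bounded. The value 0
  outside \<open>Sym\<close> is the convention in the definition of
  \<open>specialization\<close>.\<close>

definition specv :: "(nat \<Rightarrow> real) \<Rightarrow> series \<Rightarrow> real" where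
  "specv v u = (if u \<in> Sym then \<Sum>l\<in>{l. is_partition l \<and> pc u l \<noteq> 0}. pc u l * prod_list (map v l) else 0)"

lemma specv_eq:
  assumes u: "u \<in> Sym" and D: "\<And>a. u a \<noteq> 0 \<Longrightarrow> mdeg a \<le> D"
  shows "specv v u = (\<Sum>l\<in>PD D. pc u l * prod_list (map v l))"
proof -
  have "pc u l = 0" if "is_partition l" "\<not> sum_list l \<le> D" for l
    unfolding pc_def
  proof (rule sum.neutral, rule ballI)
    fix \<mu> assume "\<mu> \<in> Par (sum_list l)"
    then have "mdeg (mon \<mu>) = sum_list l" by (auto simp: mono_degree_shape Par_def)
    then have "u (mon \<mu>) = 0" using D[of "mon \<mu>"] that by auto
    then show "u (mon \<mu>) * pinv (sum_list l) \<mu> l = 0" by simp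
  qed
  then have "{l. is_partition l \<and> pc u l \<noteq> 0} \<subseteq> PD D"
    by (simp only: subset_iff mem_Collect_eq PD_iff) blast
  then have "(\<Sum>l\<in>{l. is_partition l \<and> pc u l \<noteq> 0}. pc u l * prod_list (map v l)) = (\<Sum>l\<in>PD D. pc u l * prod_list (map v l))"
    by (intro sum.mono_neutral_left) (auto simp: PD_iff)
  then show ?thesis using u by (simp add: specv_def)
qed

lemma specv_sum:
  assumes fin: "finite I" and u: "\<And>i. i \<in> I \<Longrightarrow> u i \<in> Sym"
  shows "specv v (\<lambda>a. \<Sum>i\<in>I. c i * u i a) = (\<Sum>i\<in>I. c i * specv v (u i))"
proof -
  have "\<forall>i\<in>I. \<exists>D. \<forall>a. u i a \<noteq> 0 \<longrightarrow> mdeg a \<le> D"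
    using u by (simp add: Sym_def)
  from bchoice[OF this] obtain D where D: "\<And>i a. i \<in> I \<Longrightarrow> u i a \<noteq> 0 \<Longrightarrow> mdeg a \<le> D i"
    by blast
  define E where "E = (\<Sum>i\<in>I. D i)"
  have E: "mdeg a \<le> E" if "i \<in> I" "u i a \<noteq> 0" for i a
    using D[OF that] member_le_sum[of i I D] fin that(1) unfolding E_def by simp
  let ?w = "\<lambda>a. \<Sum>i\<in>I. c i * u i a"
  have w: "mdeg a \<le> E" if "?w a \<noteq> 0" for a
  proof -
    obtain i where "i \<in> I" "c i * u i a \<noteq> 0" using \<open>?w a \<noteq> 0\<close> by (meson sum.neutral)
    then show ?thesis using E by auto
  qed
  have wS: "?w \<in> Sym" by (intro Sym_sum Sym_scale u)
  have "pc ?w l = (\<Sum>i\<in>I. c i * pc (u i) l)" for l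
    unfolding pc_def sum_distrib_left sum_distrib_right by (subst sum.swap) (simp add: mult_ac)
  moreover have "specv v ?w = (\<Sum>l\<in>PD E. pc ?w l * prod_list (map v l))"
    by (rule specv_eq[OF wS w])
  ultimately have "specv v ?w = (\<Sum>l\<in>PD E. \<Sum>i\<in>I. c i * (pc (u i) l * prod_list (map v l)))"
    by (simp add: sum_distrib_right mult.assoc)
  also have "\<dots> = (\<Sum>i\<in>I. c i * (\<Sum>l\<in>PD E. pc (u i) l * prod_list (map v l)))"
    unfolding sum_distrib_left by (rule sum.swap)
  also have "\<dots> = (\<Sum>i\<in>I. c i * specv v (u i))"
    by (rule sum_cong) (simp add: specv_eq[OF u E])
  finally show ?thesis .
qed

lemma eval_pprod: "0 \<notin> set l \<Longrightarrow> eval_vars N (pprod l) x = prod_list (map (\<lambda>r. eval_vars N (power_sum r) x) l) * eval_vars N series_one x"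
  by (induction l) (simp_all add: eval_vars_mult power_sum_Sym pprod_Sym Suc_le_eq)

lemma pprod_mset:
  assumes "mset l = mset l'" "0 \<notin> set l" shows "pprod l = pprod l'"
proof (rule eval_vars_inj)
  have l': "0 \<notin> set l'" using assms by (metis mset_eq_setD)
  show "pprod l \<in> Sym" "pprod l' \<in> Sym" using assms l' by (auto intro: pprod_Sym)
  fix N x show "eval_vars N (pprod l) x = eval_vars N (pprod l') x"
  proof -
    have "prod_list (map f l) = prod_list (map f l')" for f :: "nat \<Rightarrow> real"
      using assms(1) by (metis mset_map prod_mset_prod_list)
    then show ?thesis unfolding eval_pprod[OF assms(2)] eval_pprod[OF l'] by simp
  qed
qed

lemma specv_pprod:
  assumes "0 \<notin> set l" shows "specv v (pprod l) = prod_list (map v l)"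
proof -
  define \<mu> where "\<mu> = rev (sort l)"
  have \<mu>: "is_partition \<mu>" "mset \<mu> = mset l" using assms by (auto simp: \<mu>_def is_partition_def sorted_wrt_rev)
  define n where "n = sum_list \<mu>"
  have \<mu>n: "\<mu> \<in> Par n" "0 \<notin> set \<mu>" using \<mu>(1) by (auto simp: n_def Par_def is_partition_def)
  have "specv v (pprod \<mu>) = (\<Sum>k\<in>PD n. pc (pprod \<mu>) k * prod_list (map v k))"
    by (rule specv_eq[OF pprod_Sym[OF \<mu>n(2)]]) (auto simp: n_def dest: pprod_degree)
  also have "\<dots> = (\<Sum>k\<in>PD n. if k = \<mu> then prod_list (map v k) else 0)"
  proof (rule sum_cong)
    fix k assume k: "k \<in> PD n"
    have "pc (pprod \<mu>) k = (if k = \<mu> then 1 else 0)"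
    proof (cases "sum_list k = n")
      case True
      then show ?thesis using pinv(2)[of \<mu> n k] \<mu>n k by (auto simp: pc_def PD_iff Par_def)
    next
      case False
      have "pprod \<mu> (mon \<kappa>) = 0" if "\<kappa> \<in> Par (sum_list k)" for \<kappa>
        using pprod_degree[of \<mu> "mon \<kappa>"] that False by (auto simp: mono_degree_shape Par_def n_def)
      then show ?thesis using False by (auto simp: pc_def n_def)
    qed
    then show "pc (pprod \<mu>) k * prod_list (map v k) = (if k = \<mu> then prod_list (map v k) else 0)" by simp
  qed
  also have "\<dots> = prod_list (map v \<mu>)" using \<mu>n by (simp add: PD_iff Par_def)
  also have "\<dots> = prod_list (map v l)" by (metis \<mu>(2) mset_map prod_mset_prod_list)
  finally show ?thesis using pprod_mset[OF \<mu>(2) \<mu>n(2)] by simp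
qed

text \<open>Concatenating index lists multiplies products of power sums, so the product of the two
  expansions is an expansion of the product; evaluation in finitely many variables certifies
  this.\<close>

lemma specv_mult:
  assumes u: "u \<in> Sym" and w: "w \<in> Sym"
  shows "specv v (series_mult u w) = specv v u * specv v w"
proof -
  obtain D where D: "\<And>a. u a \<noteq> 0 \<Longrightarrow> mdeg a \<le> D" using Sym_bound[OF u] by blast
  obtain E where E: "\<And>a. w a \<noteq> 0 \<Longrightarrow> mdeg a \<le> E" using Sym_bound[OF w] by blast
  let ?I = "PD D \<times> PD E"
  let ?c = "\<lambda>p. pc u (fst p) * pc w (snd p)" and ?p = "\<lambda>p. pprod (fst p @ snd p)"
  have z: "0 \<notin> set l" if "l \<in> PD D" for l D using that by (auto simp: PD_iff is_partition_def)
  have pS: "?p p \<in> Sym" if "p \<in> ?I" for p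
    by (rule pprod_Sym) (use that z in auto)
  have eu: "eval_vars N u x = (\<Sum>l\<in>PD D. pc u l * eval_vars N (pprod l) x)" for N x
    by (subst p_expansion[OF u D]) (simp_all add: eval_vars_linear pprod_Sym_PD)
  have ew: "eval_vars N w x = (\<Sum>l\<in>PD E. pc w l * eval_vars N (pprod l) x)" for N x
    by (subst p_expansion[OF w E]) (simp_all add: eval_vars_linear pprod_Sym_PD)
  have one: "eval_vars N series_one x * eval_vars N series_one x = eval_vars N series_one x" for N x
    by (simp add: eval_series_one)
  have "series_mult u w = (\<lambda>a. \<Sum>p\<in>?I. ?c p * ?p p a)"
  proof (rule eval_vars_inj[OF series_mult_Sym[OF u w]])
    show "(\<lambda>a. \<Sum>p\<in>?I. ?c p * ?p p a) \<in> Sym" by (intro Sym_sum Sym_scale pS)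
    fix N x
    have "eval_vars N (\<lambda>a. \<Sum>p\<in>?I. ?c p * ?p p a) x = (\<Sum>p\<in>?I. ?c p * eval_vars N (?p p) x)"
      by (rule eval_vars_linear) (use pS in auto)
    also have "\<dots> = (\<Sum>p\<in>?I. (pc u (fst p) * eval_vars N (pprod (fst p)) x) * (pc w (snd p) * eval_vars N (pprod (snd p)) x))"
    proof (rule sum_cong)
      fix p assume p: "p \<in> ?I"
      have "eval_vars N (?p p) x = eval_vars N (pprod (fst p)) x * eval_vars N (pprod (snd p)) x"
        using p z[of "fst p" D] z[of "snd p" E] one[of N x] by (auto simp: eval_pprod mult_ac)
      then show "?c p * eval_vars N (?p p) x = (pc u (fst p) * eval_vars N (pprod (fst p)) x) * (pc w (snd p) * eval_vars N (pprod (snd p)) x)"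
        by simp
    qed
    also have "\<dots> = eval_vars N u x * eval_vars N w x"
      unfolding eu ew sum_product by (simp add: sum.cartesian_product case_prod_beta)
    finally show "eval_vars N (series_mult u w) x = eval_vars N (\<lambda>a. \<Sum>p\<in>?I. ?c p * ?p p a) x"
      by (simp add: eval_vars_mult[OF u w])
  qed
  then have "specv v (series_mult u w) = (\<Sum>p\<in>?I. ?c p * specv v (?p p))"
    using specv_sum[of ?I ?p v ?c] pS by simp
  also have "\<dots> = (\<Sum>p\<in>?I. (pc u (fst p) * prod_list (map v (fst p))) * (pc w (snd p) * prod_list (map v (snd p))))"
  proof (rule sum_cong)
    fix p assume p: "p \<in> ?I"
    have "0 \<notin> set (fst p @ snd p)" using p z[of "fst p" D] z[of "snd p" E] by auto
    then show "?c p * specv v (?p p) = (pc u (fst p) * prod_list (map v (fst p))) * (pc w (snd p) * prod_list (map v (snd p)))"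
      by (simp add: specv_pprod)
  qed
  also have "\<dots> = specv v u * specv v w"
  proof -
    have 1: "specv v u = (\<Sum>l\<in>PD D. pc u l * prod_list (map v l))" by (rule specv_eq[OF u D])
    have 2: "specv v w = (\<Sum>l\<in>PD E. pc w l * prod_list (map v l))" by (rule specv_eq[OF w E])
    show ?thesis unfolding 1 2 sum_product by (simp add: sum.cartesian_product case_prod_beta)
  qed
  finally show ?thesis .
qed

lemma specv_hom: "sym_alg_hom (specv v)"
  unfolding sym_alg_hom_def
proof (intro conjI allI ballI)
  show "specv v series_one = 1" using specv_pprod[of "[]" v] by simp
  fix u assume u: "u \<in> Sym"
  show "specv v (\<lambda>a. c * u a) = c * specv v u" for c
    using specv_sum[of "{()}" "\<lambda>_. u" v "\<lambda>_. c"] u by simp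
  fix w assume w: "w \<in> Sym"
  show "specv v (\<lambda>a. u a + w a) = specv v u + specv v w"
    using specv_sum[of "{True, False}" "\<lambda>b. if b then u else w" v "\<lambda>_. 1"] u w by simp
  show "specv v (series_mult u w) = specv v u * specv v w" by (rule specv_mult[OF u w])
qed

lemma series_mult_one: assumes "u \<in> Sym" shows "series_mult u series_one = u"
proof
  fix c
  have "series_mult u series_one c = (\<Sum>p\<in>{(a, b). a + b = c}. if p = (c, 0) then u c else 0)"
    unfolding series_mult_def by (rule sum.cong) (auto simp: series_one_def split: if_splits)
  also have "\<dots> = u c" by (subst sum.delta) auto
  finally show "series_mult u series_one c = u c" .
qed

lemma specv_power_sum: "m \<ge> 1 \<Longrightarrow> specv v (power_sum m) = v m"
  using specv_pprod[of "[m]" v] by (simp add: series_mult_one power_sum_Sym)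

lemma sym_alg_hom_add: "sym_alg_hom h \<Longrightarrow> u \<in> Sym \<Longrightarrow> v \<in> Sym \<Longrightarrow> h (\<lambda>a. u a + v a) = h u + h v"
  and sym_alg_hom_scale: "sym_alg_hom h \<Longrightarrow> u \<in> Sym \<Longrightarrow> h (\<lambda>a. c * u a) = c * h u"
  by (simp_all add: sym_alg_hom_def)

lemma hom_sum:
  assumes h: "sym_alg_hom h" and fin: "finite I" and u: "\<And>i. i \<in> I \<Longrightarrow> u i \<in> Sym"
  shows "h (\<lambda>a. \<Sum>i\<in>I. c i * u i a) = (\<Sum>i\<in>I. c i * h (u i))"
  using fin u
proof (induction I rule: finite_induct)
  case empty
  have "h (\<lambda>a. 0 * series_one a) = 0 * h series_one" by (rule sym_alg_hom_scale[OF h series_one_Sym])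
  then show ?case by simp
next
  case (insert i I)
  have S: "(\<lambda>a. c i * u i a) \<in> Sym" "(\<lambda>a. \<Sum>i\<in>I. c i * u i a) \<in> Sym"
    using insert.prems by (auto intro!: Sym_sum Sym_scale)
  have "h (\<lambda>a. \<Sum>i\<in>insert i I. c i * u i a) = h (\<lambda>a. c i * u i a + (\<Sum>i\<in>I. c i * u i a))"
    using insert.hyps by simp
  also have "\<dots> = h (\<lambda>a. c i * u i a) + h (\<lambda>a. \<Sum>i\<in>I. c i * u i a)"
    by (rule sym_alg_hom_add[OF h S])
  also have "h (\<lambda>a. c i * u i a) = c i * h (u i)"
    by (rule sym_alg_hom_scale[OF h]) (simp add: insert.prems)
  finally show ?case using insert by simp
qed

lemma hom_eq_specv:
  assumes h: "sym_alg_hom h" "\<And>m. m \<ge> 1 \<Longrightarrow> h (power_sum m) = v m" and u: "u \<in> Sym"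
  shows "h u = specv v u"
proof -
  have hp: "h (pprod l) = prod_list (map v l)" if "0 \<notin> set l" for l
    using that
  proof (induction l)
    case Nil then show ?case using h(1) by (simp add: sym_alg_hom_def)
  next
    case (Cons r l)
    then have "power_sum r \<in> Sym" "pprod l \<in> Sym" by (auto intro: power_sum_Sym pprod_Sym)
    then have "h (series_mult (power_sum r) (pprod l)) = h (power_sum r) * h (pprod l)"
      using h(1) unfolding sym_alg_hom_def by blast
    then show ?case using Cons h(2)[of r] by auto
  qed
  obtain D where D: "\<And>a. u a \<noteq> 0 \<Longrightarrow> mdeg a \<le> D" using Sym_bound[OF u] by blast
  have "h u = h (\<lambda>a. \<Sum>l\<in>PD D. pc u l * pprod l a)" using p_expansion[OF u D] by simp
  also have "\<dots> = (\<Sum>l\<in>PD D. pc u l * h (pprod l))"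
    by (rule hom_sum[OF h(1)]) (auto intro: pprod_Sym_PD)
  also have "\<dots> = (\<Sum>l\<in>PD D. pc u l * prod_list (map v l))"
    by (rule sum_cong) (simp add: hp PD_iff is_partition_def)
  also have "\<dots> = specv v u" by (rule specv_eq[OF u D, symmetric])
  finally show ?thesis .
qed

lemma specialization_specv: "specialization v = specv v"
  unfolding specialization_def
proof (rule the_equality)
  show "sym_alg_hom (specv v) \<and> (\<forall>m\<ge>1. specv v (power_sum m) = v m) \<and> (\<forall>u. u \<notin> Sym \<longrightarrow> specv v u = 0)"
    using specv_hom specv_power_sum by (simp add: specv_def)
  fix h assume h: "sym_alg_hom h \<and> (\<forall>m\<ge>1. h (power_sum m) = v m) \<and> (\<forall>u. u \<notin> Sym \<longrightarrow> h u = 0)"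
  show "h = specv v"
  proof
    fix u show "h u = specv v u"
      using h hom_eq_specv[of h v u] by (cases "u \<in> Sym") (auto simp: specv_def)
  qed
qed

section \<open>Plethysm with power sums\<close>

definition divm :: "nat \<Rightarrow> monomial \<Rightarrow> monomial" where
  "divm d a = Abs_poly_mapping (\<lambda>i. lookup a i div d)"

lemma lookup_divm [simp]: "lookup (divm d a) i = lookup a i div d"
proof -
  have "finite {i. lookup a i div d \<noteq> 0}"
    by (rule finite_subset[OF _ finite_lookup[of a]]) (metis (mono_tags, lifting) div_0 mult_0_right mem_Collect_eq subsetI)
  then show ?thesis unfolding divm_def by (subst lookup_Abs_poly_mapping) auto
qed

definition mulm :: "nat \<Rightarrow> monomial \<Rightarrow> monomial" where
  "mulm d a = Abs_poly_mapping (\<lambda>i. d * lookup a i)"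

lemma lookup_mulm [simp]: "lookup (mulm d a) i = d * lookup a i"
proof -
  have "finite {i. d * lookup a i \<noteq> 0}"
    by (rule finite_subset[OF _ finite_lookup[of a]]) (metis (mono_tags, lifting) div_0 mult_0_right mem_Collect_eq subsetI)
  then show ?thesis unfolding mulm_def by (subst lookup_Abs_poly_mapping) auto
qed

text \<open>The plethysm of \<open>u\<close> with the power sum \<open>p\<^sub>d\<close>, i.e. the substitution \<open>x\<^sub>i \<mapsto> x\<^sub>i\<^sup>d\<close>.\<close>

definition pleth :: "nat \<Rightarrow> series \<Rightarrow> series" where
  "pleth d u a = (if \<forall>i. d dvd lookup a i then u (divm d a) else 0)"

lemma pleth_mon: "pleth d u (mon c) = (if \<forall>x\<in>set c. d dvd x then u (mon (map (\<lambda>x. x div d) c)) else 0)"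
proof -
  have 1: "(\<forall>i. d dvd part c i) \<longleftrightarrow> (\<forall>x\<in>set c. d dvd x)"
    by (auto simp: part_def all_set_conv_all_nth)
  have 2: "divm d (mon c) = mon (map (\<lambda>x. x div d) c)"
    by (rule poly_mapping_eqI) (simp add: part_def)
  show ?thesis unfolding pleth_def lookup_mon 1 2 ..
qed

lemma mono_degree_mulm: "mdeg (mulm d a) = d * mdeg a"
proof -
  obtain N where N: "\<forall>i\<ge>N. lookup a i = 0" using keys_bound by blast
  then have "\<forall>i\<ge>N. lookup (mulm d a) i = 0" by simp
  then show ?thesis using mono_degree_eq[OF N] mono_degree_eq[of N "mulm d a"] by (simp add: sum_distrib_left)
qed

lemma mulm_divm: "\<forall>i. d dvd lookup a i \<Longrightarrow> mulm d (divm d a) = a"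
  by (rule poly_mapping_eqI) simp

lemma divm_mulm: "d > 0 \<Longrightarrow> divm d (mulm d a) = a"
  by (rule poly_mapping_eqI) simp

lemma pleth_degree:
  assumes "\<And>a. u a \<noteq> 0 \<Longrightarrow> mdeg a \<le> D" "pleth d u a \<noteq> 0"
  shows "mdeg a \<le> d * D"
proof -
  have a: "\<forall>i. d dvd lookup a i" "u (divm d a) \<noteq> 0" using assms(2) by (auto simp: pleth_def split: if_splits)
  have "mdeg a = d * mdeg (divm d a)" using mulm_divm[OF a(1)] mono_degree_mulm by metis
  then show ?thesis using assms(1)[OF a(2)] by simp
qed

lemma pleth_Sym: assumes u: "u \<in> Sym" shows "pleth d u \<in> Sym"
proof -
  obtain D where D: "\<And>a. u a \<noteq> 0 \<Longrightarrow> mdeg a \<le> D" using Sym_bound[OF u] by blast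
  have "pleth d u (map_key \<pi> a) = pleth d u a" if \<pi>: "bij \<pi>" for \<pi> a
  proof -
    have "(\<forall>i. d dvd lookup (map_key \<pi> a) i) \<longleftrightarrow> (\<forall>i. d dvd lookup a i)"
      using \<pi> by (simp add: lookup_map_key) (metis bij_pointE)
    moreover have "divm d (map_key \<pi> a) = map_key \<pi> (divm d a)"
      using \<pi> by (intro poly_mapping_eqI) (simp add: lookup_map_key)
    moreover have "u (map_key \<pi> (divm d a)) = u (divm d a)" using u \<pi> by (simp add: Sym_def)
    ultimately show ?thesis by (simp add: pleth_def)
  qed
  then show ?thesis using pleth_degree[of u D d] D unfolding Sym_def by blast
qed

lemma eval_pleth:
  assumes u: "u \<in> Sym" and d: "d > 0"
  shows "eval_vars N (pleth d u) x = eval_vars N u (\<lambda>i. x i ^ d)"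
proof -
  obtain D where D: "\<And>a. u a \<noteq> 0 \<Longrightarrow> mdeg a \<le> D" using Sym_bound[OF u] by blast
  have "eval_vars N (pleth d u) x = (\<Sum>a\<in>MonLe N (d * D). pleth d u a * xpow N x a)"
    by (rule eval_vars_eq) (rule pleth_degree[OF D])
  also have "\<dots> = (\<Sum>a\<in>{a \<in> MonLe N (d * D). \<forall>i. d dvd lookup a i}. u (divm d a) * xpow N x a)"
    by (rule sum.mono_neutral_cong_right) (auto simp: pleth_def)
  also have "\<dots> = (\<Sum>b\<in>MonLe N D. u b * xpow N (\<lambda>i. x i ^ d) b)"
  proof (rule sum.reindex_bij_witness[where j = "divm d" and i = "mulm d"])
    fix a assume a: "a \<in> {a \<in> MonLe N (d * D). \<forall>i. d dvd lookup a i}"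
    then show m: "mulm d (divm d a) = a" by (simp add: mulm_divm)
    have "d * mdeg (divm d a) \<le> d * D" using a m mono_degree_mulm[of d "divm d a"] by (simp add: MonLe_def)
    then show "divm d a \<in> MonLe N D" using a d by (auto simp: MonLe_def keys_subset_iff)
    have "(x i ^ d) ^ (lookup a i div d) = x i ^ lookup a i" for i
      using a by (simp add: power_mult[symmetric])
    then show "u (divm d a) * xpow N (\<lambda>i. x i ^ d) (divm d a) = u (divm d a) * xpow N x a"
      by (simp add: xpow_def)
  next
    fix b assume b: "b \<in> MonLe N D"
    show "divm d (mulm d b) = b" by (rule divm_mulm[OF d])
    show "mulm d b \<in> {a \<in> MonLe N (d * D). \<forall>i. d dvd lookup a i}"
      using b by (auto simp: MonLe_def keys_subset_iff mono_degree_mulm)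
  qed
  also have "\<dots> = eval_vars N u (\<lambda>i. x i ^ d)" by (rule eval_vars_eq[OF D, symmetric])
  finally show ?thesis .
qed

lemma pleth_power_sum: assumes "d > 0" "m > 0" shows "pleth d (power_sum m) = power_sum (d * m)"
proof
  fix a
  have "(\<forall>i. d dvd lookup a i) \<and> (\<exists>i. divm d a = single i m) \<longleftrightarrow> (\<exists>i. a = single i (d * m))"
  proof
    assume a: "(\<forall>i. d dvd lookup a i) \<and> (\<exists>i. divm d a = single i m)"
    then obtain i where "divm d a = single i m" by blast
    then have "mulm d (divm d a) = single i (d * m)"
      by (intro poly_mapping_eqI) (simp add: lookup_single when_def del: lookup_divm)
    then show "\<exists>i. a = single i (d * m)" using a mulm_divm by metis
  next
    assume "\<exists>i. a = single i (d * m)"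
    then obtain i where a: "a = single i (d * m)" by blast
    have "divm d a = single i m"
      unfolding a by (rule poly_mapping_eqI) (use assms in "simp add: lookup_single when_def")
    then show "(\<forall>i. d dvd lookup a i) \<and> (\<exists>i. divm d a = single i m)"
      unfolding a by (auto simp: lookup_single when_def)
  qed
  then show "pleth d (power_sum m) a = power_sum (d * m) a" by (auto simp: pleth_def power_sum_def)
qed

lemma pleth_one: assumes "d > 0" shows "pleth d series_one = series_one"
proof
  fix a
  have "(\<forall>i. d dvd lookup a i) \<and> divm d a = 0 \<longleftrightarrow> a = 0"
  proof
    assume a: "(\<forall>i. d dvd lookup a i) \<and> divm d a = 0"
    then have "a = mulm d 0" using mulm_divm by metis
    then show "a = 0" by (auto intro: poly_mapping_eqI)
  qed (auto intro: poly_mapping_eqI)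
  then show "pleth d series_one a = series_one a" by (auto simp: pleth_def series_one_def)
qed

lemma thoma_hom: "sym_alg_hom (thoma_spec \<alpha> \<beta> d)"
  by (simp add: thoma_spec_def specialization_specv specv_hom)

text \<open>Both sides are algebra homomorphisms in \<open>u\<close>, so it suffices to compare
  power sums, where p_m becomes p_(dm). The convention p_1 = 1 applies on either side only if d = m
  = 1.\<close>

theorem thoma_spec_pleth:
  assumes d: "d \<ge> 1" and u: "u \<in> Sym"
  shows "thoma_spec \<alpha> \<beta> 1 (pleth d u) = thoma_spec \<alpha> \<beta> d u"
proof -
  let ?h = "\<lambda>u. thoma_spec \<alpha> \<beta> 1 (pleth d u)"
  let ?v = "\<lambda>d m. if d = 1 \<and> m = 1 then 1 else suminf (\<lambda>i. \<alpha> i ^ (m * d)) - suminf (\<lambda>i. (- \<beta> i) ^ (m * d))"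
  have v: "thoma_spec \<alpha> \<beta> d = specv (?v d)" for d by (simp add: thoma_spec_def specialization_specv)
  have h1: "sym_alg_hom (thoma_spec \<alpha> \<beta> 1)" by (rule thoma_hom)
  have "sym_alg_hom ?h"
    unfolding sym_alg_hom_def
  proof (intro conjI allI ballI)
    show "?h series_one = 1" using h1 d by (simp add: pleth_one sym_alg_hom_def)
    fix u assume u: "u \<in> Sym"
    have "pleth d (\<lambda>a. c * u a) = (\<lambda>a. c * pleth d u a)" for c by (auto simp: pleth_def)
    then show "?h (\<lambda>a. c * u a) = c * ?h u" for c using h1 pleth_Sym[OF u] by (simp add: sym_alg_hom_def)
    fix w assume w: "w \<in> Sym"
    have "pleth d (\<lambda>a. u a + w a) = (\<lambda>a. pleth d u a + pleth d w a)" by (auto simp: pleth_def)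
    then show "?h (\<lambda>a. u a + w a) = ?h u + ?h w" using h1 pleth_Sym[OF u] pleth_Sym[OF w] by (simp add: sym_alg_hom_def)
    have "pleth d (series_mult u w) = series_mult (pleth d u) (pleth d w)"
      by (rule eval_vars_inj) (use d u w in "auto simp: eval_pleth eval_vars_mult series_mult_Sym pleth_Sym")
    then show "?h (series_mult u w) = ?h u * ?h w" using h1 pleth_Sym[OF u] pleth_Sym[OF w] by (simp add: sym_alg_hom_def)
  qed
  moreover have "?h (power_sum m) = ?v d m" if "m \<ge> 1" for m
  proof -
    have "?h (power_sum m) = specv (?v 1) (power_sum (d * m))"
      unfolding v[of 1] using that d by (subst pleth_power_sum) auto
    also have "\<dots> = ?v 1 (d * m)" by (rule specv_power_sum) (use that d in simp)
    also have "\<dots> = ?v d m" by (simp add: mult.commute)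
    finally show ?thesis .
  qed
  ultimately have "?h u = specv (?v d) u" using u by (rule hom_eq_specv)
  then show ?thesis by (simp add: v)
qed

section \<open>Counting submodules\<close>

lemma card_eq_fiber:
  assumes "finite X" "\<And>y. y \<in> \<phi> ` X \<Longrightarrow> card {x \<in> X. \<phi> x = y} = k"
  shows "card X = k * card (\<phi> ` X)"
proof -
  have "card X = (\<Sum>x\<in>X. 1)" by simp
  also have "\<dots> = (\<Sum>y\<in>\<phi> ` X. \<Sum>x\<in>{x \<in> X. \<phi> x = y}. 1)"
    by (rule sum.group[symmetric]) (use assms in auto)
  also have "\<dots> = (\<Sum>y\<in>\<phi> ` X. k)" by (rule sum_cong) (simp add: assms(2))
  finally show ?thesis by simp
qed

text \<open>Stated through coefficients so that d = 0 gives the set of the zero polynomial, whereas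
  the condition degree p < d would give the empty set.\<close>

definition polys_below :: "nat \<Rightarrow> 'a::zero poly set" where "polys_below d = {p. \<forall>i\<ge>d. Polynomial.coeff p i = 0}"

lemma card_polys_below: "card (polys_below d :: 'k::{zero,finite} poly set) = card (UNIV :: 'k set) ^ d"
proof -
  have "bij_betw Poly {xs :: 'k list. set xs \<subseteq> UNIV \<and> length xs = d} (polys_below d)"
  proof (rule bij_betw_byWitness[where f' = "\<lambda>p. map (Polynomial.coeff p) [0..<d]"])
    show "\<forall>xs\<in>{xs :: 'k list. set xs \<subseteq> UNIV \<and> length xs = d}. map (Polynomial.coeff (Poly xs)) [0..<d] = xs"
      by (auto simp: nth_default_def intro!: nth_equalityI)
    show "\<forall>p\<in>polys_below d. Poly (map (Polynomial.coeff p) [0..<d]) = (p :: 'k poly)"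
      by (auto simp: poly_eq_iff nth_default_def polys_below_def)
    show "Poly ` {xs :: 'k list. set xs \<subseteq> UNIV \<and> length xs = d} \<subseteq> polys_below d"
      by (auto simp: polys_below_def nth_default_def)
  qed auto
  then have "card {xs :: 'k list. set xs \<subseteq> UNIV \<and> length xs = d} = card (polys_below d :: 'k poly set)"
    by (rule bij_betw_same_card)
  then show ?thesis using card_lists_length_eq[of "UNIV :: 'k set" d] by simp
qed

lemma finite_polys_below: "finite (polys_below d :: 'k::{zero,finite} poly set)"
proof -
  have "card (polys_below d :: 'k poly set) > 0" by (simp add: card_polys_below card_gt_0_iff)
  then show ?thesis by (rule card_ge_0_finite)
qed

lemma polys_below_iff: "d > 0 \<Longrightarrow> p \<in> polys_below d \<longleftrightarrow> degree p < d"
  unfolding polys_below_def mem_Collect_eq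
  by (metis coeff_eq_0 leading_coeff_0_iff degree_0 not_less order_less_le_trans)

text \<open>Coprimality as an explicit identity, since a p + b r = 1 is what acts on
  vectors.\<close>

definition bezout :: "'a::comm_ring_1 \<Rightarrow> 'a \<Rightarrow> bool" where "bezout p r \<longleftrightarrow> (\<exists>a b. a * p + b * r = 1)"

lemma bezout_commute: "bezout p r \<longleftrightarrow> bezout r p"
  unfolding bezout_def by (metis add.commute)

lemma bezout_mult: assumes "bezout p r" "bezout s r" shows "bezout (p * s) r"
proof -
  obtain a b c d where "a * p + b * r = 1" "c * s + d * r = 1" using assms by (auto simp: bezout_def)
  then have "(a * p + b * r) * (c * s + d * r) = 1" by simp
  then have "(a * c) * (p * s) + (a * p * d + b * (c * s + d * r)) * r = 1" by (simp add: algebra_simps)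
  then show ?thesis unfolding bezout_def by blast
qed

lemma bezout_1 [simp]: "bezout 1 r"
  unfolding bezout_def by (intro exI[of _ 1] exI[of _ 0]) simp

lemma bezout_power: "bezout p r \<Longrightarrow> bezout (p ^ n) r"
  by (induction n) (auto intro: bezout_mult)

lemma bezout_prod: "(\<And>i. i \<in> I \<Longrightarrow> bezout (p i) r) \<Longrightarrow> bezout (\<Prod>i\<in>I. p i) r"
  by (induction I rule: infinite_finite_induct) (auto intro: bezout_mult)

text \<open>A nonzero element g of least degree in the ideal generated by f and p divides both. If
  it were not a unit, irreducibility would make it an associate of f, and f would divide p.\<close>

lemma bezout_irreducible:
  fixes f p :: "'k::field poly"
  assumes f: "irr f" and n: "\<not> f dvd p"
  shows "bezout f p"
proof -
  let ?I = "{a * f + b * p | a b. a * f + b * p \<noteq> 0}"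
  have "1 * f + 0 * p \<in> ?I" using f by (intro CollectI exI[of _ 1] exI[of _ 0]) auto
  then obtain g where g: "g \<in> ?I" "\<And>h. h \<in> ?I \<Longrightarrow> degree g \<le> degree h"
    using exists_least_iff[of "\<lambda>n. \<exists>h\<in>?I. degree h = n"] by (metis (no_types, lifting) not_less)
  obtain a b where ab: "g = a * f + b * p" "g \<noteq> 0" using g(1) by auto
  have dvd: "g dvd h" if h: "h = c * f + d * p" for h c d
  proof (rule ccontr)
    assume nd: "\<not> g dvd h"
    define A B where "A = c - h div g * a" and "B = d - h div g * b"
    have eq: "h mod g = A * f + B * p"
      using h ab(1) by (simp add: A_def B_def minus_div_mult_eq_mod[symmetric] algebra_simps)
    have nz: "h mod g \<noteq> 0" using nd by (simp add: mod_eq_0_iff_dvd)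
    then have "A * f + B * p \<in> ?I" unfolding eq by blast
    then have "degree g \<le> degree (h mod g)" unfolding eq by (rule g(2))
    then show False using degree_mod_less[OF ab(2), of h] nz by auto
  qed
  have "g dvd f" "g dvd p" using dvd[of f 1 0] dvd[of p 0 1] by simp_all
  then obtain u where u: "f = g * u" by (auto simp: dvd_def)
  have "g dvd 1"
  proof (rule ccontr)
    assume "\<not> g dvd 1"
    then have "u dvd 1" using f u irreducibleD by blast
    then have "f dvd g" using u by (metis dvd_refl mult_1_right mult_dvd_mono mult_unit_dvd_iff dvd_mult_unit_iff)
    then show False using \<open>g dvd p\<close> n dvd_trans by blast
  qed
  then obtain v where "1 = g * v" by (auto simp: dvd_def)
  then have "(v * a) * f + (v * b) * p = 1" using ab(1) by (simp add: algebra_simps)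
  then show ?thesis unfolding bezout_def by blast
qed

lemma choose2_Suc: "Suc s choose 2 = (s choose 2) + s"
  by (simp add: numeral_2_eq_2)

abbreviation rcard :: "'k::{field,finite} poly \<Rightarrow> nat" where "rcard f \<equiv> card (UNIV :: 'k set) ^ degree f"

text \<open>Over this scalar ring \<open>subspace\<close> means k[T]-submodule. The ambient type may
  be infinite; finiteness is asked of the submodules.\<close>

locale polymod = Modules.module scale
  for scale :: "'k::{field,finite} poly \<Rightarrow> 'v::ab_group_add \<Rightarrow> 'v"
begin

definition ps :: "'v set \<Rightarrow> 'v set \<Rightarrow> 'v set" where "ps A B = {a + b | a b. a \<in> A \<and> b \<in> B}"
definition ker :: "'k poly \<Rightarrow> 'v set" where "ker f = {v. scale f v = 0}"
definition between :: "'v set \<Rightarrow> 'v set \<Rightarrow> 'v set set" where "between Y X = {W. subspace W \<and> Y \<subseteq> W \<and> W \<subseteq> X}"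

lemma subspace_ps: assumes "subspace A" "subspace B" shows "subspace (ps A B)"
proof (rule subspaceI)
  show "0 \<in> ps A B" using assms subspace_0 by (force simp: ps_def)
  fix x y assume "x \<in> ps A B" "y \<in> ps A B"
  then obtain a b a' b' where "x = a + b" "y = a' + b'" "a \<in> A" "b \<in> B" "a' \<in> A" "b' \<in> B" by (auto simp: ps_def)
  then have "x + y = (a + a') + (b + b')" "a + a' \<in> A" "b + b' \<in> B" using assms by (auto simp: algebra_simps subspace_add)
  then show "x + y \<in> ps A B" unfolding ps_def by blast
next
  fix c x assume "x \<in> ps A B"
  then obtain a b where "x = a + b" "a \<in> A" "b \<in> B" by (auto simp: ps_def)
  then have "scale c x = scale c a + scale c b" "scale c a \<in> A" "scale c b \<in> B" using assms by (auto simp: scale_right_distrib subspace_scale)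
  then show "scale c x \<in> ps A B" unfolding ps_def by blast
qed

lemma ps_upper: "subspace A \<Longrightarrow> subspace B \<Longrightarrow> A \<subseteq> ps A B" "subspace A \<Longrightarrow> subspace B \<Longrightarrow> B \<subseteq> ps A B"
  unfolding ps_def by (force dest: subspace_0)+

lemma ps_least: "subspace C \<Longrightarrow> A \<subseteq> C \<Longrightarrow> B \<subseteq> C \<Longrightarrow> ps A B \<subseteq> C"
  by (auto simp: ps_def intro: subspace_add)

lemma finite_ps: "finite A \<Longrightarrow> finite B \<Longrightarrow> finite (ps A B)"
proof -
  assume "finite A" "finite B"
  moreover have "ps A B = (\<lambda>(a, b). a + b) ` (A \<times> B)" by (auto simp: ps_def)
  ultimately show ?thesis by simp
qed

lemma card_ps:
  assumes "subspace A" "subspace B" "finite A" "finite B"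
  shows "card (ps A B) * card (A \<inter> B) = card A * card B"
proof -
  let ?\<phi> = "\<lambda>(a, b). a + b :: 'v"
  have im: "ps A B = ?\<phi> ` (A \<times> B)" by (auto simp: ps_def)
  have "card (A \<times> B) = card (A \<inter> B) * card (?\<phi> ` (A \<times> B))"
  proof (rule card_eq_fiber)
    fix s assume "s \<in> ?\<phi> ` (A \<times> B)"
    then obtain a b where s: "s = a + b" "a \<in> A" "b \<in> B" by auto
    have "bij_betw (\<lambda>z. (a + z, b - z)) (A \<inter> B) {p \<in> A \<times> B. ?\<phi> p = s}"
    proof (rule bij_betw_byWitness[where f' = "\<lambda>p. fst p - a"])
      show "\<forall>p\<in>{p \<in> A \<times> B. ?\<phi> p = s}. (a + (fst p - a), b - (fst p - a)) = p"
        using s by (auto simp: algebra_simps)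
      show "(\<lambda>z. (a + z, b - z)) ` (A \<inter> B) \<subseteq> {p \<in> A \<times> B. ?\<phi> p = s}"
        using s assms by (auto intro: subspace_add subspace_diff)
      show "(\<lambda>p. fst p - a) ` {p \<in> A \<times> B. ?\<phi> p = s} \<subseteq> A \<inter> B"
      proof
        fix z assume "z \<in> (\<lambda>p. fst p - a) ` {p \<in> A \<times> B. ?\<phi> p = s}"
        then obtain a' b' where p: "z = a' - a" "a' \<in> A" "b' \<in> B" "a' + b' = a + b" using s by auto
        have "a' = a + b - b'" using p(4) by (simp add: eq_diff_eq)
        then have "z = b - b'" by (simp add: p(1))
        then have "z \<in> B" using subspace_diff[OF assms(2) s(3) p(3)] by simp
        moreover have "z \<in> A" using subspace_diff[OF assms(1) p(2) s(2)] p(1) by simp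
        ultimately show "z \<in> A \<inter> B" by simp
      qed
    qed simp
    from bij_betw_same_card[OF this] show "card {p \<in> A \<times> B. ?\<phi> p = s} = card (A \<inter> B)" by simp
  qed (use assms in simp)
  then show ?thesis using im by (simp add: card_cartesian_product mult.commute)
qed

lemma subspace_ker: "subspace (ker f)"
  by (auto simp: subspace_def ker_def scale_right_distrib) (metis mult.commute scale_scale scale_zero_right)

lemma subspace_image: assumes "subspace X" shows "subspace (scale f ` X)"
proof (rule subspaceI)
  show "0 \<in> scale f ` X" using subspace_0[OF assms] scale_zero_right[of f] by force
  fix x y assume "x \<in> scale f ` X" "y \<in> scale f ` X"
  then obtain x' y' where "x = scale f x'" "y = scale f y'" "x' \<in> X" "y' \<in> X" by auto
  then show "x + y \<in> scale f ` X" using subspace_add[OF assms] scale_right_distrib[of f x' y'] by (metis imageI)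
next
  fix c x assume "x \<in> scale f ` X"
  then obtain x' where "x = scale f x'" "x' \<in> X" by auto
  then show "scale c x \<in> scale f ` X" using subspace_scale[OF assms] scale_left_commute by (metis imageI)
qed

lemma image_subset: "subspace X \<Longrightarrow> scale f ` X \<subseteq> X"
  by (auto intro: subspace_scale)

lemma card_image_ker:
  assumes "subspace X" "finite X"
  shows "card X = card (X \<inter> ker f) * card (scale f ` X)"
proof (rule card_eq_fiber[OF assms(2)])
  fix y assume "y \<in> scale f ` X"
  then obtain a where a: "a \<in> X" "y = scale f a" by auto
  have "bij_betw (\<lambda>z. a + z) (X \<inter> ker f) {x \<in> X. scale f x = y}"
    by (rule bij_betw_byWitness[where f' = "\<lambda>x. x - a"])
      (use a assms in "auto simp: ker_def scale_right_distrib scale_right_diff_distrib intro: subspace_add subspace_diff")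
  from bij_betw_same_card[OF this] show "card {x \<in> X. scale f x = y} = card (X \<inter> ker f)" by simp
qed

definition adj :: "'v set \<Rightarrow> 'v \<Rightarrow> 'v set" where "adj W e = {w + scale p e | w p. w \<in> W}"

lemma subspace_adj: assumes "subspace W" shows "subspace (adj W e)"
proof (rule subspaceI)
  show "0 \<in> adj W e" unfolding adj_def using subspace_0[OF assms] by (force intro: exI[of _ 0])
  fix x y assume "x \<in> adj W e" "y \<in> adj W e"
  then obtain w p w' p' where "x = w + scale p e" "y = w' + scale p' e" "w \<in> W" "w' \<in> W" by (auto simp: adj_def)
  then have "x + y = (w + w') + scale (p + p') e" "w + w' \<in> W" using subspace_add[OF assms] by (auto simp: scale_left_distrib algebra_simps)
  then show "x + y \<in> adj W e" unfolding adj_def by blast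
next
  fix c x assume "x \<in> adj W e"
  then obtain w p where "x = w + scale p e" "w \<in> W" by (auto simp: adj_def)
  then have "scale c x = scale c w + scale (c * p) e" "scale c w \<in> W" using subspace_scale[OF assms] by (auto simp: scale_right_distrib)
  then show "scale c x \<in> adj W e" unfolding adj_def by blast
qed

lemma adj_upper: "W \<subseteq> adj W e" "subspace W \<Longrightarrow> e \<in> adj W e"
  unfolding adj_def by (force intro: exI[of _ 0]) (force intro: exI[of _ 1] dest: subspace_0)

lemma adj_least: "subspace Z \<Longrightarrow> W \<subseteq> Z \<Longrightarrow> e \<in> Z \<Longrightarrow> adj W e \<subseteq> Z"
  by (auto simp: adj_def intro!: subspace_add subspace_scale)

text \<open>The polynomials that carry e into \<open>Z\<close> form a proper ideal containing the
  irreducible f.\<close>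

lemma mod_subspace_dvd:
  assumes f: "irr f" and Z: "subspace Z" "scale f e \<in> Z" "e \<notin> Z" and p: "scale p e \<in> Z"
  shows "f dvd p"
proof (rule ccontr)
  assume "\<not> f dvd p"
  then obtain a b where ab: "a * f + b * p = 1" using bezout_irreducible[OF f] unfolding bezout_def by blast
  have "scale (a * f + b * p) e = scale a (scale f e) + scale b (scale p e)" by (simp add: scale_left_distrib)
  also have "\<dots> \<in> Z" by (rule subspace_add[OF Z(1) subspace_scale[OF Z(1,2)] subspace_scale[OF Z(1) p]])
  finally show False using Z(3) by (simp add: ab)
qed

lemma adj_Int:
  assumes f: "irr f" and W: "subspace W" "scale f e \<in> W" and Z: "subspace Z" "W \<subseteq> Z" "e \<notin> Z"
  shows "adj W e \<inter> Z = W"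
proof (intro equalityI subsetI)
  fix x assume x: "x \<in> adj W e \<inter> Z"
  then obtain w p where wp: "x = w + scale p e" "w \<in> W" by (auto simp: adj_def)
  have "scale p e = x - w" using wp by simp
  moreover have "x - w \<in> Z" by (rule subspace_diff[OF Z(1)]) (use x wp Z in auto)
  ultimately have "scale p e \<in> Z" by simp
  then have "f dvd p" using mod_subspace_dvd[OF f Z(1) _ Z(3)] W Z by blast
  then obtain r where "p = r * f" by (auto simp: dvd_def mult.commute)
  then have "scale p e \<in> W" using W by (metis scale_scale subspace_scale)
  then show "x \<in> W" using wp W subspace_add by blast
qed (use Z adj_upper in auto)

text \<open>The quotient of \<open>adj W e\<close> by W is simple, and the multiples of e by
  remainders modulo f represent its elements.\<close>

lemma card_adj:
  assumes f: "irr f" "degree f > 0" and W: "subspace W" "scale f e \<in> W" "e \<notin> W" "finite W"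
  shows "card (adj W e) = rcard f * card W" "finite (adj W e)"
proof -
  have bij: "bij_betw (\<lambda>(w, p). w + scale p e) (W \<times> polys_below (degree f)) (adj W e)"
    unfolding bij_betw_def
  proof
    show "inj_on (\<lambda>(w, p). w + scale p e) (W \<times> polys_below (degree f))"
    proof (rule inj_onI, clarify)
      fix w p w' p' assume a: "w \<in> W" "w' \<in> W" "p \<in> polys_below (degree f)" "p' \<in> polys_below (degree f)" "w + scale p e = w' + scale p' e"
      have "scale (p - p') e = w' - w" using a(5) by (simp add: scale_left_diff_distrib algebra_simps)
      then have "scale (p - p') e \<in> W" using a subspace_diff[OF W(1)] by simp
      then have "f dvd p - p'" by (rule mod_subspace_dvd[OF f(1) W(1,2,3)])
      moreover have "degree (p - p') < degree f"
        using a f(2) by (intro degree_diff_less) (auto simp: polys_below_iff)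
      ultimately have "p - p' = 0" using dvd_imp_degree_le[of f "p - p'"] by (meson not_less)
      then show "w = w' \<and> p = p'" using a by simp
    qed
    show "(\<lambda>(w, p). w + scale p e) ` (W \<times> polys_below (degree f)) = adj W e"
    proof (intro equalityI subsetI)
      fix x assume "x \<in> adj W e"
      then obtain w p where wp: "x = w + scale p e" "w \<in> W" by (auto simp: adj_def)
      have "scale p e = scale (p div f * f + p mod f) e" by simp
      also have "\<dots> = scale (p div f) (scale f e) + scale (p mod f) e" unfolding scale_left_distrib by simp
      finally have "x = (w + scale (p div f) (scale f e)) + scale (p mod f) e" using wp by (simp add: add.assoc)
      moreover have "w + scale (p div f) (scale f e) \<in> W" by (rule subspace_add[OF W(1) wp(2) subspace_scale[OF W(1,2)]])
      moreover have "p mod f \<in> polys_below (degree f)"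
        unfolding polys_below_iff[OF f(2)] using f(2) degree_mod_less[of f p] by (cases "p mod f = 0"; cases "f = 0") auto
      ultimately show "x \<in> (\<lambda>(w, p). w + scale p e) ` (W \<times> polys_below (degree f))" by force
    qed (auto simp: adj_def)
  qed
  show "card (adj W e) = rcard f * card W"
    using bij_betw_same_card[OF bij] by (simp add: card_cartesian_product card_polys_below mult.commute)
  show "finite (adj W e)" using bij_betw_finite[OF bij] W(4) finite_polys_below by blast
qed

lemma card_subspace_pos: "subspace W \<Longrightarrow> finite W \<Longrightarrow> card W > 0"
  using subspace_0 card_gt_0_iff by blast

lemma between_Int: "subspace Z \<Longrightarrow> W \<in> between Y X \<Longrightarrow> Y \<subseteq> Z \<Longrightarrow> W \<inter> Z \<in> between Y Z"
  by (auto simp: between_def subspace_inter)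

lemma finite_between: "finite X \<Longrightarrow> finite (between Y X)"
  by (rule finite_subset[of _ "Pow X"]) (auto simp: between_def)

end

text \<open>A chain of submodules with simple quotients in \<open>E 0 / E L\<close>, on which \<open>f\<close> acts as zero; the jumps of a
  submodule record its Schubert cell with respect to this complete flag.\<close>

locale primary_chain = polymod scale for scale :: "'k::{field,finite} poly \<Rightarrow> 'v::ab_group_add \<Rightarrow> 'v" +
  fixes f :: "'k poly" and E :: "nat \<Rightarrow> 'v set" and L Q :: nat
  assumes f: "irr f" "degree f > 0" and Q: "Q = rcard f"
    and E: "\<And>i. i \<le> L \<Longrightarrow> subspace (E i)" "\<And>i. i \<le> L \<Longrightarrow> finite (E i)"
    and Estep: "\<And>i. i < L \<Longrightarrow> E (Suc i) \<subseteq> E i" "\<And>i. i < L \<Longrightarrow> card (E i) = Q * card (E (Suc i))"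
    and killed: "\<And>x. x \<in> E 0 \<Longrightarrow> scale f x \<in> E L"
begin

lemma Q_gt1: "Q > 1"
proof -
  show ?thesis using one_less_power[OF card_field_gt1[where 'k = 'k], of "degree f"] f(2) by (simp add: Q)
qed

lemma E_mono: "i \<le> j \<Longrightarrow> j \<le> L \<Longrightarrow> E j \<subseteq> E i"
proof (induction j)
  case (Suc j)
  show ?case
  proof (cases "i = Suc j")
    case False
    then show ?thesis using Suc Estep(1)[of j] by auto
  qed simp
qed simp

text \<open>The indices at which W does not grow, so that their number is the colength of W in
  \<open>E m\<close>. The lower limit m serves the induction that starts at the bottom of the
  chain.\<close>

definition jump :: "nat \<Rightarrow> 'v set \<Rightarrow> nat set" where
  "jump m W = {i \<in> {m..<L}. W \<inter> E i \<subseteq> E (Suc i)}"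

lemma finite_jump [simp]: "finite (jump m W)" by (simp add: jump_def)

lemma jump_restrict: assumes "m \<le> n" "n \<le> L" shows "jump n (W \<inter> E n) = jump m W \<inter> {n..<L}"
proof -
  have "W \<inter> E n \<inter> E i = W \<inter> E i" if "n \<le> i" "i < L" for i
    using E_mono[of n i] that by auto
  then show ?thesis using assms by (auto simp: jump_def)
qed

lemma E_adj:
  assumes "i < L" "e \<in> E i" "e \<notin> E (Suc i)" shows "E i = adj (E (Suc i)) e"
proof -
  have k: "scale f e \<in> E (Suc i)" using killed[of e] E_mono[of 0 i] E_mono[of "Suc i" L] assms by auto
  have "adj (E (Suc i)) e \<subseteq> E i" by (rule adj_least) (use assms E Estep in auto)
  moreover have "card (adj (E (Suc i)) e) = card (E i)"
    using card_adj[OF f _ k assms(3)] E[of "Suc i"] Estep(2) assms Q by simp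
  ultimately show ?thesis using E(2)[of i] assms card_subset_eq by (metis less_imp_le_nat)
qed

text \<open>\<open>E m\<close> arises from E (m + 1) by adjoining any element outside, the quotient
  being simple; subtracting a multiple of e therefore brings each element of W into E (m +
  1).\<close>

lemma W_adj:
  assumes m: "m < L" and W: "W \<in> between (E L) (E m)" and e: "e \<in> W" "e \<notin> E (Suc m)"
  shows "W = adj (W \<inter> E (Suc m)) e" "card W = Q * card (W \<inter> E (Suc m))"
proof -
  let ?W' = "W \<inter> E (Suc m)"
  have sW: "subspace W" "E L \<subseteq> W" "W \<subseteq> E m" using W by (auto simp: between_def)
  have sW': "subspace ?W'" using sW(1) E(1)[of "Suc m"] m by (intro subspace_inter) auto
  have Em: "E m = adj (E (Suc m)) e" by (rule E_adj[OF m]) (use e sW in auto)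
  have fe: "scale f e \<in> ?W'"
    using killed[of e] E_mono[of 0 m] E_mono[of "Suc m" L] sW e(1) m by auto
  show eq: "W = adj ?W' e"
  proof (intro equalityI subsetI)
    fix w assume w: "w \<in> W"
    then obtain y p where yp: "w = y + scale p e" "y \<in> E (Suc m)" using sW(3) Em by (auto simp: adj_def)
    have "y = w - scale p e" using yp by simp
    then have "y \<in> W" using w e sW(1) by (simp add: subspace_diff subspace_scale)
    then show "w \<in> adj ?W' e" using yp by (auto simp: adj_def)
  next
    fix w assume "w \<in> adj ?W' e"
    then show "w \<in> W" using adj_least[OF sW(1), of ?W' e] e by auto
  qed
  have "finite ?W'" using E(2)[of "Suc m"] m by simp
  then show "card W = Q * card ?W'" using card_adj(1)[OF f sW' fe] e(2) eq Q by simp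
qed

lemma card_jump: "m \<le> L \<Longrightarrow> W \<in> between (E L) (E m) \<Longrightarrow> card (E m) = Q ^ card (jump m W) * card W"
proof (induction m arbitrary: W rule: inc_induct)
  case base
  then have "W = E L" by (auto simp: between_def)
  then show ?case by (simp add: jump_def)
next
  case (step m)
  let ?W' = "W \<inter> E (Suc m)"
  have W': "?W' \<in> between (E L) (E (Suc m))"
    by (rule between_Int[OF _ step.prems]) (use E(1) E_mono step.hyps in auto)
  have IH: "card (E (Suc m)) = Q ^ card (jump (Suc m) ?W') * card ?W'" by (rule step.IH[OF W'])
  have j: "jump (Suc m) ?W' = jump m W \<inter> {Suc m..<L}" by (rule jump_restrict) (use step.hyps in auto)
  have sW: "W \<subseteq> E m" using step.prems by (auto simp: between_def)
  show ?case
  proof (cases "W \<subseteq> E (Suc m)")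
    case True
    then have "jump m W = insert m (jump (Suc m) ?W')" using j step.hyps by (auto simp: jump_def)
    moreover have "m \<notin> jump (Suc m) ?W'" by (simp add: jump_def)
    ultimately show ?thesis using IH Estep(2)[of m] step.hyps True by (simp add: Int_absorb2)
  next
    case False
    then obtain e where "e \<in> W" "e \<notin> E (Suc m)" by auto
    then have "card W = Q * card ?W'" using W_adj(2) step by auto
    moreover have "m \<notin> jump m W" using False sW by (auto simp: jump_def)
    then have "jump m W = jump (Suc m) ?W'" unfolding j by (auto simp: jump_def not_less_eq_eq le_Suc_eq)
    ultimately show ?thesis using IH Estep(2)[of m] step.hyps by simp
  qed
qed

text \<open>Every such W is obtained by adjoining to W' an element e of E m outside E (m + 1), and
  the admissible e for a given W are those of W - W'. The count is the quotient of the orders of the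
  two difference sets, which is the index of W' in E (m + 1).\<close>

lemma card_new:
  assumes m: "m < L" and W': "W' \<in> between (E L) (E (Suc m))"
  shows "card {W \<in> between (E L) (E m). W \<inter> E (Suc m) = W' \<and> \<not> W \<subseteq> E (Suc m)} = Q ^ card (jump (Suc m) W')"
proof -
  let ?N = "{W \<in> between (E L) (E m). W \<inter> E (Suc m) = W' \<and> \<not> W \<subseteq> E (Suc m)}"
  let ?D = "E m - E (Suc m)"
  have sW': "subspace W'" "E L \<subseteq> W'" "W' \<subseteq> E (Suc m)" using W' by (auto simp: between_def)
  have fin: "finite (E m)" "finite (E (Suc m))" using E(2) m by auto
  have finW': "finite W'" using sW'(3) fin finite_subset by blast
  have fe: "scale f e \<in> W'" if "e \<in> E m" for e
    using killed[of e] E_mono[of 0 m] that m sW' by auto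
  have inN: "adj W' e \<in> ?N" if e: "e \<in> ?D" for e
  proof -
    have "adj W' e \<inter> E (Suc m) = W'"
      by (rule adj_Int[OF f(1) sW'(1)]) (use fe e sW' E m in auto)
    moreover have "adj W' e \<subseteq> E m" by (rule adj_least) (use E m e sW' Estep(1)[of m] in auto)
    ultimately show ?thesis using subspace_adj[OF sW'(1)] adj_upper[of W' e] sW' e by (auto simp: between_def)
  qed
  have fib: "{e \<in> ?D. adj W' e = W} = W - W'" if W: "W \<in> ?N" for W
  proof (intro equalityI subsetI)
    fix e assume "e \<in> {e \<in> ?D. adj W' e = W}"
    then show "e \<in> W - W'" using adj_upper(2)[OF sW'(1)] sW' by auto
  next
    fix e assume e: "e \<in> W - W'"
    then have "e \<notin> E (Suc m)" using W by auto
    then have "W = adj W' e" using W_adj(1)[OF m, of W e] W e by auto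
    then show "e \<in> {e \<in> ?D. adj W' e = W}" using e W \<open>e \<notin> E (Suc m)\<close> by (auto simp: between_def)
  qed
  have im: "(\<lambda>e. adj W' e) ` ?D = ?N"
  proof (intro equalityI subsetI)
    fix W assume W: "W \<in> ?N"
    then obtain e where e: "e \<in> W" "e \<notin> E (Suc m)" by auto
    then have "W = adj W' e" using W_adj(1)[OF m, of W e] W by auto
    moreover have "e \<in> ?D" using e W by (auto simp: between_def)
    ultimately show "W \<in> (\<lambda>e. adj W' e) ` ?D" by blast
  qed (use inN in auto)
  have cW: "card (W - W') = (Q - 1) * card W'" if W: "W \<in> ?N" for W
  proof -
    obtain e where "e \<in> W" "e \<notin> E (Suc m)" using W by auto
    then have "card W = Q * card W'" using W_adj(2)[OF m, of W e] W by auto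
    moreover have "W' \<subseteq> W" using W by auto
    ultimately show ?thesis using finW' by (simp add: card_Diff_subset diff_mult_distrib)
  qed
  have "card ?D = ((Q - 1) * card W') * card ((\<lambda>e. adj W' e) ` ?D)"
  proof (rule card_eq_fiber)
    fix W assume "W \<in> (\<lambda>e. adj W' e) ` ?D"
    then have "W \<in> ?N" using im by simp
    then show "card {e \<in> ?D. adj W' e = W} = (Q - 1) * card W'" using fib cW by simp
  qed (use fin in simp)
  moreover have "card ?D = (Q - 1) * card (E (Suc m))"
    using Estep[OF m] fin by (simp add: card_Diff_subset diff_mult_distrib)
  moreover have "card (E (Suc m)) = Q ^ card (jump (Suc m) W') * card W'"
    by (rule card_jump) (use m W' in auto)
  moreover have "card W' > 0" by (rule card_subspace_pos[OF sW'(1) finW'])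
  ultimately show ?thesis using im Q_gt1 by (simp add: mult_ac)
qed

text \<open>Induction from the bottom of the chain by intersecting W with E (m + 1). Over a W' with
  s jumps lie W' itself, with the new jump m, and Q^s submodules with unchanged jumps. The weight
  makes both contribute a factor Q^s, because s + 1 choose 2 is s choose 2 plus s; that factor
  raises every exponent i - (m + 1) to i - m.\<close>

lemma schubert_sum:
  fixes G :: "nat set \<Rightarrow> real"
  shows "m \<le> L \<Longrightarrow> (\<Sum>W\<in>between (E L) (E m). real Q ^ (card (jump m W) choose 2) * G (jump m W))
    = (\<Sum>S\<in>Pow {m..<L}. real Q ^ (\<Sum>i\<in>S. i - m) * G S)"
proof (induction m arbitrary: G rule: inc_induct)
  case base
  have "between (E L) (E L) = {E L}" using E(1)[of L] by (auto simp: between_def)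
  moreover have "jump L W = {}" for W by (simp add: jump_def)
  ultimately show ?case by (simp add: numeral_2_eq_2)
next
  case (step m)
  let ?B = "between (E L) (E m)" and ?B' = "between (E L) (E (Suc m))"
  let ?h = "\<lambda>W. real Q ^ (card (jump m W) choose 2) * G (jump m W)"
  let ?G' = "\<lambda>S. real Q ^ card S * (G S + G (insert m S))"
  have finB: "finite ?B" "finite ?B'" using finite_between E(2) step.hyps by auto
  have subm: "subspace (E (Suc m))" "E L \<subseteq> E (Suc m)" using E(1) E_mono step.hyps by auto
  have "(\<Sum>W\<in>?B. ?h W) = (\<Sum>W'\<in>?B'. \<Sum>W\<in>{W \<in> ?B. W \<inter> E (Suc m) = W'}. ?h W)"
    by (rule sum.group[symmetric]) (use finB between_Int[OF subm(1)] subm(2) in auto)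
  also have "\<dots> = (\<Sum>W'\<in>?B'. real Q ^ (card (jump (Suc m) W') choose 2) * ?G' (jump (Suc m) W'))"
  proof (rule sum_cong)
    fix W' assume W': "W' \<in> ?B'"
    let ?N = "{W \<in> ?B. W \<inter> E (Suc m) = W' \<and> \<not> W \<subseteq> E (Suc m)}"
    let ?S = "jump (Suc m) W'"
    have mS: "m \<notin> ?S" by (simp add: jump_def)
    have W'm: "W' \<in> ?B" using W' Estep(1)[of m] step.hyps by (auto simp: between_def)
    have W's: "W' \<subseteq> E (Suc m)" using W' by (auto simp: between_def)
    have "{W \<in> ?B. W \<inter> E (Suc m) = W'} = insert W' ?N" using W'm W's by auto
    moreover have "W' \<notin> ?N" using W's by auto
    ultimately have "(\<Sum>W\<in>{W \<in> ?B. W \<inter> E (Suc m) = W'}. ?h W) = ?h W' + (\<Sum>W\<in>?N. ?h W)"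
      using finB by simp
    also have "jump m W' = insert m ?S"
      using W's jump_restrict[of m "Suc m" W'] step.hyps by (auto simp: jump_def Int_absorb2)
    also have "(\<Sum>W\<in>?N. ?h W) = (\<Sum>W\<in>?N. real Q ^ (card ?S choose 2) * G ?S)"
    proof (rule sum_cong)
      fix W assume W: "W \<in> ?N"
      have "m \<notin> jump m W" using W by (auto simp: jump_def between_def)
      moreover have "?S = jump m W \<inter> {Suc m..<L}" using jump_restrict[of m "Suc m" W] W step.hyps by auto
      ultimately have "jump m W = ?S" by (auto simp: jump_def not_less_eq_eq le_Suc_eq)
      then show "?h W = real Q ^ (card ?S choose 2) * G ?S" by simp
    qed
    also have "\<dots> = real Q ^ card ?S * (real Q ^ (card ?S choose 2) * G ?S)"
      using card_new[OF _ W'] step.hyps by simp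
    finally show "(\<Sum>W\<in>{W \<in> ?B. W \<inter> E (Suc m) = W'}. ?h W) = real Q ^ (card ?S choose 2) * ?G' ?S"
      using mS by (simp add: choose2_Suc power_add algebra_simps)
  qed
  also have "\<dots> = (\<Sum>S\<in>Pow {Suc m..<L}. real Q ^ (\<Sum>i\<in>S. i - Suc m) * ?G' S)"
    by (rule step.IH)
  also have "\<dots> = (\<Sum>S\<in>Pow {Suc m..<L}. real Q ^ (\<Sum>i\<in>S. i - m) * G S + real Q ^ (\<Sum>i\<in>insert m S. i - m) * G (insert m S))"
  proof (rule sum_cong)
    fix S assume S: "S \<in> Pow {Suc m..<L}"
    then have fS: "finite S" "m \<notin> S" using finite_subset by auto
    have "(\<Sum>i\<in>S. i - m) = (\<Sum>i\<in>S. (i - Suc m) + 1)" by (rule sum_cong) (use S in "force simp: Suc_diff_Suc")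
    then have "(\<Sum>i\<in>S. i - m) = (\<Sum>i\<in>S. i - Suc m) + card S" by (simp only: sum.distrib) simp
    then show "real Q ^ (\<Sum>i\<in>S. i - Suc m) * ?G' S = real Q ^ (\<Sum>i\<in>S. i - m) * G S + real Q ^ (\<Sum>i\<in>insert m S. i - m) * G (insert m S)"
      using fS by (simp add: power_add algebra_simps)
  qed
  also have "\<dots> = (\<Sum>S\<in>Pow {m..<L}. real Q ^ (\<Sum>i\<in>S. i - m) * G S)"
  proof -
    have "{m..<L} = insert m {Suc m..<L}" using step.hyps by auto
    then have "Pow {m..<L} = Pow {Suc m..<L} \<union> insert m ` Pow {Suc m..<L}" by (simp add: Pow_insert)
    moreover have "Pow {Suc m..<L} \<inter> insert m ` Pow {Suc m..<L} = {}" by auto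
    moreover have "inj_on (insert m) (Pow {Suc m..<L})" by (rule inj_on_inverseI[where g = "\<lambda>S. S - {m}"]) auto
    ultimately show ?thesis by (simp add: sum.union_disjoint sum.reindex sum.distrib)
  qed
  finally show ?case .
qed

text \<open>With the sign as \<open>G\<close> the cell sum is the product of 1 - Q^i over i < L, and
  the factor i = 0 vanishes.\<close>

lemma moebius:
  assumes "E L \<noteq> E 0"
  shows "(\<Sum>W\<in>between (E L) (E 0). (-1) ^ card (jump 0 W) * real Q ^ (card (jump 0 W) choose 2)) = 0"
proof -
  have l: "0 < L" using assms by (cases L) auto
  have "(\<Sum>W\<in>between (E L) (E 0). (-1) ^ card (jump 0 W) * real Q ^ (card (jump 0 W) choose 2))
      = (\<Sum>S\<in>Pow {0..<L}. real Q ^ (\<Sum>i\<in>S. i - 0) * (-1) ^ card S)"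
    using schubert_sum[of 0 "\<lambda>S. (-1) ^ card S"] by (simp add: mult.commute)
  also have "\<dots> = (\<Sum>S\<in>Pow {0..<L}. (\<Prod>i\<in>S. - (real Q ^ i)) * (\<Prod>i\<in>{0..<L}-S. 1))"
    by (rule sum_cong) (simp add: power_sum prod_uminus mult.commute)
  also have "\<dots> = (\<Prod>i\<in>{0..<L}. - (real Q ^ i) + 1)" by (rule prod_add[symmetric]) simp
  also have "\<dots> = 0" by (rule prod_zero) (use l in "auto intro!: bexI[of _ 0]")
  finally show ?thesis .
qed

end

lemma filter_prefix:
  assumes "is_partition \<rho>" "i < length \<rho>"
  shows "part \<rho> i \<le> v \<longleftrightarrow> length (filter (\<lambda>x. v < x) \<rho>) \<le> i"
proof -
  let ?S = "{i. i < length \<rho> \<and> v < \<rho> ! i}"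
  have c: "length (filter (\<lambda>x. v < x) \<rho>) = card ?S" by (rule length_filter_conv_card)
  have "?S = {..<card ?S}"
  proof (rule downset_nat)
    fix i j assume j: "j \<in> ?S" "i < j"
    then have "\<rho> ! j \<le> \<rho> ! i" using part_desc[OF assms(1), of i j] by (simp add: part_def)
    then show "i \<in> ?S" using j by simp
  qed simp
  then have "i \<in> ?S \<longleftrightarrow> i < card ?S" by blast
  then show ?thesis using c assms(2) by (auto simp: part_def)
qed

section \<open>Types of primary modules and their submodules\<close>

context polymod
begin

text \<open>Built upwards from \<open>Y\<close>: the next generator comes from the first
  \<open>U v\<close> not inside \<open>Y\<close>, so the enlarged submodule lies in this and all
  later \<open>U w\<close>, while the earlier ones lie in \<open>Y\<close>. Comparability with the
  chain later forces each \<open>U v\<close> to be a member, by cardinality.\<close>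

lemma chain_exists:
  assumes f: "irr f" "degree f > 0"
    and X: "subspace X" "finite X"
    and U: "\<And>v::nat. subspace (U v)" "\<And>v. U v \<subseteq> X" "\<And>v w. v \<le> w \<Longrightarrow> U v \<subseteq> U w" "U K = X"
  shows "subspace Y \<Longrightarrow> Y \<subseteq> X \<Longrightarrow> scale f ` X \<subseteq> Y \<Longrightarrow> (\<And>v. U v \<subseteq> Y \<or> Y \<subseteq> U v) \<Longrightarrow>
    \<exists>E L. primary_chain scale f E L (rcard f) \<and> E 0 = X \<and> E L = Y \<and>
      (\<forall>v. \<forall>i\<le>L. U v \<subseteq> E i \<or> E i \<subseteq> U v)"
proof (induction "card X - card Y" arbitrary: Y rule: less_induct)
  case less
  note Y = less.prems
  let ?Q = "rcard f"
  show ?case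
  proof (cases "Y = X")
    case True
    have "primary_chain scale f (\<lambda>_. X) 0 ?Q"
      by (intro primary_chain.intro polymod_axioms primary_chain_axioms.intro)
        (use f X in "auto intro: subspace_scale")
    then show ?thesis using True U(2) by (intro exI[of _ "\<lambda>_. X"] exI[of _ 0]) auto
  next
    case False
    have finY: "finite Y" using Y(2) X(2) finite_subset by blast
    define v where "v = (LEAST v. \<not> U v \<subseteq> Y)"
    have "\<not> U K \<subseteq> Y" using U(4) False Y(2) by auto
    then have v: "\<not> U v \<subseteq> Y" using LeastI[of "\<lambda>v. \<not> U v \<subseteq> Y" K] by (simp add: v_def)
    have vl: "U w \<subseteq> Y" if "w < v" for w using not_less_Least[of w "\<lambda>v. \<not> U v \<subseteq> Y"] that by (auto simp: v_def)
    obtain e where e: "e \<in> U v" "e \<notin> Y" using v by auto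
    have eX: "e \<in> X" using e U(2) by auto
    have fe: "scale f e \<in> Y" using Y(3) eX by auto
    let ?Y = "adj Y e"
    have c: "card ?Y = ?Q * card Y" "finite ?Y" using card_adj[OF f Y(1) fe e(2) finY] by auto
    have sub: "Y \<subseteq> ?Y" "e \<in> ?Y" using adj_upper[of Y e] Y(1) by auto
    have YX: "?Y \<subseteq> X" by (rule adj_least[OF X(1) Y(2) eX])
    have lt: "card Y < card ?Y" by (rule psubset_card_mono[OF c(2)]) (use sub e in auto)
    have "card ?Y \<le> card X" by (rule card_mono[OF X(2) YX])
    then have meas: "card X - card ?Y < card X - card Y" using lt by simp
    have comp: "U w \<subseteq> ?Y \<or> ?Y \<subseteq> U w" for w
    proof (cases "w < v")
      case True then show ?thesis using vl sub by blast
    next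
      case False
      then have "U v \<subseteq> U w" using U(3) by simp
      moreover have "Y \<subseteq> U v" using Y(4)[of v] v by blast
      ultimately have "?Y \<subseteq> U w" using e by (intro adj_least U(1)) auto
      then show ?thesis ..
    qed
    have "\<exists>E L. primary_chain scale f E L ?Q \<and> E 0 = X \<and> E L = ?Y \<and> (\<forall>v. \<forall>i\<le>L. U v \<subseteq> E i \<or> E i \<subseteq> U v)"
      by (rule less.hyps[OF meas subspace_adj[OF Y(1)] YX _ comp]) (use Y(3) sub in auto)
    then obtain E L where E: "primary_chain scale f E L ?Q" "E 0 = X" "E L = ?Y" "\<forall>v. \<forall>i\<le>L. U v \<subseteq> E i \<or> E i \<subseteq> U v" by blast
    interpret C: primary_chain scale f E L ?Q by (rule E(1))
    define E' where "E' i = (if i \<le> L then E i else Y)" for i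
    have "primary_chain scale f E' (Suc L) ?Q"
    proof (intro primary_chain.intro polymod_axioms primary_chain_axioms.intro f refl)
      fix i assume i: "i \<le> Suc L"
      show "subspace (E' i)" "finite (E' i)" using i C.E Y(1) finY by (auto simp: E'_def)
    next
      fix i assume i: "i < Suc L"
      show "E' (Suc i) \<subseteq> E' i" "card (E' i) = ?Q * card (E' (Suc i))"
        using i C.Estep[of i] E(3) c(1) sub by (auto simp: E'_def less_Suc_eq)
    next
      fix x assume "x \<in> E' 0"
      then show "scale f x \<in> E' (Suc L)" using E(2) Y(3) by (auto simp: E'_def)
    qed
    moreover have "U v \<subseteq> E' i \<or> E' i \<subseteq> U v" for v i using E(4) Y(4) by (auto simp: E'_def)
    ultimately show ?thesis using E(2) by (intro exI[of _ E'] exI[of _ "Suc L"]) (auto simp: E'_def)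
  qed
qed

definition primary :: "'k poly \<Rightarrow> 'v set \<Rightarrow> bool" where
  "primary f X \<longleftrightarrow> subspace X \<and> finite X \<and> (\<exists>K. X \<subseteq> ker (f ^ K))"

text \<open>The type is encoded by the sizes of the kernels of the powers of f. These can be
  computed for submodules without choosing cyclic decompositions, and they are what the conjugacy
  class supplies.\<close>

definition has_type :: "'k poly \<Rightarrow> 'v set \<Rightarrow> nat list \<Rightarrow> bool" where
  "has_type f X \<rho> \<longleftrightarrow> primary f X \<and> is_partition \<rho> \<and>
     (\<forall>v. card (X \<inter> ker (f ^ v)) = (rcard f) ^ pmin \<rho> v)"

lemma ker_mult: "ker g \<subseteq> ker (h * g)"
  by (auto simp: ker_def simp flip: scale_scale)

lemma ker_power_mono: "v \<le> w \<Longrightarrow> ker (f ^ v) \<subseteq> ker (f ^ w)"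
  using ker_mult[of "f ^ v" "f ^ (w - v)"] by (simp add: power_add[symmetric])

lemma ker_one [simp]: "ker 1 = {0}"
  by (auto simp: ker_def)

lemma primary_subspace: "primary f X \<Longrightarrow> subspace W \<Longrightarrow> W \<subseteq> X \<Longrightarrow> primary f W"
  unfolding primary_def using finite_subset by blast

lemma card_type: assumes "has_type f X \<rho>" shows "card X = (rcard f) ^ sum_list \<rho>"
proof -
  obtain K where K: "X \<subseteq> ker (f ^ K)" using assms by (auto simp: has_type_def primary_def)
  let ?K = "max K (sum_list \<rho>)"
  have "X \<inter> ker (f ^ ?K) = X" using K ker_power_mono[of K ?K f] by auto
  then show ?thesis using assms pmin_large[of \<rho> ?K] by (metis has_type_def max.cobounded2)
qed

text \<open>The chain is made to pass through the sums of the kernels of f^v with f X. Such a sum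
  has index Q to the number of parts above v, which is therefore its position; v = 0 gives the
  length of the chain.\<close>

lemma type_chain:
  assumes f: "irr f" "degree f > 0" and X: "has_type f X \<rho>"
  shows "\<exists>E. primary_chain scale f E (length \<rho>) (rcard f) \<and> E 0 = X \<and>
    E (length \<rho>) = scale f ` X \<and> (\<forall>v. E (length (filter (\<lambda>x. v < x) \<rho>)) = ps (X \<inter> ker (f ^ v)) (scale f ` X))"
proof -
  define Q where "Q = rcard f"
  define F where "F = scale f ` X"
  define U where "U v = ps (X \<inter> ker (f ^ v)) F" for v
  have sX: "subspace X" "finite X" "is_partition \<rho>" and cX: "card (X \<inter> ker (f ^ v)) = Q ^ pmin \<rho> v" for v
    using X by (auto simp: has_type_def primary_def Q_def)
  obtain K where K: "X \<subseteq> ker (f ^ K)" using X by (auto simp: has_type_def primary_def)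
  have sF: "subspace F" "F \<subseteq> X" "finite F" using subspace_image[OF sX(1)] image_subset[OF sX(1)] sX(2) by (auto simp: F_def)
  have sk: "subspace (X \<inter> ker g)" for g using sX(1) subspace_ker by (rule subspace_inter)
  have sU: "subspace (U v)" "U v \<subseteq> X" "finite (U v)" for v
    using subspace_ps[OF sk sF(1)] ps_least[OF sX(1) _ sF(2)] finite_ps sX(2) sF(3) by (auto simp: U_def)
  have Umono: "U v \<subseteq> U w" if "v \<le> w" for v w
    unfolding U_def ps_def using ker_power_mono[OF that, of f] by blast
  have FU: "F \<subseteq> U v" for v unfolding U_def by (rule ps_upper(2)[OF sk sF(1)])
  have UK: "U K = X"
  proof
    show "X \<subseteq> U K" using ps_upper(1)[OF sk sF(1), of "f ^ K"] K by (auto simp: U_def)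
  qed (rule sU)
  have kc: "card X = card (X \<inter> ker f) * card F" unfolding F_def by (rule card_image_ker[OF sX(1,2)])
  have cU: "card (U v) * Q ^ length (filter (\<lambda>x. v < x) \<rho>) = card X" for v
  proof -
    let ?B = "card (X \<inter> ker (f ^ v) \<inter> F)"
    \<comment> \<open>The kernel of f^v inside f X is the image of the kernel of f^(v + 1), so its
      size follows from the type.\<close>
    have "X \<inter> ker (f ^ v) \<inter> F = scale f ` (X \<inter> ker (f ^ Suc v))"
    proof (intro equalityI subsetI)
      fix y assume "y \<in> X \<inter> ker (f ^ v) \<inter> F"
      then obtain x where "x \<in> X" "y = scale f x" "scale (f ^ v) (scale f x) = 0" by (auto simp: F_def ker_def)
      then show "y \<in> scale f ` (X \<inter> ker (f ^ Suc v))" by (auto simp: ker_def mult.commute)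
    qed (use sX(1) in "auto simp: F_def ker_def mult.commute intro: subspace_scale")
    moreover have "X \<inter> ker (f ^ Suc v) \<inter> ker f = X \<inter> ker f"
      using ker_power_mono[of 1 "Suc v" f] by auto
    ultimately have 1: "card (X \<inter> ker (f ^ Suc v)) = card (X \<inter> ker f) * ?B"
      using card_image_ker[OF sk, of "f ^ Suc v" f] sX(2) by simp
    have 2: "card (U v) * ?B = card (X \<inter> ker (f ^ v)) * card F"
      unfolding U_def by (rule card_ps[OF sk sF(1)]) (use sX sF in auto)
    have "card (U v) * card (X \<inter> ker (f ^ Suc v)) = card (X \<inter> ker f) * (card (U v) * ?B)" using 1 by simp
    also have "\<dots> = card (X \<inter> ker (f ^ v)) * card X" unfolding 2 kc by simp
    finally have "card (U v) * (Q ^ pmin \<rho> v * Q ^ length (filter (\<lambda>x. v < x) \<rho>)) = Q ^ pmin \<rho> v * card X"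
      unfolding cX pmin_Suc power_add .
    moreover have "Q ^ pmin \<rho> v > 0" unfolding cX[symmetric] by (rule card_subspace_pos[OF sk]) (use sX in simp)
    ultimately have "Q ^ pmin \<rho> v \<noteq> 0" "Q ^ pmin \<rho> v * (card (U v) * Q ^ length (filter (\<lambda>x. v < x) \<rho>)) = Q ^ pmin \<rho> v * card X"
      by (simp_all only: mult_ac)
    then show ?thesis by (metis mult_left_cancel)
  qed
  have "\<exists>E L. primary_chain scale f E L Q \<and> E 0 = X \<and> E L = F \<and> (\<forall>v. \<forall>i\<le>L. U v \<subseteq> E i \<or> E i \<subseteq> U v)"
    unfolding Q_def
    by (rule chain_exists[where U = U and K = K, OF f sX(1,2) sU(1,2) Umono UK sF(1,2)]) (use FU in "auto simp: F_def")
  then obtain E L where E: "primary_chain scale f E L Q" "E 0 = X" "E L = F" "\<And>v i. i \<le> L \<Longrightarrow> U v \<subseteq> E i \<or> E i \<subseteq> U v" by blast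
  interpret C: primary_chain scale f E L Q by (rule E(1))
  have cE: "i \<le> L \<Longrightarrow> card (E i) * Q ^ i = card X" for i
  proof (induction i)
    case 0 then show ?case using E(2) by simp
  next
    case (Suc i) then show ?case using C.Estep(2)[of i] by (simp add: mult_ac)
  qed
  have "U 0 = F"
  proof
    have "X \<inter> ker (f ^ 0) = {0}" using subspace_0[OF sX(1)] by auto
    then show "U 0 \<subseteq> F" by (auto simp: U_def ps_def)
  qed (rule FU)
  moreover have "filter (\<lambda>x. 0 < x) \<rho> = \<rho>" using sX(3) by (auto simp: is_partition_def intro!: filter_True) (metis gr0I)
  ultimately have "card F * Q ^ length \<rho> = card X" using cU[of 0] by simp
  moreover have "card F * Q ^ L = card X" using cE[of L] E(3) by simp
  moreover have "card F > 0" by (rule card_subspace_pos[OF sF(1,3)])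
  ultimately have "Q ^ length \<rho> = Q ^ L" by (metis mult_cancel1 not_gr0)
  then have L: "L = length \<rho>" using C.Q_gt1 by simp
  have "E (length (filter (\<lambda>x. v < x) \<rho>)) = U v" for v
  proof -
    let ?i = "length (filter (\<lambda>x. v < x) \<rho>)"
    have i: "?i \<le> L" using L by simp
    have "card (E ?i) * Q ^ ?i = card (U v) * Q ^ ?i" using cE[OF i] cU by simp
    then have "card (E ?i) = card (U v)" using C.Q_gt1 by simp
    then show ?thesis using E(4)[OF i, of v] C.E(2)[OF i] sU(3)[of v] card_subset_eq by metis
  qed
  then show ?thesis using E L unfolding U_def F_def Q_def by blast
qed

text \<open>Let c be the number of parts above v. Since \<open>W\<close> contains f X, the kernel of
  f^v and \<open>E c\<close> have the same sum with W, so W cuts both down by the same index, Q to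
  the number of jumps from c on. These jumps are the lowered rows of length at most v, exactly those
  in which lowering changes the number of cells in the first v columns.\<close>

lemma type_lower:
  assumes f: "irr f" "degree f > 0" and X: "has_type f X \<rho>"
    and E: "primary_chain scale f E (length \<rho>) Q" "E 0 = X" "E (length \<rho>) = scale f ` X"
      "\<And>v. E (length (filter (\<lambda>x. v < x) \<rho>)) = ps (X \<inter> ker (f ^ v)) (scale f ` X)"
    and W: "W \<in> between (scale f ` X) X"
  shows "has_type f W (lower \<rho> (primary_chain.jump E (length \<rho>) 0 W))"
proof -
  interpret C: primary_chain scale f E "length \<rho>" Q by (rule E(1))
  define S where "S = C.jump 0 W"
  have sX: "subspace X" "finite X" "is_partition \<rho>" and cX: "card (X \<inter> ker (f ^ v)) = Q ^ pmin \<rho> v" for v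
    using X by (auto simp: has_type_def primary_def C.Q)
  have sW: "subspace W" "scale f ` X \<subseteq> W" "W \<subseteq> X" "finite W" using W sX(2) finite_subset by (auto simp: between_def)
  have sF: "subspace (scale f ` X)" "finite (scale f ` X)" using subspace_image[OF sX(1)] sX(2) by auto
  have prim: "primary f W" using primary_subspace X sW by (auto simp: has_type_def)
  have "card (W \<inter> ker (f ^ v)) = Q ^ pmin (lower \<rho> S) v" for v
  proof -
    let ?c = "length (filter (\<lambda>x. v < x) \<rho>)" and ?k = "X \<inter> ker (f ^ v)"
    have c: "?c \<le> length \<rho>" by simp
    have sk: "subspace ?k" "finite ?k" using subspace_inter[OF sX(1) subspace_ker] sX(2) by auto
    have Ec: "E ?c = ps ?k (scale f ` X)" by (rule E(4))
    have sE: "subspace (E ?c)" "finite (E ?c)" using C.E[OF c] by auto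
    have FE: "scale f ` X \<subseteq> E ?c" unfolding Ec by (rule ps_upper(2)[OF sk(1) sF(1)])
    have kE: "?k \<subseteq> E ?c" unfolding Ec by (rule ps_upper(1)[OF sk(1) sF(1)])
    have "ps ?k W = ps (E ?c) W"
    proof
      show "ps ?k W \<subseteq> ps (E ?c) W" using kE by (auto simp: ps_def)
      have sk': "subspace (ps ?k W)" by (rule subspace_ps[OF sk(1) sW(1)])
      have "E ?c \<subseteq> ps ?k W" unfolding Ec
        by (rule ps_least[OF sk']) (use ps_upper[OF sk(1) sW(1)] sW(2) in auto)
      then show "ps (E ?c) W \<subseteq> ps ?k W" using ps_least[OF sk' _ ps_upper(2)[OF sk(1) sW(1)]] by blast
    qed
    then obtain P where P: "P * card (?k \<inter> W) = card ?k * card W" "P * card (E ?c \<inter> W) = card (E ?c) * card W"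
      using card_ps[OF sk(1) sW(1) sk(2) sW(4)] card_ps[OF sE(1) sW(1) sE(2) sW(4)] by simp
    have "card ?k * card W * card (E ?c \<inter> W) = P * card (E ?c \<inter> W) * card (?k \<inter> W)"
      unfolding P(1)[symmetric] by (simp only: mult_ac)
    then have "card ?k * card W * card (E ?c \<inter> W) = card (E ?c) * card W * card (?k \<inter> W)"
      unfolding P(2) .
    moreover have "card W > 0" by (rule card_subspace_pos[OF sW(1,4)])
    ultimately have 1: "card ?k * card (E ?c \<inter> W) = card (E ?c) * card (?k \<inter> W)" by simp
    have Wb: "W \<inter> E ?c \<in> between (E (length \<rho>)) (E ?c)"
      using between_Int[OF sE(1), of W "scale f ` X" X] W FE unfolding E(3) by auto
    have jc: "C.jump ?c (W \<inter> E ?c) = S \<inter> {?c..<length \<rho>}"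
      unfolding S_def by (rule C.jump_restrict) auto
    have 2: "card (E ?c) = Q ^ card (S \<inter> {?c..<length \<rho>}) * card (E ?c \<inter> W)"
      using C.card_jump[OF c Wb] unfolding jc by (simp add: Int_commute)
    have "card (E ?c \<inter> W) > 0" using card_subspace_pos[OF subspace_inter[OF sE(1) sW(1)]] sE(2) by simp
    then have 3: "Q ^ pmin \<rho> v = Q ^ card (S \<inter> {?c..<length \<rho>}) * card (?k \<inter> W)"
      using 1 unfolding 2 cX by (simp add: mult_ac)
    have SN: "S \<subseteq> {..<length \<rho>}" by (auto simp: S_def C.jump_def)
    have "pmin \<rho> v = pmin (lower \<rho> S) v + card (S \<inter> {?c..<length \<rho>})"
    proof -
      have "pmin (lower \<rho> S) v + card (S \<inter> {?c..<length \<rho>})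
          = (\<Sum>i<length \<rho>. min (part \<rho> i - ind S i) v + ind (S \<inter> {?c..<length \<rho>}) i)"
        using sum_ind[of "S \<inter> {?c..<length \<rho>}" "length \<rho>"] SN by (simp add: pmin_lower sum.distrib le_infI1)
      also have "\<dots> = (\<Sum>i<length \<rho>. min (part \<rho> i) v)"
      proof (rule sum_cong)
        fix i assume i: "i \<in> {..<length \<rho>}"
        have "part \<rho> i > 0" using part_pos[OF sX(3)] i by simp
        moreover have "i \<in> {?c..<length \<rho>} \<longleftrightarrow> part \<rho> i \<le> v" using filter_prefix[OF sX(3), of i v] i by simp
        ultimately show "min (part \<rho> i - ind S i) v + ind (S \<inter> {?c..<length \<rho>}) i = min (part \<rho> i) v"
          by (cases "i \<in> S"; cases "part \<rho> i \<le> v") (auto simp: ind_def min_def)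
      qed
      also have "\<dots> = pmin \<rho> v" by (rule pmin_part[OF sX(3), symmetric])
      finally show ?thesis by simp
    qed
    then have "Q ^ pmin (lower \<rho> S) v = card (?k \<inter> W)"
      using 3 C.Q_gt1 by (simp add: power_add mult.commute)
    moreover have "?k \<inter> W = W \<inter> ker (f ^ v)" using sW(3) by auto
    ultimately show ?thesis by simp
  qed
  then show ?thesis unfolding has_type_def S_def[symmetric] using prim C.Q by simp
qed

text \<open>All submodules in one cell have the type read off from its jumps, so the cell sum
  becomes the sum over sets of rows in \<open>EQ\<close>: step i of the chain stands for row i of
  \<open>\<rho>\<close>.\<close>

lemma elementary_sum:
  fixes \<Phi> :: "'v set \<Rightarrow> real"
  assumes f: "irr f" "degree f > 0" and Q: "Q = rcard f"
    and X: "has_type f X \<rho>" and \<Phi>: "\<And>W \<sigma>. has_type f W \<sigma> \<Longrightarrow> \<Phi> W = F \<sigma>"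
  shows "(\<Sum>W\<in>{W \<in> between (scale f ` X) X. card X = Q ^ r * card W}. real Q ^ (r choose 2) * \<Phi> W) = EQ (real Q) r F \<rho>"
proof -
  obtain E where E: "primary_chain scale f E (length \<rho>) Q" "E 0 = X" "E (length \<rho>) = scale f ` X"
      "\<And>v. E (length (filter (\<lambda>x. v < x) \<rho>)) = ps (X \<inter> ker (f ^ v)) (scale f ` X)"
    using type_chain[OF f X] Q by blast
  interpret C: primary_chain scale f E "length \<rho>" Q by (rule E(1))
  let ?G = "\<lambda>S. if card S = r then F (lower \<rho> S) else 0"
  have finX: "finite X" using X by (simp add: has_type_def primary_def)
  have iff: "card X = Q ^ r * card W \<longleftrightarrow> card (C.jump 0 W) = r" if W: "W \<in> between (scale f ` X) X" for W r
  proof -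
    have "card X = Q ^ card (C.jump 0 W) * card W" using C.card_jump[of 0 W] E(2,3) W by simp
    moreover have "card W > 0"
      by (rule card_subspace_pos) (use W finX finite_subset in "auto simp: between_def")
    ultimately show ?thesis using C.Q_gt1 by auto
  qed
  have "(\<Sum>W\<in>{W \<in> between (scale f ` X) X. card X = Q ^ r * card W}. real Q ^ (r choose 2) * \<Phi> W)
      = (\<Sum>W\<in>between (scale f ` X) X. real Q ^ (card (C.jump 0 W) choose 2) * ?G (C.jump 0 W))"
    by (rule sum.mono_neutral_cong_left)
      (use finite_between[OF finX] iff \<Phi> type_lower[OF f X E] in auto)
  also have "\<dots> = (\<Sum>S\<in>Pow {0..<length \<rho>}. real Q ^ (\<Sum>i\<in>S. i - 0) * ?G S)"
    using C.schubert_sum[of 0 ?G] E(2,3) by simp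
  also have "\<dots> = EQ (real Q) r F \<rho>"
    unfolding EQ_def by (rule sum.mono_neutral_cong_right) (auto simp: subs_def atLeast0LessThan)
  finally show ?thesis .
qed

text \<open>Iteration writes x as f^j y plus an element of V; for large j the first term
  vanishes.\<close>

lemma nakayama:
  assumes X: "primary f X" and V: "subspace V" "V \<subseteq> X" "ps (scale f ` X) V = X"
  shows "V = X"
proof
  show "X \<subseteq> V"
  proof
    fix x assume x: "x \<in> X"
    obtain K where K: "X \<subseteq> ker (f ^ K)" using X by (auto simp: primary_def)
    have "\<exists>y\<in>X. \<exists>v\<in>V. x = scale (f ^ j) y + v" for j
    proof (induction j)
      case 0 then show ?case using x subspace_0[OF V(1)] by force
    next
      case (Suc j)
      then obtain y v where yv: "y \<in> X" "v \<in> V" "x = scale (f ^ j) y + v" by blast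
      have "y \<in> ps (scale f ` X) V" using yv V(3) by simp
      then obtain y' v' where y': "y' \<in> X" "v' \<in> V" "y = scale f y' + v'" by (auto simp: ps_def)
      have "x = scale (f ^ Suc j) y' + (scale (f ^ j) v' + v)"
        using yv y' by (simp add: scale_right_distrib mult.commute add.assoc)
      moreover have "scale (f ^ j) v' + v \<in> V" using V(1) y' yv by (simp add: subspace_add subspace_scale)
      ultimately show ?case using y' by blast
    qed
    then obtain y v where "y \<in> X" "v \<in> V" "x = scale (f ^ K) y + v" by blast
    moreover have "scale (f ^ K) y = 0" using K \<open>y \<in> X\<close> by (auto simp: ker_def)
    ultimately show "x \<in> V" by simp
  qed
qed (rule V)

lemma trivial_chain:
  assumes f: "irr f" "degree f > 0"
    and X: "subspace X" "finite X" and Y: "subspace Y" "Y \<subseteq> X" "scale f ` X \<subseteq> Y"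
  shows "\<exists>E L. primary_chain scale f E L (rcard f) \<and> E 0 = X \<and> E L = Y"
  using chain_exists[OF f X, of "\<lambda>_. X" 0 Y] X Y by auto

text \<open>As m > 0, \<open>V\<close> is proper, and by \<open>nakayama\<close> so is f X + V. The
  submodules between f X + V and X then have vanishing Moebius sum; colengths above m do not occur
  because they contain V.\<close>

lemma moebius_sum:
  assumes f: "irr f" "degree f > 0" and Q: "Q = rcard f"
    and X: "primary f X" and V: "subspace V" "V \<subseteq> X" "card X = Q ^ m * card V" "m > 0"
  shows "(\<Sum>r\<le>m. \<Sum>W\<in>{W \<in> between (ps (scale f ` X) V) X. card X = Q ^ r * card W}. (-1) ^ r * real Q ^ (r choose 2)) = 0"
proof -
  have sX: "subspace X" "finite X" using X by (auto simp: primary_def)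
  let ?Y = "ps (scale f ` X) V"
  have sF: "subspace (scale f ` X)" by (rule subspace_image[OF sX(1)])
  have Y: "subspace ?Y" "?Y \<subseteq> X" "scale f ` X \<subseteq> ?Y" "V \<subseteq> ?Y"
    using subspace_ps[OF sF V(1)] ps_least[OF sX(1) image_subset[OF sX(1)] V(2)] ps_upper[OF sF V(1)] by auto
  obtain E L where E: "primary_chain scale f E L Q" "E 0 = X" "E L = ?Y"
    using trivial_chain[OF f sX Y(1-3)] Q by blast
  interpret C: primary_chain scale f E L Q by (rule E(1))
  have Vpos: "card V > 0" using card_subspace_pos[OF V(1)] V(2) sX(2) finite_subset by blast
  have "V \<noteq> X"
  proof
    assume "V = X"
    then have "1 = Q ^ m" using V(3) Vpos by simp
    then show False using C.Q_gt1 V(4) by (metis less_irrefl one_less_power)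
  qed
  then have ne: "E L \<noteq> E 0" using nakayama[OF X V(1,2)] E by auto
  have j: "card X = Q ^ card (C.jump 0 W) * card W" if "W \<in> between ?Y X" for W
    using C.card_jump[of 0 W] E that by simp
  have Wfin: "finite W" "card W > 0" if "W \<in> between ?Y X" for W
    using that sX(2) finite_subset card_subspace_pos by (auto simp: between_def)
  have iff: "card X = Q ^ r * card W \<longleftrightarrow> card (C.jump 0 W) = r" if W: "W \<in> between ?Y X" for W r
    using j[OF W] Wfin[OF W] C.Q_gt1 by auto
  have le: "card (C.jump 0 W) \<le> m" if W: "W \<in> between ?Y X" for W
  proof -
    have "card V \<le> card W" by (rule card_mono[OF Wfin(1)[OF W]]) (use W Y(4) in "auto simp: between_def")
    then have "Q ^ card (C.jump 0 W) * card V \<le> Q ^ m * card V" using j[OF W] V(3) by simp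
    then have "Q ^ card (C.jump 0 W) \<le> Q ^ m" using Vpos by simp
    then show ?thesis using C.Q_gt1 by simp
  qed
  have "(\<Sum>r\<le>m. \<Sum>W\<in>{W \<in> between ?Y X. card X = Q ^ r * card W}. (-1) ^ r * real Q ^ (r choose 2))
      = (\<Sum>r\<in>{..m}. \<Sum>W\<in>{W \<in> between ?Y X. card (C.jump 0 W) = r}. (-1) ^ card (C.jump 0 W) * real Q ^ (card (C.jump 0 W) choose 2))"
    by (intro sum.cong refl) (auto simp: iff)
  also have "\<dots> = (\<Sum>W\<in>between ?Y X. (-1) ^ card (C.jump 0 W) * real Q ^ (card (C.jump 0 W) choose 2))"
    by (rule sum.group) (use finite_between[OF sX(2)] le in auto)
  also have "\<dots> = 0" using C.moebius[OF ne] E by simp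
  finally show ?thesis .
qed

text \<open>The base \<open>b\<close> is left open: the same submodules are measured by length over
  the residue field (b = Q) and by dimension over k (b = q).\<close>

definition subs_index :: "nat \<Rightarrow> 'v set \<Rightarrow> nat \<Rightarrow> 'v set set" where
  "subs_index b X m = {W. subspace W \<and> W \<subseteq> X \<and> card X = b ^ m * card W}"

lemma finite_subs_index: "finite X \<Longrightarrow> finite (subs_index b X m)"
  by (rule finite_subset[of _ "Pow X"]) (auto simp: subs_index_def)

text \<open>Sum with signs and weights over W containing f X and over V inside W. For fixed V the
  sum over W is a Moebius sum and vanishes. The term r = 0 is W = X and gives the sum wanted; the
  terms with r \<ge> 1 are known by induction. This is the recursion of \<open>AH\<close>.\<close>

theorem sum_subs_index:
  fixes \<Phi> :: "'v set \<Rightarrow> real"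
  assumes f: "irr f" "degree f > 0" and Q: "Q = rcard f"
    and \<Phi>: "\<And>W \<sigma>. has_type f W \<sigma> \<Longrightarrow> \<Phi> W = F \<sigma>"
  shows "has_type f X \<rho> \<Longrightarrow> (\<Sum>W\<in>subs_index Q X m. \<Phi> W) = AH (real Q) F m \<rho>"
proof (induction m arbitrary: X \<rho> rule: less_induct)
  case (less m)
  have prim: "primary f X" and sX: "subspace X" "finite X" using less.prems by (auto simp: has_type_def primary_def)
  have Q1: "Q > 1"
    using one_less_power[OF card_field_gt1[where 'k = 'k] f(2)] by (simp add: Q)
  have self: "subs_index Q Z 0 = {Z}" if "subspace Z" "finite Z" for Z
  proof -
    have "W = Z" if "W \<subseteq> Z" "card Z = card W" for W using card_subset_eq[of Z W] that \<open>finite Z\<close> by simp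
    then show ?thesis using that by (auto simp: subs_index_def)
  qed
  show ?case
  proof (cases "m = 0")
    case True
    then show ?thesis using self[OF sX] \<Phi>[OF less.prems] by (simp add: AH.simps[of _ _ 0])
  next
    case False
    let ?el = "\<lambda>r. {W \<in> between (scale f ` X) X. card X = Q ^ r * card W}"
    let ?H = "\<lambda>m W. \<Sum>V\<in>subs_index Q W m. \<Phi> V"
    have fin_el: "finite (?el r)" for r using finite_between[OF sX(2)] by simp
    have "(\<Sum>r\<le>m. \<Sum>W\<in>?el r. (-1) ^ r * real Q ^ (r choose 2) * ?H (m - r) W)
       = (\<Sum>r\<le>m. \<Sum>V\<in>subs_index Q X m. \<Sum>W\<in>{W \<in> ?el r. V \<subseteq> W}. (-1) ^ r * real Q ^ (r choose 2) * \<Phi> V)"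
    proof (rule sum_cong)
      fix r assume r: "r \<in> {..m}"
      have "subs_index Q W (m - r) = {V \<in> subs_index Q X m. V \<subseteq> W}" if W: "W \<in> ?el r" for W
      proof -
        have "Q ^ m = Q ^ r * Q ^ (m - r)" using r by (simp add: power_add[symmetric])
        then have "card X = Q ^ m * card V \<longleftrightarrow> card W = Q ^ (m - r) * card V" for V
          using W Q1 by (auto simp: mult.assoc)
        then show ?thesis using W by (auto simp: subs_index_def between_def)
      qed
      then have "(\<Sum>W\<in>?el r. (-1) ^ r * real Q ^ (r choose 2) * ?H (m - r) W)
         = (\<Sum>W\<in>?el r. \<Sum>V\<in>{V \<in> subs_index Q X m. V \<subseteq> W}. (-1) ^ r * real Q ^ (r choose 2) * \<Phi> V)"
        by (intro sum.cong refl) (simp add: sum_distrib_left)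
      also have "\<dots> = (\<Sum>V\<in>subs_index Q X m. \<Sum>W\<in>{W \<in> ?el r. V \<subseteq> W}. (-1) ^ r * real Q ^ (r choose 2) * \<Phi> V)"
        by (rule sum.swap_restrict) (use fin_el finite_subs_index[OF sX(2)] in auto)
      finally show "(\<Sum>W\<in>?el r. (-1) ^ r * real Q ^ (r choose 2) * ?H (m - r) W) =
        (\<Sum>V\<in>subs_index Q X m. \<Sum>W\<in>{W \<in> ?el r. V \<subseteq> W}. (-1) ^ r * real Q ^ (r choose 2) * \<Phi> V)" .
    qed
    also have "\<dots> = (\<Sum>V\<in>subs_index Q X m. \<Phi> V * (\<Sum>r\<le>m. \<Sum>W\<in>{W \<in> ?el r. V \<subseteq> W}. (-1) ^ r * real Q ^ (r choose 2)))"
      unfolding sum_distrib_left by (subst sum.swap) (simp add: mult_ac)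
    also have "\<dots> = 0"
    proof (rule sum.neutral, rule ballI)
      fix V assume V: "V \<in> subs_index Q X m"
      then have V': "subspace V" "V \<subseteq> X" "card X = Q ^ m * card V" by (auto simp: subs_index_def)
      have sF: "subspace (scale f ` X)" by (rule subspace_image[OF sX(1)])
      have "{W \<in> ?el r. V \<subseteq> W} = {W \<in> between (ps (scale f ` X) V) X. card X = Q ^ r * card W}" for r
        using ps_upper[OF sF V'(1)] ps_least[where A = "scale f ` X" and B = V] unfolding between_def by blast
      then show "\<Phi> V * (\<Sum>r\<le>m. \<Sum>W\<in>{W \<in> ?el r. V \<subseteq> W}. (-1) ^ r * real Q ^ (r choose 2)) = 0"
        using moebius_sum[OF f Q prim V'] False by simp
    qed
    finally have zero: "(\<Sum>r\<le>m. \<Sum>W\<in>?el r. (-1) ^ r * real Q ^ (r choose 2) * ?H (m - r) W) = 0" .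
    have el0: "?el 0 = {X}"
    proof -
      have "W = X" if "W \<subseteq> X" "card X = card W" for W using card_subset_eq[OF sX(2) that(1)] that(2) by simp
      then show ?thesis using sX image_subset[OF sX(1)] by (auto simp: between_def)
    qed
    have "{..m} = insert 0 {1..m}" by auto
    then have "?H m X = - (\<Sum>r\<in>{1..m}. \<Sum>W\<in>?el r. (-1) ^ r * real Q ^ (r choose 2) * ?H (m - r) W)"
      using zero el0 by (simp add: numeral_2_eq_2)
    also have "\<dots> = (\<Sum>r\<in>{1..m}. (-1) ^ (r + 1) * (\<Sum>W\<in>?el r. real Q ^ (r choose 2) * ?H (m - r) W))"
      by (simp add: sum_negf[symmetric] sum_distrib_left mult.assoc)
    also have "\<dots> = (\<Sum>r\<in>{1..m}. (-1) ^ (r + 1) * EQ (real Q) r (AH (real Q) F (m - r)) \<rho>)"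
    proof (intro sum.cong refl arg_cong[where f = "(*) _"])
      fix r assume r: "r \<in> {1..m}"
      show "(\<Sum>W\<in>?el r. real Q ^ (r choose 2) * ?H (m - r) W) = EQ (real Q) r (AH (real Q) F (m - r)) \<rho>"
        by (rule elementary_sum[OF f Q less.prems]) (use less.IH[of "m - r"] r in auto)
    qed
    finally show ?thesis using False by (simp add: AH.simps[of _ _ m])
  qed
qed

text \<open>\<open>c\<close> lists the quotients from the top of the flag downwards, whereas the
  blocks of a parabolic start at the bottom; this is why \<open>rev \<mu>\<close> appears
  later.\<close>

fun fl :: "nat \<Rightarrow> 'v set \<Rightarrow> nat list \<Rightarrow> real" where
  "fl b X [] = (if X = {0} then 1 else 0)"
| "fl b X (m # c) = (\<Sum>W\<in>subs_index b X m. fl b W c)"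

lemma fl_FL:
  assumes f: "irr f" "degree f > 0" and Q: "Q = rcard f"
  shows "has_type f X \<rho> \<Longrightarrow> fl Q X c = FL (real Q) c \<rho>"
proof (induction c arbitrary: X \<rho>)
  case Nil
  have c: "card X = Q ^ sum_list \<rho>" using card_type[OF Nil] Q by simp
  have sX: "subspace X" "finite X" "is_partition \<rho>" using Nil by (auto simp: has_type_def primary_def)
  have Q1: "Q > 1" using one_less_power[OF card_field_gt1[where 'k = 'k] f(2)] by (simp add: Q)
  have "X = {0} \<longleftrightarrow> card X = 1"
    using subspace_0[OF sX(1)] by (auto simp: card_1_singleton_iff)
  also have "\<dots> \<longleftrightarrow> sum_list \<rho> = 0" using c Q1 by simp
  also have "\<dots> \<longleftrightarrow> \<rho> = []" using sX(3) by (cases \<rho>) (auto simp: is_partition_def)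
  finally show ?case by simp
next
  case (Cons m c)
  then show ?case using sum_subs_index[OF f Q, of "\<lambda>W. fl Q W c" "FL (real Q) c" X \<rho> m] by simp
qed

end

section \<open>Flags in sums of coprime components\<close>

definition splittings :: "nat list \<Rightarrow> (nat list \<times> nat list) set" where
  "splittings c = {(a, b). length a = length c \<and> length b = length c \<and> map2 (+) a b = c}"

lemma splittings_Nil [simp]: "splittings [] = {([], [])}"
  by (auto simp: splittings_def)

lemma splittings_Cons: "bij_betw (\<lambda>(i, a, b). (i # a, (m - i) # b)) ({..m} \<times> splittings c) (splittings (m # c))"
proof (rule bij_betw_byWitness[where f' = "\<lambda>(a, b). (hd a, tl a, tl b)"])
  have c: "\<exists>i j a' b'. a = i # a' \<and> b = j # b' \<and> m = i + j \<and> (a', b') \<in> splittings c" if "(a, b) \<in> splittings (m # c)" for a b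
  proof -
    have l: "length a = Suc (length c)" "length b = Suc (length c)" and e: "map2 (+) a b = m # c"
      using that by (auto simp: splittings_def)
    obtain i a' j b' where ab: "a = i # a'" "b = j # b'" using l by (metis length_Suc_conv)
    show ?thesis using e l unfolding ab by (auto simp: splittings_def)
  qed
  show "\<forall>p\<in>splittings (m # c). (case (case p of (a, b) \<Rightarrow> (hd a, tl a, tl b)) of (i, a, b) \<Rightarrow> (i # a, (m - i) # b)) = p"
    using c by fastforce
  show "(\<lambda>(a, b). (hd a, tl a, tl b)) ` splittings (m # c) \<subseteq> {..m} \<times> splittings c"
    using c by fastforce
  have "(i # a, (m - i) # b) \<in> splittings (m # c)" if "i \<le> m" "(a, b) \<in> splittings c" for i a b
    using that unfolding splittings_def by simp
  then show "(\<lambda>(i, a, b). (i # a, (m - i) # b)) ` ({..m} \<times> splittings c) \<subseteq> splittings (m # c)"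
    by auto
qed auto

lemma finite_splittings [simp]: "finite (splittings c)"
proof (induction c)
  case (Cons m c)
  then show ?case using bij_betw_finite[OF splittings_Cons[of m c]] by blast
qed simp

lemma sum_splittings_Cons:
  fixes g h :: "nat list \<Rightarrow> real"
  shows "(\<Sum>(a, b)\<in>splittings (m # c). g a * h b) = (\<Sum>i\<le>m. \<Sum>(a, b)\<in>splittings c. g (i # a) * h ((m - i) # b))"
proof -
  have "(\<Sum>(a, b)\<in>splittings (m # c). g a * h b) = (\<Sum>x\<in>{..m} \<times> splittings c. case (case x of (i, a, b) \<Rightarrow> (i # a, (m - i) # b)) of (a, b) \<Rightarrow> g a * h b)"
    by (rule sum.reindex_bij_betw[OF splittings_Cons, symmetric])
  also have "\<dots> = (\<Sum>(i, p)\<in>{..m} \<times> splittings c. case p of (a, b) \<Rightarrow> g (i # a) * h ((m - i) # b))"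
    by (rule sum.cong) auto
  also have "\<dots> = (\<Sum>i\<le>m. \<Sum>(a, b)\<in>splittings c. g (i # a) * h ((m - i) # b))"
    by (rule sum.cartesian_product[symmetric])
  finally show ?thesis .
qed

context polymod
begin

text \<open>By \<open>nakayama\<close>, f X is smaller than a nonzero X, and a chain with simple
  quotients connects the two.\<close>

lemma primary_card:
  assumes f: "irr f" "degree f > 0"
  shows "primary f X \<Longrightarrow> \<exists>j. card X = (rcard f) ^ j"
proof (induction "card X" arbitrary: X rule: less_induct)
  case less
  let ?Q = "rcard f"
  have X: "subspace X" "finite X" using less.prems by (auto simp: primary_def)
  have Y: "subspace (scale f ` X)" "scale f ` X \<subseteq> X" using subspace_image image_subset X by auto
  show ?case
  proof (cases "scale f ` X = X")
    case True
    have s0: "subspace {0}" by (simp add: subspace_def)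
    have "{0} = X"
      by (rule nakayama[OF less.prems s0]) (use True X subspace_0 in "auto simp: ps_def")
    then show ?thesis by (intro exI[of _ 0]) auto
  next
    case False
    have "card (scale f ` X) < card X" using False Y X by (intro psubset_card_mono) auto
    moreover have "primary f (scale f ` X)" by (rule primary_subspace[OF less.prems Y])
    ultimately obtain j where j: "card (scale f ` X) = ?Q ^ j" using less.hyps by blast
    obtain E L where E: "primary_chain scale f E L ?Q" "E 0 = X" "E L = scale f ` X"
      using trivial_chain[OF f X Y] by blast
    interpret C: primary_chain scale f E L ?Q by (rule E(1))
    have "card X = ?Q ^ card (C.jump 0 (scale f ` X)) * card (scale f ` X)"
      using C.card_jump[of 0 "scale f ` X"] E Y by (auto simp: between_def)
    then show ?thesis unfolding j by (metis power_add)
  qed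
qed

lemma fl_card: "fl b X c \<noteq> 0 \<Longrightarrow> card X = b ^ sum_list c"
proof (induction c arbitrary: X)
  case Nil
  then show ?case by (auto split: if_splits)
next
  case (Cons m c)
  then obtain W where "W \<in> subs_index b X m" "fl b W c \<noteq> 0"
    using sum.not_neutral_contains_not_neutral by (metis fl.simps(2))
  then show ?case using Cons.IH[of W] by (simp add: subs_index_def power_add)
qed

text \<open>All submodules have orders that are powers of q^(deg f), so an index q^m with m not
  divisible by deg f does not occur; the other steps only change the unit of length.\<close>

lemma fl_dilate:
  assumes f: "irr f" "degree f > 0" and q: "q = card (UNIV :: 'k set)"
  shows "primary f X \<Longrightarrow> fl q X c =
    (if \<forall>x\<in>set c. degree f dvd x then fl (q ^ degree f) X (map (\<lambda>x. x div degree f) c) else 0)"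
proof (induction c arbitrary: X)
  case (Cons m c)
  have q1: "q > 1" using card_field_gt1 by (simp add: q)
  have prim: "primary f W" if "W \<in> subs_index q X m" for W
    using primary_subspace[OF Cons.prems] that by (auto simp: subs_index_def)
  show ?case
  proof (cases "degree f dvd m")
    case True
    then have "q ^ m = (q ^ degree f) ^ (m div degree f)" by (simp flip: power_mult)
    then have "subs_index (q ^ degree f) X (m div degree f) = subs_index q X m" by (simp add: subs_index_def)
    then show ?thesis using Cons.IH[OF prim] True by (cases "\<forall>x\<in>set c. degree f dvd x") auto
  next
    case False
    have "subs_index q X m = {}"
    proof (rule ccontr)
      assume "subs_index q X m \<noteq> {}"
      then obtain W where W: "W \<in> subs_index q X m" by auto
      obtain i j where ij: "card X = (q ^ degree f) ^ i" "card W = (q ^ degree f) ^ j"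
        using primary_card[OF f Cons.prems] primary_card[OF f prim[OF W]] unfolding q by blast
      then have "(q ^ degree f) ^ i = q ^ m * (q ^ degree f) ^ j" using W by (simp add: subs_index_def)
      then have "q ^ (degree f * i) = q ^ (m + degree f * j)" by (simp add: power_mult power_add)
      then have "degree f * i = m + degree f * j" using q1 by simp
      then have "degree f dvd m" by (metis dvd_add_left_iff dvd_triv_left)
      then show False using False by simp
    qed
    then show ?thesis using False by simp
  qed
qed simp

text \<open>For compositions of the wrong size both sides vanish, the flag numbers by counting
  elements and the series by homogeneity. The change of unit from q to q^(deg f) is the
  plethysm.\<close>

lemma fl_rser:
  assumes f: "irr f" "degree f > 0" and q: "q = card (UNIV :: 'k set)" and X: "has_type f X \<rho>"
  shows "fl q X c = pleth (degree f) (rser \<rho> (1 / real (q ^ degree f))) (mon c)"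
proof -
  let ?Q = "q ^ degree f"
  have Q1: "?Q > 1" using card_field_gt1 f(2) unfolding q by (metis one_less_power)
  have X': "primary f X" "is_partition \<rho>" using X by (auto simp: has_type_def)
  have "fl ?Q X c = rser \<rho> (1 / real ?Q) (mon c)" for c
  proof (cases "sum_list c = sum_list \<rho>")
    case True
    have "fl ?Q X c = FL (real ?Q) c \<rho>" by (rule fl_FL[OF f _ X]) (simp add: q)
    also have "\<dots> = rser \<rho> (1 / real ?Q) (mon c)" by (rule FL_rser) (use Q1 X' True in "simp_all del: of_nat_power")
    finally show ?thesis .
  next
    case False
    have "fl ?Q X c = 0"
    proof (rule ccontr)
      assume "fl ?Q X c \<noteq> 0"
      then have "card X = ?Q ^ sum_list c" by (rule fl_card)
      moreover have "card X = ?Q ^ sum_list \<rho>" using card_type[OF X] by (simp add: q)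
      ultimately have "?Q ^ sum_list c = ?Q ^ sum_list \<rho>" by simp
      then show False using Q1 False power_inject_exp by blast
    qed
    moreover have "schur \<nu> (mon c) = 0" if "\<nu> \<in> Par (sum_list \<rho>)" for \<nu>
      using schur_degree[of \<nu> "mon c"] that False by (auto simp: Par_def mono_degree_mon)
    ultimately show ?thesis by (simp add: rser_def)
  qed
  then show ?thesis using fl_dilate[OF f q X'(1)] by (simp add: pleth_mon)
qed

text \<open>Letting the variable act as zero turns every finite submodule into a primary one.\<close>

lemma card_subspace_power:
  assumes "subspace X" "finite X"
  shows "\<exists>j. card X = card (UNIV :: 'k set) ^ j"
proof -
  interpret P: polymod "\<lambda>p. scale [:poly p 0:]"
  proof (unfold_locales, goal_cases)
    case (1 a x y) then show ?case by (rule scale_right_distrib)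
  next
    case (2 a b x)
    have "[:poly (a + b) 0:] = [:poly a 0:] + [:poly b 0:]" by simp
    then show ?case by (simp only: scale_left_distrib)
  next
    case (3 a b x)
    have "[:poly (a * b) 0:] = [:poly a 0:] * [:poly b 0:]" by simp
    then show ?case by (simp only: scale_scale)
  next
    case (4 x)
    have "[:poly 1 0:] = (1 :: 'k poly)" by simp
    then show ?case by (simp only: scale_one)
  qed
  have "P.subspace X" using assms by (auto simp: P.subspace_def subspace_def)
  moreover have "X \<subseteq> P.ker ([:0, 1:] ^ 1)" by (auto simp: P.ker_def)
  ultimately have "P.primary [:0, 1:] X" using assms(2) unfolding P.primary_def by blast
  then show ?thesis using P.primary_card[of "[:0, 1:]" X] by (simp add: irreducible_linear_field_poly)
qed

lemma subspace_card_index: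
  assumes "subspace X" "finite X" "subspace W" "W \<subseteq> X"
  shows "\<exists>i. card X = card (UNIV :: 'k set) ^ i * card W"
proof -
  let ?q = "card (UNIV :: 'k set)"
  obtain a where a: "card X = ?q ^ a" using card_subspace_power assms by blast
  obtain b where b: "card W = ?q ^ b" using card_subspace_power[OF assms(3) finite_subset[OF assms(4,2)]] by blast
  have "?q ^ b \<le> ?q ^ a" using card_mono[OF assms(2,4)] a b by simp
  then have "b \<le> a" using card_field_gt1[where 'k = 'k] by simp
  then have "card X = ?q ^ (a - b) * card W" unfolding a b by (simp flip: power_add)
  then show ?thesis ..
qed

context
  fixes p r :: "'k poly" and X Y :: "'v set" and q :: nat
  assumes pr: "bezout p r" and X: "subspace X" "finite X" "X \<subseteq> ker p" and Y: "subspace Y" "finite Y" "Y \<subseteq> ker r"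
    and q: "q = card (UNIV :: 'k set)"
begin

lemma coprime_Int: "X \<inter> Y = {0}"
proof -
  obtain a b where ab: "a * p + b * r = 1" using pr by (auto simp: bezout_def)
  have "v = 0" if "v \<in> X" "v \<in> Y" for v
  proof -
    have "v = scale (a * p + b * r) v" by (simp add: ab)
    also have "\<dots> = scale a (scale p v) + scale b (scale r v)" by (simp add: scale_left_distrib)
    also have "scale p v = 0" using that X(3) by (auto simp: ker_def)
    also have "scale r v = 0" using that Y(3) by (auto simp: ker_def)
    also have "scale a 0 + scale b 0 = 0" by simp
    finally show ?thesis .
  qed
  then show ?thesis using subspace_0 X(1) Y(1) by auto
qed

lemma ps_sub_Int:
  assumes "subspace A" "A \<subseteq> X" "subspace B" "B \<subseteq> Y"
  shows "ps A B \<inter> X = A" "ps A B \<inter> Y = B" "card (ps A B) = card A * card B" "subspace (ps A B)" "ps A B \<subseteq> ps X Y"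
proof -
  show "ps A B \<inter> X = A"
  proof (intro equalityI subsetI)
    fix x assume x: "x \<in> ps A B \<inter> X"
    then obtain a b where ab: "x = a + b" "a \<in> A" "b \<in> B" by (auto simp: ps_def)
    have "b = x - a" using ab by simp
    then have "b \<in> X" using subspace_diff[OF X(1), of x a] x ab assms by auto
    then have "b = 0" using coprime_Int ab assms by auto
    then show "x \<in> A" using ab by simp
  qed (use assms ps_upper(1) in blast)
  show "ps A B \<inter> Y = B"
  proof (intro equalityI subsetI)
    fix x assume x: "x \<in> ps A B \<inter> Y"
    then obtain a b where ab: "x = a + b" "a \<in> A" "b \<in> B" by (auto simp: ps_def)
    have "a = x - b" using ab by simp
    then have "a \<in> Y" using subspace_diff[OF Y(1), of x b] x ab assms by auto
    then have "a = 0" using coprime_Int ab assms by auto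
    then show "x \<in> B" using ab by simp
  qed (use assms ps_upper(2) in blast)
  have "A \<inter> B = {0}" using coprime_Int assms subspace_0 by blast
  then show "card (ps A B) = card A * card B"
    using card_ps[OF assms(1,3)] assms X(2) Y(2) finite_subset by fastforce
qed (use assms subspace_ps in "auto simp: ps_def")

text \<open>The component of w in X is (b r) w, because p kills X and r kills Y; so it stays in
  every submodule containing w.\<close>

lemma subspace_split:
  assumes W: "subspace W" "W \<subseteq> ps X Y"
  shows "ps (W \<inter> X) (W \<inter> Y) = W"
proof (intro equalityI subsetI)
  obtain a b where ab: "a * p + b * r = 1" using pr by (auto simp: bezout_def)
  fix w assume w: "w \<in> W"
  then obtain x y where xy: "w = x + y" "x \<in> X" "y \<in> Y" using W(2) by (auto simp: ps_def)
  have "x = scale (a * p + b * r) x" by (simp add: ab)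
  also have "\<dots> = scale a (scale p x) + scale b (scale r x)" by (simp add: scale_left_distrib)
  also have "\<dots> = scale b (scale r x) + scale b (scale r y)"
  proof -
    have k: "scale p x = 0" "scale r y = 0" using xy X(3) Y(3) by (auto simp: ker_def)
    show ?thesis unfolding k by simp
  qed
  also have "\<dots> = scale b (scale r w)" by (simp only: xy(1) scale_right_distrib)
  finally have x: "x \<in> W" using W(1) w subspace_scale by metis
  have "y = w - x" using xy by simp
  then have "y \<in> W" using subspace_diff[OF W(1) w x] by simp
  then show "w \<in> ps (W \<inter> X) (W \<inter> Y)" using x xy by (auto simp: ps_def)
qed (use W subspace_add in "auto simp: ps_def")

text \<open>A submodule corresponds to the pair of its intersections with X and Y; orders multiply,
  so the exponents of the two indices add up to m.\<close>

lemma sum_subs_index_ps: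
  fixes F :: "'v set \<Rightarrow> real"
  shows "(\<Sum>W\<in>subs_index q (ps X Y) m. F W) = (\<Sum>i\<le>m. \<Sum>A\<in>subs_index q X i. \<Sum>B\<in>subs_index q Y (m - i). F (ps A B))"
proof -
  let ?S = "SIGMA i:{..m}. subs_index q X i \<times> subs_index q Y (m - i)"
  have q1: "q > 1" using card_field_gt1 by (simp add: q)
  have cXY: "card (ps X Y) = card X * card Y" by (rule ps_sub_Int) (use X Y in auto)
  have pos: "card A > 0" if "subspace A" "A \<subseteq> X \<or> A \<subseteq> Y" for A
    using that card_subspace_pos X(2) Y(2) finite_subset by blast
  have "bij_betw (\<lambda>(i, A, B). ps A B) ?S (subs_index q (ps X Y) m)"
    unfolding bij_betw_def
  proof
    show "inj_on (\<lambda>(i, A, B). ps A B) ?S"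
    proof (rule inj_onI)
      fix x x' assume "x \<in> ?S" "x' \<in> ?S" "(case x of (i, A, B) \<Rightarrow> ps A B) = (case x' of (i, A, B) \<Rightarrow> ps A B)"
      then obtain i A B i' A' B' where x: "x = (i, A, B)" "x' = (i', A', B')"
        and a: "A \<in> subs_index q X i" "B \<in> subs_index q Y (m - i)" "A' \<in> subs_index q X i'" "B' \<in> subs_index q Y (m - i')"
        and eq: "ps A B = ps A' B'" by auto
      have s: "subspace A" "A \<subseteq> X" "subspace B" "B \<subseteq> Y" "subspace A'" "A' \<subseteq> X" "subspace B'" "B' \<subseteq> Y"
        "card X = q ^ i * card A" "card X = q ^ i' * card A'"
        using a by (auto simp: subs_index_def)
      have AB: "A = A'" "B = B'" using ps_sub_Int(1,2)[OF s(1-4)] ps_sub_Int(1,2)[OF s(5-8)] eq by auto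
      then have "q ^ i * card A = q ^ i' * card A" using s(9,10) by metis
      then have "q ^ i = q ^ i'" using pos[OF s(1)] s(2) by (metis less_irrefl mult_right_cancel)
      then show "x = x'" using x AB q1 by simp
    qed
    show "(\<lambda>(i, A, B). ps A B) ` ?S = subs_index q (ps X Y) m"
    proof (intro equalityI subsetI)
      fix W assume "W \<in> (\<lambda>(i, A, B). ps A B) ` ?S"
      then obtain i A B where W: "W = ps A B" "i \<le> m" "A \<in> subs_index q X i" "B \<in> subs_index q Y (m - i)" by auto
      then have s: "subspace A" "A \<subseteq> X" "subspace B" "B \<subseteq> Y" and c: "card X = q ^ i * card A" "card Y = q ^ (m - i) * card B"
        by (auto simp: subs_index_def)
      have "card (ps X Y) = q ^ i * q ^ (m - i) * card W"
        unfolding cXY c W(1) ps_sub_Int(3)[OF s] by simp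
      then have "card (ps X Y) = q ^ m * card W" using W(2) by (simp flip: power_add)
      then show "W \<in> subs_index q (ps X Y) m" using ps_sub_Int(4,5)[OF s] W(1) by (simp add: subs_index_def)
    next
      fix W assume "W \<in> subs_index q (ps X Y) m"
      then have W: "subspace W" "W \<subseteq> ps X Y" "card (ps X Y) = q ^ m * card W" by (auto simp: subs_index_def)
      let ?A = "W \<inter> X" and ?B = "W \<inter> Y"
      have s: "subspace ?A" "?A \<subseteq> X" "subspace ?B" "?B \<subseteq> Y" using W X Y subspace_inter by auto
      have Weq: "ps ?A ?B = W" by (rule subspace_split[OF W(1,2)])
      obtain i j where ij: "card X = q ^ i * card ?A" "card Y = q ^ j * card ?B"
        using subspace_card_index[OF X(1,2) s(1,2)] subspace_card_index[OF Y(1,2) s(3,4)] unfolding q by blast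
      have cW: "card W = card ?A * card ?B" using ps_sub_Int(3)[OF s] by (simp only: Weq)
      have "card (ps X Y) = q ^ (i + j) * card W" unfolding cXY ij cW by (simp add: power_add)
      then have "q ^ (i + j) * card W = q ^ m * card W" using W(3) by (simp only:)
      moreover have "card W > 0" using cW pos s by simp
      ultimately have "q ^ (i + j) = q ^ m" by (metis less_irrefl mult_right_cancel)
      then have "i + j = m" using q1 by simp
      then have "(i, ?A, ?B) \<in> ?S" using ij s by (auto simp: subs_index_def)
      then show "W \<in> (\<lambda>(i, A, B). ps A B) ` ?S" using Weq by force
    qed
  qed
  then have "(\<Sum>W\<in>subs_index q (ps X Y) m. F W) = (\<Sum>x\<in>?S. F (case x of (i, A, B) \<Rightarrow> ps A B))"
    by (rule sum.reindex_bij_betw[symmetric])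
  also have "\<dots> = (\<Sum>i\<le>m. \<Sum>x\<in>subs_index q X i \<times> subs_index q Y (m - i). F (ps (fst x) (snd x)))"
    by (subst sum.Sigma) (use finite_subs_index X(2) Y(2) in "auto simp: case_prod_beta")
  also have "\<dots> = (\<Sum>i\<le>m. \<Sum>A\<in>subs_index q X i. \<Sum>B\<in>subs_index q Y (m - i). F (ps A B))"
    by (simp add: sum.cartesian_product case_prod_beta)
  finally show ?thesis .
qed

end

lemma fl_ps:
  assumes pr: "bezout p r" and q: "q = card (UNIV :: 'k set)"
  shows "subspace X \<Longrightarrow> finite X \<Longrightarrow> X \<subseteq> ker p \<Longrightarrow> subspace Y \<Longrightarrow> finite Y \<Longrightarrow> Y \<subseteq> ker r \<Longrightarrow>
    fl q (ps X Y) c = (\<Sum>(a, b)\<in>splittings c. fl q X a * fl q Y b)"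
proof (induction c arbitrary: X Y)
  case Nil
  have "ps X Y = {0} \<longleftrightarrow> X = {0} \<and> Y = {0}"
    using ps_upper[OF Nil(1,4)] subspace_0[OF Nil(1)] subspace_0[OF Nil(4)] by (auto simp: ps_def)
  then show ?case by simp
next
  case (Cons m c)
  have IH: "fl q (ps A B) c = (\<Sum>(a, b)\<in>splittings c. fl q A a * fl q B b)"
    if "A \<in> subs_index q X i" "B \<in> subs_index q Y j" for A B i j
    by (rule Cons.IH) (use that Cons.prems finite_subset in "auto simp: subs_index_def")
  have "fl q (ps X Y) (m # c) = (\<Sum>i\<le>m. \<Sum>A\<in>subs_index q X i. \<Sum>B\<in>subs_index q Y (m - i). fl q (ps A B) c)"
    using sum_subs_index_ps[OF pr Cons.prems q, of "\<lambda>W. fl q W c" m] by simp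
  also have "\<dots> = (\<Sum>i\<le>m. \<Sum>A\<in>subs_index q X i. \<Sum>B\<in>subs_index q Y (m - i). \<Sum>s\<in>splittings c. fl q A (fst s) * fl q B (snd s))"
    by (intro sum.cong refl) (auto simp: IH case_prod_beta)
  also have "\<dots> = (\<Sum>i\<le>m. \<Sum>s\<in>splittings c. (\<Sum>A\<in>subs_index q X i. fl q A (fst s)) * (\<Sum>B\<in>subs_index q Y (m - i). fl q B (snd s)))"
  proof (rule sum_cong)
    fix i
    have "(\<Sum>A\<in>subs_index q X i. \<Sum>B\<in>subs_index q Y (m - i). \<Sum>s\<in>splittings c. fl q A (fst s) * fl q B (snd s))
       = (\<Sum>A\<in>subs_index q X i. \<Sum>s\<in>splittings c. \<Sum>B\<in>subs_index q Y (m - i). fl q A (fst s) * fl q B (snd s))"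
      by (intro sum.cong refl sum.swap)
    also have "\<dots> = (\<Sum>s\<in>splittings c. \<Sum>A\<in>subs_index q X i. \<Sum>B\<in>subs_index q Y (m - i). fl q A (fst s) * fl q B (snd s))"
      by (rule sum.swap)
    finally show "(\<Sum>A\<in>subs_index q X i. \<Sum>B\<in>subs_index q Y (m - i). \<Sum>s\<in>splittings c. fl q A (fst s) * fl q B (snd s))
       = (\<Sum>s\<in>splittings c. (\<Sum>A\<in>subs_index q X i. fl q A (fst s)) * (\<Sum>B\<in>subs_index q Y (m - i). fl q B (snd s)))"
      by (simp only: sum_product)
  qed
  also have "\<dots> = (\<Sum>(a, b)\<in>splittings (m # c). fl q X a * fl q Y b)"
    unfolding sum_splittings_Cons by (simp add: case_prod_beta)
  finally show ?case .
qed

lemma ker_coprime: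
  assumes pr: "bezout p r" and V: "subspace V"
  shows "V \<inter> ker (p * r) = ps (V \<inter> ker p) (V \<inter> ker r)"
proof (intro equalityI subsetI)
  obtain a b where ab: "a * p + b * r = 1" using pr by (auto simp: bezout_def)
  fix v assume v: "v \<in> V \<inter> ker (p * r)"
  then have k: "scale (p * r) v = 0" by (simp add: ker_def)
  have "v = scale (b * r) v + scale (a * p) v" by (metis ab add.commute scale_left_distrib scale_one)
  moreover have "scale p (scale (b * r) v) = scale b (scale (p * r) v)" "scale r (scale (a * p) v) = scale a (scale (p * r) v)"
    by (simp_all only: scale_scale mult_ac)
  then have "scale (b * r) v \<in> V \<inter> ker p" "scale (a * p) v \<in> V \<inter> ker r"
    using v subspace_scale[OF V] unfolding k by (auto simp: ker_def)
  ultimately show "v \<in> ps (V \<inter> ker p) (V \<inter> ker r)" unfolding ps_def by blast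
next
  have "V \<inter> ker p \<subseteq> V \<inter> ker (p * r)" using ker_mult[of p r] by (auto simp: mult.commute)
  moreover have "V \<inter> ker r \<subseteq> V \<inter> ker (p * r)" using ker_mult[of r p] by auto
  moreover have "subspace (V \<inter> ker (p * r))" by (rule subspace_inter[OF V subspace_ker])
  ultimately show "v \<in> ps (V \<inter> ker p) (V \<inter> ker r) \<Longrightarrow> v \<in> V \<inter> ker (p * r)" for v using ps_least by blast
qed

lemma fl_zero: assumes "q > 1" shows "fl q {0} c = series_one (mon c)"
proof -
  have "mon c = 0 \<longleftrightarrow> (\<forall>x\<in>set c. x = 0)"
    by (auto simp: poly_mapping_eq_iff fun_eq_iff part_def all_set_conv_all_nth)
  moreover have "fl q {0} c = (if \<forall>x\<in>set c. x = 0 then 1 else 0)"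
  proof (induction c)
    case (Cons m c)
    have "subs_index q {0} m = (if m = 0 then {{0}} else {})"
    proof -
      have "subspace W \<and> W \<subseteq> {0} \<longleftrightarrow> W = {0}" for W
        using subspace_0[of W] by (auto simp: subspace_def)
      then show ?thesis using assms by (auto simp: subs_index_def)
    qed
    then show ?case using Cons.IH by simp
  qed simp
  ultimately show ?thesis by (simp add: series_one_def)
qed

text \<open>The kernels of f^K in V are the primary components, with types given by the kernel
  sizes; their flag functions are multiplied by induction over subsets of \<open>S\<close>, using
  coprimality. The order of \<open>V\<close> guarantees that the components fill it.\<close>

theorem fl_symmetric_function:
  assumes q: "q = card (UNIV :: 'k set)" and V: "subspace V" "finite V" and S: "finite S"
    and irr: "\<And>f. f \<in> S \<Longrightarrow> irr f \<and> degree f > 0"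
    and cop: "\<And>f g. f \<in> S \<Longrightarrow> g \<in> S \<Longrightarrow> f \<noteq> g \<Longrightarrow> bezout f g"
    and part: "\<And>f. f \<in> S \<Longrightarrow> is_partition (\<phi> f)"
    and ck: "\<And>f v. f \<in> S \<Longrightarrow> card (V \<inter> ker (f ^ v)) = (q ^ degree f) ^ pmin (\<phi> f) v"
    and cV: "card V = (\<Prod>f\<in>S. (q ^ degree f) ^ sum_list (\<phi> f))"
  shows "\<exists>u\<in>Sym. (\<forall>c. fl q V c = u (mon c)) \<and>
    thoma_spec \<alpha> \<beta> 1 u = (\<Prod>f\<in>S. r_fun (\<phi> f) (thoma_spec \<alpha> \<beta> (degree f)) ((1 / real q) ^ degree f))"
proof -
  have q1: "q > 1" using card_field_gt1 by (simp add: q)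
  \<comment> \<open>\<open>K\<close> bounds the size of every partition involved, so the kernels of
    the powers of each f are stationary from exponent K on.\<close>
  define K where "K = (\<Sum>f\<in>S. sum_list (\<phi> f))"
  let ?h = "thoma_spec \<alpha> \<beta> 1"
  let ?Y = "\<lambda>F. V \<inter> ker (\<Prod>f\<in>F. f ^ K)"
  let ?r = "\<lambda>f. r_fun (\<phi> f) (thoma_spec \<alpha> \<beta> (degree f)) ((1 / real q) ^ degree f)"
  have hom: "sym_alg_hom ?h" by (rule thoma_hom)
  have sk: "subspace (V \<inter> ker g)" "finite (V \<inter> ker g)" for g
    using subspace_inter[OF V(1) subspace_ker] V(2) by auto
  have ht: "has_type f (V \<inter> ker (f ^ K)) (\<phi> f)" if f: "f \<in> S" for f
  proof -
    have le: "sum_list (\<phi> f) \<le> K" unfolding K_def by (rule member_le_sum) (use f S in auto)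
    have "pmin (\<phi> f) (min K v) = pmin (\<phi> f) v" for v
      using le pmin_large[of "\<phi> f"] by (cases "v \<le> K") (auto simp: min_def)
    moreover have "V \<inter> ker (f ^ K) \<inter> ker (f ^ v) = V \<inter> ker (f ^ min K v)" for v
      using ker_power_mono[of K v f] ker_power_mono[of v K f] by (auto simp: min_def)
    ultimately have "card (V \<inter> ker (f ^ K) \<inter> ker (f ^ v)) = (q ^ degree f) ^ pmin (\<phi> f) v" for v
      using ck[OF f] by simp
    then show ?thesis unfolding has_type_def primary_def using sk part[OF f] q by blast
  qed
  have one: "\<exists>u\<in>Sym. (\<forall>c. fl q (V \<inter> ker (f ^ K)) c = u (mon c)) \<and> ?h u = ?r f" if f: "f \<in> S" for f
  proof -
    let ?d = "degree f" and ?t = "1 / real (q ^ degree f)"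
    have f': "irr f" "?d > 0" using irr[OF f] by auto
    have s: "schur \<nu> \<in> Sym" if "\<nu> \<in> Par (sum_list (\<phi> f))" for \<nu>
      using that schur_Sym by (auto simp: Par_def)
    have r: "rser (\<phi> f) ?t = (\<lambda>a. inverse (?t ^ n_stat (\<phi> f)) *
        (\<Sum>\<nu>\<in>Par (sum_list (\<phi> f)). poly (kostka_foulkes \<nu> (\<phi> f)) ?t * schur \<nu> a))"
      by (rule ext) (simp only: rser_def)
    have "thoma_spec \<alpha> \<beta> ?d (rser (\<phi> f) ?t) = inverse (?t ^ n_stat (\<phi> f)) * thoma_spec \<alpha> \<beta> ?d
        (\<lambda>a. \<Sum>\<nu>\<in>Par (sum_list (\<phi> f)). poly (kostka_foulkes \<nu> (\<phi> f)) ?t * schur \<nu> a)"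
      unfolding r by (rule sym_alg_hom_scale[OF thoma_hom]) (intro Sym_sum Sym_scale s)
    also have "\<dots> = r_fun (\<phi> f) (thoma_spec \<alpha> \<beta> ?d) ?t"
      unfolding r_fun_def by (subst hom_sum[OF thoma_hom finite_partitions_of s]) auto
    also have "?t = (1 / real q) ^ ?d" by (simp add: power_one_over)
    finally have "?h (pleth ?d (rser (\<phi> f) ?t)) = ?r f"
      using thoma_spec_pleth[OF _ rser_Sym, of ?d \<alpha> \<beta> "\<phi> f" ?t] f'(2) by (simp add: power_one_over)
    moreover have "fl q (V \<inter> ker (f ^ K)) c = pleth ?d (rser (\<phi> f) ?t) (mon c)" for c
      by (rule fl_rser[OF f' q ht[OF f]])
    ultimately show ?thesis using pleth_Sym[OF rser_Sym] by blast
  qed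
  have "(\<exists>u\<in>Sym. (\<forall>c. fl q (?Y F) c = u (mon c)) \<and> ?h u = (\<Prod>f\<in>F. ?r f)) \<and>
      card (?Y F) = (\<Prod>f\<in>F. (q ^ degree f) ^ sum_list (\<phi> f))" if "F \<subseteq> S" for F
    using finite_subset[OF that S] that
  proof (induction F rule: finite_induct)
    case empty
    have "?Y {} = {0}" using subspace_0[OF V(1)] by auto
    moreover have "?h series_one = 1" using hom by (simp add: sym_alg_hom_def)
    ultimately show ?case using fl_zero[OF q1] series_one_Sym by auto
  next
    case (insert f F)
    have f: "f \<in> S" and F: "F \<subseteq> S" using insert.prems by auto
    obtain u where u: "u \<in> Sym" "\<And>c. fl q (?Y F) c = u (mon c)" "?h u = (\<Prod>f\<in>F. ?r f)"
      and cF: "card (?Y F) = (\<Prod>f\<in>F. (q ^ degree f) ^ sum_list (\<phi> f))" using insert.IH[OF F] by blast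
    obtain w where w: "w \<in> Sym" "\<And>c. fl q (V \<inter> ker (f ^ K)) c = w (mon c)" "?h w = ?r f" using one[OF f] by blast
    have bz: "bezout (f ^ K) (\<Prod>f\<in>F. f ^ K)"
    proof -
      have "bezout (\<Prod>g\<in>F. g ^ K) (f ^ K)"
      proof (rule bezout_prod)
        fix g assume "g \<in> F"
        then have "bezout g f" using cop[of g f] f F insert.hyps by auto
        then have "bezout (g ^ K) f" by (rule bezout_power)
        then show "bezout (g ^ K) (f ^ K)" using bezout_power bezout_commute by blast
      qed
      then show ?thesis by (simp add: bezout_commute)
    qed
    have Y: "?Y (insert f F) = ps (V \<inter> ker (f ^ K)) (?Y F)"
      using ker_coprime[OF bz V(1)] insert.hyps by simp
    have "fl q (?Y (insert f F)) c = series_mult w u (mon c)" for c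
      unfolding Y series_mult_mon splittings_def[symmetric]
      by (subst fl_ps[OF bz q sk _ sk]) (auto simp: w(2) u(2))
    moreover have "?h (series_mult w u) = ?h w * ?h u" using hom w u by (simp add: sym_alg_hom_def)
    moreover have "card (?Y (insert f F)) = card (V \<inter> ker (f ^ K)) * card (?Y F)"
      unfolding Y by (rule ps_sub_Int(3)[OF bz sk _ sk _ q sk(1) _ sk(1)]) auto
    moreover have "card (V \<inter> ker (f ^ K)) = (q ^ degree f) ^ sum_list (\<phi> f)"
      using card_type[OF ht[OF f]] by (simp add: q)
    ultimately show ?case using series_mult_Sym[OF w(1) u(1)] insert.hyps cF w(3) u(3) by auto
  qed
  from this[OF subset_refl] have 1: "\<exists>u\<in>Sym. (\<forall>c. fl q (?Y S) c = u (mon c)) \<and> ?h u = (\<Prod>f\<in>S. ?r f)"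
    and 2: "card (?Y S) = card V" unfolding cV by blast+
  have "?Y S = V" by (rule card_subset_eq[OF V(2) _ 2]) simp
  then show ?thesis using 1 by simp
qed

end

section \<open>Kernels read off from the conjugacy class\<close>

text \<open>If one divided the other, the cofactor would be a constant, equal to 1 because both are
  monic.\<close>

lemma irred_bezout:
  assumes "f \<in> irred_polys" "h \<in> irred_polys" "f \<noteq> h"
  shows "bezout f h"
proof (rule bezout_irreducible)
  show "irr f" using assms by (simp add: irred_polys_def)
  show "\<not> f dvd h"
  proof
    assume "f dvd h"
    then obtain u where u: "h = f * u" by (auto simp: dvd_def)
    have "\<not> f dvd 1" using assms by (simp add: irred_polys_def Factorial_Ring.irreducible_def)
    then have "u dvd 1" using u assms irreducibleD by (auto simp: irred_polys_def)
    then obtain c where c: "u = [:c:]" by (auto simp: is_unit_poly_iff)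
    have "lead_coeff h = lead_coeff f * c" by (simp add: u c lead_coeff_mult)
    then have "c = 1" using assms by (simp add: irred_polys_def)
    then show False using u c assms by (simp add: one_pCons[symmetric])
  qed
qed

lemma irred_degree: "f \<in> irred_polys \<Longrightarrow> degree f > 0"
  by (auto simp: irred_polys_def Factorial_Ring.irreducible_def is_unit_iff_degree intro!: Nat.gr0I)

definition coset :: "'a::comm_ring_1 \<Rightarrow> 'a \<Rightarrow> 'a set" where "coset F a = {y. F dvd y - a}"

lemma coset_eq_iff: "coset F a = coset F b \<longleftrightarrow> F dvd a - b"
proof
  assume "coset F a = coset F b"
  moreover have "a \<in> coset F a" by (simp add: coset_def)
  ultimately show "F dvd a - b" by (simp add: coset_def)
next
  assume ab: "F dvd a - b"
  have "F dvd y - a \<longleftrightarrow> F dvd y - b" for y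
    using dvd_add[of F "y - a" "a - b"] dvd_diff[of F "y - b" "a - b"] ab by auto
  then show "coset F a = coset F b" by (simp add: coset_def)
qed

lemma PIdl_class_ring: "PIdl\<^bsub>class_ring\<^esub> F = coset F 0"
  by (auto simp: cgenideal_def class_ring_simps coset_def dvd_def mult.commute)

lemma a_r_coset_class_ring: "coset F 0 +>\<^bsub>class_ring\<^esub> a = coset F a"
  by (force simp: a_r_coset_def r_coset_def class_ring_simps coset_def)

lemma quotient_module_simps:
  "carrier (quotient_module class_ring (PIdl\<^bsub>class_ring\<^esub> F)) = range (coset F)"
  "zero (quotient_module class_ring (PIdl\<^bsub>class_ring\<^esub> F)) = coset F 0"
  "p \<odot>\<^bsub>quotient_module class_ring (PIdl\<^bsub>class_ring\<^esub> F)\<^esub> coset F r = coset F (p * r)"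
proof -
  show "carrier (quotient_module class_ring (PIdl\<^bsub>class_ring\<^esub> F)) = range (coset F)"
    by (auto simp: quotient_module_def FactRing_def A_RCOSETS_def' PIdl_class_ring a_r_coset_class_ring class_ring_simps)
  show "zero (quotient_module class_ring (PIdl\<^bsub>class_ring\<^esub> F)) = coset F 0"
    by (simp add: quotient_module_def FactRing_def PIdl_class_ring)
  have "coset F (a * b) = coset F (p * r)" if "a \<in> coset F p" "b \<in> coset F r" for a b
  proof -
    have "a * b - p * r = (a - p) * b + p * (b - r)" by (simp add: algebra_simps)
    then show ?thesis unfolding coset_eq_iff using that by (simp add: coset_def)
  qed
  moreover have "p \<in> coset F p" "r \<in> coset F r" by (simp_all add: coset_def)
  ultimately have "(\<Union>a\<in>coset F p. \<Union>b\<in>coset F r. coset F (a * b)) = coset F (p * r)" by blast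
  then show "p \<odot>\<^bsub>quotient_module class_ring (PIdl\<^bsub>class_ring\<^esub> F)\<^esub> coset F r = coset F (p * r)"
    by (simp add: quotient_module_def FactRing_def rcoset_mult_def PIdl_class_ring a_r_coset_class_ring class_ring_simps)
qed

lemma polys_below_iff': "p \<in> polys_below d \<longleftrightarrow> p = 0 \<or> degree p < d"
  by (cases "d = 0") (auto simp: polys_below_iff, auto simp: polys_below_def poly_eq_iff)

text \<open>The annihilated classes are those of the multiples of A, and A s with s a remainder
  modulo B represents each of them once.\<close>

lemma card_quotient_annihilated:
  fixes F A B p :: "'k::{field,finite} poly"
  assumes F: "F = A * B" "F \<noteq> 0" and iff: "\<And>r. F dvd p * r \<longleftrightarrow> A dvd r"
  shows "card {X \<in> range (coset F). p \<odot>\<^bsub>quotient_module class_ring (PIdl\<^bsub>class_ring\<^esub> F)\<^esub> X = coset F 0}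
    = card (UNIV :: 'k set) ^ degree B"
proof -
  have AB: "A \<noteq> 0" "B \<noteq> 0" using F by auto
  let ?Z = "{X \<in> range (coset F). p \<odot>\<^bsub>quotient_module class_ring (PIdl\<^bsub>class_ring\<^esub> F)\<^esub> X = coset F 0}"
  have Z: "coset F r \<in> ?Z \<longleftrightarrow> A dvd r" for r
    by (auto simp: quotient_module_simps coset_eq_iff iff)
  have "bij_betw (\<lambda>s. coset F (A * s)) (polys_below (degree B)) ?Z"
    unfolding bij_betw_def
  proof
    show "inj_on (\<lambda>s. coset F (A * s)) (polys_below (degree B))"
    proof (rule inj_onI)
      fix s s' assume s: "s \<in> polys_below (degree B)" "s' \<in> polys_below (degree B)" "coset F (A * s) = coset F (A * s')"
      have "A * B dvd A * (s - s')" using s(3) by (simp add: coset_eq_iff F(1) right_diff_distrib)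
      then have d: "B dvd s - s'" using AB by simp
      have "s - s' \<in> polys_below (degree B)" using s by (simp add: polys_below_def)
      then show "s = s'" using d dvd_imp_degree_le[of B "s - s'"] unfolding polys_below_iff' by (metis eq_iff_diff_eq_0 not_less)
    qed
    show "(\<lambda>s. coset F (A * s)) ` polys_below (degree B) = ?Z"
    proof (intro equalityI subsetI)
      fix X assume X: "X \<in> ?Z"
      then obtain r where r: "X = coset F r" by auto
      then obtain s where s: "r = A * s" using Z X by (auto simp: dvd_def)
      have "A * s - A * (s mod B) = F * (s div B)"
        unfolding F(1) by (simp add: right_diff_distrib[symmetric] minus_mod_eq_mult_div mult.assoc)
      then have "X = coset F (A * (s mod B))" unfolding r s coset_eq_iff by simp
      moreover have "s mod B \<in> polys_below (degree B)"
        using degree_mod_less[OF AB(2), of s] by (auto simp: polys_below_iff')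
      ultimately show "X \<in> (\<lambda>s. coset F (A * s)) ` polys_below (degree B)" by blast
    next
      fix X assume "X \<in> (\<lambda>s. coset F (A * s)) ` polys_below (degree B)"
      then obtain s where "X = coset F (A * s)" by auto
      then show "X \<in> ?Z" using Z[of "A * s"] by simp
    qed
  qed
  from bij_betw_same_card[OF this] show ?thesis by (simp add: card_polys_below)
qed

text \<open>The annihilated classes are the multiples of A = f^(m - v), 1 or f^m, according to
  whether h = f with v \<le> m, h = f with v > m, or h is another irreducible, whose powers act
  invertibly.\<close>

lemma card_quotient_power:
  fixes f h :: "'k::{field,finite} poly"
  assumes f: "f \<in> irred_polys" and h: "h \<in> irred_polys"
  shows "card {X \<in> range (coset (f ^ m)). h ^ v \<odot>\<^bsub>quotient_module class_ring (PIdl\<^bsub>class_ring\<^esub> (f ^ m))\<^esub> X = coset (f ^ m) 0}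
    = (if f = h then card (UNIV :: 'k set) ^ (degree h * min m v) else 1)"
proof -
  have f0: "f \<noteq> 0" using f by (auto simp: irred_polys_def)
  consider "f = h" "v \<le> m" | "f = h" "m < v" | "f \<noteq> h" by linarith
  then show ?thesis
  proof cases
    case 1
    have e: "f ^ m = f ^ (m - v) * f ^ v" using 1 by (simp flip: power_add)
    have "f ^ m dvd h ^ v * r \<longleftrightarrow> f ^ (m - v) dvd r" for r
      unfolding e using 1 f0 by (simp add: mult.commute)
    from card_quotient_annihilated[OF e _ this] show ?thesis
      using 1 f0 by (simp add: degree_power_eq mult.commute min_def)
  next
    case 2
    have "f ^ m dvd f ^ v" using 2 by (simp add: le_imp_power_dvd)
    then have "f ^ m dvd h ^ v * r \<longleftrightarrow> 1 dvd r" for r using 2 by simp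
    from card_quotient_annihilated[OF _ _ this, of "f ^ m"] show ?thesis
      using 2 f0 by (simp add: degree_power_eq mult.commute min_def)
  next
    case 3
    have "bezout (h ^ v) (f ^ m)" using irred_bezout[OF f h 3] bezout_power bezout_commute by metis
    then obtain a b where ab: "a * h ^ v + b * f ^ m = 1" by (auto simp: bezout_def)
    have "f ^ m dvd h ^ v * r \<longleftrightarrow> f ^ m dvd r" for r
    proof
      assume "f ^ m dvd h ^ v * r"
      then have "f ^ m dvd a * (h ^ v * r) + f ^ m * (b * r)" by simp
      also have "a * (h ^ v * r) + f ^ m * (b * r) = (a * h ^ v + b * f ^ m) * r" by (simp add: algebra_simps)
      finally show "f ^ m dvd r" by (simp add: ab)
    qed simp
    from card_quotient_annihilated[OF _ _ this, of 1] show ?thesis using 3 f0 by simp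
  qed
qed

text \<open>A module isomorphism restricts to the kernels of h^v. In the direct sum the kernel is a
  product over the cyclic summands, and those with f different from h contribute a single
  element.\<close>

lemma class_type_kernel:
  fixes g :: "'k::{field,finite} mat"
  assumes g: "g \<in> carrier_mat n n" and ct: "class_type n g \<phi>" and fin: "finite {f \<in> irred_polys. \<phi> f \<noteq> []}" and h: "h \<in> irred_polys"
  shows "card {w \<in> carrier_vec n. poly_mat (h ^ v) g *\<^sub>v w = 0\<^sub>v n} = (card (UNIV :: 'k set) ^ degree h) ^ pmin (\<phi> h) v"
proof -
  define J where "J = {(f, i). f \<in> (irred_polys :: 'k poly set) \<and> i < length (\<phi> f)}"
  define M where "M = (\<lambda>(f, i). quotient_module (class_ring :: 'k poly ring) (PIdl\<^bsub>class_ring\<^esub> (f ^ (\<phi> f ! i))))"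
  let ?D = "direct_sum_module J M"
  let ?p = "h ^ v"
  have "J = Sigma {f \<in> irred_polys. \<phi> f \<noteq> []} (\<lambda>f. {..<length (\<phi> f)})" by (auto simp: J_def)
  then have finJ: "finite J" using fin by simp
  obtain \<Phi> where hom: "\<Phi> \<in> LinearCombinations.module_hom class_ring (mat_module n g) ?D"
    and bij: "bij_betw \<Phi> (carrier_vec n) (carrier ?D)"
    using ct by (auto simp: class_type_def module_isomorphic_def J_def M_def mat_module_def)
  have sm: "\<Phi> (poly_mat p g *\<^sub>v w) = p \<odot>\<^bsub>?D\<^esub> \<Phi> w" if "w \<in> carrier_vec n" for p w
    using module_hom_smult[OF hom, of p w] that by (simp add: mat_module_def class_ring_simps)
  have cD: "carrier ?D = (\<Pi>\<^sub>E j\<in>J. carrier (M j))" using finJ by (simp add: direct_sum_module_def)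
  have smD: "p \<odot>\<^bsub>?D\<^esub> x = (\<lambda>j\<in>J. p \<odot>\<^bsub>M j\<^esub> x j)" for p x by (simp add: direct_sum_module_def)
  have zD: "zero ?D = (\<lambda>j\<in>J. zero (M j))" by (simp add: direct_sum_module_def)
  have s0: "0 \<odot>\<^bsub>M j\<^esub> X = zero (M j)" if "X \<in> carrier (M j)" for j X
    using that by (auto simp: M_def quotient_module_simps split: prod.splits)
  have cl: "poly_mat p g *\<^sub>v w \<in> carrier_vec n" for p w
    by (rule carrier_vecI) (use g in "simp add: poly_mat_def")
  have p0: "poly_mat 0 g *\<^sub>v w = 0\<^sub>v n" if "w \<in> carrier_vec n" for w
    by (rule eq_vecI) (use g that in "auto simp: poly_mat_def scalar_prod_def")
  have \<Phi>D: "\<Phi> w \<in> carrier ?D" if "w \<in> carrier_vec n" for w using bij that by (auto simp: bij_betw_def)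
  \<comment> \<open>Obtained from the scalar 0, which sends everything to zero on both
    sides.\<close>
  have z: "\<Phi> (0\<^sub>v n) = zero ?D"
  proof -
    have "\<Phi> (0\<^sub>v n) = 0 \<odot>\<^bsub>?D\<^esub> \<Phi> (0\<^sub>v n)" using sm[of "0\<^sub>v n" 0] p0[of "0\<^sub>v n"] by simp
    also have "\<dots> = zero ?D" unfolding smD zD
      using \<Phi>D[of "0\<^sub>v n"] unfolding cD by (intro restrict_ext s0) (rule PiE_mem, simp_all)
    finally show ?thesis .
  qed
  have "poly_mat ?p g *\<^sub>v w = 0\<^sub>v n \<longleftrightarrow> ?p \<odot>\<^bsub>?D\<^esub> \<Phi> w = zero ?D" if w: "w \<in> carrier_vec n" for w
    unfolding sm[OF w, symmetric] z[symmetric]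
    using bij_betw_imp_inj_on[OF bij] cl by (auto simp: inj_on_def)
  then have "bij_betw \<Phi> {w \<in> carrier_vec n. poly_mat ?p g *\<^sub>v w = 0\<^sub>v n} {x \<in> carrier ?D. ?p \<odot>\<^bsub>?D\<^esub> x = zero ?D}"
    by (intro bij_betw_Collect[OF bij]) auto
  then have "card {w \<in> carrier_vec n. poly_mat ?p g *\<^sub>v w = 0\<^sub>v n} = card {x \<in> carrier ?D. ?p \<odot>\<^bsub>?D\<^esub> x = zero ?D}"
    by (rule bij_betw_same_card)
  also have "{x \<in> carrier ?D. ?p \<odot>\<^bsub>?D\<^esub> x = zero ?D} = (\<Pi>\<^sub>E j\<in>J. {X \<in> carrier (M j). ?p \<odot>\<^bsub>M j\<^esub> X = zero (M j)})"
  proof -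
    have e: "(\<lambda>j\<in>J. ?p \<odot>\<^bsub>M j\<^esub> x j) = (\<lambda>j\<in>J. zero (M j)) \<longleftrightarrow> (\<forall>j\<in>J. ?p \<odot>\<^bsub>M j\<^esub> x j = zero (M j))" for x
      unfolding fun_eq_iff restrict_def by meson
    show ?thesis unfolding smD zD cD e PiE_def Pi_def by blast
  qed
  also have "card \<dots> = (\<Prod>j\<in>J. card {X \<in> carrier (M j). ?p \<odot>\<^bsub>M j\<^esub> X = zero (M j)})"
    by (rule card_PiE[OF finJ])
  also have "\<dots> = (\<Prod>j\<in>J. if fst j = h then card (UNIV :: 'k set) ^ (degree h * min (\<phi> h ! snd j) v) else 1)"
  proof (rule prod.cong[OF refl])
    fix j assume "j \<in> J"
    then obtain f i where j: "j = (f, i)" "f \<in> irred_polys" by (auto simp: J_def)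
    then show "card {X \<in> carrier (M j). ?p \<odot>\<^bsub>M j\<^esub> X = zero (M j)} =
        (if fst j = h then card (UNIV :: 'k set) ^ (degree h * min (\<phi> h ! snd j) v) else 1)"
      using card_quotient_power[OF j(2) h, of "\<phi> f ! i" v] by (simp add: M_def quotient_module_simps)
  qed
  also have "\<dots> = (\<Prod>j\<in>Pair h ` {..<length (\<phi> h)}. card (UNIV :: 'k set) ^ (degree h * min (\<phi> h ! snd j) v))"
    by (rule prod.mono_neutral_cong_right) (use finJ h in "auto simp: J_def")
  also have "\<dots> = (\<Prod>i<length (\<phi> h). card (UNIV :: 'k set) ^ (degree h * min (\<phi> h ! i) v))"
    by (subst prod.reindex) (auto simp: inj_on_def)
  also have "\<dots> = (card (UNIV :: 'k set) ^ degree h) ^ (\<Sum>i<length (\<phi> h). min (\<phi> h ! i) v)"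
    by (simp add: power_sum power_mult)
  also have "(\<Sum>i<length (\<phi> h). min (\<phi> h ! i) v) = pmin (\<phi> h) v"
    by (simp add: pmin_def sum_list_sum_nth atLeast0LessThan)
  finally show ?thesis .
qed

text \<open>Vectors of all dimensions together do not form a group, so column vectors are taken as
  functions on the naturals that vanish from n on.\<close>

definition act_op :: "nat \<Rightarrow> 'k::field mat \<Rightarrow> (nat \<Rightarrow> 'k) \<Rightarrow> nat \<Rightarrow> 'k" where
  "act_op n g w i = (if i < n then \<Sum>j<n. g $$ (i, j) * w j else 0)"

text \<open>On coordinates from n on the variable acts as 0, which makes the whole function type a
  k[T]-module; the space of interest is \<open>fin_space n\<close>.\<close>

definition act :: "nat \<Rightarrow> 'k::field mat \<Rightarrow> 'k poly \<Rightarrow> (nat \<Rightarrow> 'k) \<Rightarrow> nat \<Rightarrow> 'k" where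
  "act n g p w i = (\<Sum>l\<le>degree p. poly.coeff p l * (act_op n g ^^ l) w i)"

definition fin_space :: "nat \<Rightarrow> (nat \<Rightarrow> 'k::zero) set" where
  "fin_space n = {w. \<forall>i\<ge>n. w i = 0}"

lemma act_extend: "degree p \<le> N \<Longrightarrow> act n g p w i = (\<Sum>l\<le>N. poly.coeff p l * (act_op n g ^^ l) w i)"
  unfolding act_def by (rule sum.mono_neutral_left) (auto simp: coeff_eq_0)

lemma act_op_add: "act_op n g (x + y) = act_op n g x + act_op n g y"
  by (auto simp: act_op_def fun_eq_iff distrib_left sum.distrib)

lemma act_op_sum: "act_op n g (\<lambda>i. \<Sum>l\<in>A. c l * f l i) i = (\<Sum>l\<in>A. c l * act_op n g (f l) i)"
proof -
  have "(\<Sum>j<n. g $$ (i, j) * (\<Sum>l\<in>A. c l * f l j)) = (\<Sum>l\<in>A. \<Sum>j<n. g $$ (i, j) * (c l * f l j))"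
    unfolding sum_distrib_left by (rule sum.swap)
  also have "\<dots> = (\<Sum>l\<in>A. c l * (\<Sum>j<n. g $$ (i, j) * f l j))"
    by (simp add: sum_distrib_left mult.left_commute)
  finally show ?thesis by (simp add: act_op_def)
qed

lemma act_0 [simp]: "act n g 0 w = 0"
  by (auto simp: act_def fun_eq_iff)

lemma act_pCons: "act n g (pCons a p) w i = a * w i + act_op n g (act n g p w) i"
proof -
  have "act n g (pCons a p) w i = (\<Sum>l\<le>Suc (degree p). poly.coeff (pCons a p) l * (act_op n g ^^ l) w i)"
    by (rule act_extend) (simp add: degree_pCons_le)
  also have "\<dots> = a * w i + (\<Sum>l\<le>degree p. poly.coeff p l * act_op n g ((act_op n g ^^ l) w) i)"
    by (subst sum.atMost_Suc_shift) simp
  also have "(\<Sum>l\<le>degree p. poly.coeff p l * act_op n g ((act_op n g ^^ l) w) i) = act_op n g (act n g p w) i"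
    unfolding act_op_sum[symmetric] by (simp add: act_def[abs_def])
  finally show ?thesis .
qed

lemma act_add_right: "act n g p (x + y) = act n g p x + act n g p y"
proof (induction p)
  case (pCons a p)
  show ?case
    by (rule ext, unfold act_pCons pCons.IH act_op_add) (simp add: act_pCons algebra_simps)
qed simp

lemma act_add_left: "act n g (p + r) x = act n g p x + act n g r x"
proof
  fix i
  let ?N = "max (degree p) (degree r)"
  have "degree (p + r) \<le> ?N" by (rule degree_add_le_max)
  then show "act n g (p + r) x i = (act n g p x + act n g r x) i"
    using act_extend[of "p + r" ?N n g x i] act_extend[of p ?N n g x i] act_extend[of r ?N n g x i]
    by (simp add: distrib_right sum.distrib)
qed

lemma act_smult: "act n g (smult a p) x i = a * act n g p x i"
  using act_extend[of "smult a p" "degree p" n g x i] act_extend[of p "degree p" n g x i]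
  by (simp add: degree_smult_le sum_distrib_left mult.assoc)

lemma act_mult: "act n g (p * r) x = act n g p (act n g r x)"
proof (induction p)
  case (pCons a p)
  have "act n g (pCons a p * r) x i = act n g (pCons a p) (act n g r x) i" for i
    using pCons.IH by (simp add: act_add_left act_smult act_pCons)
  then show ?case by blast
qed simp

lemma polymod_act: "polymod (act n g :: 'k::{field,finite} poly \<Rightarrow> _)"
proof (unfold_locales, goal_cases)
  case (4 x)
  have "act n g (pCons 1 0) x i = x i" for i by (simp only: act_pCons) (simp add: act_op_def)
  then show ?case by (simp add: one_pCons fun_eq_iff)
qed (simp_all add: act_add_right act_add_left act_mult)

lemma act_fin_space: assumes "w \<in> fin_space n" shows "act n g p w \<in> fin_space n"
proof (induction p)
  case (pCons a p)
  then show ?case using assms by (simp add: fin_space_def act_pCons act_op_def)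
qed (simp add: fin_space_def)

lemma bij_vec_fin_space: "bij_betw (\<lambda>v i. if i < n then v $ i else 0) (carrier_vec n) (fin_space n)"
  by (rule bij_betw_byWitness[where f' = "vec n"]) (auto simp: fin_space_def fun_eq_iff)

lemma act_op_vec:
  assumes "g \<in> carrier_mat n n" "v \<in> carrier_vec n"
  shows "act_op n g (\<lambda>i. if i < n then v $ i else 0) = (\<lambda>i. if i < n then (g *\<^sub>v v) $ i else 0)"
  using assms by (auto simp: act_op_def fun_eq_iff scalar_prod_def atLeast0LessThan intro!: sum.cong)

lemma act_op_funpow_vec:
  assumes g: "g \<in> carrier_mat n n"
  shows "v \<in> carrier_vec n \<Longrightarrow>
    (act_op n g ^^ l) (\<lambda>i. if i < n then v $ i else 0) = (\<lambda>i. if i < n then (g ^\<^sub>m l *\<^sub>v v) $ i else 0)"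
proof (induction l arbitrary: v)
  case 0
  then show ?case using g by (auto simp: fun_eq_iff)
next
  case (Suc l)
  have "g ^\<^sub>m Suc l *\<^sub>v v = g ^\<^sub>m l *\<^sub>v (g *\<^sub>v v)"
    using g Suc.prems by (simp add: assoc_mult_mat_vec[of _ n n _ n])
  moreover have "g *\<^sub>v v \<in> carrier_vec n" using g Suc.prems by simp
  ultimately show ?case
    using Suc.IH[of "g *\<^sub>v v"] by (simp only: funpow_Suc_right o_def act_op_vec[OF g Suc.prems])
qed

lemma act_vec:
  assumes g: "g \<in> carrier_mat n n" and v: "v \<in> carrier_vec n"
  shows "act n g p (\<lambda>i. if i < n then v $ i else 0) = (\<lambda>i. if i < n then (poly_mat p g *\<^sub>v v) $ i else 0)"
proof
  fix i
  have "(\<Sum>l\<le>degree p. poly.coeff p l * (\<Sum>j<n. (g ^\<^sub>m l) $$ (i, j) * v $ j))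
      = (\<Sum>j<n. (\<Sum>l\<le>degree p. poly.coeff p l * (g ^\<^sub>m l) $$ (i, j)) * v $ j)"
    unfolding sum_distrib_left sum_distrib_right by (subst sum.swap) (simp add: mult.assoc)
  moreover have "(g ^\<^sub>m l *\<^sub>v v) $ i = (\<Sum>j<n. (g ^\<^sub>m l) $$ (i, j) * v $ j)" if "i < n" for l
  proof -
    have "g ^\<^sub>m l \<in> carrier_mat n n" using g by simp
    from carrier_matD[OF this] show ?thesis using that v by (simp add: scalar_prod_def atLeast0LessThan)
  qed
  moreover have "(poly_mat p g *\<^sub>v v) $ i = (\<Sum>j<n. (\<Sum>l\<le>degree p. poly.coeff p l * (g ^\<^sub>m l) $$ (i, j)) * v $ j)" if "i < n"
    using that v g by (auto simp: poly_mat_def scalar_prod_def atLeast0LessThan intro!: sum.cong)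
  ultimately show "act n g p (\<lambda>i. if i < n then v $ i else 0) i = (if i < n then (poly_mat p g *\<^sub>v v) $ i else 0)"
    by (simp add: act_def act_op_funpow_vec[OF g v])
qed

lemma card_act_kernel:
  assumes g: "g \<in> carrier_mat n n"
  shows "card {w \<in> fin_space n. act n g p w = 0} = card {v \<in> carrier_vec n. poly_mat p g *\<^sub>v v = 0\<^sub>v n}"
proof -
  have "act n g p (\<lambda>i. if i < n then v $ i else 0) = 0 \<longleftrightarrow> poly_mat p g *\<^sub>v v = 0\<^sub>v n" if "v \<in> carrier_vec n" for v
  proof -
    have "dim_vec (poly_mat p g *\<^sub>v v) = n" using g by (simp add: poly_mat_def)
    then show ?thesis unfolding act_vec[OF g that] by (auto simp: fun_eq_iff vec_eq_iff)
  qed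
  then have "bij_betw (\<lambda>v i. if i < n then v $ i else 0) {v \<in> carrier_vec n. poly_mat p g *\<^sub>v v = 0\<^sub>v n} {w \<in> fin_space n. act n g p w = 0}"
    by (intro bij_betw_Collect[OF bij_vec_fin_space]) auto
  from bij_betw_same_card[OF this] show ?thesis by simp
qed

lemma card_fin_space: "card (fin_space n :: (nat \<Rightarrow> 'k::{zero,finite}) set) = card (UNIV :: 'k set) ^ n"
  and finite_fin_space: "finite (fin_space n :: (nat \<Rightarrow> 'k::{zero,finite}) set)"
proof -
  have "bij_betw (\<lambda>p. poly.coeff p) (polys_below n) (fin_space n :: (nat \<Rightarrow> 'k) set)"
    unfolding bij_betw_def
  proof
    show "inj_on (\<lambda>p. poly.coeff p) (polys_below n)" by (auto simp: inj_on_def poly_eq_iff)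
    show "poly.coeff ` polys_below n = (fin_space n :: (nat \<Rightarrow> 'k) set)"
    proof (intro equalityI subsetI)
      fix w :: "nat \<Rightarrow> 'k" assume w: "w \<in> fin_space n"
      have "poly.coeff (Poly (map w [0..<n])) = w"
        using w by (auto simp: fun_eq_iff nth_default_def fin_space_def)
      moreover have "Poly (map w [0..<n]) \<in> polys_below n" by (auto simp: polys_below_def nth_default_def)
      ultimately show "w \<in> poly.coeff ` polys_below n" by force
    qed (auto simp: fin_space_def polys_below_def)
  qed
  from bij_betw_same_card[OF this] bij_betw_finite[OF this]
  show "card (fin_space n :: (nat \<Rightarrow> 'k) set) = card (UNIV :: 'k set) ^ n" "finite (fin_space n :: (nat \<Rightarrow> 'k) set)"
    by (simp_all add: card_polys_below finite_polys_below)
qed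

section \<open>Permutation characters count flags of submodules\<close>

context polymod
begin

fun flag_chains :: "nat \<Rightarrow> 'v set \<Rightarrow> nat list \<Rightarrow> 'v set list set" where
  "flag_chains b X [] = (if X = {0} then {[]} else {})"
| "flag_chains b X (m # c) = (\<Union>W\<in>subs_index b X m. (#) W ` flag_chains b W c)"

lemma card_flag_chains: "finite X \<Longrightarrow> finite (flag_chains b X c) \<and> real (card (flag_chains b X c)) = fl b X c"
proof (induction c arbitrary: X)
  case (Cons m c)
  have IH: "finite (flag_chains b W c) \<and> real (card (flag_chains b W c)) = fl b W c" if "W \<in> subs_index b X m" for W
    by (rule Cons.IH) (use that Cons.prems finite_subset in "auto simp: subs_index_def")
  have "card (flag_chains b X (m # c)) = (\<Sum>W\<in>subs_index b X m. card ((#) W ` flag_chains b W c))"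
    unfolding flag_chains.simps by (rule card_UN_disjoint) (use IH finite_subs_index[OF Cons.prems] in auto)
  also have "\<dots> = (\<Sum>W\<in>subs_index b X m. card (flag_chains b W c))"
    by (intro sum.cong refl card_image) simp
  finally have "real (card (flag_chains b X (m # c))) = fl b X (m # c)" using IH by simp
  moreover have "finite (flag_chains b X (m # c))" using IH finite_subs_index[OF Cons.prems] by simp
  ultimately show ?case by blast
qed simp

end

lemma act_T: "act n g [:0, 1:] w = act_op n g w"
proof -
  have 1: "act n g [:1:] w = w" by (rule ext) (simp add: act_pCons, simp add: act_op_def)
  show ?thesis by (rule ext) (simp only: act_pCons 1, simp)
qed

lemma act_const: "act n g [:c:] w i = c * w i"
  by (simp add: act_pCons, simp add: act_op_def)

lemma subspace_act_iff:
  fixes g :: "'k::{field,finite} mat"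
  shows "Modules.module.subspace (act n g) S \<longleftrightarrow>
    0 \<in> S \<and> (\<forall>x\<in>S. \<forall>y\<in>S. x + y \<in> S) \<and> (\<forall>c. \<forall>x\<in>S. (\<lambda>i. c * x i) \<in> S) \<and> act_op n g ` S \<subseteq> S"
proof -
  interpret M: polymod "act n g" by (rule polymod_act)
  show ?thesis
  proof
    assume S: "M.subspace S"
    have "(\<lambda>i. c * x i) \<in> S" if "x \<in> S" for c x
    proof -
      have "(\<lambda>i. c * x i) = act n g [:c:] x" by (simp add: fun_eq_iff act_const)
      then show ?thesis using M.subspace_scale[OF S that] by simp
    qed
    moreover have "act_op n g x \<in> S" if "x \<in> S" for x
      using M.subspace_scale[OF S that, of "[:0, 1:]"] by (simp only: act_T)
    ultimately show "0 \<in> S \<and> (\<forall>x\<in>S. \<forall>y\<in>S. x + y \<in> S) \<and> (\<forall>c. \<forall>x\<in>S. (\<lambda>i. c * x i) \<in> S) \<and> act_op n g ` S \<subseteq> S"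
      using M.subspace_0[OF S] M.subspace_add[OF S] by blast
  next
    assume S: "0 \<in> S \<and> (\<forall>x\<in>S. \<forall>y\<in>S. x + y \<in> S) \<and> (\<forall>c. \<forall>x\<in>S. (\<lambda>i. c * x i) \<in> S) \<and> act_op n g ` S \<subseteq> S"
    have "act n g p x \<in> S" if x: "x \<in> S" for p x
    proof (induction p)
      case (pCons a p)
      have e: "act n g (pCons a p) x = (\<lambda>i. a * x i) + act_op n g (act n g p x)"
        by (simp add: fun_eq_iff act_pCons)
      show ?case unfolding e using S x pCons.IH by (blast intro: imageI)
    next
      case 0
      show ?case unfolding act_0 using S by blast
    qed
    then show "M.subspace S" using S by (intro M.subspaceI) auto
  qed
qed

section \<open>Bases adapted to a flag\<close>

definition comb :: "(nat \<Rightarrow> nat \<Rightarrow> 'k::field) \<Rightarrow> nat \<Rightarrow> (nat \<Rightarrow> 'k) \<Rightarrow> nat \<Rightarrow> 'k" where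
  "comb u d w i = (\<Sum>j<d. u j i * w j)"

definition spanned :: "(nat \<Rightarrow> nat \<Rightarrow> 'k::field) \<Rightarrow> nat \<Rightarrow> (nat \<Rightarrow> 'k) set" where
  "spanned u d = comb u d ` fin_space d"

lemma fin_space_0: "fin_space 0 = {0 :: nat \<Rightarrow> 'a::zero}"
  by (auto simp: fin_space_def fun_eq_iff)

lemma spanned_0: "spanned u 0 = {0}"
  by (auto simp: spanned_def fin_space_0 comb_def[abs_def] fun_eq_iff)

lemma spanned_Suc: "spanned (u(d := e)) (Suc d) = {w + (\<lambda>i. c * e i) | w c. w \<in> spanned u d}"
proof (intro equalityI subsetI)
  fix x assume "x \<in> spanned (u(d := e)) (Suc d)"
  then obtain w where w: "w \<in> fin_space (Suc d)" "x = comb (u(d := e)) (Suc d) w" by (auto simp: spanned_def)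
  have "x = comb u d (w(d := 0)) + (\<lambda>i. w d * e i)"
    unfolding w(2) by (auto simp: comb_def fun_eq_iff intro!: sum.cong)
  moreover have "w(d := 0) \<in> fin_space d" using w(1) by (auto simp: fin_space_def)
  ultimately show "x \<in> {w + (\<lambda>i. c * e i) | w c. w \<in> spanned u d}" unfolding spanned_def by blast
next
  fix x assume "x \<in> {w + (\<lambda>i. c * e i) | w c. w \<in> spanned u d}"
  then obtain w c where w: "w \<in> fin_space d" "x = comb u d w + (\<lambda>i. c * e i)" by (auto simp: spanned_def)
  have "x = comb (u(d := e)) (Suc d) (w(d := c))"
    unfolding w(2) by (auto simp: comb_def fun_eq_iff intro!: sum.cong)
  moreover have "w(d := c) \<in> fin_space (Suc d)" using w(1) by (auto simp: fin_space_def)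
  ultimately show "x \<in> spanned (u(d := e)) (Suc d)" unfolding spanned_def by blast
qed

lemma spanned_cong: "(\<And>j. j < d \<Longrightarrow> u j = u' j) \<Longrightarrow> spanned u d = spanned u' d"
  by (auto simp: spanned_def comb_def[abs_def] intro!: image_cong)

fun dims :: "nat list \<Rightarrow> nat list" where
  "dims [] = []"
| "dims (m # c) = sum_list c # dims c"

lemma dims_le: "d \<in> set (dims c) \<Longrightarrow> d \<le> sum_list c"
  by (induction c) force+

lemma set_dims: "set (dims c) = (\<lambda>j. sum_list (drop (Suc j) c)) ` {..<length c}"
proof (induction c)
  case (Cons m c)
  have "{..<length (m # c)} = insert 0 (Suc ` {..<length c})" by (simp add: lessThan_Suc_eq_insert_0)
  then show ?case using Cons by (simp add: image_image)
qed simp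

lemma set_dims_rev: "set (dims (rev \<mu>)) = (\<lambda>b. sum_list (take b \<mu>)) ` {..<length \<mu>}"
proof -
  have "sum_list (drop (Suc j) (rev \<mu>)) = sum_list (take (length \<mu> - Suc j) \<mu>)" for j
    by (simp add: drop_rev)
  then have "set (dims (rev \<mu>)) = (\<lambda>b. sum_list (take b \<mu>)) ` (\<lambda>j. length \<mu> - Suc j) ` {..<length \<mu>}"
    by (simp add: set_dims image_image)
  also have "(\<lambda>j. length \<mu> - Suc j) ` {..<length \<mu>} = {..<length \<mu>}"
  proof (intro equalityI subsetI)
    fix j assume "j \<in> {..<length \<mu>}"
    then have "j = length \<mu> - Suc (length \<mu> - Suc j)" "length \<mu> - Suc j \<in> {..<length \<mu>}" by auto
    then show "j \<in> (\<lambda>j. length \<mu> - Suc j) ` {..<length \<mu>}" by blast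
  qed auto
  finally show ?thesis .
qed

text \<open>For the zero matrix the submodules are exactly the vector subspaces.\<close>

lemma extend_basis:
  fixes u :: "nat \<Rightarrow> nat \<Rightarrow> 'k::{field,finite}"
  assumes X: "Modules.module.subspace (act n (0\<^sub>m n n :: 'k mat)) X" "finite X"
  shows "Modules.module.subspace (act n (0\<^sub>m n n :: 'k mat)) (spanned u d) \<Longrightarrow> spanned u d \<subseteq> X \<Longrightarrow>
    card X = card (UNIV :: 'k set) ^ m * card (spanned u d) \<Longrightarrow>
    \<exists>u'. (\<forall>j<d. u' j = u j) \<and> spanned u' (m + d) = X"
proof (induction m arbitrary: u d)
  case 0
  then have "spanned u d = X" using card_subset_eq[OF X(2)] by simp
  then show ?case by auto
next
  case (Suc m)
  interpret K: polymod "act n (0\<^sub>m n n :: 'k mat)" by (rule polymod_act)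
  have fin: "finite (spanned u d)" using Suc.prems(2) X(2) finite_subset by blast
  have pos: "card (spanned u d) > 0" by (rule K.card_subspace_pos[OF Suc.prems(1) fin])
  have "spanned u d \<noteq> X"
  proof
    assume "spanned u d = X"
    then have "card (UNIV :: 'k set) ^ Suc m = 1" using Suc.prems(3) pos by simp
    then show False using one_less_power[OF card_field_gt1[where 'k = 'k], of "Suc m"] by simp
  qed
  then obtain e where e: "e \<in> X" "e \<notin> spanned u d" using Suc.prems(2) by auto
  have p0: "act n (0\<^sub>m n n) p w = (\<lambda>i. poly.coeff p 0 * w i)" for p :: "'k poly" and w
  proof (cases p)
    case (pCons a r)
    show ?thesis unfolding pCons by (rule ext) (simp add: act_pCons, simp add: act_op_def)
  qed
  have S: "spanned (u(d := e)) (Suc d) = K.adj (spanned u d) e"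
    unfolding spanned_Suc K.adj_def p0
  proof (rule Collect_cong)
    fix x
    show "(\<exists>w c. x = w + (\<lambda>i. c * e i) \<and> w \<in> spanned u d) \<longleftrightarrow>
        (\<exists>w p. x = w + (\<lambda>i. poly.coeff p 0 * e i) \<and> w \<in> spanned u d)"
      by (metis coeff_pCons_0)
  qed
  have c: "card (K.adj (spanned u d) e) = card (UNIV :: 'k set) ^ degree [:0, 1 :: 'k:] * card (spanned u d)"
  proof (rule K.card_adj(1)[OF _ _ Suc.prems(1) _ e(2) fin])
    show "irr [:0, 1 :: 'k:]" by (simp add: irreducible_linear_field_poly)
    have "(0 :: nat \<Rightarrow> 'k) \<in> spanned u d" by (rule K.subspace_0[OF Suc.prems(1)])
    then show "act n (0\<^sub>m n n) [:0, 1 :: 'k:] e \<in> spanned u d" by (simp add: p0 zero_fun_def)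
  qed simp
  have "\<exists>u'. (\<forall>j<Suc d. u' j = (u(d := e)) j) \<and> spanned u' (m + Suc d) = X"
  proof (rule Suc.IH)
    show "K.subspace (spanned (u(d := e)) (Suc d))" unfolding S by (rule K.subspace_adj[OF Suc.prems(1)])
    show "spanned (u(d := e)) (Suc d) \<subseteq> X" unfolding S by (rule K.adj_least[OF X(1) Suc.prems(2) e(1)])
    show "card X = card (UNIV :: 'k set) ^ m * card (spanned (u(d := e)) (Suc d))"
      unfolding S c using Suc.prems(3) by (simp add: mult_ac)
  qed
  then show ?case by (metis add_Suc_shift fun_upd_other less_Suc_eq less_irrefl)
qed

text \<open>Every flag consists of the spans of initial segments of a single basis, extended from
  the bottom space upwards. The extension takes place among vector subspaces, that is, submodules
  for the zero matrix.\<close>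

lemma chain_basis:
  fixes g :: "'k::{field,finite} mat"
  assumes q: "q = card (UNIV :: 'k set)"
  shows "Modules.module.subspace (act n g) X \<Longrightarrow> finite X \<Longrightarrow> Ws \<in> polymod.flag_chains (act n g) q X c \<Longrightarrow>
    \<exists>u. spanned u (sum_list c) = X \<and> Ws = map (spanned u) (dims c)"
proof (induction c arbitrary: X Ws)
  case Nil
  interpret M: polymod "act n g" by (rule polymod_act)
  show ?case using Nil by (auto simp: spanned_0 split: if_splits)
next
  case (Cons m c)
  interpret M: polymod "act n g" by (rule polymod_act)
  interpret K: polymod "act n (0\<^sub>m n n :: 'k mat)" by (rule polymod_act)
  have MK: "K.subspace S" if "M.subspace S" for S
  proof -
    have "act_op n (0\<^sub>m n n) x = 0" for x :: "nat \<Rightarrow> 'k" by (simp add: act_op_def fun_eq_iff)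
    then show ?thesis using that unfolding subspace_act_iff by auto
  qed
  obtain W Ws' where W: "Ws = W # Ws'" "W \<in> M.subs_index q X m" "Ws' \<in> M.flag_chains q W c"
    using Cons.prems by auto
  have W': "M.subspace W" "W \<subseteq> X" "card X = q ^ m * card W" using W by (auto simp: M.subs_index_def)
  then have "finite W" using Cons.prems finite_subset by blast
  then obtain u where u: "spanned u (sum_list c) = W" "Ws' = map (spanned u) (dims c)"
    using Cons.IH[OF W'(1) _ W(3)] by blast
  have "\<exists>u'. (\<forall>j<sum_list c. u' j = u j) \<and> spanned u' (m + sum_list c) = X"
    by (rule extend_basis[OF MK[OF Cons.prems(1)] Cons.prems(2)]) (use u W' q MK in auto)
  then obtain u' where u': "\<forall>j<sum_list c. u' j = u j" "spanned u' (m + sum_list c) = X" by blast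
  have sp: "spanned u' d = spanned u d" if "d \<le> sum_list c" for d
    by (rule spanned_cong) (use that u' in auto)
  have "Ws = map (spanned u') (dims (m # c))"
    using W(1) u sp dims_le[of _ c] by auto
  then show ?case using u'(2) by auto
qed

section \<open>The general linear group\<close>

lemma carrier_GL: "carrier (GL n) = Units (ring_mat TYPE('k::field) n ())"
  by (simp add: GL_def units_of_carrier)

lemma group_GL: "group (GL n :: 'k::field mat monoid)"
proof -
  interpret R: ring "ring_mat TYPE('k) n ()" by (rule ring_mat)
  show ?thesis unfolding GL_def by (rule R.units_group)
qed

lemma mult_GL: "x \<otimes>\<^bsub>GL n\<^esub> y = x * y" and one_GL: "\<one>\<^bsub>GL n\<^esub> = 1\<^sub>m n"
  by (simp_all add: GL_def units_of_mult units_of_one ring_mat_simps)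

lemma GL_carrier_mat: "x \<in> carrier (GL n) \<Longrightarrow> x \<in> carrier_mat n n"
  by (auto simp: carrier_GL Units_def ring_mat_simps)

lemma finite_carrier_mat: "finite (carrier_mat n m :: 'k::finite mat set)"
proof -
  have "A \<in> (\<lambda>f. mat n m f) ` (({..<n} \<times> {..<m}) \<rightarrow>\<^sub>E UNIV)" if "A \<in> carrier_mat n m" for A :: "'k mat"
  proof
    show "A = mat n m (restrict (\<lambda>p. A $$ p) ({..<n} \<times> {..<m}))" by (rule eq_matI) (use that in auto)
  qed auto
  moreover have "finite ((\<lambda>f. mat n m f) ` (({..<n} \<times> {..<m}) \<rightarrow>\<^sub>E (UNIV :: 'k set)))"
    by (intro finite_imageI finite_PiE) auto
  ultimately show ?thesis by (meson finite_subset subsetI)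
qed

lemma finite_GL: "finite (carrier (GL n) :: 'k::{field,finite} mat set)"
  by (rule finite_subset[OF _ finite_carrier_mat]) (auto dest: GL_carrier_mat)

lemma act_op_mult:
  assumes "x \<in> carrier_mat n n" "y \<in> carrier_mat n n"
  shows "act_op n (x * y) w = act_op n x (act_op n y w)"
proof
  fix i
  show "act_op n (x * y) w i = act_op n x (act_op n y w) i"
  proof (cases "i < n")
    case True
    have "act_op n (x * y) w i = (\<Sum>k<n. (\<Sum>j<n. x $$ (i, j) * y $$ (j, k)) * w k)"
      using assms True by (simp add: act_op_def scalar_prod_def atLeast0LessThan)
    also have "\<dots> = (\<Sum>j<n. x $$ (i, j) * (\<Sum>k<n. y $$ (j, k) * w k))"
      unfolding sum_distrib_left sum_distrib_right by (subst sum.swap) (simp add: mult.assoc)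
    finally show ?thesis using True by (simp add: act_op_def)
  qed (simp add: act_op_def)
qed

lemma act_op_fin_space: "act_op n x w \<in> fin_space n"
  by (simp add: act_op_def fin_space_def)

lemma act_op_one: "w \<in> fin_space n \<Longrightarrow> act_op n (1\<^sub>m n) w = w"
proof
  fix i assume w: "w \<in> fin_space n"
  have "(\<Sum>j<n. 1\<^sub>m n $$ (i, j) * w j) = (\<Sum>j<n. if j = i then w i else 0)" if "i < n"
    using that by (intro sum.cong) auto
  then show "act_op n (1\<^sub>m n) w i = w i" using w by (simp add: act_op_def fin_space_def)
qed

lemma fin_space_mono: "d \<le> n \<Longrightarrow> fin_space d \<subseteq> fin_space n"
  by (auto simp: fin_space_def)

lemma act_op_GL_inverse:
  assumes x: "x \<in> carrier (GL n)"
  shows "inv\<^bsub>GL n\<^esub> x \<in> carrier (GL n)"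
    "w \<in> fin_space n \<Longrightarrow> act_op n (inv\<^bsub>GL n\<^esub> x) (act_op n x w) = w"
    "w \<in> fin_space n \<Longrightarrow> act_op n x (act_op n (inv\<^bsub>GL n\<^esub> x) w) = w"
proof -
  interpret G: group "GL n :: 'a mat monoid" by (rule group_GL)
  show i: "inv\<^bsub>GL n\<^esub> x \<in> carrier (GL n)" using x by simp
  note m = GL_carrier_mat[OF x] GL_carrier_mat[OF i]
  show "w \<in> fin_space n \<Longrightarrow> act_op n (inv\<^bsub>GL n\<^esub> x) (act_op n x w) = w"
    using act_op_mult[OF m(2,1), of w] G.l_inv[OF x] by (simp add: mult_GL one_GL act_op_one)
  show "w \<in> fin_space n \<Longrightarrow> act_op n x (act_op n (inv\<^bsub>GL n\<^esub> x) w) = w"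
    using act_op_mult[OF m, of w] G.r_inv[OF x] by (simp add: mult_GL one_GL act_op_one)
qed

text \<open>Two group elements and a matrix h are allowed so that the equivalence covers both the
  stability of the flag of x under g (x = y, h = g) and the comparison of the flags of x and y (h =
  1).\<close>

lemma act_op_conj_stable:
  assumes x: "x \<in> carrier (GL n)" and y: "y \<in> carrier (GL n)" and h: "h \<in> carrier_mat n n" and d: "d \<le> n"
  shows "act_op n (inv\<^bsub>GL n\<^esub> x * h * y) ` fin_space d \<subseteq> fin_space d \<longleftrightarrow>
    act_op n h ` act_op n y ` fin_space d \<subseteq> act_op n x ` fin_space d"
proof -
  note xi = act_op_GL_inverse[OF x]
  note m = GL_carrier_mat[OF x] GL_carrier_mat[OF xi(1)] GL_carrier_mat[OF y]
  have e: "act_op n (inv\<^bsub>GL n\<^esub> x * h * y) w = act_op n (inv\<^bsub>GL n\<^esub> x) (act_op n h (act_op n y w))" for w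
    using m h by (simp add: act_op_mult[of _ n])
  have "act_op n (inv\<^bsub>GL n\<^esub> x) z \<in> fin_space d \<longleftrightarrow> z \<in> act_op n x ` fin_space d" if z: "z \<in> fin_space n" for z
  proof
    assume "act_op n (inv\<^bsub>GL n\<^esub> x) z \<in> fin_space d"
    then show "z \<in> act_op n x ` fin_space d" using xi(3)[OF z] by force
  next
    assume "z \<in> act_op n x ` fin_space d"
    then show "act_op n (inv\<^bsub>GL n\<^esub> x) z \<in> fin_space d" using xi(2) fin_space_mono[OF d] by auto
  qed
  then show ?thesis using act_op_fin_space[of n h] by (auto simp: e image_subset_iff)
qed

lemma stable_iff_entries:
  fixes p :: "'k::field mat"
  assumes d: "d \<le> n"
  shows "act_op n p ` fin_space d \<subseteq> fin_space d \<longleftrightarrow> (\<forall>i<n. \<forall>j<n. j < d \<and> d \<le> i \<longrightarrow> p $$ (i, j) = 0)"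
proof
  assume s: "act_op n p ` fin_space d \<subseteq> fin_space d"
  show "\<forall>i<n. \<forall>j<n. j < d \<and> d \<le> i \<longrightarrow> p $$ (i, j) = 0"
  proof (intro allI impI)
    fix i j assume ij: "i < n" "j < n" "j < d \<and> d \<le> i"
    let ?e = "\<lambda>l. if l = j then 1 else 0 :: 'k"
    have "?e \<in> fin_space d" using ij by (auto simp: fin_space_def)
    then have "act_op n p ?e \<in> fin_space d" using s by blast
    then have "act_op n p ?e i = 0" using ij by (simp only: fin_space_def) blast
    moreover have "(\<Sum>l<n. p $$ (i, l) * ?e l) = (\<Sum>l<n. if l = j then p $$ (i, j) else 0)"
      by (intro sum.cong) auto
    ultimately show "p $$ (i, j) = 0" using ij by (simp add: act_op_def)
  qed
next
  assume p: "\<forall>i<n. \<forall>j<n. j < d \<and> d \<le> i \<longrightarrow> p $$ (i, j) = 0"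
  show "act_op n p ` fin_space d \<subseteq> fin_space d"
  proof
    fix z assume "z \<in> act_op n p ` fin_space d"
    then obtain w where w: "w \<in> fin_space d" "z = act_op n p w" by auto
    have "p $$ (i, j) * w j = 0" if "i < n" "d \<le> i" "j < n" for i j
      using p w(1) that by (cases "j < d") (auto simp: fin_space_def)
    then show "z \<in> fin_space d" using w(2) by (auto simp: fin_space_def act_op_def intro!: sum.neutral)
  qed
qed

lemma parabolic_iff_stable:
  assumes "sum_list \<mu> = n"
  shows "p \<in> parabolic n \<mu> \<longleftrightarrow>
    p \<in> carrier (GL n) \<and> (\<forall>d\<in>set (dims (rev \<mu>)). act_op n p ` fin_space d \<subseteq> fin_space d)"
proof -
  have "d \<le> n" if "d \<in> set (dims (rev \<mu>))" for d using dims_le[OF that] assms by simp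
  then have "(\<forall>d\<in>set (dims (rev \<mu>)). act_op n p ` fin_space d \<subseteq> fin_space d) \<longleftrightarrow>
      (\<forall>d\<in>set (dims (rev \<mu>)). \<forall>i<n. \<forall>j<n. j < d \<and> d \<le> i \<longrightarrow> p $$ (i, j) = 0)"
    by (intro ball_cong refl stable_iff_entries)
  also have "\<dots> \<longleftrightarrow> (\<forall>b<length \<mu>. \<forall>i<n. \<forall>j<n. j < sum_list (take b \<mu>) \<and> sum_list (take b \<mu>) \<le> i \<longrightarrow> p $$ (i, j) = 0)"
    unfolding set_dims_rev by auto
  \<comment> \<open>The boundary added for b = \<open>length \<mu>\<close> is n itself and imposes
    no condition on rows below n.\<close>
  also have "\<dots> \<longleftrightarrow> (\<forall>b\<le>length \<mu>. \<forall>i<n. \<forall>j<n. j < sum_list (take b \<mu>) \<and> sum_list (take b \<mu>) \<le> i \<longrightarrow> p $$ (i, j) = 0)"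
    using assms by (auto simp: le_less)
  finally show ?thesis by (auto simp: parabolic_def)
qed

lemma card_act_op_image:
  fixes x :: "'k::{field,finite} mat"
  assumes x: "x \<in> carrier (GL n)" and d: "d \<le> n"
  shows "card (act_op n x ` fin_space d) = card (UNIV :: 'k set) ^ d"
proof -
  have "inj_on (act_op n x) (fin_space d)"
    by (rule inj_on_inverseI[where g = "act_op n (inv\<^bsub>GL n\<^esub> x)"])
      (use act_op_GL_inverse(2)[OF x] fin_space_mono[OF d] in auto)
  then show ?thesis by (simp add: card_image card_fin_space)
qed

definition flag :: "nat \<Rightarrow> 'k::field mat \<Rightarrow> nat list \<Rightarrow> (nat \<Rightarrow> 'k) set list" where
  "flag n x c = map (\<lambda>d. act_op n x ` fin_space d) (dims c)"

lemma act_op_image_0: "act_op n x ` fin_space 0 = {0}"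
  by (auto simp: fin_space_0 act_op_def fun_eq_iff)

lemma subspace_act_op_image:
  fixes g :: "'k::{field,finite} mat"
  shows "Modules.module.subspace (act n g) (act_op n x ` fin_space d) \<longleftrightarrow>
    act_op n g ` act_op n x ` fin_space d \<subseteq> act_op n x ` fin_space d"
proof -
  have "0 \<in> act_op n x ` fin_space d"
    by (rule image_eqI[of _ _ 0]) (auto simp: act_op_def fin_space_def fun_eq_iff)
  moreover have "a + b \<in> act_op n x ` fin_space d" if ab: "a \<in> act_op n x ` fin_space d" "b \<in> act_op n x ` fin_space d" for a b
  proof -
    obtain v w where "a = act_op n x v" "b = act_op n x w" "v \<in> fin_space d" "w \<in> fin_space d" using ab by blast
    then have "a + b = act_op n x (v + w)" "v + w \<in> fin_space d" by (auto simp: act_op_add fin_space_def)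
    then show ?thesis by blast
  qed
  moreover have "(\<lambda>i. c * a i) \<in> act_op n x ` fin_space d" if a: "a \<in> act_op n x ` fin_space d" for c a
  proof -
    obtain v where "a = act_op n x v" "v \<in> fin_space d" using a by auto
    then have "(\<lambda>i. c * a i) = act_op n x (\<lambda>i. c * v i)" "(\<lambda>i. c * v i) \<in> fin_space d"
      by (auto simp: act_op_def fin_space_def fun_eq_iff sum_distrib_left mult.left_commute)
    then show ?thesis by blast
  qed
  ultimately show ?thesis unfolding subspace_act_iff by blast
qed

lemma flag_in_flag_chains:
  fixes g x :: "'k::{field,finite} mat"
  assumes x: "x \<in> carrier (GL n)" and q: "q = card (UNIV :: 'k set)"
  shows "sum_list c \<le> n \<Longrightarrow> flag n x c \<in> polymod.flag_chains (act n g) q (act_op n x ` fin_space (sum_list c)) c \<longleftrightarrow>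
    (\<forall>d\<in>set (dims c). act_op n g ` act_op n x ` fin_space d \<subseteq> act_op n x ` fin_space d)"
proof -
  interpret M: polymod "act n g" by (rule polymod_act)
  show "sum_list c \<le> n \<Longrightarrow> flag n x c \<in> M.flag_chains q (act_op n x ` fin_space (sum_list c)) c \<longleftrightarrow>
    (\<forall>d\<in>set (dims c). act_op n g ` act_op n x ` fin_space d \<subseteq> act_op n x ` fin_space d)"
  proof (induction c)
    case Nil
    then show ?case by (simp add: flag_def act_op_image_0)
  next
    case (Cons m c)
    let ?W = "act_op n x ` fin_space (sum_list c)"
    have "?W \<subseteq> act_op n x ` fin_space (sum_list (m # c))"
      by (rule image_mono[OF fin_space_mono]) simp
    moreover have "card (act_op n x ` fin_space (sum_list (m # c))) = q ^ m * card ?W"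
      using Cons.prems card_act_op_image[OF x, of "sum_list c"] card_act_op_image[OF x, of "m + sum_list c"]
      by (simp add: q power_add)
    ultimately have "?W \<in> M.subs_index q (act_op n x ` fin_space (sum_list (m # c))) m \<longleftrightarrow>
        act_op n g ` ?W \<subseteq> ?W"
      by (simp add: M.subs_index_def subspace_act_op_image)
    moreover have "flag n x (m # c) \<in> M.flag_chains q X (m # c) \<longleftrightarrow>
        ?W \<in> M.subs_index q X m \<and> flag n x c \<in> M.flag_chains q ?W c" for X
      by (auto simp: flag_def)
    ultimately show ?case using Cons.IH Cons.prems by simp
  qed
qed

text \<open>Applying x to the standard flag maps the elements x with x^(-1) g x in the parabolic
  onto the g-stable flags. Every fibre is a coset of the parabolic, so its order cancels against the
  denominator of the induced character.\<close>

theorem parabolic_char_eq_fl: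
  fixes g :: "'k::{field,finite} mat"
  assumes g: "g \<in> carrier (GL n)" and \<mu>: "sum_list \<mu> = n"
  shows "parabolic_char n \<mu> g = of_real (polymod.fl (act n g) (card (UNIV :: 'k set)) (fin_space n) (rev \<mu>))"
proof -
  interpret M: polymod "act n g" by (rule polymod_act)
  interpret G: group "GL n :: 'k mat monoid" by (rule group_GL)
  let ?q = "card (UNIV :: 'k set)" and ?c = "rev \<mu>" and ?P = "parabolic n \<mu> :: 'k mat set"
  let ?A = "{x \<in> carrier (GL n). inv\<^bsub>GL n\<^esub> x * g * x \<in> ?P}"
  have gm: "g \<in> carrier_mat n n" by (rule GL_carrier_mat[OF g])
  have dn: "d \<le> n" if "d \<in> set (dims ?c)" for d using dims_le[OF that] \<mu> by simp
  have top: "act_op n x ` fin_space n = fin_space n" if x: "x \<in> carrier (GL n)" for x :: "'k mat"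
  proof (intro equalityI subsetI)
    fix w :: "nat \<Rightarrow> 'k" assume w: "w \<in> fin_space n"
    show "w \<in> act_op n x ` fin_space n"
      using act_op_GL_inverse(3)[OF x w] act_op_fin_space by (metis imageI)
  qed (use act_op_fin_space in auto)
  have conj: "inv\<^bsub>GL n\<^esub> x * g * x \<in> ?P \<longleftrightarrow> flag n x ?c \<in> M.flag_chains ?q (fin_space n) ?c" if x: "x \<in> carrier (GL n)" for x
  proof -
    have "inv\<^bsub>GL n\<^esub> x * g * x = inv\<^bsub>GL n\<^esub> x \<otimes>\<^bsub>GL n\<^esub> g \<otimes>\<^bsub>GL n\<^esub> x" by (simp add: mult_GL)
    then have "inv\<^bsub>GL n\<^esub> x * g * x \<in> carrier (GL n)" using x g by simp
    then have "inv\<^bsub>GL n\<^esub> x * g * x \<in> ?P \<longleftrightarrow>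
        (\<forall>d\<in>set (dims ?c). act_op n g ` act_op n x ` fin_space d \<subseteq> act_op n x ` fin_space d)"
      unfolding parabolic_iff_stable[OF \<mu>] using act_op_conj_stable[OF x x gm dn] by blast
    also have "\<dots> \<longleftrightarrow> flag n x ?c \<in> M.flag_chains ?q (fin_space n) ?c"
      using flag_in_flag_chains[OF x refl, of ?c g] \<mu> top[OF x] by simp
    finally show ?thesis .
  qed
  have img: "(\<lambda>x. flag n x ?c) ` ?A = M.flag_chains ?q (fin_space n) ?c"
  proof (intro equalityI subsetI)
    fix Ws assume Ws: "Ws \<in> M.flag_chains ?q (fin_space n) ?c"
    have "M.subspace (fin_space n)"
      using subspace_act_op_image[of n g "1\<^sub>m n" n] top[of "1\<^sub>m n"] G.one_closed act_op_fin_space[of n g]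
      by (simp add: one_GL image_subset_iff)
    then obtain u where u: "spanned u (sum_list ?c) = fin_space n" "Ws = map (spanned u) (dims ?c)"
      using chain_basis[OF refl _ finite_fin_space Ws] by blast
    have u1: "spanned u n = fin_space n" using u(1) \<mu> by simp
    \<comment> \<open>The columns of \<open>x\<close> are the adapted basis, so \<open>x\<close>
      carries the standard flag to the given one.\<close>
    define x where "x = mat n n (\<lambda>(i, j). u j i)"
    have xm: "x \<in> carrier_mat n n" by (simp add: x_def)
    have xu: "act_op n x w = comb u n w" if "w \<in> fin_space n" for w
    proof
      fix i
      have "comb u n w \<in> fin_space n" using that u1 by (auto simp: spanned_def)
      then show "act_op n x w i = comb u n w i" by (auto simp: act_op_def x_def comb_def fin_space_def)
    qed
    have xd: "act_op n x ` fin_space d = spanned u d" if d: "d \<le> n" for d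
    proof -
      have "act_op n x w = comb u d w" if w: "w \<in> fin_space d" for w
      proof
        fix i
        have "comb u n w i = comb u d w i"
          unfolding comb_def by (rule sum.mono_neutral_right) (use d w in "auto simp: fin_space_def")
        then show "act_op n x w i = comb u d w i" using xu[of w] w fin_space_mono[OF d] by auto
      qed
      then show ?thesis by (auto simp: spanned_def intro!: image_cong)
    qed
    have inj: "inj_on (act_op n x) (fin_space n)"
      by (rule eq_card_imp_inj_on[OF finite_fin_space]) (simp add: xd u1)
    have "det x \<noteq> 0"
    proof
      assume "det x = 0"
      then obtain v where v: "v \<in> carrier_vec n" "v \<noteq> 0\<^sub>v n" "x *\<^sub>v v = 0\<^sub>v n"
        using det_0_iff_vec_prod_zero_field[OF xm] by blast
      let ?w = "\<lambda>i. if i < n then v $ i else 0"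
      have "act_op n x ?w = 0" unfolding act_op_vec[OF xm v(1)] v(3) by (simp add: fun_eq_iff)
      also have "0 = act_op n x 0" by (simp add: act_op_def fun_eq_iff)
      finally have e: "act_op n x ?w = act_op n x 0" .
      have "?w = 0" using inj_on_eq_iff[OF inj, of ?w 0] e by (simp add: fin_space_def)
      then have "v = 0\<^sub>v n" using v(1) by (intro eq_vecI) (auto simp: fun_eq_iff split: if_splits)
      then show False using v(2) by simp
    qed
    then have x: "x \<in> carrier (GL n)" unfolding carrier_GL by (rule det_non_zero_imp_unit[OF xm])
    have "flag n x ?c = Ws" unfolding flag_def u(2) using xd dn by simp
    then show "Ws \<in> (\<lambda>x. flag n x ?c) ` ?A" using conj[OF x] Ws x by force
  qed (use conj in auto)
  \<comment> \<open>Two elements give the same flag iff they differ by a right factor in the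
    parabolic; containment of the members suffices because their orders agree.\<close>
  have fib: "card {y \<in> ?A. flag n y ?c = Fl} = card ?P" if Fl: "Fl \<in> (\<lambda>x. flag n x ?c) ` ?A" for Fl
  proof -
    obtain x where x: "x \<in> carrier (GL n)" "Fl = flag n x ?c" "flag n x ?c \<in> M.flag_chains ?q (fin_space n) ?c"
      using Fl conj by auto
    have xim: "inv\<^bsub>GL n\<^esub> x \<in> carrier_mat n n" by (rule GL_carrier_mat) (use x in simp)
    have eq: "flag n y ?c = Fl \<longleftrightarrow> inv\<^bsub>GL n\<^esub> x \<otimes>\<^bsub>GL n\<^esub> y \<in> ?P" if y: "y \<in> carrier (GL n)" for y
    proof -
      have "inv\<^bsub>GL n\<^esub> x \<otimes>\<^bsub>GL n\<^esub> y \<in> ?P \<longleftrightarrow> (\<forall>d\<in>set (dims ?c). act_op n (inv\<^bsub>GL n\<^esub> x * 1\<^sub>m n * y) ` fin_space d \<subseteq> fin_space d)"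
        unfolding parabolic_iff_stable[OF \<mu>] using x y xim by (simp add: mult_GL[symmetric]) (simp add: mult_GL)
      also have "\<dots> \<longleftrightarrow> (\<forall>d\<in>set (dims ?c). act_op n y ` fin_space d \<subseteq> act_op n x ` fin_space d)"
      proof -
        have "act_op n (1\<^sub>m n) ` act_op n y ` S = act_op n y ` S" for S
          by (simp add: image_image act_op_one[OF act_op_fin_space])
        then show ?thesis using act_op_conj_stable[OF x(1) y one_carrier_mat dn] by simp
      qed
      also have "\<dots> \<longleftrightarrow> (\<forall>d\<in>set (dims ?c). act_op n y ` fin_space d = act_op n x ` fin_space d)"
      proof -
        have "act_op n y ` fin_space d = act_op n x ` fin_space d"
          if "d \<in> set (dims ?c)" "act_op n y ` fin_space d \<subseteq> act_op n x ` fin_space d" for d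
          by (rule card_subset_eq[OF _ that(2)])
            (use card_act_op_image[OF x(1) dn[OF that(1)]] card_act_op_image[OF y dn[OF that(1)]] finite_fin_space in auto)
        then show ?thesis by blast
      qed
      also have "\<dots> \<longleftrightarrow> flag n y ?c = Fl" by (auto simp: flag_def x(2))
      finally show ?thesis by simp
    qed
    have "bij_betw (\<lambda>p. x \<otimes>\<^bsub>GL n\<^esub> p) ?P {y \<in> ?A. flag n y ?c = Fl}"
    proof (rule bij_betw_byWitness[where f' = "\<lambda>y. inv\<^bsub>GL n\<^esub> x \<otimes>\<^bsub>GL n\<^esub> y"])
      have PG: "p \<in> carrier (GL n)" if "p \<in> ?P" for p using that by (simp add: parabolic_def)
      show "\<forall>p\<in>?P. inv\<^bsub>GL n\<^esub> x \<otimes>\<^bsub>GL n\<^esub> (x \<otimes>\<^bsub>GL n\<^esub> p) = p"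
        using PG x(1) by (simp add: G.m_assoc[symmetric])
      show "\<forall>y\<in>{y \<in> ?A. flag n y ?c = Fl}. x \<otimes>\<^bsub>GL n\<^esub> (inv\<^bsub>GL n\<^esub> x \<otimes>\<^bsub>GL n\<^esub> y) = y"
        using x(1) by (simp add: G.m_assoc[symmetric])
      show "(\<lambda>y. inv\<^bsub>GL n\<^esub> x \<otimes>\<^bsub>GL n\<^esub> y) ` {y \<in> ?A. flag n y ?c = Fl} \<subseteq> ?P" using eq by auto
      show "(\<lambda>p. x \<otimes>\<^bsub>GL n\<^esub> p) ` ?P \<subseteq> {y \<in> ?A. flag n y ?c = Fl}"
      proof (rule image_subsetI)
        fix p assume p: "p \<in> ?P"
        have y: "x \<otimes>\<^bsub>GL n\<^esub> p \<in> carrier (GL n)" using x(1) PG[OF p] by simp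
        have "inv\<^bsub>GL n\<^esub> x \<otimes>\<^bsub>GL n\<^esub> (x \<otimes>\<^bsub>GL n\<^esub> p) \<in> ?P" using p PG x(1) by (simp add: G.m_assoc[symmetric])
        then have f: "flag n (x \<otimes>\<^bsub>GL n\<^esub> p) ?c = Fl" using eq[OF y] by simp
        then have "inv\<^bsub>GL n\<^esub> (x \<otimes>\<^bsub>GL n\<^esub> p) * g * (x \<otimes>\<^bsub>GL n\<^esub> p) \<in> ?P" using conj[OF y] x by simp
        then show "x \<otimes>\<^bsub>GL n\<^esub> p \<in> {y \<in> ?A. flag n y ?c = Fl}"
          using y f by simp
      qed
    qed
    from bij_betw_same_card[OF this] show ?thesis by simp
  qed
  have cA: "card ?A = card ?P * card (M.flag_chains ?q (fin_space n) ?c)"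
    unfolding img[symmetric] by (rule card_eq_fiber[OF _ fib]) (simp_all add: finite_GL)
  have "act_op n (1\<^sub>m n :: 'k mat) ` fin_space d \<subseteq> fin_space d" if "d \<in> set (dims ?c)" for d
    using fin_space_mono[OF dn[OF that]] by (auto simp: act_op_one subset_iff)
  then have "1\<^sub>m n \<in> ?P" using G.one_closed by (simp add: parabolic_iff_stable[OF \<mu>] one_GL)
  moreover have "finite ?P" by (rule finite_subset[OF _ finite_GL[of n]]) (auto simp: parabolic_def)
  ultimately have "card ?P \<noteq> 0" by auto
  moreover have "parabolic_char n \<mu> g = of_nat (card ?A) / of_nat (card ?P)"
    unfolding parabolic_char_def induced_char_def Let_def mult_GL
    by (subst sum.inter_filter[symmetric]) (auto simp: finite_GL)
  ultimately have "parabolic_char n \<mu> g = of_nat (card (M.flag_chains ?q (fin_space n) ?c))"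
    unfolding cA by simp
  then show ?thesis using M.card_flag_chains[OF finite_fin_space, of ?q n ?c] by (metis of_real_of_nat_eq)
qed

section \<open>Unipotent characters\<close>

lemma matrix_cancel:
  fixes A B :: "'i \<Rightarrow> 'i \<Rightarrow> real" and x :: "'i \<Rightarrow> complex"
  assumes "finite I" "i \<in> I" "\<And>j. j \<in> I \<Longrightarrow> (\<Sum>k\<in>I. A i k * B k j) = (if i = j then 1 else 0)"
  shows "(\<Sum>k\<in>I. of_real (A i k) * (\<Sum>j\<in>I. of_real (B k j) * x j)) = x i"
proof -
  have "(\<Sum>k\<in>I. of_real (A i k) * (\<Sum>j\<in>I. of_real (B k j) * x j)) = (\<Sum>k\<in>I. \<Sum>j\<in>I. of_real (A i k * B k j) * x j)"
    by (simp add: sum_distrib_left mult.assoc)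
  also have "\<dots> = (\<Sum>j\<in>I. \<Sum>k\<in>I. of_real (A i k * B k j) * x j)" by (rule sum.swap)
  also have "\<dots> = (\<Sum>j\<in>I. of_real (\<Sum>k\<in>I. A i k * B k j) * x j)" by (simp add: sum_distrib_right)
  also have "\<dots> = (\<Sum>j\<in>I. if i = j then x j else 0)"
    by (rule sum_cong) (simp add: assms(3))
  also have "\<dots> = x i" using assms(1,2) by simp
  finally show ?thesis .
qed

text \<open>The Kostka matrix is triangular for dominance with nonzero diagonal; its inverse
  exhibits the solution of the defining equations and proves it unique.\<close>

lemma unipotent_char_inversion:
  "\<exists>C. (\<forall>\<mu>\<in>Par n. \<forall>\<mu>'\<in>Par n.
          (\<Sum>\<nu>\<in>Par n. real (kostka \<nu> \<mu>) * C \<nu> \<mu>') = (if \<mu> = \<mu>' then 1 else 0)) \<and>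
     (\<forall>\<nu>\<in>Par n. \<forall>g\<in>carrier (GL n :: 'k::field mat monoid).
          unipotent_char n \<nu> g = (\<Sum>\<mu>\<in>Par n. of_real (C \<nu> \<mu>) * parabolic_char n \<mu> g))"
proof -
  let ?P = "Par n" and ?G = "carrier (GL n :: 'k mat monoid)"
  have "\<exists>C. (\<forall>i\<in>?P. \<forall>j\<in>?P. (\<Sum>k\<in>?P. C i k * real (kostka j k)) = (if i = j then 1 else 0)) \<and>
            (\<forall>i\<in>?P. \<forall>j\<in>?P. (\<Sum>k\<in>?P. real (kostka k i) * C k j) = (if i = j then 1 else 0))"
  proof (rule triangular_inverse[where rank = "dom_rank n", OF finite_partitions_of])
    show "real (kostka i i) \<noteq> 0" if "i \<in> ?P" for i
      using that kostka_diag by (simp add: Par_def)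
    show "dom_rank n i < dom_rank n j" if "i \<in> ?P" "j \<in> ?P" "real (kostka j i) \<noteq> 0" "i \<noteq> j" for i j
      by (rule kostka_triangular) (use that in auto)
  qed
  then obtain C where C: "\<And>i j. i \<in> ?P \<Longrightarrow> j \<in> ?P \<Longrightarrow> (\<Sum>k\<in>?P. C i k * real (kostka j k)) = (if i = j then 1 else 0)"
      "\<And>i j. i \<in> ?P \<Longrightarrow> j \<in> ?P \<Longrightarrow> (\<Sum>k\<in>?P. real (kostka k i) * C k j) = (if i = j then 1 else 0)" by blast
  define X where "X \<nu> g = (if \<nu> \<in> ?P \<and> g \<in> ?G then \<Sum>\<mu>\<in>?P. of_real (C \<nu> \<mu>) * parabolic_char n \<mu> g else 0)" for \<nu> g
  have "unipotent_char n = X"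
    unfolding unipotent_char_def
  proof (rule the_equality)
    have "parabolic_char n \<mu> g = (\<Sum>\<nu>\<in>?P. of_nat (kostka \<nu> \<mu>) * X \<nu> g)" if "\<mu> \<in> ?P" "g \<in> ?G" for \<mu> g
    proof -
      have "(\<Sum>\<nu>\<in>?P. of_real (real (kostka \<nu> \<mu>)) * (\<Sum>\<mu>'\<in>?P. of_real (C \<nu> \<mu>') * parabolic_char n \<mu>' g)) = parabolic_char n \<mu> g"
        by (rule matrix_cancel[where A = "\<lambda>\<mu> \<nu>. real (kostka \<nu> \<mu>)", OF finite_partitions_of that(1) C(2)[OF that(1)]])
      then show ?thesis using that(2) by (simp add: X_def)
    qed
    moreover have "X \<nu> g = 0" if "\<nu> \<notin> ?P \<or> g \<notin> ?G" for \<nu> g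
      unfolding X_def by (rule if_not_P) (use that in blast)
    ultimately show "(\<forall>\<nu> g. \<nu> \<notin> ?P \<or> g \<notin> ?G \<longrightarrow> X \<nu> g = 0) \<and>
        (\<forall>\<mu>\<in>?P. \<forall>g\<in>?G. parabolic_char n \<mu> g = (\<Sum>\<nu>\<in>?P. of_nat (kostka \<nu> \<mu>) * X \<nu> g))"
      by blast
  next
    fix Y :: "nat list \<Rightarrow> 'k mat \<Rightarrow> complex"
    assume Y: "(\<forall>\<nu> g. \<nu> \<notin> ?P \<or> g \<notin> ?G \<longrightarrow> Y \<nu> g = 0) \<and>
        (\<forall>\<mu>\<in>?P. \<forall>g\<in>?G. parabolic_char n \<mu> g = (\<Sum>\<nu>\<in>?P. of_nat (kostka \<nu> \<mu>) * Y \<nu> g))"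
    have "Y \<nu> g = X \<nu> g" for \<nu> g
    proof (cases "\<nu> \<in> ?P \<and> g \<in> ?G")
      case True
      have "X \<nu> g = (\<Sum>\<mu>\<in>?P. of_real (C \<nu> \<mu>) * (\<Sum>\<nu>'\<in>?P. of_real (real (kostka \<nu>' \<mu>)) * Y \<nu>' g))"
        using True Y by (simp add: X_def)
      also have "\<dots> = Y \<nu> g"
        by (rule matrix_cancel[where B = "\<lambda>\<mu> \<nu>. real (kostka \<nu> \<mu>)", OF finite_partitions_of]) (use True C(1) in auto)
      finally show ?thesis by simp
    qed (use Y in "auto simp: X_def")
    then show "Y = X" by (simp add: fun_eq_iff)
  qed
  then show ?thesis using C(2) by (intro exI[of _ C]) (simp add: X_def)
qed

text \<open>Kostka numbers are the monomial coefficients of Schur functions, so inverting psi = K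
  chi amounts to expanding \<open>u\<close> in Schur functions with coefficients chi^nu(g). These
  are real, since \<open>C\<close> and the values psi^mu(g) are, and the specialization is
  linear.\<close>

lemma GLB_unipotent_char_eq:
  fixes g :: "'k::field mat"
  assumes g: "g \<in> carrier (GL n)" and u: "u \<in> Sym" "\<And>a. u a \<noteq> 0 \<Longrightarrow> mdeg a = n"
    and \<psi>: "\<And>\<mu>. \<mu> \<in> Par n \<Longrightarrow> parabolic_char n \<mu> g = of_real (u (mon \<mu>))"
  shows "GLB_unipotent_char \<alpha> \<beta> n g = of_real (thoma_spec \<alpha> \<beta> 1 u)"
proof -
  let ?P = "Par n"
  obtain C where C: "\<And>\<mu> \<mu>'. \<mu> \<in> ?P \<Longrightarrow> \<mu>' \<in> ?P \<Longrightarrow>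
        (\<Sum>\<nu>\<in>?P. real (kostka \<nu> \<mu>) * C \<nu> \<mu>') = (if \<mu> = \<mu>' then 1 else 0)"
      "\<And>\<nu>. \<nu> \<in> ?P \<Longrightarrow> unipotent_char n \<nu> g = (\<Sum>\<mu>\<in>?P. of_real (C \<nu> \<mu>) * parabolic_char n \<mu> g)"
    using unipotent_char_inversion[of n, where 'k = 'k] g by blast
  define x where "x \<nu> = (\<Sum>\<mu>\<in>?P. C \<nu> \<mu> * u (mon \<mu>))" for \<nu>
  have x: "unipotent_char n \<nu> g = of_real (x \<nu>)" if "\<nu> \<in> ?P" for \<nu>
    using that by (simp add: C(2) x_def \<psi>)
  have sS: "schur \<nu> \<in> Sym" if "\<nu> \<in> ?P" for \<nu> using that schur_Sym by (simp add: Par_def)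
  have "u = (\<lambda>a. \<Sum>\<nu>\<in>?P. x \<nu> * schur \<nu> a)"
  proof (rule Sym_eqI_mon[OF u(1)])
    show "(\<lambda>a. \<Sum>\<nu>\<in>?P. x \<nu> * schur \<nu> a) \<in> Sym" by (intro Sym_sum Sym_scale sS)
    fix \<mu> assume \<mu>: "is_partition \<mu>"
    show "u (mon \<mu>) = (\<Sum>\<nu>\<in>?P. x \<nu> * schur \<nu> (mon \<mu>))"
    proof (cases "\<mu> \<in> ?P")
      case True
      have "complex_of_real (\<Sum>\<nu>\<in>?P. x \<nu> * schur \<nu> (mon \<mu>))
          = (\<Sum>\<nu>\<in>?P. of_real (real (kostka \<nu> \<mu>)) * (\<Sum>\<mu>'\<in>?P. of_real (C \<nu> \<mu>') * of_real (u (mon \<mu>'))))"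
        by (simp add: kostka_schur x_def mult.commute)
      also have "\<dots> = of_real (u (mon \<mu>))"
        by (rule matrix_cancel[where A = "\<lambda>\<mu> \<nu>. real (kostka \<nu> \<mu>)", OF finite_partitions_of True C(1)[OF True]])
      finally show ?thesis by (simp only: of_real_eq_iff)
    next
      case False
      then have n: "sum_list \<mu> \<noteq> n" using \<mu> by (simp add: Par_def)
      then have "u (mon \<mu>) = 0" using u(2)[of "mon \<mu>"] by (auto simp: mono_degree_mon)
      moreover have "schur \<nu> (mon \<mu>) = 0" if "\<nu> \<in> ?P" for \<nu>
        using schur_degree[of \<nu> "mon \<mu>"] that n by (auto simp: Par_def mono_degree_mon)
      ultimately show ?thesis by simp
    qed
  qed
  then have "thoma_spec \<alpha> \<beta> 1 u = thoma_spec \<alpha> \<beta> 1 (\<lambda>a. \<Sum>\<nu>\<in>?P. x \<nu> * schur \<nu> a)" by (rule arg_cong)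
  also have "\<dots> = (\<Sum>\<nu>\<in>?P. x \<nu> * thoma_spec \<alpha> \<beta> 1 (schur \<nu>))"
    by (rule hom_sum[OF thoma_hom finite_partitions_of sS])
  finally show ?thesis by (simp add: GLB_unipotent_char_def x)
qed

lemma shape_mon_rev:
  assumes "is_partition \<mu>" shows "shape (mon (rev \<mu>)) = \<mu>"
proof -
  have 0: "0 \<notin> set \<mu>" using assms by (simp add: is_partition_def)
  have "{i. part (rev \<mu>) i \<noteq> 0} = {0..<length \<mu>}"
  proof -
    have "rev \<mu> ! i \<noteq> 0" if "i < length \<mu>" for i using that 0 by (metis length_rev nth_mem set_rev)
    then show ?thesis by (auto simp: part_def)
  qed
  then have "mset (shp (part (rev \<mu>))) = image_mset (part (rev \<mu>)) (mset_set {0..<length (rev \<mu>)})"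
    by (simp add: mset_shp)
  also have "\<dots> = image_mset ((!) (rev \<mu>)) (mset_set {0..<length (rev \<mu>)})"
    by (rule image_mset_cong) (auto simp: part_def)
  also have "\<dots> = mset \<mu>" by (metis map_nth mset_map mset_rev mset_upt)
  finally show ?thesis
    unfolding shape_def lookup_mon by (intro partition_eqI_mset is_partition_shp assms)
qed

theorem mainTheorem1:
  fixes q n :: nat and t :: real
    and \<alpha> \<beta> :: "nat \<Rightarrow> real"
    and g :: "'k::{field, finite} mat"
    and \<phi> :: "'k poly \<Rightarrow> nat list"
  assumes "q = card (UNIV :: 'k set)" and "t = 1 / real q"
    and "(\<alpha>, \<beta>) \<in> thoma_simplex"
    and "g \<in> carrier (GL n)"
    and "\<forall>f \<in> irred_polys. is_partition (\<phi> f)"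
    and "finite {f \<in> irred_polys. \<phi> f \<noteq> []}"
    and "(\<Sum>f | f \<in> irred_polys \<and> \<phi> f \<noteq> []. degree f * sum_list (\<phi> f)) = n"
    and "class_type n g \<phi>"
  shows "GLB_unipotent_char \<alpha> \<beta> n g =
    of_real (\<Prod>f | f \<in> irred_polys \<and> \<phi> f \<noteq> [].
      r_fun (\<phi> f) (thoma_spec \<alpha> \<beta> (degree f)) (t ^ degree f))"
proof -
  interpret M: polymod "act n g" by (rule polymod_act)
  let ?V = "fin_space n :: (nat \<Rightarrow> 'k) set"
  let ?S = "{f \<in> irred_polys. \<phi> f \<noteq> []}"
  have gm: "g \<in> carrier_mat n n" by (rule GL_carrier_mat[OF assms(4)])
  have V: "M.subspace ?V" "finite ?V"
    using act_fin_space finite_fin_space by (auto intro!: M.subspaceI) (auto simp: fin_space_def)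
  have cV: "card ?V = q ^ n" by (simp add: card_fin_space assms(1))
  have q1: "q > 1" using card_field_gt1 by (simp add: assms(1))
  have "\<exists>u\<in>Sym. (\<forall>c. M.fl q ?V c = u (mon c)) \<and>
      thoma_spec \<alpha> \<beta> 1 u = (\<Prod>f\<in>?S. r_fun (\<phi> f) (thoma_spec \<alpha> \<beta> (degree f)) ((1 / real q) ^ degree f))"
  proof (rule M.fl_symmetric_function[OF assms(1) V assms(6)])
    show "irr f \<and> degree f > 0" if "f \<in> ?S" for f
      using that irred_degree by (auto simp: irred_polys_def)
    show "bezout f h" if "f \<in> ?S" "h \<in> ?S" "f \<noteq> h" for f h
      using that irred_bezout by auto
    show "is_partition (\<phi> f)" if "f \<in> ?S" for f using that assms(5) by auto
    show "card (?V \<inter> M.ker (f ^ v)) = (q ^ degree f) ^ pmin (\<phi> f) v" if f: "f \<in> ?S" for f v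
    proof -
      have "?V \<inter> M.ker (f ^ v) = {w \<in> ?V. act n g (f ^ v) w = 0}" by (auto simp: M.ker_def)
      then show ?thesis
        using card_act_kernel[OF gm, of "f ^ v"] class_type_kernel[OF gm assms(8,6), of f v] f
        by (simp add: assms(1))
    qed
    show "card ?V = (\<Prod>f\<in>?S. (q ^ degree f) ^ sum_list (\<phi> f))"
      unfolding cV by (subst assms(7)[symmetric]) (simp add: power_sum power_mult)
  qed
  then obtain u where u: "u \<in> Sym" "\<And>c. M.fl q ?V c = u (mon c)"
    and h: "thoma_spec \<alpha> \<beta> 1 u = (\<Prod>f\<in>?S. r_fun (\<phi> f) (thoma_spec \<alpha> \<beta> (degree f)) ((1 / real q) ^ degree f))"
    by blast
  have "GLB_unipotent_char \<alpha> \<beta> n g = of_real (thoma_spec \<alpha> \<beta> 1 u)"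
  proof (rule GLB_unipotent_char_eq[OF assms(4) u(1)])
    fix a assume a: "u a \<noteq> 0"
    \<comment> \<open>A nonzero flag number forces the quotient sizes to multiply up to q^n, so
      \<open>u\<close> is homogeneous of degree n.\<close>
    have "u (mon (shape a)) \<noteq> 0" using a SymD[OF u(1), of "mon (shape a)" a] by simp
    then have "M.fl q ?V (shape a) \<noteq> 0" by (simp add: u(2))
    then have "q ^ n = q ^ sum_list (shape a)" using M.fl_card cV by metis
    then show "mdeg a = n" using q1 by (simp add: mono_degree_shape)
  next
    fix \<mu> assume "\<mu> \<in> Par n"
    then have \<mu>: "is_partition \<mu>" "sum_list \<mu> = n" by (auto simp: Par_def)
    \<comment> \<open>Flags list the block sizes in reverse order; the symmetry of \<open>u\<close>
      removes the reversal.\<close>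
    have "u (mon (rev \<mu>)) = u (mon \<mu>)"
      by (rule SymD[OF u(1)]) (simp add: shape_mon_rev \<mu>)
    then show "parabolic_char n \<mu> g = of_real (u (mon \<mu>))"
      using parabolic_char_eq_fl[OF assms(4) \<mu>(2)] u(2) assms(1) by simp
  qed
  then show ?thesis unfolding h assms(2) .
qed

end
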